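(* Let $k\in\mathbb{N}$ and let $\mu\in H^2((0,1);\mathbb{R})$ be such that $\langle\mu,\varphi_k\rangle=0$. Let $a_k:=\sum_{j\in\mathbb{N}}\left(\lambda_j-\frac{\lambda_k}{2}\right)\langle\mu,\varphi_j\rangle\langle\varphi_j,\mu\varphi_k\rangle$ (absolutely convergent) and assume that $a_k\neq0$. There exist $T^*,C,\nu>0$ such that, for all $T\in(0,T^* )$ and all $u\in L^2((0,T);\mathbb{R})$ with $\|u\|_{L^2}\leq1$, the solution $\psi$ to system (S) with initial data $\psi(0)=\varphi_0$ satisfies $$\left|\langle\psi(T)-\varphi_0,\varphi_k\rangle+ia_k\|u_1\|_{L^2}^2\right|\leq CT^\nu\|u_1\|_{L^2}^2+C\|\psi(T)-\varphi_0\|_{L^2}^2,$$ where $u_1(t):=\int_0^tu$ and $\|u_1\|_{L^2}$ is the norm in $L^2(0,T)$.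
   Context: $\mathbb{N}=\{0,1,2,\dots\}$. $\langle\phi,\psi\rangle:=\int_0^1\phi\overline{\psi}$ on $L^2((0,1);\mathbb{C})$. Let $\lambda_j:=(j\pi)^2$, $\varphi_0:=1$, $\varphi_j(x):=\sqrt2\cos(j\pi x)$ for $j\geq1$: eigenvalues and orthonormal eigenfunctions of $A:=-\partial_x^2$ with domain $H^2_N:=\{\varphi\in H^2((0,1);\mathbb{C}):\varphi'(0)=\varphi'(1)=0\}$. Let $\mathbb{S}$ be the unit sphere of $L^2((0,1);\mathbb{C})$. System (S): $i\partial_t\psi=-\partial_x^2\psi-u(t)\mu(x)\psi$ on $(0,T)\times(0,1)$, $\partial_x\psi(t,0)=\partial_x\psi(t,1)=0$, where $u\in L^2((0,T);\mathbb{R})$ is the control. For each such $u$ there is a unique mild solution $\psi\in C^0([0,T];H^2_N\cap\mathbb{S})$ with $\psi(0)=\varphi_0$, i.e. $\psi(t)=e^{-iAt}\varphi_0+i\int_0^tu(s)e^{-iA(t-s)}(\mu\psi(s))\,\mathrm{d}s$. *)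

theory Defs
  imports "HOL-Analysis.Analysis"
begin

text \<open>
  Elements of \<open>L\<^sup>2\<close> and \<open>H\<^sup>2\<close> are represented by functions on \<open>\<real>\<close>; only their values almost
  everywhere on the relevant interval matter.  Equality in \<open>L\<^sup>2\<close> is equality almost everywhere.
\<close>

definition L2 :: "real set \<Rightarrow> (real \<Rightarrow> 'a::{banach,second_countable_topology}) set" where
  "L2 S = {f \<in> borel_measurable (lebesgue_on S). integrable (lebesgue_on S) (\<lambda>x. (norm (f x))\<^sup>2)}"

definition L2_norm :: "real set \<Rightarrow> (real \<Rightarrow> 'a::{banach,second_countable_topology}) \<Rightarrow> real" where
  "L2_norm S f = sqrt (LINT x|lebesgue_on S. (norm (f x))\<^sup>2)"

abbreviation I01 :: "real set" where
  "I01 \<equiv> {0<..<1}"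

definition ip :: "(real \<Rightarrow> complex) \<Rightarrow> (real \<Rightarrow> complex) \<Rightarrow> complex" where
  "ip f g = (LINT x|lebesgue_on I01. f x * cnj (g x))"

definition test_functions :: "(real \<Rightarrow> real) set" where
  "test_functions = {\<theta>. (\<forall>n x. (deriv ^^ n) \<theta> field_differentiable at x) \<and>
     (\<exists>K. compact K \<and> K \<subseteq> I01 \<and> (\<forall>x. x \<notin> K \<longrightarrow> \<theta> x = 0))}"

definition weak_deriv ::
  "(real \<Rightarrow> 'a::{banach,second_countable_topology}) \<Rightarrow> (real \<Rightarrow> 'a) \<Rightarrow> bool" where
  "weak_deriv f g \<longleftrightarrow> (\<forall>\<theta>\<in>test_functions.
     (LINT x|lebesgue_on I01. deriv \<theta> x *\<^sub>R f x) = - (LINT x|lebesgue_on I01. \<theta> x *\<^sub>R g x))"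

definition H2 :: "(real \<Rightarrow> 'a::{banach,second_countable_topology}) set" where
  "H2 = {f \<in> L2 I01. \<exists>g\<in>L2 I01. \<exists>h\<in>L2 I01. weak_deriv f g \<and> weak_deriv g h}"

text \<open>
  The boundary values of the derivative of an \<open>H\<^sup>2\<close> function are those of its representative that
  is continuous on \<open>[0,1]\<close>; below, this is \<open>g\<close>.
\<close>

definition H2N :: "(real \<Rightarrow> complex) set" where
  "H2N = {f \<in> H2. \<exists>g\<in>L2 I01. weak_deriv f g \<and> continuous_on {0..1} g \<and> g 0 = 0 \<and> g 1 = 0}"

text \<open>The choice of a representative is immaterial: weak derivatives are unique almost everywhere.\<close>

definition wd :: "(real \<Rightarrow> complex) \<Rightarrow> real \<Rightarrow> complex" where
  "wd f = (SOME g. g \<in> L2 I01 \<and> weak_deriv f g)"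

definition H2_norm :: "(real \<Rightarrow> complex) \<Rightarrow> real" where
  "H2_norm f = sqrt ((L2_norm I01 f)\<^sup>2 + (L2_norm I01 (wd f))\<^sup>2 + (L2_norm I01 (wd (wd f)))\<^sup>2)"

definition eigval :: "nat \<Rightarrow> real" where
  "eigval j = (real j * pi)\<^sup>2"

definition eigfun :: "nat \<Rightarrow> real \<Rightarrow> complex" where
  "eigfun j x = (if j = 0 then 1 else complex_of_real (sqrt 2 * cos (real j * pi * x)))"

text \<open>
  \<open>exp_A t f\<close> is \<open>e\<^sup>-\<^sup>i\<^sup>A\<^sup>t f = \<Sum>\<^sub>j e\<^sup>-\<^sup>i\<^sup>\<lambda>\<^sup>j\<^sup>t \<langle>f, \<phi>\<^sub>j\<rangle> \<phi>\<^sub>j\<close>, the series converging in \<open>L\<^sup>2\<close>; the limit is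
  determined up to equality almost everywhere, and the description operator picks a representative.
\<close>

definition exp_A :: "real \<Rightarrow> (real \<Rightarrow> complex) \<Rightarrow> real \<Rightarrow> complex" where
  "exp_A t f = (SOME g. g \<in> L2 I01 \<and>
     (\<lambda>n. L2_norm I01 (\<lambda>x. g x -
        (\<Sum>j<n. exp (- \<i> * complex_of_real (eigval j * t)) * ip f (eigfun j) * eigfun j x)))
       \<longlonglongrightarrow> 0)"

text \<open>
  The Bochner integral for \<open>L\<^sup>2\<close>-valued functions, as in \<^const>\<open>has_bochner_integral\<close> (which needs a
  type of class \<^class>\<open>banach\<close>): the \<open>n\<close>-th approximating simple function takes the value
  \<open>g n m\<close> on \<open>E n m\<close>, summed over \<open>m < N n\<close>.  Integrability of the distance to
  the simple functions contains the strong measurability of \<open>F\<close>.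
\<close>

definition has_L2_integral ::
  "real measure \<Rightarrow> (real \<Rightarrow> real \<Rightarrow> complex) \<Rightarrow> (real \<Rightarrow> complex) \<Rightarrow> bool" where
  "has_L2_integral M F G \<longleftrightarrow>
     (\<forall>s\<in>space M. F s \<in> L2 I01) \<and> G \<in> L2 I01 \<and>
     (\<exists>(N :: nat \<Rightarrow> nat) (E :: nat \<Rightarrow> nat \<Rightarrow> real set) (g :: nat \<Rightarrow> nat \<Rightarrow> real \<Rightarrow> complex).
        (\<forall>n. \<forall>m<N n. E n m \<in> sets M \<and> emeasure M (E n m) < \<infinity> \<and> g n m \<in> L2 I01) \<and>
        (\<forall>n. integrable M
           (\<lambda>s. L2_norm I01 (\<lambda>x. F s x - (\<Sum>m<N n. indicator (E n m) s * g n m x)))) \<and>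
        (\<lambda>n. LINT s|M. L2_norm I01 (\<lambda>x. F s x - (\<Sum>m<N n. indicator (E n m) s * g n m x)))
          \<longlonglongrightarrow> 0 \<and>
        (\<lambda>n. L2_norm I01 (\<lambda>x. G x - (\<Sum>m<N n. complex_of_real (measure M (E n m)) * g n m x)))
          \<longlonglongrightarrow> 0)"

text \<open>
  \<open>\<psi> \<in> C\<^sup>0([0,T]; H\<^sup>2\<^sub>N \<inter> S)\<close> together with the Duhamel formula, for the initial datum \<open>\<psi>0\<close>;
  the state at time \<open>t\<close> is \<open>\<psi> t\<close>.
\<close>

definition mild_solution ::
  "real \<Rightarrow> (real \<Rightarrow> real) \<Rightarrow> (real \<Rightarrow> real) \<Rightarrow> (real \<Rightarrow> complex) \<Rightarrow> (real \<Rightarrow> real \<Rightarrow> complex) \<Rightarrow> bool" where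
  "mild_solution T \<mu> u \<psi>0 \<psi> \<longleftrightarrow>
     (\<forall>t\<in>{0..T}. \<psi> t \<in> H2N \<and> L2_norm I01 (\<psi> t) = 1) \<and>
     (\<forall>t\<in>{0..T}. ((\<lambda>s. H2_norm (\<lambda>x. \<psi> s x - \<psi> t x)) \<longlongrightarrow> 0) (at t within {0..T})) \<and>
     (\<forall>t\<in>{0..T}. \<exists>G.
        has_L2_integral (lebesgue_on {0..t})
          (\<lambda>s x. complex_of_real (u s) * exp_A (t - s) (\<lambda>y. complex_of_real (\<mu> y) * \<psi> s y) x) G \<and>
        (AE x in lebesgue_on I01. \<psi> t x = exp_A t \<psi>0 x + \<i> * G x))"

definition a_term :: "(real \<Rightarrow> real) \<Rightarrow> nat \<Rightarrow> nat \<Rightarrow> complex" where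
  "a_term \<mu> k j = complex_of_real (eigval j - eigval k / 2) *
     ip (\<lambda>x. complex_of_real (\<mu> x)) (eigfun j) *
     ip (eigfun j) (\<lambda>x. complex_of_real (\<mu> x) * eigfun k x)"

definition a_coeff :: "(real \<Rightarrow> real) \<Rightarrow> nat \<Rightarrow> complex" where
  "a_coeff \<mu> k = (\<Sum>j. a_term \<mu> k j)"

definition primitive :: "(real \<Rightarrow> real) \<Rightarrow> real \<Rightarrow> real" where
  "primitive u t = (LINT s|lebesgue_on {0..t}. u s)"

end

theory Submission
  imports Defs
begin

text \<open>
  Let \<open>U = u\<^sub>1\<close>.  The gauge transform \<open>G = e\<^sup>-\<^sup>i\<^sup>U\<^sup>\<mu> \<psi>\<close> removes \<open>u\<close> from the equation: the coefficients \<open>z\<^sub>j\<close> of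
  \<open>G - 1\<close> are \<open>\<integral> e\<^sup>-\<^sup>i\<^sup>\<lambda>\<^sup>j\<^sup>(\<^sup>t\<^sup>-\<^sup>s\<^sup>) q\<^sub>j(s) ds\<close>, where \<open>q\<^sub>j\<close> contains only \<open>U\<close>.  In mode \<open>k\<close> the part of \<open>q\<^sub>k\<close> that is
  linear in \<open>U\<close> is \<open>U \<beta>(G)\<close>, and \<open>\<beta>(1) = 0\<close> since \<open>\<langle>\<mu>, \<phi>\<^sub>k\<rangle> = 0\<close>; the quadratic part gives the main term
  because \<open>a\<^sub>k = \<integral> \<mu>'\<^sup>2 \<phi>\<^sub>k\<close>.

  The functional \<open>\<beta>\<close> contains boundary values, so that \<open>\<integral> U e\<^sup>i\<^sup>\<lambda>\<^sup>k\<^sup>s \<beta>(G - 1)\<close> is not estimated through the size of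
  \<open>G - 1\<close>.  Expanding \<open>G - 1\<close> in the eigenbasis turns it into a sum of bilinear integrals over the triangle
  \<open>s < t\<close>, and the large sieve inequality for the exponentials \<open>e\<^sup>i\<^sup>\<lambda>\<^sup>j\<^sup>s\<close>, applied on the squares of a dyadic
  decomposition of the triangle, gains the factor \<open>T\<^sup>1\<^sup>/\<^sup>4\<close>.

  Undoing the gauge at time \<open>T\<close> costs \<open>U(T)\<^sup>2\<close>.  As \<open>a\<^sub>k \<noteq> 0\<close>, the function \<open>\<mu>\<close> is not constant, so some mode
  \<open>j \<noteq> 0\<close> has \<open>\<langle>\<mu>, \<phi>\<^sub>j\<rangle> \<noteq> 0\<close>; reading off \<open>U(T)\<close> from this mode bounds \<open>U(T)\<^sup>2\<close> by
  \<open>\<parallel>\<psi>(T) - 1\<parallel>\<^sup>2 + T \<parallel>U\<parallel>\<^sup>2\<close> up to a constant.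
\<close>

section \<open>Square-integrable functions\<close>

text \<open>The control is bounded in \<open>L^2\<close> only, while the remainder must be quadratic
  in its primitive, so no final estimate may see \<open>u\<close> itself; this forces the gauge. Its
  price: \<open>G\<close> in general violates the Neumann condition, so the sources
  \<open>q_j\<close> carry boundary values that do not decay in \<open>j\<close>, and neither do the
  numbers \<open>\<beta>(\<phi>_j)\<close>. The sup norm of \<open>G - 1\<close> does not help: it
  is of order \<open>T^(1/2)\<close> because \<open>u\<close> has norm at most 1, which yields a
  term merely linear in \<open>U\<close>. What remains is square summation over \<open>j\<close>. On
  a square the two time variables separate and Cauchy-Schwarz over \<open>j\<close> applies; on the
  triangle they are coupled, whence the dyadic decomposition.

  The exponent 1/4 is a choice: over an interval of length \<open>L\<close>, two exponentials whose
  indices differ by \<open>n\<close> have inner product at most \<open>min(L, n^-2)\<close>, and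
  \<open>L^(1/4) n^(-3/2)\<close> is an interpolation still summable in \<open>n\<close>.

  The final constants may depend on \<open>\<mu>\<close> and \<open>k\<close> alone; the estimates
  are therefore stated through one number \<open>K\<close> that bounds \<open>\<mu>\<close> in all
  norms that occur.\<close>

lemma integrable_lebesgue_on_iff:
  fixes f :: "real \<Rightarrow> 'a::euclidean_space"
  assumes "S \<in> sets lebesgue"
  shows "integrable (lebesgue_on S) f \<longleftrightarrow> f absolutely_integrable_on S"
  using assms unfolding set_integrable_def
  by (simp add: integrable_restrict_space)

lemma L2_measurable: "f \<in> L2 S \<Longrightarrow> f \<in> borel_measurable (lebesgue_on S)"
  by (simp add: L2_def)

lemma L2_square_integrable: "f \<in> L2 S \<Longrightarrow> integrable (lebesgue_on S) (\<lambda>x. (norm (f x))\<^sup>2)"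
  by (simp add: L2_def)

lemma L2_mult_integrable:
  fixes f g :: "real \<Rightarrow> 'a::{real_normed_field,banach,second_countable_topology}"
  assumes "f \<in> L2 S" "g \<in> L2 S"
  shows "integrable (lebesgue_on S) (\<lambda>x. f x * g x)"
proof (rule Bochner_Integration.integrable_bound)
  show "integrable (lebesgue_on S) (\<lambda>x. (norm (f x))\<^sup>2 + (norm (g x))\<^sup>2)"
    using assms by (simp add: L2_def)
  show "(\<lambda>x. f x * g x) \<in> borel_measurable (lebesgue_on S)"
    using assms by (intro borel_measurable_times) (auto simp: L2_def)
  have "norm (f x * g x) \<le> norm ((norm (f x))\<^sup>2 + (norm (g x))\<^sup>2)" for x
  proof -
    have "0 \<le> norm (f x) * norm (g x)" by simp
    moreover have "2 * (norm (f x) * norm (g x)) \<le> (norm (f x))\<^sup>2 + (norm (g x))\<^sup>2"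
      using sum_squares_bound[of "norm (f x)" "norm (g x)"] by (simp add: mult.assoc)
    ultimately show ?thesis unfolding norm_mult real_norm_def by linarith
  qed
  then show "AE x in lebesgue_on S. norm (f x * g x) \<le> norm ((norm (f x))\<^sup>2 + (norm (g x))\<^sup>2)"
    by simp
qed

lemma L2_norm_mem:
  fixes f :: "real \<Rightarrow> 'a::{real_normed_field,banach,second_countable_topology}"
  assumes "f \<in> L2 S"
  shows "(\<lambda>x. norm (f x)) \<in> L2 S"
  using assms by (auto simp: L2_def)

lemma L2_norm_norm [simp]:
  fixes f :: "real \<Rightarrow> 'a::{real_normed_field,banach,second_countable_topology}"
  shows "L2_norm S (\<lambda>x. norm (f x)) = L2_norm S f"
  by (simp add: L2_norm_def)

lemma L2_norm_nonneg [simp]: "0 \<le> L2_norm S f"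
  by (simp add: L2_norm_def)

lemma L2_norm_square: "(L2_norm S f)\<^sup>2 = (LINT x|lebesgue_on S. (norm (f x))\<^sup>2)"
  by (simp add: L2_norm_def)

text \<open>The integral of \<open>(r f - g)^2\<close> is a nonnegative quadratic polynomial in
  \<open>r\<close>; its value at the minimum \<open>r = C / A\<close> gives the inequality.\<close>

lemma L2_Cauchy_Schwarz_real:
  fixes f g :: "real \<Rightarrow> real"
  assumes "f \<in> L2 S" "g \<in> L2 S"
  shows "(LINT x|lebesgue_on S. f x * g x) \<le> L2_norm S f * L2_norm S g"
proof -
  let ?M = "lebesgue_on S"
  define A where "A = (LINT x|?M. (f x)\<^sup>2)"
  define B where "B = (LINT x|?M. (g x)\<^sup>2)"
  define C where "C = (LINT x|?M. f x * g x)"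
  have i: "integrable ?M (\<lambda>x. (f x)\<^sup>2)" "integrable ?M (\<lambda>x. (g x)\<^sup>2)" "integrable ?M (\<lambda>x. f x * g x)"
    using assms L2_square_integrable[of f S] L2_square_integrable[of g S] L2_mult_integrable[of f S g] by auto
  have q: "0 \<le> r\<^sup>2 * A - 2 * r * C + B" for r
  proof -
    have "0 \<le> (LINT x|?M. (r * f x - g x)\<^sup>2)" by (rule integral_nonneg_AE) simp
    also have "\<dots> = (LINT x|?M. r\<^sup>2 * (f x)\<^sup>2 - 2 * r * (f x * g x) + (g x)\<^sup>2)"
      by (rule Bochner_Integration.integral_cong) (auto simp: power2_eq_square algebra_simps)
    also have "\<dots> = r\<^sup>2 * A - 2 * r * C + B"
      unfolding A_def B_def C_def using i by simp
    finally show ?thesis .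
  qed
  have A0: "0 \<le> A" and B0: "0 \<le> B" unfolding A_def B_def by (auto intro: integral_nonneg_AE)
  have "C\<^sup>2 \<le> A * B"
  proof (cases "A = 0")
    case True
    have "C = 0"
    proof (rule ccontr)
      assume "C \<noteq> 0"
      \<comment> \<open>With \<open>A = 0\<close> the polynomial is affine in \<open>r\<close>, and
        this \<open>r\<close> makes its value equal to -1.\<close>
      then show False using q[of "(B + 1) / (2 * C)"] True by simp
    qed
    then show ?thesis using True by simp
  next
    case False
    then have "A > 0" using A0 by simp
    have "0 \<le> (C / A)\<^sup>2 * A - 2 * (C / A) * C + B" by (rule q)
    also have "\<dots> = B - C\<^sup>2 / A" using \<open>A > 0\<close> by (simp add: power2_eq_square field_simps)
    finally show ?thesis using \<open>A > 0\<close> by (simp add: field_simps)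
  qed
  then have "\<bar>C\<bar> \<le> sqrt A * sqrt B" by (simp add: real_le_rsqrt real_sqrt_mult[symmetric])
  then show ?thesis unfolding A_def B_def C_def L2_norm_def by (simp; linarith)
qed

lemma L2_Cauchy_Schwarz:
  fixes f g :: "real \<Rightarrow> 'a::{real_normed_field,banach,second_countable_topology}"
  assumes "f \<in> L2 S" "g \<in> L2 S"
  shows "norm (LINT x|lebesgue_on S. f x * g x) \<le> L2_norm S f * L2_norm S g"
    and "(LINT x|lebesgue_on S. norm (f x) * norm (g x)) \<le> L2_norm S f * L2_norm S g"
proof -
  show 1: "(LINT x|lebesgue_on S. norm (f x) * norm (g x)) \<le> L2_norm S f * L2_norm S g"
    using L2_Cauchy_Schwarz_real[OF L2_norm_mem L2_norm_mem, OF assms] by simp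
  have "norm (LINT x|lebesgue_on S. f x * g x) \<le> (LINT x|lebesgue_on S. norm (f x * g x))"
    by (rule integral_norm_bound)
  with 1 show "norm (LINT x|lebesgue_on S. f x * g x) \<le> L2_norm S f * L2_norm S g"
    by (simp add: norm_mult)
qed

lemma L2_bounded_mult:
  fixes f g :: "real \<Rightarrow> 'a::{real_normed_field,banach,second_countable_topology}"
  assumes f: "f \<in> L2 S" and g: "g \<in> borel_measurable (lebesgue_on S)"
    and B: "\<And>x. x \<in> S \<Longrightarrow> norm (g x) \<le> B"
  shows "(\<lambda>x. g x * f x) \<in> L2 S"
    and "0 \<le> B \<Longrightarrow> L2_norm S (\<lambda>x. g x * f x) \<le> B * L2_norm S f"
proof -
  let ?M = "lebesgue_on S"
  have m: "(\<lambda>x. g x * f x) \<in> borel_measurable ?M"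
    using f g by (intro borel_measurable_times) (auto simp: L2_def)
  have i1: "integrable ?M (\<lambda>x. B\<^sup>2 * (norm (f x))\<^sup>2)"
    using f by (simp add: L2_def)
  have le: "(norm (g x * f x))\<^sup>2 \<le> B\<^sup>2 * (norm (f x))\<^sup>2" if "x \<in> S" for x
    using B[OF that] by (simp add: norm_mult power_mult_distrib mult_right_mono power_mono)
  have i2: "integrable ?M (\<lambda>x. (norm (g x * f x))\<^sup>2)"
  proof (rule Bochner_Integration.integrable_bound[OF i1])
    show "(\<lambda>x. (norm (g x * f x))\<^sup>2) \<in> borel_measurable ?M" using m by measurable
    show "AE x in ?M. norm ((norm (g x * f x))\<^sup>2) \<le> norm (B\<^sup>2 * (norm (f x))\<^sup>2)"
      using le by (intro AE_I2) (auto simp: space_restrict_space)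
  qed
  show "(\<lambda>x. g x * f x) \<in> L2 S" using m i2 by (simp add: L2_def)
  assume "0 \<le> B"
  have "(LINT x|?M. (norm (g x * f x))\<^sup>2) \<le> (LINT x|?M. B\<^sup>2 * (norm (f x))\<^sup>2)"
    using le by (intro integral_mono i1 i2) (auto simp: space_restrict_space)
  then have "(LINT x|?M. (norm (g x * f x))\<^sup>2) \<le> (B * L2_norm S f)\<^sup>2"
    by (simp add: power_mult_distrib L2_norm_square)
  then show "L2_norm S (\<lambda>x. g x * f x) \<le> B * L2_norm S f"
    unfolding L2_norm_def using \<open>0 \<le> B\<close> by (intro real_le_lsqrt) (auto simp: L2_norm_def[symmetric])
qed

lemma L2_add:
  fixes f g :: "real \<Rightarrow> 'a::{real_normed_field,banach,second_countable_topology}"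
  assumes f: "f \<in> L2 S" and g: "g \<in> L2 S"
  shows "(\<lambda>x. f x + g x) \<in> L2 S" and "L2_norm S (\<lambda>x. f x + g x) \<le> L2_norm S f + L2_norm S g"
proof -
  let ?M = "lebesgue_on S"
  have m: "(\<lambda>x. f x + g x) \<in> borel_measurable ?M"
    using f g by (intro borel_measurable_add) (auto simp: L2_def)
  have sq: "integrable ?M (\<lambda>x. (norm (f x))\<^sup>2)" "integrable ?M (\<lambda>x. (norm (g x))\<^sup>2)"
    using f g by (auto simp: L2_def)
  have fg: "integrable ?M (\<lambda>x. norm (f x) * norm (g x))"
    using L2_mult_integrable[OF L2_norm_mem L2_norm_mem, OF f g] .
  let ?h = "\<lambda>x. (norm (f x))\<^sup>2 + 2 * (norm (f x) * norm (g x)) + (norm (g x))\<^sup>2"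
  have ih: "integrable ?M ?h" using sq fg by simp
  have le: "(norm (f x + g x))\<^sup>2 \<le> ?h x" for x
    using power_mono[OF norm_triangle_ineq[of "f x" "g x"], of 2] by (simp add: power2_sum)
  have i: "integrable ?M (\<lambda>x. (norm (f x + g x))\<^sup>2)"
  proof (rule Bochner_Integration.integrable_bound[OF ih])
    show "(\<lambda>x. (norm (f x + g x))\<^sup>2) \<in> borel_measurable ?M" using m by measurable
    show "AE x in ?M. norm ((norm (f x + g x))\<^sup>2) \<le> norm (?h x)"
      using le by (intro AE_I2) (smt (verit) real_norm_def zero_le_power2)
  qed
  show "(\<lambda>x. f x + g x) \<in> L2 S" using m i by (simp add: L2_def)
  have "(LINT x|?M. (norm (f x + g x))\<^sup>2) \<le> (LINT x|?M. ?h x)"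
    using le by (intro integral_mono i ih)
  also have "\<dots> = (L2_norm S f)\<^sup>2 + 2 * (LINT x|?M. norm (f x) * norm (g x)) + (L2_norm S g)\<^sup>2"
    using sq fg by (simp add: L2_norm_square)
  also have "\<dots> \<le> (L2_norm S f)\<^sup>2 + 2 * (L2_norm S f * L2_norm S g) + (L2_norm S g)\<^sup>2"
    using L2_Cauchy_Schwarz(2)[OF f g] by simp
  also have "\<dots> = (L2_norm S f + L2_norm S g)\<^sup>2" by (simp add: power2_sum)
  finally show "L2_norm S (\<lambda>x. f x + g x) \<le> L2_norm S f + L2_norm S g"
    unfolding L2_norm_def[of S "\<lambda>x. f x + g x"] by (intro real_le_lsqrt) auto
qed

lemma L2_cmult:
  fixes f :: "real \<Rightarrow> 'a::{real_normed_field,banach,second_countable_topology}"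
  assumes "f \<in> L2 S"
  shows "(\<lambda>x. c * f x) \<in> L2 S" and "L2_norm S (\<lambda>x. c * f x) = norm c * L2_norm S f"
proof -
  show "(\<lambda>x. c * f x) \<in> L2 S"
    using L2_bounded_mult(1)[OF assms, of "\<lambda>_. c" "norm c"] by simp
  show "L2_norm S (\<lambda>x. c * f x) = norm c * L2_norm S f"
    by (simp add: L2_norm_def norm_mult power_mult_distrib real_sqrt_mult)
qed

lemma L2_diff:
  fixes f g :: "real \<Rightarrow> 'a::{real_normed_field,banach,second_countable_topology}"
  assumes f: "f \<in> L2 S" and g: "g \<in> L2 S"
  shows "(\<lambda>x. f x - g x) \<in> L2 S" and "L2_norm S (\<lambda>x. f x - g x) \<le> L2_norm S f + L2_norm S g"
  using L2_add[OF f L2_cmult(1)[OF g, of "-1"]] L2_cmult(2)[OF g, of "-1"] by simp_all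

lemma L2_sum:
  fixes f :: "'i \<Rightarrow> real \<Rightarrow> 'a::{real_normed_field,banach,second_countable_topology}"
  assumes "\<And>i. i \<in> I \<Longrightarrow> f i \<in> L2 S"
  shows "(\<lambda>x. \<Sum>i\<in>I. f i x) \<in> L2 S"
  using assms
proof (induction I rule: infinite_finite_induct)
  case (insert i I)
  then show ?case using L2_add(1)[of "f i" S "\<lambda>x. \<Sum>i\<in>I. f i x"] by simp
qed (simp_all add: L2_def)

lemma L2_cong_AE:
  assumes "f \<in> L2 S" "AE x in lebesgue_on S. f x = g x" "S \<in> sets lebesgue"
    "g \<in> borel_measurable (lebesgue_on S)"
  shows "g \<in> L2 S"
proof -
  have "integrable (lebesgue_on S) (\<lambda>x. (norm (g x))\<^sup>2)"
    using assms(1,2,4) L2_measurable[OF assms(1)]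
    by (subst integrable_cong_AE[where g="\<lambda>x. (norm (f x))\<^sup>2"]) (auto simp: L2_def)
  then show ?thesis using assms by (simp add: L2_def)
qed

lemma L2_norm_cong_AE:
  assumes "AE x in lebesgue_on S. f x = g x" "f \<in> borel_measurable (lebesgue_on S)"
    "g \<in> borel_measurable (lebesgue_on S)"
  shows "L2_norm S f = L2_norm S g"
  using assms unfolding L2_norm_def
  by (intro arg_cong[where f=sqrt] integral_cong_AE) auto

section \<open>Open and closed intervals, Bochner and gauge integrals\<close>

lemma lebesgue_on_singleton_null:
  fixes S :: "real set"
  assumes "S \<in> sets lebesgue" "x \<in> S"
  shows "emeasure (lebesgue_on S) {x} = 0" "{x} \<in> sets (lebesgue_on S)"
  using assms by (auto simp: emeasure_restrict_space sets_restrict_space_iff)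

text \<open>The given notions live on open intervals, the calculus of primitives on closed ones. The
  two endpoints form a null set, so integrals, integrability and measurability transfer.\<close>

lemma LINT_Ioo_eq_Icc:
  fixes f :: "real \<Rightarrow> 'a::{banach,second_countable_topology}"
  shows "(LINT x|lebesgue_on {a<..<b}. f x) = (LINT x|lebesgue_on {a..b}. f x)"
    and "integrable (lebesgue_on {a<..<b}) f \<longleftrightarrow> integrable (lebesgue_on {a..b}) f"
    and "f \<in> borel_measurable (lebesgue_on {a<..<b}) \<longleftrightarrow> f \<in> borel_measurable (lebesgue_on {a..b})"
proof -
  have 1: "countable {a,b}" by simp
  have 2: "emeasure lebesgue {x} = 0" "{x} \<in> sets lebesgue" for x :: real by auto
  have 3: "indicator {a<..<b} x *\<^sub>R f x = indicator {a..b} x *\<^sub>R f x" if "x \<notin> {a, b}" for x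
    using that by (auto simp: indicator_def)
  show "(LINT x|lebesgue_on {a<..<b}. f x) = (LINT x|lebesgue_on {a..b}. f x)"
    by (simp add: integral_restrict_space) (rule integral_discrete_difference[OF 1 2 3])
  show "integrable (lebesgue_on {a<..<b}) f \<longleftrightarrow> integrable (lebesgue_on {a..b}) f"
    by (simp add: integrable_restrict_space) (rule integrable_discrete_difference[OF 1 2 3])
  have m: "h \<in> borel_measurable lebesgue"
    if "g \<in> borel_measurable lebesgue" "\<And>x. x \<notin> {a, b} \<Longrightarrow> g x = h x" for g h :: "real \<Rightarrow> 'a"
    by (rule measurable_discrete_difference[OF that(1) 1]) (use that(2) in auto)
  have b: "f \<in> borel_measurable (lebesgue_on S) \<longleftrightarrow> (\<lambda>x. indicator S x *\<^sub>R f x) \<in> borel_measurable lebesgue"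
    if "S \<in> sets lebesgue" for S :: "real set"
    by (rule borel_measurable_restrict_space_iff) (use that in simp)
  have "(\<lambda>x. indicator {a<..<b} x *\<^sub>R f x) \<in> borel_measurable lebesgue \<longleftrightarrow>
      (\<lambda>x. indicator {a..b} x *\<^sub>R f x) \<in> borel_measurable lebesgue"
    by (intro iffI; elim m) (auto simp: indicator_def)
  then show "f \<in> borel_measurable (lebesgue_on {a<..<b}) \<longleftrightarrow> f \<in> borel_measurable (lebesgue_on {a..b})"
    by (simp add: b)
qed

lemma L2_Ioo_eq_Icc: "L2 {a<..<b} = L2 {a..b}" "L2_norm {a<..<b} f = L2_norm {a..b} f"
  unfolding L2_def L2_norm_def LINT_Ioo_eq_Icc by simp_all

lemma AE_Ioo_iff_Icc:
  "(AE x in lebesgue_on {a<..<b}. P x) \<longleftrightarrow> (AE x in lebesgue_on {a..b::real}. P x)"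
proof -
  have n: "AE x in lebesgue. x \<noteq> c" for c :: real
    by (rule AE_I[where N="{c}"]) auto
  have "AE x in lebesgue. (x \<in> {a<..<b} \<longrightarrow> P x) \<longleftrightarrow> (x \<in> {a..b} \<longrightarrow> P x)"
    using n[of a] n[of b] by eventually_elim auto
  then show ?thesis
    by (simp add: AE_restrict_space_iff) (rule eventually_subst, simp)
qed

text \<open>The bridge between the Bochner integral of the definitions and the gauge integral, in
  which integration by parts and dominated convergence are carried out below.\<close>

lemma LINT_Icc_eq_integral:
  fixes f :: "real \<Rightarrow> 'a::euclidean_space"
  assumes "f absolutely_integrable_on {a..b}"
  shows "(LINT x|lebesgue_on {a..b}. f x) = integral {a..b} f"
  using assms by (intro lebesgue_integral_eq_integral) (auto simp: integrable_lebesgue_on_iff)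

lemma continuous_imp_L2:
  fixes f :: "real \<Rightarrow> 'a::{real_normed_field,euclidean_space}"
  assumes "continuous_on {a..b} f"
  shows "f \<in> L2 {a..b}"
proof -
  have "(\<lambda>x. (norm (f x))\<^sup>2) absolutely_integrable_on {a..b}"
    using assms by (intro absolutely_integrable_continuous_real continuous_intros)
  then show ?thesis
    using continuous_imp_measurable_on_sets_lebesgue[OF assms]
    by (auto simp: L2_def integrable_lebesgue_on_iff)
qed

lemma L2_absolutely_integrable:
  fixes f :: "real \<Rightarrow> 'a::{real_normed_field,euclidean_space}"
  assumes "f \<in> L2 {a..b}"
  shows "f absolutely_integrable_on {a..b}"
  using L2_mult_integrable[OF assms, of "\<lambda>_. 1"] continuous_imp_L2[of a b "\<lambda>_. 1::'a"]
  by (simp add: integrable_lebesgue_on_iff)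

lemma L2_mult_absolutely_integrable:
  fixes f g :: "real \<Rightarrow> 'a::{real_normed_field,euclidean_space}"
  assumes "f \<in> L2 {a..b}" "g \<in> L2 {a..b}"
  shows "(\<lambda>x. f x * g x) absolutely_integrable_on {a..b}"
  using L2_mult_integrable[OF assms] by (simp add: integrable_lebesgue_on_iff)

lemma L2_Cauchy_Schwarz_integral:
  fixes f g :: "real \<Rightarrow> 'a::{real_normed_field,euclidean_space}"
  assumes "f \<in> L2 {a..b}" "g \<in> L2 {a..b}"
  shows "norm (integral {a..b} (\<lambda>x. f x * g x)) \<le> L2_norm {a..b} f * L2_norm {a..b} g"
  using L2_Cauchy_Schwarz(1)[OF assms] LINT_Icc_eq_integral[OF L2_mult_absolutely_integrable[OF assms]]
  by simp

lemma L2_norm_square_integral: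
  fixes f :: "real \<Rightarrow> 'a::{real_normed_field,euclidean_space}"
  assumes "f \<in> L2 {a..b}"
  shows "(\<lambda>x. (norm (f x))\<^sup>2) absolutely_integrable_on {a..b}"
    and "(L2_norm {a..b} f)\<^sup>2 = integral {a..b} (\<lambda>x. (norm (f x))\<^sup>2)"
proof -
  show 1: "(\<lambda>x. (norm (f x))\<^sup>2) absolutely_integrable_on {a..b}"
    using L2_square_integrable[OF assms] by (simp add: integrable_lebesgue_on_iff)
  show "(L2_norm {a..b} f)\<^sup>2 = integral {a..b} (\<lambda>x. (norm (f x))\<^sup>2)"
    using LINT_Icc_eq_integral[OF 1] by (simp add: L2_norm_square)
qed

lemma L2_norm_bound:
  fixes f :: "real \<Rightarrow> 'a::{real_normed_field,euclidean_space}"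
  assumes "f \<in> L2 {a..b}" "\<And>x. x \<in> {a..b} \<Longrightarrow> norm (f x) \<le> B" "0 \<le> B" "a \<le> b"
  shows "L2_norm {a..b} f \<le> B * sqrt (b - a)"
proof -
  have "(L2_norm {a..b} f)\<^sup>2 \<le> integral {a..b} (\<lambda>x. B\<^sup>2)"
    unfolding L2_norm_square_integral(2)[OF assms(1)]
  proof (rule integral_le)
    show "(\<lambda>x. (norm (f x))\<^sup>2) integrable_on {a..b}"
      using L2_norm_square_integral(1)[OF assms(1)] set_lebesgue_integral_eq_integral(1) by blast
    show "(norm (f x))\<^sup>2 \<le> B\<^sup>2" if "x \<in> {a..b}" for x
      using assms(2)[OF that] by (intro power_mono) auto
  qed (rule integrable_continuous_interval, simp)
  also have "\<dots> = (B * sqrt (b - a))\<^sup>2" using assms(4) by (simp add: power_mult_distrib)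
  finally show ?thesis by (rule power2_le_imp_le) (use assms(3,4) in simp)
qed

lemma L2_norm_one_le:
  assumes "a \<le> b"
  shows "L2_norm {a..b} (\<lambda>_. 1::'a::{real_normed_field,euclidean_space}) \<le> sqrt (b - a)"
  using L2_norm_bound[OF continuous_imp_L2, of a b "\<lambda>_. 1::'a" 1] assms by simp

lemma L2_norm_integral_bound:
  fixes f :: "real \<Rightarrow> 'a::{real_normed_field,euclidean_space}"
  assumes f: "f \<in> L2 {a..b}" and "a \<le> b"
  shows "norm (integral {a..b} f) \<le> sqrt (b - a) * L2_norm {a..b} f"
proof -
  have "norm (integral {a..b} (\<lambda>x. 1 * f x)) \<le> L2_norm {a..b} (\<lambda>_. 1::'a) * L2_norm {a..b} f"
    by (rule L2_Cauchy_Schwarz_integral[OF continuous_imp_L2 f]) simp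
  also have "\<dots> \<le> sqrt (b - a) * L2_norm {a..b} f"
    by (rule mult_right_mono[OF L2_norm_one_le[OF assms(2)] L2_norm_nonneg])
  finally show ?thesis by simp
qed

lemma L2_norm_integral_norm_bound:
  fixes f :: "real \<Rightarrow> 'a::{real_normed_field,euclidean_space}"
  assumes f: "f \<in> L2 {a..b}" and "a \<le> b"
  shows "integral {a..b} (\<lambda>x. norm (f x)) \<le> sqrt (b - a) * L2_norm {a..b} f"
  using L2_norm_integral_bound[OF L2_norm_mem[OF f] assms(2)] by simp

section \<open>Absolutely continuous functions\<close>

text \<open>Absolute continuity with the density as part of the data. The integral identity replaces
  differentiability, so a weak derivative can serve as \<open>f\<close>; the density matters only up
  to null sets, while \<open>F\<close> has values at every point, the endpoints included.\<close>

definition ac :: "(real \<Rightarrow> 'a::euclidean_space) \<Rightarrow> (real \<Rightarrow> 'a) \<Rightarrow> real \<Rightarrow> real \<Rightarrow> bool" where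
  "ac F f a b \<longleftrightarrow> f absolutely_integrable_on {a..b} \<and> (\<forall>t\<in>{a..b}. F t = F a + integral {a..t} f)"

lemma acI:
  assumes "f absolutely_integrable_on {a..b}" "\<And>t. t \<in> {a..b} \<Longrightarrow> F t = F a + integral {a..t} f"
  shows "ac F f a b"
  using assms unfolding ac_def by blast

lemma abs_integrable_imp_integrable:
  fixes f :: "'n::euclidean_space \<Rightarrow> 'a::euclidean_space"
  shows "f absolutely_integrable_on S \<Longrightarrow> f integrable_on S"
  by (simp add: absolutely_integrable_on_def)

lemma ac_absolutely_integrable: "ac F f a b \<Longrightarrow> f absolutely_integrable_on {a..b}"
  by (simp add: ac_def)

lemma ac_integrable: "ac F f a b \<Longrightarrow> f integrable_on {a..b}"
  by (simp add: ac_def abs_integrable_imp_integrable)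

lemma ac_eq: "ac F f a b \<Longrightarrow> t \<in> {a..b} \<Longrightarrow> F t = F a + integral {a..t} f"
  unfolding ac_def by blast

lemma abs_integrable_subinterval:
  fixes f :: "real \<Rightarrow> 'a::euclidean_space"
  assumes "f absolutely_integrable_on {a..b}" "a \<le> c" "d \<le> b"
  shows "f absolutely_integrable_on {c..d}"
  by (rule absolutely_integrable_on_subinterval[OF assms(1)]) (use assms in auto)

lemma L2_subinterval:
  fixes f :: "real \<Rightarrow> 'a::{real_normed_field,euclidean_space}"
  assumes f: "f \<in> L2 {a..b}" and cd: "a \<le> c" "d \<le> b"
  shows "f \<in> L2 {c..d}" "L2_norm {c..d} f \<le> L2_norm {a..b} f"
proof -
  note i = L2_norm_square_integral(1)[OF f]
  have sub: "{c..d} \<subseteq> {a..b}" using cd by auto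
  have "f \<in> borel_measurable (lebesgue_on {c..d})"
    by (rule measurable_restrict_mono[OF L2_measurable[OF f] sub])
  then show L: "f \<in> L2 {c..d}"
    using abs_integrable_subinterval[OF i cd] by (simp add: L2_def integrable_lebesgue_on_iff)
  have "(L2_norm {c..d} f)\<^sup>2 \<le> (L2_norm {a..b} f)\<^sup>2"
    unfolding L2_norm_square_integral(2)[OF L] L2_norm_square_integral(2)[OF f]
    by (rule integral_subset_le[OF sub abs_integrable_imp_integrable[OF L2_norm_square_integral(1)[OF L]] abs_integrable_imp_integrable[OF i]]) simp
  then show "L2_norm {c..d} f \<le> L2_norm {a..b} f" by (rule power2_le_imp_le) simp
qed

lemma ac_diff_eq:
  assumes "ac F f a b" "a \<le> s" "s \<le> t" "t \<le> b"
  shows "F t - F s = integral {s..t} f"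
proof -
  have "integral {a..s} f + integral {s..t} f = integral {a..t} f"
    using assms by (intro Henstock_Kurzweil_Integration.integral_combine)
      (auto intro!: abs_integrable_imp_integrable abs_integrable_subinterval[OF ac_absolutely_integrable])
  then show ?thesis using ac_eq[OF assms(1), of s] ac_eq[OF assms(1), of t] assms by (simp add: algebra_simps)
qed

lemma ac_continuous:
  assumes "ac F f a b"
  shows "continuous_on {a..b} F"
proof -
  have "continuous_on {a..b} (\<lambda>t. F a + integral {a..t} f)"
    using assms by (intro continuous_intros indefinite_integral_continuous_1 ac_integrable)
  then show ?thesis
    by (rule continuous_on_eq) (simp add: ac_eq[OF assms, symmetric])
qed

lemma ac_cong:
  assumes "ac F f a b" "\<And>t. t \<in> {a..b} \<Longrightarrow> F t = G t" "\<And>t. t \<in> {a..b} \<Longrightarrow> f t = g t"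
  shows "ac G g a b"
proof (rule acI)
  show "g absolutely_integrable_on {a..b}"
    using ac_absolutely_integrable[OF assms(1)] assms(3) set_integrable_cong[of lebesgue lebesgue "{a..b}" "{a..b}" f g] by auto
  fix t assume t: "t \<in> {a..b}"
  have "integral {a..t} f = integral {a..t} g"
    using t assms(3) by (intro integral_cong) auto
  then show "G t = G a + integral {a..t} g"
    using ac_eq[OF assms(1) t] assms(2)[of t] assms(2)[of a] t by auto
qed

lemma ac_cong_AE:
  assumes "ac F f a b" "\<And>t. t \<in> {a..b} - N \<Longrightarrow> f t = g t" "negligible N"
  shows "ac F g a b"
proof (rule acI)
  show "g absolutely_integrable_on {a..b}"
    by (rule absolutely_integrable_spike[OF ac_absolutely_integrable[OF assms(1)] assms(3)]) (use assms(2) in auto)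
  fix t assume t: "t \<in> {a..b}"
  have "integral {a..t} f = integral {a..t} g"
    using t assms(2) by (intro integral_spike[OF assms(3)]) auto
  then show "F t = F a + integral {a..t} g"
    using ac_eq[OF assms(1) t] by auto
qed

lemma ac_const: "ac (\<lambda>_. c) (\<lambda>_. 0) a b"
  by (rule acI) auto

lemma ac_add:
  assumes "ac F f a b" "ac G g a b"
  shows "ac (\<lambda>t. F t + G t) (\<lambda>t. f t + g t) a b"
proof (rule acI)
  show "(\<lambda>t. f t + g t) absolutely_integrable_on {a..b}"
    using assms by (intro set_integral_add) (auto dest: ac_absolutely_integrable)
  fix t assume t: "t \<in> {a..b}"
  have "f integrable_on {a..t}" "g integrable_on {a..t}"
    using assms t by (auto intro!: abs_integrable_imp_integrable abs_integrable_subinterval[OF ac_absolutely_integrable])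
  then show "F t + G t = F a + G a + integral {a..t} (\<lambda>t. f t + g t)"
    using ac_eq[OF assms(1) t] ac_eq[OF assms(2) t] by (simp add: integral_add)
qed

lemma ac_linear:
  assumes "ac F f a b" "bounded_linear h"
  shows "ac (\<lambda>t. h (F t)) (\<lambda>t. h (f t)) a b"
proof (rule acI)
  show "(\<lambda>t. h (f t)) absolutely_integrable_on {a..b}"
    using absolutely_integrable_linear[OF ac_absolutely_integrable[OF assms(1)] assms(2)] by (simp add: o_def)
  fix t assume t: "t \<in> {a..b}"
  have "f integrable_on {a..t}"
    using assms t by (auto intro!: abs_integrable_imp_integrable abs_integrable_subinterval[OF ac_absolutely_integrable])
  then have "integral {a..t} (\<lambda>t. h (f t)) = h (integral {a..t} f)"
    using integral_linear[OF _ assms(2), of f] by (simp add: o_def)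
  then show "h (F t) = h (F a) + integral {a..t} (\<lambda>t. h (f t))"
    using ac_eq[OF assms(1) t] assms(2) by (simp add: linear_simps)
qed

lemma ac_cmult:
  fixes F :: "real \<Rightarrow> 'a::{real_normed_field,euclidean_space}"
  assumes "ac F f a b"
  shows "ac (\<lambda>t. c * F t) (\<lambda>t. c * f t) a b"
  using ac_linear[OF assms bounded_linear_mult_right] .

lemma ac_diff:
  assumes "ac F f a b" "ac G g a b"
  shows "ac (\<lambda>t. F t - G t) (\<lambda>t. f t - g t) a b"
  using ac_add[OF assms(1) ac_linear[OF assms(2), of "\<lambda>x. - x"]]
    by (simp add: bounded_linear_minus bounded_linear_ident)

lemma ac_sum:
  assumes "finite I" "\<And>i. i \<in> I \<Longrightarrow> ac (F i) (f i) a b"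
  shows "ac (\<lambda>t. \<Sum>i\<in>I. F i t) (\<lambda>t. \<Sum>i\<in>I. f i t) a b"
  using assms by (induction I rule: finite_induct) (auto simp: ac_const intro!: ac_add)

lemma ac_C1:
  fixes F :: "real \<Rightarrow> 'a::euclidean_space"
  assumes "\<And>t. t \<in> {a..b} \<Longrightarrow> (F has_vector_derivative f t) (at t within {a..b})"
    and "continuous_on {a..b} f"
  shows "ac F f a b"
proof (rule acI)
  show "f absolutely_integrable_on {a..b}"
    using assms(2) by (rule absolutely_integrable_continuous_real)
  fix t assume t: "t \<in> {a..b}"
  have "(f has_integral (F t - F a)) {a..t}"
  proof (rule fundamental_theorem_of_calculus)
    show "(F has_vector_derivative f x) (at x within {a..t})" if "x \<in> {a..t}" for x
      using t that by (intro has_vector_derivative_within_subset[OF assms(1)]) auto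
  qed (use t in auto)
  then show "F t = F a + integral {a..t} f" by (simp add: integral_unique)
qed

lemma ac_primitive:
  fixes f :: "real \<Rightarrow> 'a::euclidean_space"
  assumes "f absolutely_integrable_on {a..b}"
  shows "ac (\<lambda>t. integral {a..t} f) f a b"
  by (rule acI) (use assms in simp_all)

text \<open>Dominated convergence in the integral identity. Only the densities have to be dominated;
  the values converge pointwise. This carries the evolution equation over to limits of cosine
  polynomials and to the exponential series.\<close>

lemma ac_limit:
  fixes f :: "nat \<Rightarrow> real \<Rightarrow> 'a::euclidean_space"
  assumes "\<And>n. ac (F n) (f n) a b" "h integrable_on {a..b}"
    and "\<And>n t. t \<in> {a..b} \<Longrightarrow> norm (f n t) \<le> h t"
    and "\<And>t. t \<in> {a..b} \<Longrightarrow> (\<lambda>n. F n t) \<longlonglongrightarrow> G t"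
    and "\<And>t. t \<in> {a..b} \<Longrightarrow> (\<lambda>n. f n t) \<longlonglongrightarrow> g t"
  shows "ac G g a b"
proof (rule acI)
  show "g absolutely_integrable_on {a..b}"
  proof (rule dominated_convergence_absolutely_integrable[OF ac_absolutely_integrable[OF assms(1)] assms(2) _ assms(5)])
    show "norm (g t) \<le> h t" if "t \<in> {a..b}" for t
      by (rule Lim_bounded[OF tendsto_norm[OF assms(5)[OF that]], of 0]) (use assms(3) that in blast)
  qed simp
  fix t assume t: "t \<in> {a..b}"
  have "(\<lambda>n. integral {a..t} (f n)) \<longlonglongrightarrow> integral {a..t} g"
  proof (rule dominated_convergence(2))
    show "f n integrable_on {a..t}" for n
      using t assms(1)[of n] by (auto intro!: abs_integrable_imp_integrable abs_integrable_subinterval[OF ac_absolutely_integrable])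
    show "h integrable_on {a..t}"
      using assms(2) t by (auto intro: integrable_on_subinterval)
  qed (use assms t in auto)
  moreover have "(\<lambda>n. integral {a..t} (f n)) \<longlonglongrightarrow> G t - G a"
  proof (rule Lim_transform_eventually)
    show "(\<lambda>n. F n t - F n a) \<longlonglongrightarrow> G t - G a"
      using t by (intro tendsto_diff assms(4)) auto
    show "\<forall>\<^sub>F n in sequentially. F n t - F n a = integral {a..t} (f n)"
      using ac_eq[OF assms(1) t] by (intro always_eventually) auto
  qed
  ultimately show "G t = G a + integral {a..t} g"
    using LIMSEQ_unique by (metis add_diff_cancel_left' add_diff_eq diff_add_cancel add.commute)
qed

lemma abs_integrable_cont_mult:
  fixes f g :: "real \<Rightarrow> 'a::{real_normed_field,euclidean_space}"
  assumes "continuous_on {a..b} f" "g absolutely_integrable_on {a..b}"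
  shows "(\<lambda>x. f x * g x) absolutely_integrable_on {a..b}"
proof (rule absolutely_integrable_bounded_measurable_product[OF _ _ _ _ assms(2), where h="(*)"])
  show "bilinear ((*) :: 'a \<Rightarrow> 'a \<Rightarrow> 'a)" by (simp add: bilinear_conv_bounded_bilinear bounded_bilinear_mult)
  show "f \<in> borel_measurable (lebesgue_on {a..b})"
    using assms(1) by (rule continuous_imp_measurable_on_sets_lebesgue) simp
  show "bounded (f ` {a..b})"
    using assms(1) by (intro compact_imp_bounded compact_continuous_image) auto
qed simp

text \<open>Fubini on the square, cut along its diagonal.\<close>

lemma integral_mult_integral:
  fixes f g :: "real \<Rightarrow> 'a::{real_normed_field,euclidean_space}"
  assumes f: "f absolutely_integrable_on {a..b}" and g: "g absolutely_integrable_on {a..b}"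
  shows "integral {a..b} f * integral {a..b} g =
    integral {a..b} (\<lambda>s. f s * integral {a..s} g + integral {a..s} f * g s)"
proof -
  define M where "M = lebesgue_on {a..b}"
  interpret fM: finite_measure M unfolding M_def by (rule finite_measure_lebesgue_on) (simp add: lmeasurable_cbox[of a b, simplified])
  interpret pair_sigma_finite M M ..
  have fi: "integrable M f" and gi: "integrable M g"
    using f g by (auto simp: M_def integrable_lebesgue_on_iff)
  note [measurable] = borel_measurable_integrable[OF fi] borel_measurable_integrable[OF gi]
  have idm: "(\<lambda>x. x) \<in> borel_measurable M"
    unfolding M_def by (rule continuous_imp_measurable_on_sets_lebesgue) auto
  have [measurable]: "Measurable.pred (M \<Otimes>\<^sub>M M) (\<lambda>z. snd z \<le> fst z)"
    unfolding pred_def by (intro borel_measurable_le measurable_compose[OF measurable_snd idm] measurable_compose[OF measurable_fst idm])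
  have pred_le: "{r \<in> space M. r \<le> s} \<in> sets M" for s
    by (intro borel_measurable_le idm) simp
  define K where "K = (\<lambda>(s,r). f s * g r)"
  define K1 where "K1 = (\<lambda>(s,r). if r \<le> s then f s * g r else 0)"
  define K2 where "K2 = (\<lambda>(s,r). if r \<le> s then 0 else f s * g r)"
  have Km[measurable]: "K \<in> borel_measurable (M \<Otimes>\<^sub>M M)" unfolding K_def by measurable
  have K1m[measurable]: "K1 \<in> borel_measurable (M \<Otimes>\<^sub>M M)" unfolding K1_def case_prod_beta by measurable
  have K2m[measurable]: "K2 \<in> borel_measurable (M \<Otimes>\<^sub>M M)" unfolding K2_def case_prod_beta by measurable
  have Ki: "integrable (M \<Otimes>\<^sub>M M) K"
  proof (rule Fubini_integrable[OF Km])
    show "integrable M (\<lambda>x. \<integral>y. norm (K (x, y)) \<partial>M)"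
      using fi by (simp add: K_def norm_mult integrable_norm)
    show "AE x in M. integrable M (\<lambda>y. K (x, y))"
      using gi by (simp add: K_def)
  qed
  have K1i: "integrable (M \<Otimes>\<^sub>M M) K1"
    by (rule Bochner_Integration.integrable_bound[OF Ki K1m]) (auto simp: K_def K1_def)
  have K2i: "integrable (M \<Otimes>\<^sub>M M) K2"
    by (rule Bochner_Integration.integrable_bound[OF Ki K2m]) (auto simp: K_def K2_def)
  have inner: "(\<integral>r. (if r \<le> s then h r else 0) \<partial>M) = integral {a..s} h"
    and inner2: "(\<integral>r. (if s \<le> r then 0 else h r) \<partial>M) = integral {a..s} h"
    if "h absolutely_integrable_on {a..b}" "s \<in> {a..b}" for h :: "real \<Rightarrow> 'a" and s
  proof -
    have hi: "integrable M h" using that by (simp add: M_def integrable_lebesgue_on_iff)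
    have [measurable]: "h \<in> borel_measurable M" using hi by simp
    have "integrable M (\<lambda>r. if r \<le> s then h r else 0)"
      by (rule Bochner_Integration.integrable_bound[OF hi measurable_If[OF _ _ pred_le]]) auto
    then have "(\<integral>r. (if r \<le> s then h r else 0) \<partial>M) = integral {a..b} (\<lambda>r. if r \<le> s then h r else 0)"
      unfolding M_def by (intro lebesgue_integral_eq_integral) auto
    also have "\<dots> = integral {a..b} (\<lambda>r. if r \<in> {..s} then h r else 0)" by simp
    also have "\<dots> = integral ({..s} \<inter> {a..b}) h" by (rule Henstock_Kurzweil_Integration.integral_restrict_Int)
    also have "{..s} \<inter> {a..b} = {a..s}" using that by auto
    finally show 1: "(\<integral>r. (if r \<le> s then h r else 0) \<partial>M) = integral {a..s} h" .
    \<comment> \<open>The diagonal was assigned to \<open>K1\<close>, so the inner integrals of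
      \<open>K2\<close> run over a strict inequality; the difference is the single point
      \<open>s\<close>, a null set.\<close>
    have "(\<integral>r. (if s \<le> r then 0 else h r) \<partial>M) = (\<integral>r. (if r \<le> s then h r else 0) \<partial>M)"
    proof (rule integral_discrete_difference[where X="{s}"])
      show "emeasure M {x} = 0" "{x} \<in> sets M" if "x \<in> {s}" for x
        using that \<open>s \<in> {a..b}\<close> unfolding M_def by (auto intro!: lebesgue_on_singleton_null simp: sets_restrict_space_iff)
    qed auto
    with 1 show "(\<integral>r. (if s \<le> r then 0 else h r) \<partial>M) = integral {a..s} h" by simp
  qed
  have cF: "continuous_on {a..b} (\<lambda>s. integral {a..s} f)" and cG: "continuous_on {a..b} (\<lambda>s. integral {a..s} g)"
    using f g by (auto intro!: indefinite_integral_continuous_1 abs_integrable_imp_integrable)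
  have i1: "(\<lambda>s. f s * integral {a..s} g) absolutely_integrable_on {a..b}"
    using abs_integrable_cont_mult[OF cG f] by (simp add: mult.commute)
  have i2: "(\<lambda>s. integral {a..s} f * g s) absolutely_integrable_on {a..b}"
    by (rule abs_integrable_cont_mult[OF cF g])
  have "integral\<^sup>L (M \<Otimes>\<^sub>M M) K1 = (\<integral>s. (\<integral>r. K1 (s, r) \<partial>M) \<partial>M)"
    using integral_fst'[OF K1i] by simp
  also have "\<dots> = (\<integral>s. f s * integral {a..s} g \<partial>M)"
  proof (rule Bochner_Integration.integral_cong)
    fix s assume "s \<in> space M"
    then have s: "s \<in> {a..b}" by (simp add: M_def)
    have "(\<integral>r. K1 (s, r) \<partial>M) = (\<integral>r. f s * (if r \<le> s then g r else 0) \<partial>M)"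
      by (rule Bochner_Integration.integral_cong) (auto simp: K1_def)
    then show "(\<integral>r. K1 (s, r) \<partial>M) = f s * integral {a..s} g" using inner[OF g s] by simp
  qed simp
  also have "\<dots> = integral {a..b} (\<lambda>s. f s * integral {a..s} g)"
    unfolding M_def by (rule LINT_Icc_eq_integral[OF i1])
  finally have e1: "integral\<^sup>L (M \<Otimes>\<^sub>M M) K1 = integral {a..b} (\<lambda>s. f s * integral {a..s} g)" .
  have "integral\<^sup>L (M \<Otimes>\<^sub>M M) K2 = (\<integral>r. (\<integral>s. K2 (s, r) \<partial>M) \<partial>M)"
    using integral_snd[of "\<lambda>s r. K2 (s, r)"] K2i by simp
  also have "\<dots> = (\<integral>r. integral {a..r} f * g r \<partial>M)"
  proof (rule Bochner_Integration.integral_cong)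
    fix r assume "r \<in> space M"
    then have r: "r \<in> {a..b}" by (simp add: M_def)
    have "(\<integral>s. K2 (s, r) \<partial>M) = (\<integral>s. (if r \<le> s then 0 else f s) * g r \<partial>M)"
      by (rule Bochner_Integration.integral_cong) (auto simp: K2_def)
    then show "(\<integral>s. K2 (s, r) \<partial>M) = integral {a..r} f * g r" using inner2[OF f r] by simp
  qed simp
  also have "\<dots> = integral {a..b} (\<lambda>s. integral {a..s} f * g s)"
    unfolding M_def by (rule LINT_Icc_eq_integral[OF i2])
  finally have e2: "integral\<^sup>L (M \<Otimes>\<^sub>M M) K2 = integral {a..b} (\<lambda>s. integral {a..s} f * g s)" .
  have "integral {a..b} f * integral {a..b} g = (\<integral>s. f s \<partial>M) * (\<integral>r. g r \<partial>M)"
    unfolding M_def by (simp add: LINT_Icc_eq_integral f g)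
  also have "\<dots> = (\<integral>s. (\<integral>r. K (s, r) \<partial>M) \<partial>M)" by (simp add: K_def)
  also have "\<dots> = integral\<^sup>L (M \<Otimes>\<^sub>M M) K" using integral_fst'[OF Ki] by simp
  also have "\<dots> = integral\<^sup>L (M \<Otimes>\<^sub>M M) (\<lambda>z. K1 z + K2 z)"
    by (rule Bochner_Integration.integral_cong) (auto simp: K_def K1_def K2_def)
  also have "\<dots> = integral\<^sup>L (M \<Otimes>\<^sub>M M) K1 + integral\<^sup>L (M \<Otimes>\<^sub>M M) K2" using K1i K2i by simp
  also have "\<dots> = integral {a..b} (\<lambda>s. f s * integral {a..s} g + integral {a..s} f * g s)"
    unfolding e1 e2 using i1 i2 by (intro integral_add[symmetric] abs_integrable_imp_integrable)
  finally show ?thesis .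
qed

text \<open>A product rule without derivatives: writing each factor as its initial value plus the
  integral of its density leaves a product of two integrals, which is the Fubini identity
  \<open>integral_mult_integral\<close>, and terms linear in one integral.\<close>

lemma ac_mult:
  fixes F G :: "real \<Rightarrow> 'a::{real_normed_field,euclidean_space}"
  assumes F: "ac F f a b" and G: "ac G g a b"
  shows "ac (\<lambda>t. F t * G t) (\<lambda>t. f t * G t + F t * g t) a b"
proof (rule acI)
  note fi = ac_absolutely_integrable[OF F] and gi = ac_absolutely_integrable[OF G]
  have i1: "(\<lambda>t. f t * G t) absolutely_integrable_on {a..b}"
    using abs_integrable_cont_mult[OF ac_continuous[OF G] fi] by (simp add: mult.commute)
  have i2: "(\<lambda>t. F t * g t) absolutely_integrable_on {a..b}"
    by (rule abs_integrable_cont_mult[OF ac_continuous[OF F] gi])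
  show "(\<lambda>t. f t * G t + F t * g t) absolutely_integrable_on {a..b}"
    using i1 i2 by (rule set_integral_add)
  fix t assume t: "t \<in> {a..b}"
  have fi: "f absolutely_integrable_on {a..t}" and gi: "g absolutely_integrable_on {a..t}"
    using fi gi t by (auto intro: abs_integrable_subinterval)
  have c: "continuous_on {a..t} (\<lambda>s. integral {a..s} f)" "continuous_on {a..t} (\<lambda>s. integral {a..s} g)"
    using fi gi by (auto intro!: indefinite_integral_continuous_1 abs_integrable_imp_integrable)
  have "integral {a..t} (\<lambda>s. f s * G s + F s * g s) =
      integral {a..t} (\<lambda>s. (f s * integral {a..s} g + integral {a..s} f * g s) + (G a * f s + F a * g s))"
  proof (rule integral_cong)
    fix s assume "s \<in> {a..t}"
    then have "s \<in> {a..b}" using t by auto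
    note eqs = ac_eq[OF F this] ac_eq[OF G this]
    show "f s * G s + F s * g s = (f s * integral {a..s} g + integral {a..s} f * g s) + (G a * f s + F a * g s)"
      unfolding eqs by (simp add: algebra_simps)
  qed
  also have "\<dots> = integral {a..t} f * integral {a..t} g + (G a * integral {a..t} f + F a * integral {a..t} g)"
  proof -
    have i: "(\<lambda>s. f s * integral {a..s} g) integrable_on {a..t}" "(\<lambda>s. integral {a..s} f * g s) integrable_on {a..t}"
      using abs_integrable_cont_mult[OF c(2) fi] abs_integrable_cont_mult[OF c(1) gi]
      by (auto simp: mult.commute intro: abs_integrable_imp_integrable)
    have j: "(\<lambda>s. G a * f s) integrable_on {a..t}" "(\<lambda>s. F a * g s) integrable_on {a..t}"
      using fi gi by (auto intro: integrable_on_mult_right abs_integrable_imp_integrable)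
    show ?thesis
      using integral_add[OF integrable_add[OF i] integrable_add[OF j]] integral_add[OF j]
      by (simp add: integral_mult_integral[OF fi gi])
  qed
  also have "\<dots> = F t * G t - F a * G a"
    unfolding ac_eq[OF F t] ac_eq[OF G t] by (simp add: algebra_simps)
  finally show "F t * G t = F a * G a + integral {a..t} (\<lambda>t. f t * G t + F t * g t)" by simp
qed

lemma ac_by_parts:
  fixes F G :: "real \<Rightarrow> 'a::{real_normed_field,euclidean_space}"
  assumes F: "ac F f a b" and G: "ac G g a b" and "a \<le> b"
  shows "integral {a..b} (\<lambda>t. f t * G t) = F b * G b - F a * G a - integral {a..b} (\<lambda>t. F t * g t)"
proof -
  have i1: "(\<lambda>t. f t * G t) integrable_on {a..b}"
    using abs_integrable_cont_mult[OF ac_continuous[OF G] ac_absolutely_integrable[OF F]]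
    by (simp add: mult.commute abs_integrable_imp_integrable)
  have i2: "(\<lambda>t. F t * g t) integrable_on {a..b}"
    using abs_integrable_cont_mult[OF ac_continuous[OF F] ac_absolutely_integrable[OF G]]
    by (simp add: abs_integrable_imp_integrable)
  have "integral {a..b} (\<lambda>t. f t * G t + F t * g t) = F b * G b - F a * G a"
    using ac_eq[OF ac_mult[OF F G], of b] assms(3) by (simp only: atLeastAtMost_iff) simp
  then show ?thesis using integral_add[OF i1 i2] by (simp add: algebra_simps)
qed

section \<open>Regularity of weakly differentiable functions\<close>

text \<open>The set function \<open>A \<mapsto> \<integral>_A f\<close> vanishes on intervals, hence
  on Borel sets by induction over their generation, hence on Lebesgue sets, which are Borel up to
  null sets; a density with vanishing set integrals is zero almost everywhere.\<close>

lemma AE_eq_0_of_integrals_eq_0: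
  fixes f :: "real \<Rightarrow> 'a::euclidean_space"
  assumes f: "f absolutely_integrable_on {a..b}"
    and z: "\<And>t. t \<in> {a..b} \<Longrightarrow> integral {a..t} f = 0"
  shows "AE x in lebesgue_on {a..b}. f x = 0"
proof -
  define F where "F x = indicator {a..b} x *\<^sub>R f x" for x
  have Fi: "integrable lebesgue F"
    using f by (simp add: F_def[abs_def] set_integrable_def)
  have Fset: "set_integrable lebesgue A F" if "A \<in> sets lebesgue" for A
    unfolding set_integrable_def using Fi that by (rule integrable_mult_indicator[rotated])
  let ?I = "\<lambda>A. set_lebesgue_integral lebesgue A F"
  have Iiv: "?I {c..d} = 0" if "c \<le> d" for c d
  proof -
    have "?I {c..d} = integral {c..d} F"
      by (rule set_lebesgue_integral_eq_integral(2)[OF Fset]) simp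
    also have "\<dots> = integral {c..d} (\<lambda>x. if x \<in> {a..b} then f x else 0)"
      by (rule integral_cong) (auto simp: F_def)
    also have "\<dots> = integral ({a..b} \<inter> {c..d}) f"
      by (rule Henstock_Kurzweil_Integration.integral_restrict_Int)
    also have "{a..b} \<inter> {c..d} = {max a c..min b d}" by auto
    also have "integral {max a c..min b d} f = 0"
    proof (cases "max a c \<le> min b d")
      case True
      have "ac (\<lambda>t. integral {a..t} f) f a b" by (rule ac_primitive[OF f])
      from ac_diff_eq[OF this, of "max a c" "min b d"] True z[of "max a c"] z[of "min b d"]
      show ?thesis by auto
    qed auto
    finally show ?thesis .
  qed
  \<comment> \<open>The total integral is what the complement step of the induction needs. The
    \<open>min\<close> and \<open>max\<close> below cover \<open>a > b\<close>, where
    \<open>F\<close> is zero.\<close>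
  have Iall: "?I UNIV = 0"
  proof -
    have "?I UNIV = ?I {min a b..max a b}"
      unfolding set_lebesgue_integral_def
      by (rule Bochner_Integration.integral_cong) (auto simp: F_def indicator_def)
    then show ?thesis using Iiv[of "min a b" "max a b"] by simp
  qed
  have borel: "?I A = 0" if "A \<in> sets borel" for A
    using that
  proof (induction A rule: borel_set_induct)
    case empty
    then show ?case by (simp add: set_lebesgue_integral_def)
  next
    case (interval c d)
    then show ?case by (rule Iiv)
  next
    case (compl A)
    then have A: "A \<in> sets lebesgue" "- A \<in> sets lebesgue" using borel_comp[of A] by simp_all
    have "?I (A \<union> - A) = ?I A + ?I (- A)"
      using A by (intro set_integral_Un Fset) auto
    then show ?case using Iall compl by simp
  next
    case (union A)
    have "?I (\<Union>i. A i) = (\<Sum>i. ?I (A i))"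
    proof (rule lebesgue_integral_countable_add)
      show "A i \<in> sets lebesgue" for i using union by simp
      show "A i \<inter> A j = {}" if "i \<noteq> j" for i j
        using union that by (auto simp: disjoint_family_on_def)
      show "set_integrable lebesgue (\<Union>i. A i) F" using union by (intro Fset) auto
    qed
    then show ?case using union by simp
  qed
  have leb: "?I A = 0" if "A \<in> sets lebesgue" for A
  proof -
    from that obtain S N N' where A: "A = S \<union> N" "N \<subseteq> N'" "N' \<in> null_sets lborel" "S \<in> sets lborel"
      by (rule sets_completionE)
    have "AE x in lebesgue. x \<notin> N'"
      using A(3) by (intro AE_not_in null_sets_completionI)
    then have "AE x in lebesgue. x \<in> S \<longleftrightarrow> x \<in> A"
      by eventually_elim (use A in auto)
    then have "?I A = ?I S"
      using that A(4) Fset[of A] Fset[of S]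
      by (intro set_integral_cong_set) (auto simp: set_integrable_def set_borel_measurable_def)
    then show ?thesis using borel A(4) by simp
  qed
  let ?M = "lebesgue_on {a..b}"
  interpret finite_measure ?M
    by (rule finite_measure_lebesgue_on) (simp add: lmeasurable_cbox[of a b, simplified])
  show ?thesis
  proof (rule density_zero)
    show "integrable ?M f" using f by (simp add: integrable_lebesgue_on_iff)
    fix A assume "A \<in> sets ?M"
    then have A: "A \<in> sets lebesgue" by (simp add: sets_restrict_space_iff)
    have "set_lebesgue_integral ?M A f = (LINT x|lebesgue. indicator {a..b} x *\<^sub>R indicator A x *\<^sub>R f x)"
      unfolding set_lebesgue_integral_def by (rule integral_restrict_space) simp
    also have "\<dots> = ?I A"
      unfolding set_lebesgue_integral_def F_def by (simp add: mult.commute)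
    finally show "set_lebesgue_integral ?M A f = 0" using leb[OF A] by simp
  qed
qed

section \<open>Smooth functions of compact support\<close>

definition flat_exp :: "nat \<Rightarrow> real \<Rightarrow> real" where
  "flat_exp p y = (if y > 0 then exp (- 1 / y) * (1 / y) ^ p else 0)"

lemma flat_exp_nonneg: "0 \<le> flat_exp p y"
  by (simp add: flat_exp_def)

lemma power_le_fact_exp:
  fixes x :: real
  assumes "0 \<le> x"
  shows "x ^ n \<le> fact n * exp x"
proof -
  have "(\<Sum>k\<in>{n}. x ^ k /\<^sub>R fact k) \<le> (\<Sum>k. x ^ k /\<^sub>R fact k)"
    using assms by (intro sum_le_suminf summable_exp_generic) auto
  then have "x ^ n / fact n \<le> exp x" by (simp add: exp_def divide_inverse mult.commute)
  then show ?thesis by (simp add: field_simps)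
qed

text \<open>The square is deliberate: one power of \<open>y\<close> is consumed by the difference
  quotient at 0, the other makes that quotient tend to 0.\<close>

lemma flat_exp_le: "y > 0 \<Longrightarrow> flat_exp p y \<le> fact (p + 2) * y\<^sup>2"
proof -
  assume y: "y > 0"
  have "(1 / y) ^ (p + 2) \<le> fact (p + 2) * exp (1 / y)"
    using y by (intro power_le_fact_exp) simp
  then have "(1 / y) ^ (p + 2) * exp (- 1 / y) \<le> fact (p + 2) * exp (1 / y) * exp (- 1 / y)"
    by (intro mult_right_mono) auto
  also have "\<dots> = fact (p + 2)" by (simp add: exp_minus)
  finally have "y\<^sup>2 * ((1 / y) ^ (p + 2) * exp (- 1 / y)) \<le> y\<^sup>2 * fact (p + 2)"
    by (intro mult_left_mono) auto
  moreover have "y\<^sup>2 * ((1 / y) ^ (p + 2) * exp (- 1 / y)) = flat_exp p y"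
    using y by (simp add: flat_exp_def power_add power_divide power2_eq_square)
  ultimately show ?thesis by (simp add: mult.commute)
qed

text \<open>The powers of \<open>1 / y\<close> are in the definition so that the family is closed
  under differentiation up to linear combinations. At 0 the difference quotient is squeezed by
  \<open>flat_exp_le\<close>.\<close>

lemma flat_exp_deriv:
  "(flat_exp p has_field_derivative flat_exp (p + 2) y - real p * flat_exp (p + 1) y) (at y)"
proof -
  consider "y > 0" | "y < 0" | "y = 0" by linarith
  then show ?thesis
  proof cases
    case 1
    have "((\<lambda>y. exp (- (1 / y)) * (1 / y) ^ p) has_field_derivative
        exp (- (1 / y)) * (1 / y\<^sup>2) * (1 / y) ^ p + (real p * (1 / y) ^ (p - 1) * (- 1 / y\<^sup>2)) * exp (- (1 / y))) (at y)"
      by (rule derivative_eq_intros refl | use 1 in \<open>simp add: power2_eq_square\<close>)+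
    also have "exp (- (1 / y)) * (1 / y\<^sup>2) * (1 / y) ^ p + (real p * (1 / y) ^ (p - 1) * (- 1 / y\<^sup>2)) * exp (- (1 / y))
        = flat_exp (p + 2) y - real p * flat_exp (p + 1) y"
      using 1 by (cases p) (auto simp: flat_exp_def power_add power2_eq_square mult_ac)
    finally show ?thesis
      by (rule has_field_derivative_transform_within_open[where S="{0<..}"]) (use 1 in \<open>auto simp: flat_exp_def\<close>)
  next
    case 2
    have "((\<lambda>y. 0) has_field_derivative flat_exp (p + 2) y - real p * flat_exp (p + 1) y) (at y)"
      using 2 by (simp add: flat_exp_def)
    then show ?thesis
      by (rule has_field_derivative_transform_within_open[where S="{..<0}"]) (use 2 in \<open>auto simp: flat_exp_def\<close>)
  next
    case 3
    have "((\<lambda>h. (flat_exp p (0 + h) - flat_exp p 0) / h) \<longlongrightarrow> 0) (at 0)"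
    proof (rule Lim_null_comparison)
      show "((\<lambda>h. fact (p + 2) * \<bar>h\<bar>) \<longlongrightarrow> 0) (at (0::real))"
        by (auto intro!: tendsto_eq_intros)
      show "\<forall>\<^sub>F h in at 0. norm ((flat_exp p (0 + h) - flat_exp p 0) / h) \<le> fact (p + 2) * \<bar>h\<bar>"
      proof (intro always_eventually allI)
        fix h :: real
        show "norm ((flat_exp p (0 + h) - flat_exp p 0) / h) \<le> fact (p + 2) * \<bar>h\<bar>"
        proof (cases "h > 0")
          case True
          then show ?thesis using flat_exp_le[OF True, of p] flat_exp_nonneg[of p h]
            by (simp add: flat_exp_def[of p 0] power2_eq_square divide_le_eq mult.assoc)
        next
          case False
          have "0 \<le> fact (p + 2) * \<bar>h\<bar>" by (intro mult_nonneg_nonneg) auto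
          with False show ?thesis by (simp add: flat_exp_def del: fact_Suc)
        qed
      qed
    qed
    then show ?thesis using 3 by (simp add: DERIV_def flat_exp_def)
  qed
qed

text \<open>A syntactic class containing a derivative of each of its members, so that smoothness of
  all orders follows from one rule induction.\<close>

inductive_set smooth_bumps :: "(real \<Rightarrow> real) set" where
  const: "(\<lambda>x. c) \<in> smooth_bumps"
| flat: "(\<lambda>x. flat_exp p (\<alpha> * x + \<gamma>)) \<in> smooth_bumps"
| add: "f \<in> smooth_bumps \<Longrightarrow> g \<in> smooth_bumps \<Longrightarrow> (\<lambda>x. f x + g x) \<in> smooth_bumps"
| mult: "f \<in> smooth_bumps \<Longrightarrow> g \<in> smooth_bumps \<Longrightarrow> (\<lambda>x. f x * g x) \<in> smooth_bumps"

lemma smooth_bumps_deriv: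
  "f \<in> smooth_bumps \<Longrightarrow> \<exists>f'\<in>smooth_bumps. \<forall>x. (f has_field_derivative f' x) (at x)"
proof (induction rule: smooth_bumps.induct)
  case (const c)
  show ?case by (rule bexI[OF _ smooth_bumps.const[of 0]]) auto
next
  case (flat p \<alpha> \<gamma>)
  let ?f' = "\<lambda>x. \<alpha> * flat_exp (p + 2) (\<alpha> * x + \<gamma>) + (- \<alpha> * real p) * flat_exp (p + 1) (\<alpha> * x + \<gamma>)"
  have "?f' \<in> smooth_bumps"
    by (intro smooth_bumps.intros)
  moreover have "((\<lambda>x. flat_exp p (\<alpha> * x + \<gamma>)) has_field_derivative ?f' x) (at x)" for x
    by (rule DERIV_cong[OF DERIV_chain2[OF flat_exp_deriv]]) (auto intro!: derivative_eq_intros simp: algebra_simps)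
  ultimately show ?case by (intro bexI[of _ ?f']) auto
next
  case (add f g)
  then obtain f' g' where "f' \<in> smooth_bumps" "g' \<in> smooth_bumps"
    "\<And>x. (f has_field_derivative f' x) (at x)" "\<And>x. (g has_field_derivative g' x) (at x)" by blast
  then show ?case
    by (intro bexI[OF _ smooth_bumps.add[of f' g']]) (auto intro!: derivative_intros)
next
  case (mult f g)
  then obtain f' g' where *: "f' \<in> smooth_bumps" "g' \<in> smooth_bumps"
    "\<And>x. (f has_field_derivative f' x) (at x)" "\<And>x. (g has_field_derivative g' x) (at x)" by blast
  have "(\<lambda>x. f' x * g x + f x * g' x) \<in> smooth_bumps"
    using * mult by (intro smooth_bumps.intros)
  moreover have "((\<lambda>x. f x * g x) has_field_derivative f' x * g x + f x * g' x) (at x)" for x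
    by (rule DERIV_cong[OF DERIV_mult[OF *(3,4)]]) (simp add: algebra_simps)
  ultimately show ?case by (intro bexI[of _ "\<lambda>x. f' x * g x + f x * g' x"]) auto
qed

lemma smooth_bumps_deriv_funpow:
  assumes "f \<in> smooth_bumps"
  shows "(deriv ^^ n) f \<in> smooth_bumps"
proof (induction n)
  case (Suc n)
  then obtain f' where f': "f' \<in> smooth_bumps" "\<forall>x. ((deriv ^^ n) f has_field_derivative f' x) (at x)"
    using smooth_bumps_deriv by blast
  then have "deriv ((deriv ^^ n) f) = f'" by (intro ext DERIV_imp_deriv) auto
  then show ?case using f' by simp
qed (simp add: assms)

lemma smooth_bumps_continuous: "f \<in> smooth_bumps \<Longrightarrow> continuous_on S f"
  using smooth_bumps_deriv[of f] DERIV_continuous_on by (metis has_field_derivative_at_within)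

text \<open>The test function is the primitive of \<open>g\<close> from 0. To the left of the
  support it vanishes trivially, to the right because \<open>g\<close> has mean zero.\<close>

lemma test_function_of_smooth_bump:
  assumes "g \<in> smooth_bumps" "0 < a" "a \<le> b" "b < 1" "\<And>x. x \<notin> {a..b} \<Longrightarrow> g x = 0" "integral {0..1} g = 0"
  obtains \<theta> where "\<theta> \<in> test_functions" "deriv \<theta> = g" "\<And>x. (\<theta> has_field_derivative g x) (at x)"
    "\<theta> 0 = 0" "\<theta> 1 = 0"
proof -
  define \<theta> where "\<theta> x = integral {0..x} g" for x
  have cont: "continuous_on S g" for S by (rule smooth_bumps_continuous[OF assms(1)])
  have low: "\<theta> x = 0" if "x < a" for x
  proof -
    have "integral {0..x} g = integral {0..x} (\<lambda>_. 0)"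
      using that assms(5) by (intro integral_cong) auto
    then show ?thesis by (simp add: \<theta>_def)
  qed
  have high: "\<theta> x = 0" if "x > b" for x
  proof -
    have "0 \<le> x" using that assms by linarith
    have gi: "g integrable_on {s..t}" for s t by (rule integrable_continuous_interval[OF cont])
    have zz: "integral {s..t} g = 0" if "b < s" for s t
    proof -
      have "integral {s..t} g = integral {s..t} (\<lambda>_. 0)"
        using that assms(5) by (intro integral_cong) auto
      then show ?thesis by simp
    qed
    show ?thesis
    proof (cases "x \<le> 1")
      case True
      then have "integral {0..x} g + integral {x..1} g = integral {0..1} g"
        using \<open>0 \<le> x\<close> gi by (intro Henstock_Kurzweil_Integration.integral_combine) auto
      then show ?thesis using zz[OF that] assms(6) by (simp add: \<theta>_def)
    next
      case False
      then have "integral {0..1} g + integral {1..x} g = integral {0..x} g"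
        using gi by (intro Henstock_Kurzweil_Integration.integral_combine) auto
      then show ?thesis using zz[OF assms(4)] assms(6) by (simp add: \<theta>_def)
    qed
  qed
  have d: "(\<theta> has_field_derivative g x) (at x)" for x
  proof (cases "x > 0")
    case True
    have "(\<theta> has_real_derivative g x) (at x within {0..x+1})"
      unfolding \<theta>_def by (rule integral_has_real_derivative[OF cont]) (use True in auto)
    then show ?thesis using at_within_interior[of x "{0..x+1}"] True by simp
  next
    case False
    have "((\<lambda>_. 0) has_field_derivative g x) (at x)"
      using False assms(2,5) by simp
    then show ?thesis
      by (rule has_field_derivative_transform_within_open[where S="{..<a}"])
        (use False assms(2) low in auto)
  qed
  have dg: "deriv \<theta> = g" using d by (intro ext DERIV_imp_deriv)
  have "(deriv ^^ n) \<theta> field_differentiable at x" for n x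
  proof (cases n)
    case 0
    then show ?thesis using d by (auto simp: field_differentiable_def)
  next
    case (Suc m)
    then have "(deriv ^^ n) \<theta> = (deriv ^^ m) g" by (simp add: funpow_swap1 dg del: funpow.simps) (simp add: funpow_Suc_right dg del: funpow.simps)
    then show ?thesis
      using smooth_bumps_deriv[OF smooth_bumps_deriv_funpow[OF assms(1)], of m] by (auto simp: field_differentiable_def)
  qed
  moreover have "\<exists>K. compact K \<and> K \<subseteq> I01 \<and> (\<forall>x. x \<notin> K \<longrightarrow> \<theta> x = 0)"
    by (rule exI[of _ "{a..b}"]) (use assms low high in \<open>auto simp: not_le\<close>)
  ultimately have "\<theta> \<in> test_functions" by (auto simp: test_functions_def)
  then show ?thesis using that dg d low[of 0] high[of 1] assms by blast
qed

lemma flat_exp_0_le_1: "flat_exp 0 y \<le> 1"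
  by (simp add: flat_exp_def)

lemma flat_exp_scaled_tendsto:
  "(\<lambda>n. flat_exp 0 (real (Suc n) * y)) \<longlonglongrightarrow> (if y > 0 then 1 else 0)"
proof (cases "y > 0")
  case True
  have "(\<lambda>n. exp (- (1 / y) * inverse (real (Suc n)))) \<longlonglongrightarrow> exp (- (1 / y) * 0)"
    by (intro tendsto_intros LIMSEQ_inverse_real_of_nat)
  moreover have "flat_exp 0 (real (Suc n) * y) = exp (- (1 / y) * inverse (real (Suc n)))" for n
    using True by (simp add: flat_exp_def divide_inverse mult.commute)
  ultimately show ?thesis using True by simp
next
  case False
  then have "flat_exp 0 (real (Suc n) * y) = 0" for n
    using mult_nonneg_nonpos[of "real (Suc n)" y] by (simp add: flat_exp_def)
  then show ?thesis using False by simp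
qed

text \<open>A smooth approximation of the indicator of \<open>{a<..<b}\<close>, which it reaches
  pointwise as \<open>n\<close> grows; the support stays in \<open>{a..b}\<close> for all
  \<open>n\<close>.\<close>

definition bump :: "nat \<Rightarrow> real \<Rightarrow> real \<Rightarrow> real \<Rightarrow> real" where
  "bump n a b x = flat_exp 0 (real (Suc n) * (x - a)) * flat_exp 0 (real (Suc n) * (b - x))"

lemma bump_smooth: "bump n a b \<in> smooth_bumps"
proof -
  have "(\<lambda>x. flat_exp 0 (real (Suc n) * x + - (real (Suc n) * a)) *
      flat_exp 0 (- real (Suc n) * x + real (Suc n) * b)) \<in> smooth_bumps"
    by (intro smooth_bumps.intros)
  also have "(\<lambda>x. flat_exp 0 (real (Suc n) * x + - (real (Suc n) * a)) *
      flat_exp 0 (- real (Suc n) * x + real (Suc n) * b)) = bump n a b"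
    by (auto simp: bump_def fun_eq_iff algebra_simps)
  finally show ?thesis .
qed

lemma bump_support: "x \<notin> {a..b} \<Longrightarrow> bump n a b x = 0"
proof -
  have "flat_exp 0 (real (Suc n) * y) = 0" if "y < 0" for y
    using that mult_nonneg_nonpos[of "real (Suc n)" y] by (simp add: flat_exp_def)
  then show "x \<notin> {a..b} \<Longrightarrow> bump n a b x = 0"
    by (auto simp: bump_def not_le)
qed

lemma bump_bounds: "0 \<le> bump n a b x" "bump n a b x \<le> 1"
  unfolding bump_def using flat_exp_nonneg flat_exp_0_le_1 by (auto intro!: mult_nonneg_nonneg mult_le_one)

lemma bump_tendsto: "(\<lambda>n. bump n a b x) \<longlonglongrightarrow> (if x \<in> {a<..<b} then 1 else 0)"
proof -
  have "(\<lambda>n. bump n a b x) \<longlonglongrightarrow> (if x - a > 0 then 1 else 0) * (if b - x > 0 then 1 else 0)"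
    unfolding bump_def by (intro tendsto_mult flat_exp_scaled_tendsto)
  then show ?thesis by (auto split: if_splits)
qed

lemma bump_integral_tendsto:
  fixes h :: "real \<Rightarrow> complex"
  assumes h: "h absolutely_integrable_on {0..1}" and ab: "0 < a" "a \<le> b" "b < 1"
  shows "(\<lambda>x. of_real (bump n a b x) * h x) absolutely_integrable_on {0..1}"
    and "(\<lambda>n. integral {0..1} (\<lambda>x. of_real (bump n a b x) * h x)) \<longlonglongrightarrow> integral {a..b} h"
proof -
  show i: "(\<lambda>x. of_real (bump n a b x) * h x) absolutely_integrable_on {0..1}" for n
    by (intro abs_integrable_cont_mult[OF _ h] continuous_on_of_real smooth_bumps_continuous bump_smooth)
  have hn: "(\<lambda>x. norm (h x)) integrable_on {0..1}"
    using h by (simp add: absolutely_integrable_on_def)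
  have "(\<lambda>n. integral {0..1} (\<lambda>x. of_real (bump n a b x) * h x)) \<longlonglongrightarrow>
      integral {0..1} (\<lambda>x. of_real (if x \<in> {a<..<b} then 1 else 0) * h x)"
  proof (rule dominated_convergence(2)[OF abs_integrable_imp_integrable[OF i] hn])
    show "norm (of_real (bump n a b x) * h x) \<le> norm (h x)" for n x
      using bump_bounds[of n a b x] by (simp add: norm_mult mult_left_le_one_le)
    show "(\<lambda>n. of_real (bump n a b x) * h x) \<longlonglongrightarrow> of_real (if x \<in> {a<..<b} then 1 else 0) * h x" for x
      by (intro tendsto_intros bump_tendsto)
  qed
  also have "integral {0..1} (\<lambda>x. of_real (if x \<in> {a<..<b} then 1 else 0) * h x) =
      integral {0..1} (\<lambda>x. if x \<in> {a<..<b} then h x else 0)"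
    by (rule integral_cong) auto
  also have "\<dots> = integral ({a<..<b} \<inter> {0..1}) h"
    by (rule Henstock_Kurzweil_Integration.integral_restrict_Int)
  also have "{a<..<b} \<inter> {0..1} = {a<..<b}" using ab by auto
  also have "integral {a<..<b} h = integral {a..b} h"
    by (rule integral_open_interval_real[symmetric])
  finally show "(\<lambda>n. integral {0..1} (\<lambda>x. of_real (bump n a b x) * h x)) \<longlonglongrightarrow> integral {a..b} h" .
qed

text \<open>The du Bois-Reymond lemma: the test functions used are primitives of differences of bumps.\<close>

lemma constant_of_test_functions:
  fixes h :: "real \<Rightarrow> complex"
  assumes h: "h absolutely_integrable_on {0..1}"
    and z: "\<And>\<theta>. \<theta> \<in> test_functions \<Longrightarrow> \<theta> 0 = 0 \<Longrightarrow> \<theta> 1 = 0 \<Longrightarrow> (\<And>x. (\<theta> has_field_derivative deriv \<theta> x) (at x)) \<Longrightarrow>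
      continuous_on {0..1} (deriv \<theta>) \<Longrightarrow>
      integral {0..1} (\<lambda>x. of_real (deriv \<theta> x) * h x) = 0"
  obtains c where "AE x in lebesgue_on {0..1}. h x = c"
proof -
  define Y where "Y n a b = integral {0..1} (bump n a b)" for n a b
  define J where "J n a b = integral {0..1} (\<lambda>x. of_real (bump n a b x) * h x)" for n a b
  \<comment> \<open>The averages of \<open>h\<close> over two intervals inside the unit interval
    agree. The cross-multiplied form is the limit of an identity for bumps and includes degenerate
    intervals.\<close>
  have key: "of_real (d - c) * integral {a..b} h = of_real (b - a) * integral {c..d} h"
    if "0 < a" "a \<le> b" "b < 1" "0 < c" "c \<le> d" "d < 1" for a b c d
  proof -
    have ki: "(\<lambda>x. bump n s t x) integrable_on {0..1}" for n s t
      by (intro integrable_continuous_interval smooth_bumps_continuous bump_smooth)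
    have YJ: "of_real (Y n c d) * J n a b = of_real (Y n a b) * J n c d" for n
    proof -
      \<comment> \<open>Each bump is weighted with the mass of the other one, so that the difference
        has mean zero and is the derivative of a test function.\<close>
      let ?g = "\<lambda>x. Y n c d * bump n a b x + (- Y n a b) * bump n c d x"
      have gs: "?g \<in> smooth_bumps" by (intro smooth_bumps.intros bump_smooth)
      have "integral {0..1} ?g = integral {0..1} (\<lambda>x. Y n c d * bump n a b x) + integral {0..1} (\<lambda>x. (- Y n a b) * bump n c d x)"
        by (intro integral_add integrable_on_mult_right ki)
      also have "\<dots> = 0" by (simp add: Y_def)
      finally have gi: "integral {0..1} ?g = 0" .
      have supp: "?g x = 0" if "x \<notin> {min a c..max b d}" for x
      proof -
        have n: "x \<notin> {a..b}" "x \<notin> {c..d}" using that by auto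
        show ?thesis by (simp add: bump_support[OF n(1)] bump_support[OF n(2)])
      qed
      have le: "0 < min a c" "min a c \<le> max b d" "max b d < 1" using that by auto
      obtain \<theta> where \<theta>: "\<theta> \<in> test_functions" "deriv \<theta> = ?g" "\<And>x. (\<theta> has_field_derivative ?g x) (at x)"
          "\<theta> 0 = 0" "\<theta> 1 = 0"
        using test_function_of_smooth_bump[OF gs le supp gi] by blast
      have "continuous_on {0..1} (deriv \<theta>)" unfolding \<theta>(2) by (rule smooth_bumps_continuous[OF gs])
      with \<theta> have "integral {0..1} (\<lambda>x. of_real (?g x) * h x) = 0"
        using z[of \<theta>] by simp
      moreover have "integral {0..1} (\<lambda>x. of_real (?g x) * h x) =
          integral {0..1} (\<lambda>x. of_real (Y n c d) * (of_real (bump n a b x) * h x) - of_real (Y n a b) * (of_real (bump n c d x) * h x))"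
        by (rule integral_cong) (simp add: algebra_simps)
      moreover have "\<dots> = of_real (Y n c d) * J n a b - of_real (Y n a b) * J n c d"
        unfolding J_def using bump_integral_tendsto(1)[OF h] that
        by (subst integral_diff) (auto intro!: integrable_on_mult_right abs_integrable_imp_integrable)
      ultimately show ?thesis by simp
    qed
    have Yl: "(\<lambda>n. of_real (Y n s t) :: complex) \<longlonglongrightarrow> of_real (t - s)" if "0 < s" "s \<le> t" "t < 1" for s t
    proof -
      have "(\<lambda>n. integral {0..1} (\<lambda>x. of_real (bump n s t x) * 1) :: complex) \<longlonglongrightarrow> integral {s..t} (\<lambda>_. 1)"
        by (rule bump_integral_tendsto(2)) (use that in auto)
      moreover have "integral {0..1} (\<lambda>x. of_real (bump n s t x) * 1) = (of_real (Y n s t) :: complex)" for n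
        unfolding Y_def using integral_linear[OF ki bounded_linear_of_real, of n s t] by (simp add: o_def)
      ultimately show ?thesis using that by (simp add: of_real_def)
    qed
    have Jl: "(\<lambda>n. J n s t) \<longlonglongrightarrow> integral {s..t} h" if "0 < s" "s \<le> t" "t < 1" for s t
      unfolding J_def by (rule bump_integral_tendsto(2)[OF h that])
    have "(\<lambda>n. of_real (Y n c d) * J n a b) \<longlonglongrightarrow> of_real (d - c) * integral {a..b} h"
      by (intro tendsto_mult Yl Jl that)
    moreover have "(\<lambda>n. of_real (Y n a b) * J n c d) \<longlonglongrightarrow> of_real (b - a) * integral {c..d} h"
      by (intro tendsto_mult Yl Jl that)
    ultimately show ?thesis unfolding YJ by (rule LIMSEQ_unique)
  qed
  \<comment> \<open>The average of \<open>h\<close> over the middle third, a fixed interval against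
    which every other one is compared by \<open>key\<close>.\<close>
  define m where "m = 3 * integral {1/3..2/3} h"
  have hm: "(\<lambda>x. h x - m) absolutely_integrable_on {0..1}"
    by (rule set_integral_diff(1)[OF h absolutely_integrable_continuous_real]) simp
  define H where "H t = integral {0..t} (\<lambda>x. h x - m)" for t
  have acH: "ac H (\<lambda>x. h x - m) 0 1" unfolding H_def by (rule ac_primitive[OF hm])
  have Heq: "H a = H b" if "0 < a" "a \<le> b" "b < 1" for a b
  proof -
    have "H b - H a = integral {a..b} (\<lambda>x. h x - m)"
      using that by (intro ac_diff_eq[OF acH]) auto
    also have "\<dots> = integral {a..b} h - of_real (b - a) * m"
    proof -
      have "h integrable_on {a..b}"
        by (rule abs_integrable_imp_integrable[OF abs_integrable_subinterval[OF h]]) (use that in simp_all)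
      then have "integral {a..b} (\<lambda>x. h x - m) = integral {a..b} h - integral {a..b} (\<lambda>_. m)"
        by (rule integral_diff) (rule integrable_continuous_interval, simp)
      then show ?thesis using that by (simp add: scaleR_conv_of_real)
    qed
    also have "\<dots> = 0"
      using key[of a b "1/3" "2/3"] that by (simp add: m_def)
    finally show ?thesis by simp
  qed
  have contH: "continuous_on {0..1} H" by (rule ac_continuous[OF acH])
  \<comment> \<open>\<open>Heq\<close> compares interior points only; continuity of \<open>H\<close>
    extends the identity to the endpoints, in particular to 0, where \<open>H\<close>
    vanishes.\<close>
  have Hhalf: "H t = H (1/2)" if "t \<in> {0..1}" for t
  proof -
    have *: "H t = H (1/2)" if "t \<in> {0<..<1}" for t
    proof (cases "t \<le> 1/2")
      case True
      then show ?thesis using that by (intro Heq) auto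
    next
      case False
      then show ?thesis using that by (intro Heq[symmetric]) auto
    qed
    have cl: "closure {0<..<1::real} = {0..1}" by simp
    show ?thesis
      by (rule continuous_constant_on_closure[of "{0<..<1}" H, unfolded cl, OF contH * that])
  qed
  have H0: "H 0 = 0" unfolding H_def by simp
  have "H t = 0" if "t \<in> {0..1}" for t
    using trans[OF Hhalf[OF that] Hhalf[of 0, symmetric]] H0 by simp
  then have "AE x in lebesgue_on {0..1}. h x - m = 0"
    by (intro AE_eq_0_of_integrals_eq_0[OF hm]) (simp only: H_def)
  then show ?thesis by (intro that[of m]) simp
qed

section \<open>Weak derivatives and continuous representatives\<close>

lemma continuous_AE_eq:
  fixes f g :: "real \<Rightarrow> complex"
  assumes "continuous_on {0..1} f" "continuous_on {0..1} g" "AE x in lebesgue_on {0..1}. f x = g x"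
    and x: "x \<in> {0..1}"
  shows "f x = g x"
proof -
  have c: "continuous_on {0..1} (\<lambda>x. norm (f x - g x))"
    using assms by (intro continuous_intros)
  have "(LINT x|lebesgue_on {0..1}. norm (f x - g x)) = (LINT x|lebesgue_on {0..1::real}. (0::real))"
  proof (rule integral_cong_AE)
    show "(\<lambda>x. norm (f x - g x)) \<in> borel_measurable (lebesgue_on {0..1})"
      using c by (rule continuous_imp_measurable_on_sets_lebesgue) simp
    show "AE x in lebesgue_on {0..1}. norm (f x - g x) = 0"
      using assms(3) by eventually_elim simp
  qed simp
  then have "integral {0..1} (\<lambda>x. norm (f x - g x)) = 0"
    using LINT_Icc_eq_integral[OF absolutely_integrable_continuous_real[OF c]] by simp
  then have "norm (f x - g x) = 0"
    using integral_eq_0_iff[OF c] x by auto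
  then show ?thesis by simp
qed

lemma integral_cong_AE_lebesgue:
  fixes f g :: "real \<Rightarrow> 'a::euclidean_space"
  assumes "AE x in lebesgue_on {a..b}. f x = g x"
  shows "integral {a..b} f = integral {a..b} g"
    and "f absolutely_integrable_on {a..b} \<Longrightarrow> g absolutely_integrable_on {a..b}"
proof -
  from assms have "AE x in lebesgue. x \<in> {a..b} \<longrightarrow> f x = g x"
    by (simp add: AE_restrict_space_iff)
  then obtain N where N: "negligible N" "{x. \<not> (x \<in> {a..b} \<longrightarrow> f x = g x)} \<subseteq> N"
    by (auto simp: eventually_ae_filter_negligible)
  show "integral {a..b} f = integral {a..b} g"
    by (rule integral_spike[OF N(1)]) (use N(2) in auto)
  show "g absolutely_integrable_on {a..b}" if "f absolutely_integrable_on {a..b}"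
    by (rule absolutely_integrable_spike[OF that N(1)]) (use N(2) in auto)
qed

lemma ac_cong_AE_lebesgue:
  assumes "ac F f a b" "AE x in lebesgue_on {a..b}. f x = g x"
  shows "ac F g a b"
proof -
  from assms(2) have "AE x in lebesgue. x \<in> {a..b} \<longrightarrow> f x = g x"
    by (simp add: AE_restrict_space_iff)
  then obtain N where N: "negligible N" "{x. \<not> (x \<in> {a..b} \<longrightarrow> f x = g x)} \<subseteq> N"
    by (auto simp: eventually_ae_filter_negligible)
  show ?thesis
    by (rule ac_cong_AE[OF assms(1) _ N(1)]) (use N(2) in auto)
qed

lemma LINT_scaleR_I01:
  fixes f :: "real \<Rightarrow> complex"
  assumes "(\<lambda>x. of_real (r x) * f x) absolutely_integrable_on {0..1}"
  shows "(LINT x|lebesgue_on I01. r x *\<^sub>R f x) = integral {0..1} (\<lambda>x. of_real (r x) * f x)"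
  unfolding LINT_Ioo_eq_Icc using LINT_Icc_eq_integral[OF assms] by (simp add: scaleR_conv_of_real)

lemma test_function_props:
  assumes "\<theta> \<in> test_functions"
  shows "(\<theta> has_field_derivative deriv \<theta> x) (at x)" "continuous_on S (deriv \<theta>)" "\<theta> 0 = 0" "\<theta> 1 = 0"
proof -
  from assms have d: "(deriv ^^ n) \<theta> field_differentiable at x" for n x
    by (auto simp: test_functions_def)
  show "(\<theta> has_field_derivative deriv \<theta> x) (at x)"
    using d[of 0] by (simp add: field_differentiable_derivI)
  have "deriv \<theta> field_differentiable at x" for x using d[of 1] by simp
  then show "continuous_on S (deriv \<theta>)"
    by (meson continuous_at_imp_continuous_on field_differentiable_imp_continuous_at)
  obtain K where "K \<subseteq> I01" "\<forall>x. x \<notin> K \<longrightarrow> \<theta> x = 0"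
    using assms by (auto simp: test_functions_def)
  moreover have "0 \<notin> I01" "1 \<notin> I01" by auto
  ultimately show "\<theta> 0 = 0" "\<theta> 1 = 0" by blast+
qed

lemma ac_of_real_deriv:
  assumes "\<And>x. (\<theta> has_field_derivative \<theta>' x) (at x)" "continuous_on {a..b} \<theta>'"
  shows "ac (\<lambda>x. of_real (\<theta> x) :: complex) (\<lambda>x. of_real (\<theta>' x)) a b"
proof (rule ac_C1)
  show "((\<lambda>x. of_real (\<theta> x) :: complex) has_vector_derivative of_real (\<theta>' t)) (at t within {a..b})" for t
    using assms(1)[of t] by (intro has_vector_derivative_of_real has_vector_derivative_at_within)
      (simp add: has_real_derivative_iff_has_vector_derivative)
  show "continuous_on {a..b} (\<lambda>x. of_real (\<theta>' x) :: complex)"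
    using assms(2) by (intro continuous_on_of_real)
qed

text \<open>By parts, \<open>f\<close> minus the primitive of \<open>g\<close> is annihilated by the
  derivatives of all test functions, so it is constant by the du Bois-Reymond lemma.\<close>

lemma weak_deriv_imp_ac:
  fixes f g :: "real \<Rightarrow> complex"
  assumes f: "f \<in> L2 I01" and g: "g \<in> L2 I01" and w: "weak_deriv f g"
  obtains F where "ac F g 0 1" "AE x in lebesgue_on {0..1}. f x = F x"
proof -
  have fi: "f absolutely_integrable_on {0..1}" and gi: "g absolutely_integrable_on {0..1}"
    using f g by (auto simp: L2_Ioo_eq_Icc intro: L2_absolutely_integrable)
  define G where "G t = integral {0..t} g" for t
  have G: "ac G g 0 1" unfolding G_def by (rule ac_primitive[OF gi])
  have Gi: "G absolutely_integrable_on {0..1}"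
    by (rule absolutely_integrable_continuous_real[OF ac_continuous[OF G]])
  have h: "(\<lambda>x. f x - G x) absolutely_integrable_on {0..1}"
    using fi Gi by (rule set_integral_diff)
  obtain c where "AE x in lebesgue_on {0..1}. f x - G x = c"
  proof (rule constant_of_test_functions[OF h])
    fix \<theta> :: "real \<Rightarrow> real"
    assume t: "\<theta> \<in> test_functions" "\<theta> 0 = 0" "\<theta> 1 = 0"
      "\<And>x. (\<theta> has_field_derivative deriv \<theta> x) (at x)" "continuous_on {0..1} (deriv \<theta>)"
    have T: "ac (\<lambda>x. of_real (\<theta> x) :: complex) (\<lambda>x. of_real (deriv \<theta> x)) 0 1"
      by (rule ac_of_real_deriv[OF t(4,5)])
    have c: "continuous_on {0..1} (\<lambda>x. of_real (deriv \<theta> x) :: complex)"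
      using t(5) by (intro continuous_on_of_real)
    note i1 = abs_integrable_cont_mult[OF c fi] and i2 = abs_integrable_cont_mult[OF ac_continuous[OF T] gi]
      and i3 = abs_integrable_cont_mult[OF c Gi]
    have "integral {0..1} (\<lambda>x. of_real (deriv \<theta> x) * f x) = - integral {0..1} (\<lambda>x. of_real (\<theta> x) * g x)"
      using w t(1) LINT_scaleR_I01[OF i1] LINT_scaleR_I01[OF i2] by (simp add: weak_deriv_def)
    also have "\<dots> = integral {0..1} (\<lambda>x. of_real (deriv \<theta> x) * G x)"
      using ac_by_parts[OF T G] t(2,3) by simp
    finally show "integral {0..1} (\<lambda>x. of_real (deriv \<theta> x) * (f x - G x)) = 0"
      using integral_diff[OF abs_integrable_imp_integrable[OF i1] abs_integrable_imp_integrable[OF i3]]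
      by (simp add: right_diff_distrib)
  qed
  then have "AE x in lebesgue_on {0..1}. f x = c + G x"
    by eventually_elim (simp add: diff_eq_eq)
  moreover have "ac (\<lambda>x. c + G x) g 0 1"
    using ac_add[OF ac_const[of c] G] by simp
  ultimately show ?thesis using that by blast
qed

lemma ac_imp_weak_deriv:
  fixes f F F1 :: "real \<Rightarrow> complex"
  assumes F: "ac F F1 0 1" and ae: "AE x in lebesgue_on {0..1}. f x = F x"
  shows "weak_deriv f F1"
  unfolding weak_deriv_def
proof
  fix \<theta> assume t: "\<theta> \<in> test_functions"
  note p = test_function_props[OF t]
  have T: "ac (\<lambda>x. of_real (\<theta> x) :: complex) (\<lambda>x. of_real (deriv \<theta> x)) 0 1"
    by (rule ac_of_real_deriv[OF p(1,2)])
  have c: "continuous_on {0..1} (\<lambda>x. of_real (deriv \<theta> x) :: complex)"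
    using p(2) by (intro continuous_on_of_real)
  have e: "AE x in lebesgue_on {0..1}. of_real (deriv \<theta> x) * F x = of_real (deriv \<theta> x) * f x"
    using ae by eventually_elim simp
  have i1: "(\<lambda>x. of_real (deriv \<theta> x) * f x) absolutely_integrable_on {0..1}"
    by (rule integral_cong_AE_lebesgue(2)[OF e abs_integrable_cont_mult[OF c absolutely_integrable_continuous_real[OF ac_continuous[OF F]]]])
  note i2 = abs_integrable_cont_mult[OF ac_continuous[OF T] ac_absolutely_integrable[OF F]]
  show "(LINT x|lebesgue_on I01. deriv \<theta> x *\<^sub>R f x) = - (LINT x|lebesgue_on I01. \<theta> x *\<^sub>R F1 x)"
    unfolding LINT_scaleR_I01[OF i1] LINT_scaleR_I01[OF i2]
    using ac_by_parts[OF T F] integral_cong_AE_lebesgue(1)[OF e] p(3,4) by simp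
qed

text \<open>Continuity turns equality of the primitives almost everywhere into equality everywhere,
  so the difference of the densities has zero integral over every \<open>{0..t}\<close>.\<close>

lemma ac_deriv_unique:
  fixes F F' F1 :: "real \<Rightarrow> complex"
  assumes F: "ac F F1 0 1" and F': "ac F' g 0 1" and ae: "AE x in lebesgue_on {0..1}. F x = F' x"
  shows "AE x in lebesgue_on {0..1}. g x = F1 x"
proof -
  have eq: "F x = F' x" if "x \<in> {0..1}" for x
    using continuous_AE_eq[OF ac_continuous[OF F] ac_continuous[OF F'] ae that] .
  have "AE x in lebesgue_on {0..1}. g x - F1 x = 0"
  proof (rule AE_eq_0_of_integrals_eq_0)
    note D = ac_diff[OF F' F]
    show "(\<lambda>x. g x - F1 x) absolutely_integrable_on {0..1}" by (rule ac_absolutely_integrable[OF D])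
    show "integral {0..t} (\<lambda>x. g x - F1 x) = 0" if "t \<in> {0..1}" for t
      using ac_eq[OF D that] eq[OF that] eq[of 0] by simp
  qed
  then show ?thesis by simp
qed

lemma AE_eq_sym_trans:
  assumes "AE x in M. f x = F x" "AE x in M. f x = G x"
  shows "AE x in M. F x = G x"
  using assms by eventually_elim simp

text \<open>Any density of a continuous representative describes what the choice operator in
  \<open>wd\<close> returned; this makes \<open>H2_norm\<close> computable.\<close>

lemma wd_AE:
  assumes f: "f \<in> L2 I01" and F1: "F1 \<in> L2 I01" and F: "ac F F1 0 1"
    and ae: "AE x in lebesgue_on {0..1}. f x = F x"
  shows "wd f \<in> L2 I01" "AE x in lebesgue_on {0..1}. wd f x = F1 x"
proof -
  have wdf: "wd f \<in> L2 I01 \<and> weak_deriv f (wd f)"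
    unfolding wd_def by (rule someI[of _ F1]) (simp add: F1 ac_imp_weak_deriv[OF F ae])
  show 1: "wd f \<in> L2 I01" using wdf ..
  have w: "weak_deriv f (wd f)" using wdf ..
  obtain F' where F': "ac F' (wd f) 0 1" "AE x in lebesgue_on {0..1}. f x = F' x"
    using weak_deriv_imp_ac[OF f 1 w] .
  show "AE x in lebesgue_on {0..1}. wd f x = F1 x"
    by (rule ac_deriv_unique[OF F F'(1) AE_eq_sym_trans[OF ae F'(2)]])
qed

text \<open>\<open>H^2\<close> through continuous representatives: \<open>f\<close> and
  \<open>f1\<close> have values at every point, so that boundary values make sense, while
  \<open>f2\<close> is merely square integrable.\<close>

definition W2 :: "(real \<Rightarrow> complex) \<Rightarrow> (real \<Rightarrow> complex) \<Rightarrow> (real \<Rightarrow> complex) \<Rightarrow> bool" where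
  "W2 f f1 f2 \<longleftrightarrow> ac f f1 0 1 \<and> ac f1 f2 0 1 \<and> f2 \<in> L2 {0..1}"

lemma W2D:
  assumes "W2 f f1 f2"
  shows "ac f f1 0 1" "ac f1 f2 0 1" "f2 \<in> L2 {0..1}" "continuous_on {0..1} f" "continuous_on {0..1} f1"
    "f \<in> L2 {0..1}" "f1 \<in> L2 {0..1}"
  using assms by (auto simp: W2_def dest: ac_continuous intro: continuous_imp_L2)

lemma H2_W2:
  fixes f :: "real \<Rightarrow> complex"
  assumes "f \<in> H2"
  obtains F F1 F2 where "W2 F F1 F2" "AE x in lebesgue_on {0..1}. f x = F x"
proof -
  obtain g h where gh: "f \<in> L2 I01" "g \<in> L2 I01" "h \<in> L2 I01" "weak_deriv f g" "weak_deriv g h"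
    using assms by (auto simp: H2_def)
  obtain F1 where F1: "ac F1 h 0 1" "AE x in lebesgue_on {0..1}. g x = F1 x"
    using weak_deriv_imp_ac[OF gh(2,3,5)] .
  obtain F where F: "ac F g 0 1" "AE x in lebesgue_on {0..1}. f x = F x"
    using weak_deriv_imp_ac[OF gh(1,2,4)] .
  have "W2 F F1 h"
    using ac_cong_AE_lebesgue[OF F(1) F1(2)] F1(1) gh(3) by (simp add: W2_def L2_Ioo_eq_Icc)
  then show ?thesis using that F(2) by blast
qed

text \<open>The function \<open>g\<close> of \<open>H2N\<close> and the derivative \<open>F1\<close>
  of the representative are both continuous and agree almost everywhere, hence also at the two ends;
  this transports the Neumann condition.\<close>

lemma H2N_W2:
  assumes "f \<in> H2N"
  obtains F F1 F2 where "W2 F F1 F2" "AE x in lebesgue_on {0..1}. f x = F x" "F1 0 = 0" "F1 1 = 0"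
proof -
  obtain g where g: "f \<in> H2" "f \<in> L2 I01" "g \<in> L2 I01" "weak_deriv f g" "continuous_on {0..1} g" "g 0 = 0" "g 1 = 0"
    using assms by (auto simp: H2N_def H2_def)
  obtain F F1 F2 where F: "W2 F F1 F2" "AE x in lebesgue_on {0..1}. f x = F x"
    using H2_W2[OF g(1)] .
  obtain F' where F': "ac F' g 0 1" "AE x in lebesgue_on {0..1}. f x = F' x"
    using weak_deriv_imp_ac[OF g(2,3,4)] .
  have "AE x in lebesgue_on {0..1}. g x = F1 x"
    by (rule ac_deriv_unique[OF W2D(1)[OF F(1)] F'(1) AE_eq_sym_trans[OF F(2) F'(2)]])
  then have "g x = F1 x" if "x \<in> {0..1}" for x
    using continuous_AE_eq[OF g(5) W2D(5)[OF F(1)] _ that] by simp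
  from this[of 0] this[of 1] that[OF F] g(6,7) show ?thesis by auto
qed

lemma H2_norm_W2:
  assumes f: "f \<in> L2 I01" and W: "W2 F F1 F2" and ae: "AE x in lebesgue_on {0..1}. f x = F x"
  shows "H2_norm f = sqrt ((L2_norm {0..1} F)\<^sup>2 + (L2_norm {0..1} F1)\<^sup>2 + (L2_norm {0..1} F2)\<^sup>2)"
proof -
  note W' = W2D[OF W]
  have 1: "wd f \<in> L2 I01" "AE x in lebesgue_on {0..1}. wd f x = F1 x"
    using wd_AE[OF f _ W'(1) ae] W'(7) by (simp_all add: L2_Ioo_eq_Icc)
  have 2: "wd (wd f) \<in> L2 I01" "AE x in lebesgue_on {0..1}. wd (wd f) x = F2 x"
    using wd_AE[OF 1(1) _ W'(2) 1(2)] W'(3) by (simp_all add: L2_Ioo_eq_Icc)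
  have "L2_norm {0..1} f = L2_norm {0..1} F" "L2_norm {0..1} (wd f) = L2_norm {0..1} F1"
    "L2_norm {0..1} (wd (wd f)) = L2_norm {0..1} F2"
    using f 1 2 W' ae by (auto intro!: L2_norm_cong_AE L2_measurable simp: L2_Ioo_eq_Icc)
  then show ?thesis by (simp add: H2_norm_def L2_Ioo_eq_Icc)
qed

lemma H2_of_real:
  fixes f :: "real \<Rightarrow> real"
  assumes "f \<in> H2"
  shows "(\<lambda>x. complex_of_real (f x)) \<in> H2"
proof -
  have L: "(\<lambda>x. complex_of_real (f x)) \<in> L2 I01" if "f \<in> L2 I01" for f :: "real \<Rightarrow> real"
    using that by (auto simp: L2_def)
  have w: "weak_deriv (\<lambda>x. complex_of_real (f x)) (\<lambda>x. complex_of_real (g x))"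
    if "weak_deriv f g" for f g :: "real \<Rightarrow> real"
    using that by (auto simp: weak_deriv_def scaleR_conv_of_real of_real_mult[symmetric] simp del: of_real_mult)
  show ?thesis using assms L w unfolding H2_def by blast
qed

section \<open>Cosine series\<close>

definition eigfun' :: "nat \<Rightarrow> real \<Rightarrow> complex" where
  "eigfun' j x = complex_of_real (- sqrt 2 * (real j * pi) * sin (real j * pi * x))"

lemma eigfun_of_real: "eigfun j x = complex_of_real (if j = 0 then 1 else sqrt 2 * cos (real j * pi * x))"
  by (simp add: eigfun_def)

lemma cnj_eigfun [simp]: "cnj (eigfun j x) = eigfun j x"
  by (simp add: eigfun_def)

lemma norm_eigfun_le: "norm (eigfun j x) \<le> 2"
proof -
  have "sqrt 2 * \<bar>cos (real j * pi * x)\<bar> \<le> 2 * 1"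
    by (intro mult_mono) (auto simp: real_le_lsqrt)
  then show ?thesis by (simp add: eigfun_def norm_mult)
qed

lemma eigval_nonneg [simp]: "0 \<le> eigval j"
  by (simp add: eigval_def)

lemma eigval_0 [simp]: "eigval 0 = 0"
  by (simp add: eigval_def)

lemma eigval_eq_iff: "eigval i = eigval j \<longleftrightarrow> i = j"
  by (simp add: eigval_def power_mult_distrib power2_eq_iff_nonneg)

lemma eigfun'_0 [simp]: "eigfun' j 0 = 0"
  and eigfun'_1 [simp]: "eigfun' j 1 = 0"
  by (simp_all add: eigfun'_def)

lemma cnj_eigfun' [simp]: "cnj (eigfun' j x) = eigfun' j x"
  by (simp add: eigfun'_def)

lemma continuous_on_eigfun [continuous_intros]: "continuous_on S (eigfun j)"
  unfolding eigfun_def by (cases "j = 0") (auto intro!: continuous_intros)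

lemma continuous_on_eigfun' [continuous_intros]: "continuous_on S (eigfun' j)"
  unfolding eigfun'_def by (intro continuous_intros)

lemma ac_eigfun: "ac (eigfun j) (eigfun' j) a b"
proof -
  have "((\<lambda>x. if j = 0 then 1 else sqrt 2 * cos (real j * pi * x)) has_field_derivative
     - sqrt 2 * (real j * pi) * sin (real j * pi * x)) (at x)" for x
    by (cases "j = 0") (auto intro!: derivative_eq_intros)
  then show ?thesis
    unfolding eigfun_of_real[abs_def] eigfun'_def[abs_def]
    by (rule ac_of_real_deriv) (intro continuous_intros)
qed

lemma ac_eigfun': "ac (eigfun' j) (\<lambda>x. - of_real (eigval j) * eigfun j x) a b"
proof -
  have "((\<lambda>x. - sqrt 2 * (real j * pi) * sin (real j * pi * x)) has_field_derivative
     - sqrt 2 * (real j * pi)\<^sup>2 * cos (real j * pi * x)) (at x)" for x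
    by (auto intro!: derivative_eq_intros simp: power2_eq_square)
  then have "ac (eigfun' j) (\<lambda>x. complex_of_real (- sqrt 2 * (real j * pi)\<^sup>2 * cos (real j * pi * x))) a b"
    unfolding eigfun'_def[abs_def] by (rule ac_of_real_deriv) (intro continuous_intros)
  then show ?thesis
    by (rule ac_cong) (auto simp: eigfun_def eigval_def)
qed

lemma W2_eigfun: "W2 (eigfun j) (eigfun' j) (\<lambda>x. - of_real (eigval j) * eigfun j x)"
  unfolding W2_def using ac_eigfun ac_eigfun' by (auto intro!: continuous_imp_L2 continuous_intros)

lemma continuous_integrable_I:
  fixes f :: "real \<Rightarrow> 'a::euclidean_space"
  shows "continuous_on {a..b} f \<Longrightarrow> f integrable_on {a..b}"
  by (rule integrable_continuous_interval)

section \<open>Cosine coefficients: orthonormality and decay\<close>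

definition coef :: "(real \<Rightarrow> complex) \<Rightarrow> nat \<Rightarrow> complex" where
  "coef f j = integral {0..1} (\<lambda>x. f x * eigfun j x)"

text \<open>One integration by parts; the boundary terms vanish because \<open>eigfun' j\<close> is
  zero at both ends.\<close>

lemma eigval_coef:
  assumes f: "ac f f1 0 1"
  shows "of_real (eigval j) * coef f j = integral {0..1} (\<lambda>x. f1 x * eigfun' j x)"
proof -
  have "integral {0..1} (\<lambda>x. f1 x * eigfun' j x) = - integral {0..1} (\<lambda>x. f x * (- of_real (eigval j) * eigfun j x))"
    using ac_by_parts[OF f ac_eigfun'[of j 0 1]] by simp
  also have "\<dots> = integral {0..1} (\<lambda>x. of_real (eigval j) * (f x * eigfun j x))"
    by (simp only: integral_neg[symmetric] minus_mult_left[symmetric] minus_mult_right[symmetric] minus_minus mult.left_commute)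
  finally show ?thesis by (simp add: coef_def)
qed

text \<open>The second integration by parts keeps the boundary values of \<open>f1\<close>. They
  vanish for the Neumann functions \<open>\<Psi> t\<close>, but not for \<open>\<mu>\<close> or for
  the gauge-transformed state.\<close>

lemma integral_eigfun':
  assumes f: "ac f1 f2 0 1"
  shows "integral {0..1} (\<lambda>x. f1 x * eigfun' j x) = f1 1 * eigfun j 1 - f1 0 * eigfun j 0 - coef f2 j"
  using ac_by_parts[OF f ac_eigfun[of j 0 1]] by (simp add: coef_def)

lemma eigfun'_orthogonal: "integral {0..1} (\<lambda>x. eigfun' i x * eigfun' j x) = of_real (eigval i) * coef (eigfun i) j"
proof -
  have "coef (\<lambda>x. - of_real (eigval i) * eigfun i x) j = - of_real (eigval i) * coef (eigfun i) j"
    unfolding coef_def mult.assoc by (rule integral_mult_right)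
  then show ?thesis
    unfolding integral_eigfun'[OF ac_eigfun', of i j] by simp
qed

text \<open>For different indices, symmetry of the integral of \<open>eigfun' i * eigfun' j\<close>
  makes the coefficient vanish, the eigenvalues being distinct. For equal indices
  \<open>eigfun'^2 + \<lambda> eigfun^2\<close> is the constant \<open>2 \<lambda>\<close>, and by
  parts both terms have the same integral.\<close>

lemma coef_eigfun: "coef (eigfun i) j = (if i = j then 1 else 0)"
proof (cases "i = j")
  case False
  have "of_real (eigval i) * coef (eigfun i) j = of_real (eigval j) * coef (eigfun j) i"
    using eigfun'_orthogonal[of i j] eigfun'_orthogonal[of j i] by (simp add: mult.commute)
  moreover have "coef (eigfun j) i = coef (eigfun i) j" by (simp add: coef_def mult.commute)
  ultimately have "of_real (eigval i - eigval j) * coef (eigfun i) j = 0"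
    by (simp add: algebra_simps)
  then show ?thesis using False eigval_eq_iff[of i j] by simp
next
  case True
  show ?thesis
  proof (cases j)
    case 0
    then show ?thesis using True by (simp add: coef_def eigfun_def)
  next
    case (Suc k)
    then have l0: "eigval j \<noteq> 0" using eigval_eq_iff[of j 0] by simp
    have "integral {0..1} (\<lambda>x. eigfun' j x * eigfun' j x + of_real (eigval j) * (eigfun j x * eigfun j x))
      = integral {0..1} (\<lambda>x::real. of_real (2 * eigval j))"
    proof (rule integral_cong)
      fix x :: real
      have "(sqrt 2 * (real j * pi) * sin (real j * pi * x))\<^sup>2 + eigval j * (sqrt 2 * cos (real j * pi * x))\<^sup>2 =
         2 * eigval j * ((sin (real j * pi * x))\<^sup>2 + (cos (real j * pi * x))\<^sup>2)"
        by (simp add: eigval_def power_mult_distrib algebra_simps del: sin_cos_squared_add sin_cos_squared_add2)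
      also have "\<dots> = 2 * eigval j" by simp
      finally have *: "(sqrt 2 * (real j * pi) * sin (real j * pi * x))\<^sup>2 + eigval j * (sqrt 2 * cos (real j * pi * x))\<^sup>2 = 2 * eigval j" .
      show "eigfun' j x * eigfun' j x + of_real (eigval j) * (eigfun j x * eigfun j x) = of_real (2 * eigval j)"
        using Suc unfolding *[symmetric] eigfun'_def eigfun_def by (simp add: power2_eq_square)
    qed
    also have "\<dots> = of_real (2 * eigval j)" by simp
    finally have "integral {0..1} (\<lambda>x. eigfun' j x * eigfun' j x) + of_real (eigval j) * coef (eigfun j) j = of_real (2 * eigval j)"
      unfolding coef_def
      by (subst (asm) integral_add) (auto intro!: continuous_integrable_I continuous_intros)
    then have "2 * of_real (eigval j) * coef (eigfun j) j = 2 * of_real (eigval j)"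
      unfolding eigfun'_orthogonal by simp
    then show ?thesis using l0 True by simp
  qed
qed

lemma norm_coef_le:
  assumes "f \<in> L2 {0..1}"
  shows "norm (coef f j) \<le> 2 * L2_norm {0..1} f"
proof -
  have c: "eigfun j \<in> L2 {0..1}" by (intro continuous_imp_L2 continuous_intros)
  have "norm (coef f j) \<le> L2_norm {0..1} f * L2_norm {0..1} (eigfun j)"
    unfolding coef_def by (rule L2_Cauchy_Schwarz_integral[OF assms c])
  also have "\<dots> \<le> L2_norm {0..1} f * 2"
    using L2_norm_bound[OF c norm_eigfun_le] by (intro mult_left_mono) auto
  finally show ?thesis by simp
qed

lemma eigval_coef_bound:
  assumes f: "W2 f f1 f2"
  shows "norm (of_real (eigval j) * coef f j) \<le> 2 * norm (f1 1) + 2 * norm (f1 0) + 2 * L2_norm {0..1} f2"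
proof -
  note W = W2D[OF f]
  have "norm (f1 1 * eigfun j 1 - f1 0 * eigfun j 0 - coef f2 j)
      \<le> norm (f1 1 * eigfun j 1) + norm (f1 0 * eigfun j 0) + norm (coef f2 j)"
    by (meson add_right_mono norm_triangle_ineq4 order_trans)
  also have "\<dots> \<le> norm (f1 1) * 2 + norm (f1 0) * 2 + 2 * L2_norm {0..1} f2"
    unfolding norm_mult by (intro add_mono mult_left_mono norm_eigfun_le norm_coef_le W) auto
  finally show ?thesis
    unfolding eigval_coef[OF W(1)] integral_eigfun'[OF W(2)] by (simp add: mult.commute)
qed

text \<open>Since \<open>\<lambda>_j coef f j\<close> stays bounded even with boundary values of
  \<open>f1\<close>, the coefficients decay like \<open>j^-2\<close>. The shift by
  \<open>Suc\<close> keeps the weight finite at 0, and mode 0 is added to the constant.\<close>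

lemma coef_decay:
  assumes f: "W2 f f1 f2"
  obtains C where "0 \<le> C" "\<And>j. norm (coef f j) \<le> C * inverse ((real (Suc j))\<^sup>2)"
proof -
  define K where "K = 2 * norm (f1 1) + 2 * norm (f1 0) + 2 * L2_norm {0..1} f2"
  have K0: "0 \<le> K" by (simp add: K_def)
  have "norm (coef f j) \<le> (K + norm (coef f 0)) * inverse ((real (Suc j))\<^sup>2)" for j
  proof (cases j)
    case 0
    then show ?thesis using K0 by simp
  next
    case (Suc k)
    \<comment> \<open>For \<open>j \<ge> 1\<close> one has
      \<open>j + 1 \<le> 2 j \<le> j pi\<close>.\<close>
    have "(real (Suc j))\<^sup>2 \<le> (real j * pi)\<^sup>2"
      using Suc pi_gt3 mult_left_mono[of 2 pi "real j"] by (intro power_mono) auto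
    then have "(real (Suc j))\<^sup>2 * norm (coef f j) \<le> norm (of_real (eigval j) * coef f j)"
      by (simp add: norm_mult eigval_def[symmetric] mult_right_mono)
    also have "\<dots> \<le> K" unfolding K_def by (rule eigval_coef_bound[OF f])
    finally have "(real (Suc j))\<^sup>2 * norm (coef f j) \<le> K + norm (coef f 0)"
      by (rule order_trans) simp
    then show ?thesis by (simp add: field_simps)
  qed
  then show ?thesis using that[of "K + norm (coef f 0)"] K0 by auto
qed

lemma coef_summable:
  assumes f: "W2 f f1 f2"
  shows "summable (\<lambda>j. norm (coef f j))"
proof -
  obtain C where C: "\<And>j. norm (coef f j) \<le> C * inverse ((real (Suc j))\<^sup>2)"
    using coef_decay[OF f] by blast
  have "summable (\<lambda>j. C * inverse ((real (Suc j))\<^sup>2))"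
    using inverse_power_summable[of 2, where 'a=real] by (intro summable_mult) (subst summable_Suc_iff, simp)
  then show ?thesis
    by (rule summable_comparison_test') (use C in simp)
qed

section \<open>Completeness of the cosine system\<close>

inductive_set cos_polys :: "(real \<Rightarrow> real) set" where
  base: "(\<lambda>x. a * cos (real j * pi * x)) \<in> cos_polys"
| add: "f \<in> cos_polys \<Longrightarrow> g \<in> cos_polys \<Longrightarrow> (\<lambda>x. f x + g x) \<in> cos_polys"

lemma cos_polys_mult_base:
  "f \<in> cos_polys \<Longrightarrow> (\<lambda>x. f x * (a * cos (real j * pi * x))) \<in> cos_polys"
proof (induction rule: cos_polys.induct)
  case (base b i)
  \<comment> \<open>The product-to-sum formula. The case distinction stands for the absolute value
    of \<open>i - j\<close>, since subtraction of natural numbers truncates; the cosine is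
    even.\<close>
  have "(\<lambda>x. (a * b / 2) * cos (real (i + j) * pi * x) + (a * b / 2) * cos (real (if i \<ge> j then i - j else j - i) * pi * x)) \<in> cos_polys"
    by (intro cos_polys.intros)
  also have "(\<lambda>x. (a * b / 2) * cos (real (i + j) * pi * x) + (a * b / 2) * cos (real (if i \<ge> j then i - j else j - i) * pi * x))
     = (\<lambda>x. b * cos (real i * pi * x) * (a * cos (real j * pi * x)))"
  proof
    fix x
    have 1: "cos (real (i + j) * pi * x) = cos (real i * pi * x + real j * pi * x)" by (simp add: algebra_simps)
    have 2: "cos (real (if i \<ge> j then i - j else j - i) * pi * x) = cos (real i * pi * x - real j * pi * x)"
    proof (cases "i \<ge> j")
      case True
      then show ?thesis by (simp add: of_nat_diff algebra_simps)
    next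
      case False
      have "real (j - i) * pi * x = - (real i * pi * x - real j * pi * x)"
        using False by (simp add: of_nat_diff algebra_simps)
      then have "cos (real (j - i) * pi * x) = cos (real i * pi * x - real j * pi * x)"
        by (simp only: cos_minus)
      then show ?thesis using False by simp
    qed
    show "(a * b / 2) * cos (real (i + j) * pi * x) + (a * b / 2) * cos (real (if i \<ge> j then i - j else j - i) * pi * x)
     = b * cos (real i * pi * x) * (a * cos (real j * pi * x))"
      unfolding 1 2 cos_add cos_diff by (simp add: algebra_simps)
  qed
  finally show ?case .
next
  case (add f g)
  then show ?case using cos_polys.add[OF add.IH] by (simp add: distrib_right)
qed

lemma cos_polys_mult:
  assumes "f \<in> cos_polys" "g \<in> cos_polys"
  shows "(\<lambda>x. f x * g x) \<in> cos_polys"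
  using assms(2)
proof (induction rule: cos_polys.induct)
  case (base a j)
  show ?case by (rule cos_polys_mult_base[OF assms(1)])
next
  case (add g h)
  then show ?case using cos_polys.add[OF add.IH] by (simp add: distrib_left)
qed

lemma cos_polys_continuous: "f \<in> cos_polys \<Longrightarrow> continuous_on S f"
  by (induction rule: cos_polys.induct) (auto intro!: continuous_intros)

text \<open>Stone-Weierstrass: the cosine polynomials form an algebra, and \<open>cos (pi x)\<close>
  alone separates the points of the closed unit interval.\<close>

lemma cos_polys_dense:
  fixes f :: "real \<Rightarrow> real"
  assumes "continuous_on {0..1} f" "0 < e"
  obtains g where "g \<in> cos_polys" "\<And>x. x \<in> {0..1} \<Longrightarrow> \<bar>f x - g x\<bar> < e"
proof -
  have "\<exists>g. g \<in> cos_polys \<and> (\<forall>x\<in>{0..1}. \<bar>f x - g x\<bar> < e)"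
  proof (rule Stone_Weierstrass_HOL)
    show "(\<lambda>x. c) \<in> cos_polys" for c
      using cos_polys.base[of c 0] by simp
    show "\<exists>f. f \<in> cos_polys \<and> f x \<noteq> f y" if "x \<in> {0..1} \<and> y \<in> {0..1} \<and> x \<noteq> y" for x y :: real
    proof (intro exI conjI)
      show "(\<lambda>x. 1 * cos (real 1 * pi * x)) \<in> cos_polys" by (rule cos_polys.base)
      have "cos (pi * x) \<noteq> cos (pi * y)"
        using cos_inj_pi[of "pi * x" "pi * y"] that by (auto simp: mult_le_cancel_left1)
      then show "1 * cos (real 1 * pi * x) \<noteq> 1 * cos (real 1 * pi * y)" by simp
    qed
  qed (use assms cos_polys_continuous in \<open>auto intro: cos_polys.add cos_polys_mult\<close>)
  then show ?thesis using that by blast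
qed

lemma coef_eq_0_imp_cos_poly:
  assumes h: "h absolutely_integrable_on {0..1}" and z: "\<And>j. coef h j = 0" and "g \<in> cos_polys"
  shows "integral {0..1} (\<lambda>x. h x * of_real (g x)) = 0"
  using assms(3)
proof (induction rule: cos_polys.induct)
  case (base a j)
  define c where "c = (if j = 0 then complex_of_real a else complex_of_real (a / sqrt 2))"
  have "complex_of_real (a * cos (real j * pi * x)) = c * eigfun j x" for x
    by (simp add: c_def eigfun_def)
  then have "integral {0..1} (\<lambda>x. h x * of_real (a * cos (real j * pi * x))) = integral {0..1} (\<lambda>x. c * (h x * eigfun j x))"
    by (simp add: mult_ac del: integral_mult_right)
  also have "\<dots> = c * coef h j" by (simp add: coef_def)
  finally show ?case using z by simp
next
  case (add f g)
  have i: "(\<lambda>x. h x * of_real (g x)) integrable_on {0..1}" if "g \<in> cos_polys" for g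
    using abs_integrable_cont_mult[OF continuous_on_of_real[OF cos_polys_continuous[OF that]] h]
    by (simp add: mult.commute abs_integrable_imp_integrable)
  show ?case using add integral_add[OF i[OF add.hyps(1)] i[OF add.hyps(2)]] by (simp add: distrib_left)
qed

text \<open>The conjugate of \<open>h\<close> is uniformly close to a cosine polynomial
  \<open>r\<close> with complex coefficients, and \<open>h r\<close> has zero integral; so the
  integral of \<open>|h|^2\<close> is arbitrarily small.\<close>

lemma coef_complete:
  assumes h: "continuous_on {0..1} h" and z: "\<And>j. coef h j = 0" and x: "x \<in> {0..1}"
  shows "h x = 0"
proof -
  have hi: "h absolutely_integrable_on {0..1}" using h by (rule absolutely_integrable_continuous_real)
  have nh: "(\<lambda>x. norm (h x)) integrable_on {0..1}"
    using h by (intro continuous_integrable_I continuous_intros)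
  define B where "B = integral {0..1} (\<lambda>x. norm (h x))"
  have B0: "0 \<le> B" unfolding B_def by (rule integral_nonneg[OF nh]) simp
  have c2: "continuous_on {0..1} (\<lambda>x. (norm (h x))\<^sup>2)" using h by (intro continuous_intros)
  define I where "I = integral {0..1} (\<lambda>x. (norm (h x))\<^sup>2)"
  have I0: "0 \<le> I" unfolding I_def by (rule integral_nonneg[OF continuous_integrable_I[OF c2]]) simp
  have Ie: "I \<le> 2 * e * B" if e: "0 < e" for e
  proof -
    have cr: "continuous_on {0..1} (\<lambda>x. Re (h x))" "continuous_on {0..1} (\<lambda>x. Im (h x))"
      using h by (auto intro: continuous_intros)
    obtain p where p: "p \<in> cos_polys" "\<And>x. x \<in> {0..1} \<Longrightarrow> \<bar>Re (h x) - p x\<bar> < e"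
      using cos_polys_dense[OF cr(1) e] by blast
    obtain q where q: "q \<in> cos_polys" "\<And>x. x \<in> {0..1} \<Longrightarrow> \<bar>Im (h x) - q x\<bar> < e"
      using cos_polys_dense[OF cr(2) e] by blast
    define r where "r x = of_real (p x) - \<i> * of_real (q x)" for x
    have cp: "continuous_on {0..1} (\<lambda>x. complex_of_real (p x))" "continuous_on {0..1} (\<lambda>x. complex_of_real (q x))"
      using p q by (auto intro: continuous_on_of_real cos_polys_continuous)
    have rc: "continuous_on {0..1} r" unfolding r_def by (intro continuous_intros cp)
    have "integral {0..1} (\<lambda>x. h x * r x) = integral {0..1} (\<lambda>x. h x * of_real (p x) - \<i> * (h x * of_real (q x)))"
      by (rule integral_cong) (simp add: r_def algebra_simps)
    also have "\<dots> = integral {0..1} (\<lambda>x. h x * of_real (p x)) - integral {0..1} (\<lambda>x. \<i> * (h x * of_real (q x)))"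
      by (intro integral_diff continuous_integrable_I continuous_intros h cp)
    also have "\<dots> = 0" using coef_eq_0_imp_cos_poly[OF hi z p(1)] coef_eq_0_imp_cos_poly[OF hi z q(1)] by simp
    finally have r0: "integral {0..1} (\<lambda>x. h x * r x) = 0" .
    have bound: "norm (cnj (h x) - r x) \<le> 2 * e" if "x \<in> {0..1}" for x
    proof -
      have "cnj (h x) - r x = complex_of_real (Re (h x) - p x) - \<i> * complex_of_real (Im (h x) - q x)"
        by (simp add: r_def complex_eq_iff)
      then have "norm (cnj (h x) - r x) \<le> norm (complex_of_real (Re (h x) - p x)) + norm (\<i> * complex_of_real (Im (h x) - q x))"
        using norm_triangle_ineq4 by metis
      also have "\<dots> \<le> e + e" using p(2)[OF that] q(2)[OF that] by (simp only: norm_mult norm_of_real) simp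
      finally show ?thesis by simp
    qed
    have "complex_of_real I = integral {0..1} (\<lambda>x. complex_of_real ((norm (h x))\<^sup>2))"
      unfolding I_def using integral_linear[OF continuous_integrable_I[OF c2] bounded_linear_of_real[where 'a=complex]] by (simp add: o_def)
    also have "\<dots> = integral {0..1} (\<lambda>x. h x * cnj (h x))"
      by (simp only: complex_norm_square)
    also have "\<dots> = integral {0..1} (\<lambda>x. h x * cnj (h x)) - integral {0..1} (\<lambda>x. h x * r x)" using r0 by simp
    also have "\<dots> = integral {0..1} (\<lambda>x. h x * cnj (h x) - h x * r x)"
      by (intro integral_diff[symmetric] continuous_integrable_I continuous_intros h rc)
    finally have "norm (complex_of_real I) = norm (integral {0..1} (\<lambda>x. h x * cnj (h x) - h x * r x))" by simp
    also have "\<dots> \<le> integral {0..1} (\<lambda>x. 2 * e * norm (h x))"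
    proof (rule Henstock_Kurzweil_Integration.integral_norm_bound_integral)
      show "(\<lambda>x. h x * cnj (h x) - h x * r x) integrable_on {0..1}"
        by (intro continuous_integrable_I continuous_intros h rc)
      show "(\<lambda>x. 2 * e * norm (h x)) integrable_on {0..1}" using nh by (rule integrable_on_mult_right)
      show "norm (h x * cnj (h x) - h x * r x) \<le> 2 * e * norm (h x)" if "x \<in> {0..1}" for x
        using mult_left_mono[OF bound[OF that], of "norm (h x)"]
        by (simp add: norm_mult right_diff_distrib[symmetric] mult.commute)
    qed
    also have "\<dots> = 2 * e * B" by (simp add: B_def)
    finally show ?thesis using I0 by simp
  qed
  have "I \<le> 0"
  proof (rule field_le_epsilon)
    fix e :: real assume e: "0 < e"
    \<comment> \<open>\<open>B + 1\<close> in place of \<open>B\<close> guards against division by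
      zero.\<close>
    have "I \<le> 2 * (e / (2 * (B + 1))) * B" using e B0 by (intro Ie) simp
    also have "\<dots> = e * (B / (B + 1))" using B0 by (simp add: field_simps)
    also have "\<dots> \<le> e * 1" using B0 e by (intro mult_left_mono) auto
    finally show "I \<le> 0 + e" by simp
  qed
  with I0 have "I = 0" by simp
  then have "(norm (h x))\<^sup>2 = 0" unfolding I_def using integral_eq_0_iff[OF c2] x by auto
  then show ?thesis by simp
qed

section \<open>Operations on \<open>H^2\<close>: conjugation, products, exponentials\<close>

lemma W2_imp_abs_integrable:
  assumes "W2 f f1 f2"
  shows "f absolutely_integrable_on {0..1}"
  by (rule absolutely_integrable_continuous_real[OF W2D(4)[OF assms]])

lemma ac_cnj: "ac F f a b \<Longrightarrow> ac (\<lambda>t. cnj (F t)) (\<lambda>t. cnj (f t)) a b"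
  by (rule ac_linear[OF _ bounded_linear_cnj])

lemma L2_cnj: "f \<in> L2 S \<Longrightarrow> (\<lambda>x. cnj (f x)) \<in> L2 S"
  by (auto simp: L2_def intro!: measurable_compose[OF _ borel_measurable_continuous_onI[OF continuous_on_cnj[OF continuous_on_id]]])

lemma W2_cnj: "W2 f f1 f2 \<Longrightarrow> W2 (\<lambda>x. cnj (f x)) (\<lambda>x. cnj (f1 x)) (\<lambda>x. cnj (f2 x))"
  by (simp add: W2_def ac_cnj L2_cnj)

lemma coef_cnj: "coef (\<lambda>x. cnj (f x)) j = cnj (coef f j)"
proof -
  have "coef (\<lambda>x. cnj (f x)) j = integral {0..1} (\<lambda>x. cnj (f x * eigfun j x))"
    by (simp add: coef_def)
  then show ?thesis by (simp add: coef_def integral_cnj)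
qed

lemma L2_mult_continuous:
  fixes f g :: "real \<Rightarrow> complex"
  assumes "f \<in> L2 {a..b}" "continuous_on {a..b} g"
  shows "(\<lambda>x. g x * f x) \<in> L2 {a..b}"
proof -
  have "bounded (g ` {a..b})"
    by (intro compact_imp_bounded compact_continuous_image assms(2) compact_Icc)
  then obtain B where B: "\<forall>y\<in>g ` {a..b}. norm y \<le> B"
    unfolding bounded_iff by blast
  have "g \<in> borel_measurable (lebesgue_on {a..b})"
    using assms(2) by (rule continuous_imp_measurable_on_sets_lebesgue) simp
  then show ?thesis
    by (rule L2_bounded_mult(1)[OF assms(1)]) (use B in blast)
qed

lemma W2_mult:
  assumes f: "W2 f f1 f2" and g: "W2 g g1 g2"
  shows "W2 (\<lambda>x. f x * g x) (\<lambda>x. f1 x * g x + f x * g1 x) (\<lambda>x. f2 x * g x + 2 * f1 x * g1 x + f x * g2 x)"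
  unfolding W2_def
proof (intro conjI)
  note F = W2D[OF f] and G = W2D[OF g]
  show "ac (\<lambda>x. f x * g x) (\<lambda>x. f1 x * g x + f x * g1 x) 0 1"
    by (rule ac_mult[OF F(1) G(1)])
  show "ac (\<lambda>x. f1 x * g x + f x * g1 x) (\<lambda>x. f2 x * g x + 2 * f1 x * g1 x + f x * g2 x) 0 1"
    by (rule ac_cong[OF ac_add[OF ac_mult[OF F(2) G(1)] ac_mult[OF F(1) G(2)]]]) (auto simp: algebra_simps)
  have "(\<lambda>x. g x * f2 x) \<in> L2 {0..1}" "(\<lambda>x. f x * g2 x) \<in> L2 {0..1}"
    by (rule L2_mult_continuous[OF F(3) G(4)], rule L2_mult_continuous[OF G(3) F(4)])
  moreover have "(\<lambda>x. 2 * f1 x * g1 x) \<in> L2 {0..1}"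
    by (intro continuous_imp_L2 continuous_intros F G)
  ultimately show "(\<lambda>x. f2 x * g x + 2 * f1 x * g1 x + f x * g2 x) \<in> L2 {0..1}"
    by (intro L2_add(1)) (simp_all add: mult.commute)
qed

lemma W2_const: "W2 (\<lambda>_. c) (\<lambda>_. 0) (\<lambda>_. 0)"
  unfolding W2_def using ac_const[of c] ac_const[of 0] by (auto intro: continuous_imp_L2)

lemma W2_diff:
  assumes f: "W2 f f1 f2" and g: "W2 g g1 g2"
  shows "W2 (\<lambda>x. f x - g x) (\<lambda>x. f1 x - g1 x) (\<lambda>x. f2 x - g2 x)"
  using assms by (simp add: W2_def ac_diff L2_diff)

lemma W2_exp:
  assumes f: "W2 f f1 f2"
  shows "W2 (\<lambda>x. exp (c * f x)) (\<lambda>x. c * f1 x * exp (c * f x))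
    (\<lambda>x. c * f2 x * exp (c * f x) + c * f1 x * (c * f1 x * exp (c * f x)))"
  unfolding W2_def
proof (intro conjI)
  note F = W2D[OF f]
  have ce: "continuous_on {0..1} (\<lambda>x. exp (c * f x))" by (intro continuous_intros F)
  show e: "ac (\<lambda>x. exp (c * f x)) (\<lambda>x. c * f1 x * exp (c * f x)) 0 1"
  proof (rule ac_C1)
    show "continuous_on {0..1} (\<lambda>x. c * f1 x * exp (c * f x))" by (intro continuous_intros F)
    fix t :: real assume t: "t \<in> {0..1}"
    \<comment> \<open>As the primitive of the continuous \<open>f1\<close>, the function
      \<open>f\<close> is classically differentiable, so the ordinary chain rule applies at this
      level; the second derivative follows from the product rule \<open>ac_mult\<close>.\<close>
    have "((\<lambda>x. f 0 + integral {0..x} f1) has_vector_derivative 0 + f1 t) (at t within {0..1})"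
      by (intro has_vector_derivative_add has_vector_derivative_const integral_has_vector_derivative[OF F(5) t])
    then have "(f has_vector_derivative 0 + f1 t) (at t within {0..1})"
      by (rule has_vector_derivative_transform[OF t, rotated 1]) (simp add: ac_eq[OF F(1), symmetric])
    then have "(f has_vector_derivative f1 t) (at t within {0..1})" by simp
    then have "((\<lambda>x. c * f x) has_vector_derivative c * f1 t) (at t within {0..1})"
      by (rule has_vector_derivative_mult_right)
    from field_vector_diff_chain_within[OF this, of exp "exp (c * f t)"]
    show "((\<lambda>x. exp (c * f x)) has_vector_derivative c * f1 t * exp (c * f t)) (at t within {0..1})"
      by (simp add: o_def DERIV_exp has_field_derivative_at_within)
  qed
  show "ac (\<lambda>x. c * f1 x * exp (c * f x))
     (\<lambda>x. c * f2 x * exp (c * f x) + c * f1 x * (c * f1 x * exp (c * f x))) 0 1"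
    by (rule ac_mult[OF ac_cmult[OF F(2)] e])
  have "(\<lambda>x. (c * exp (c * f x)) * f2 x) \<in> L2 {0..1}"
    by (rule L2_mult_continuous[OF F(3)]) (intro continuous_intros F)
  then have "(\<lambda>x. c * f2 x * exp (c * f x)) \<in> L2 {0..1}" by (simp add: mult_ac)
  moreover have "(\<lambda>x. c * f1 x * (c * f1 x * exp (c * f x))) \<in> L2 {0..1}"
    by (intro continuous_imp_L2 continuous_intros F)
  ultimately show "(\<lambda>x. c * f2 x * exp (c * f x) + c * f1 x * (c * f1 x * exp (c * f x))) \<in> L2 {0..1}"
    by (rule L2_add(1))
qed

section \<open>Pointwise cosine expansion and termwise pairing\<close>

lemma eigfun_partial_sum_bound:
  assumes c: "summable (\<lambda>j. norm (c j :: complex))"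
  shows "norm (\<Sum>j<n. c j * eigfun j x) \<le> 2 * (\<Sum>j. norm (c j))"
proof -
  have "norm (\<Sum>j<n. c j * eigfun j x) \<le> (\<Sum>j<n. norm (c j) * 2)"
    by (rule sum_norm_le) (simp add: norm_mult mult_left_mono norm_eigfun_le)
  also have "\<dots> = 2 * (\<Sum>j<n. norm (c j))" by (simp add: sum_distrib_left mult.commute)
  also have "\<dots> \<le> 2 * (\<Sum>j. norm (c j))" using c by (simp add: sum_le_suminf)
  finally show ?thesis .
qed

lemma eigfun_series_uniform:
  assumes c: "summable (\<lambda>j. norm (c j :: complex))"
  shows "\<exists>S. continuous_on UNIV S \<and> (\<forall>x. (\<lambda>j. c j * eigfun j x) sums S x) \<and>
    uniform_limit UNIV (\<lambda>n x. \<Sum>j<n. c j * eigfun j x) S sequentially"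
proof -
  define S where "S x = (\<Sum>j. c j * eigfun j x)" for x
  have le: "norm (c j * eigfun j x) \<le> norm (c j) * 2" for j x
    using norm_eigfun_le[of j x] by (simp add: norm_mult mult_left_mono)
  have sm: "summable (\<lambda>j. norm (c j) * 2)" using c by (rule summable_mult2)
  have ul: "uniform_limit UNIV (\<lambda>n x. \<Sum>j<n. c j * eigfun j x) S sequentially"
    unfolding S_def by (rule Weierstrass_m_test[OF le sm])
  have cont: "continuous_on UNIV S"
    by (rule uniform_limit_theorem[OF _ ul]) (auto intro!: continuous_intros always_eventually)
  have "(\<lambda>j. c j * eigfun j x) sums S x" for x
    unfolding S_def by (rule summable_sums, rule summable_comparison_test'[OF sm]) (rule le)
  then show ?thesis using cont ul by blast
qed

text \<open>The partial sums are bounded by twice the sum of the moduli of the coefficients, so a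
  multiple of \<open>|w|\<close> dominates and the integration can be done termwise for integrable
  \<open>w\<close>.\<close>

lemma pairing_sums:
  assumes S: "\<And>x. x \<in> {0..1} \<Longrightarrow> (\<lambda>j. c j * eigfun j x) sums S x" and c: "summable (\<lambda>j. norm (c j))"
    and w: "w absolutely_integrable_on {0..1}"
  shows "(\<lambda>j. c j * coef w j) sums integral {0..1} (\<lambda>x. S x * w x)"
proof -
  have i: "(\<lambda>x. eigfun j x * w x) absolutely_integrable_on {0..1}" for j
    by (rule abs_integrable_cont_mult[OF continuous_on_eigfun w])
  have i2: "(\<lambda>x. c j * (eigfun j x * w x)) integrable_on {0..1}" for j
    by (intro integrable_on_mult_right abs_integrable_imp_integrable i)
  have cw: "coef w j = integral {0..1} (\<lambda>x. eigfun j x * w x)" for j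
    unfolding coef_def by (rule integral_cong) (rule mult.commute)
  have eq: "(\<Sum>j<n. c j * coef w j) = integral {0..1} (\<lambda>x. (\<Sum>j<n. c j * eigfun j x) * w x)" for n
  proof -
    have "integral {0..1} (\<lambda>x. (\<Sum>j<n. c j * eigfun j x) * w x) = integral {0..1} (\<lambda>x. \<Sum>j<n. c j * (eigfun j x * w x))"
      by (simp add: sum_distrib_right mult.assoc)
    also have "\<dots> = (\<Sum>j<n. integral {0..1} (\<lambda>x. c j * (eigfun j x * w x)))"
      by (rule integral_sum) (auto intro: i2)
    also have "\<dots> = (\<Sum>j<n. c j * coef w j)"
      by (simp only: cw integral_mult_right)
    finally show ?thesis by (rule sym)
  qed
  have nw: "(\<lambda>x. norm (w x)) integrable_on {0..1}" using w by (simp add: absolutely_integrable_on_def)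
  have "(\<lambda>n. integral {0..1} (\<lambda>x. (\<Sum>j<n. c j * eigfun j x) * w x)) \<longlonglongrightarrow> integral {0..1} (\<lambda>x. S x * w x)"
  proof (rule dominated_convergence(2))
    show "(\<lambda>x. (\<Sum>j<n. c j * eigfun j x) * w x) integrable_on {0..1}" for n
      by (intro abs_integrable_imp_integrable abs_integrable_cont_mult[OF _ w] continuous_intros)
    show "(\<lambda>x. (2 * (\<Sum>j. norm (c j))) * norm (w x)) integrable_on {0..1}"
      using nw by (rule integrable_on_mult_right)
    show "norm ((\<Sum>j<n. c j * eigfun j x) * w x) \<le> (2 * (\<Sum>j. norm (c j))) * norm (w x)" for n x
      unfolding norm_mult by (intro mult_right_mono eigfun_partial_sum_bound[OF c]) simp
    show "(\<lambda>n. (\<Sum>j<n. c j * eigfun j x) * w x) \<longlonglongrightarrow> S x * w x" if "x \<in> {0..1}" for x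
      using S[OF that] by (intro tendsto_intros) (simp add: sums_def)
  qed
  then show ?thesis unfolding sums_def eq .
qed

lemma coef_of_series:
  assumes S: "\<And>x. x \<in> {0..1} \<Longrightarrow> (\<lambda>j. c j * eigfun j x) sums S x" and c: "summable (\<lambda>j. norm (c j))"
  shows "coef S i = c i"
proof -
  have "(\<lambda>j. c j * coef (eigfun i) j) sums integral {0..1} (\<lambda>x. S x * eigfun i x)"
    by (rule pairing_sums[OF S c]) (auto intro!: absolutely_integrable_continuous_real continuous_intros)
  moreover have "(\<lambda>j. c j * coef (eigfun i) j) = (\<lambda>j. if j = i then c i else 0)"
    by (auto simp: coef_eigfun)
  ultimately have "(\<lambda>j. if j = i then c i else 0) sums coef S i" by (simp add: coef_def)
  then show ?thesis by (rule sums_unique2) (rule sums_single[of i "\<lambda>_. c i"])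
qed

text \<open>The series converges uniformly to a continuous function with the coefficients of
  \<open>f\<close>, and completeness identifies the two at every point. Validity at the two ends is
  essential for expanding boundary values later.\<close>

lemma W2_expansion:
  assumes f: "W2 f f1 f2" and x: "x \<in> {0..1}"
  shows "(\<lambda>j. coef f j * eigfun j x) sums f x"
proof -
  obtain S where S: "continuous_on UNIV S" "\<And>x. (\<lambda>j. coef f j * eigfun j x) sums S x"
    using eigfun_series_uniform[OF coef_summable[OF f]] by (elim exE conjE) simp
  have cS: "continuous_on {0..1} S" using S(1) continuous_on_subset by blast
  have z: "coef (\<lambda>x. f x - S x) j = 0" for j
  proof -
    have "coef (\<lambda>x. f x - S x) j = coef f j - coef S j"
      unfolding coef_def left_diff_distrib
      by (intro integral_diff continuous_integrable_I continuous_intros W2D(4)[OF f] cS)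
    then show ?thesis using coef_of_series[OF S(2) coef_summable[OF f]] by simp
  qed
  have c: "continuous_on {0..1} (\<lambda>x. f x - S x)" by (intro continuous_on_diff W2D(4)[OF f] cS)
  have "f x - S x = 0" using coef_complete[OF c z x] .
  then show ?thesis using S(2)[of x] by simp
qed

lemma W2_pairing:
  assumes f: "W2 f f1 f2" and w: "w absolutely_integrable_on {0..1}"
  shows "(\<lambda>j. coef f j * coef w j) sums integral {0..1} (\<lambda>x. f x * w x)"
  by (rule pairing_sums[OF W2_expansion[OF f] coef_summable[OF f] w])

lemma ip_eigfun:
  assumes "f \<in> L2 I01" "AE x in lebesgue_on {0..1}. f x = F x"
  shows "ip f (eigfun j) = coef F j"
proof -
  have f: "f \<in> L2 {0..1}" using assms(1) by (simp add: L2_Ioo_eq_Icc)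
  have e: "eigfun j \<in> L2 {0..1}" by (intro continuous_imp_L2 continuous_intros)
  have ae: "AE x in lebesgue_on {0..1}. f x * eigfun j x = F x * eigfun j x"
    using assms(2) by eventually_elim simp
  have "ip f (eigfun j) = integral {0..1} (\<lambda>x. f x * eigfun j x)"
    unfolding ip_def LINT_Ioo_eq_Icc
    using LINT_Icc_eq_integral[OF L2_mult_absolutely_integrable[OF f e]] by simp
  also have "\<dots> = coef F j" unfolding coef_def by (rule integral_cong_AE_lebesgue(1)[OF ae])
  finally show ?thesis .
qed

lemma coef_diff:
  assumes "f absolutely_integrable_on {0..1}" "g absolutely_integrable_on {0..1}"
  shows "coef (\<lambda>x. f x - g x) j = coef f j - coef g j"
proof -
  have i: "(\<lambda>x. f x * eigfun j x) integrable_on {0..1}" if "f absolutely_integrable_on {0..1}" for f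
    using abs_integrable_cont_mult[OF continuous_on_eigfun that] by (simp add: mult.commute abs_integrable_imp_integrable)
  show ?thesis unfolding coef_def left_diff_distrib by (rule integral_diff[OF i[OF assms(1)] i[OF assms(2)]])
qed

lemma coef_L2_limit:
  assumes g: "g \<in> L2 {0..1}" and s: "\<And>n. s n \<in> L2 {0..1}"
    and lim: "(\<lambda>n. L2_norm {0..1} (\<lambda>x. g x - s n x)) \<longlonglongrightarrow> 0"
  shows "(\<lambda>n. coef (s n) j) \<longlonglongrightarrow> coef g j"
proof -
  have "(\<lambda>n. coef g j - coef (s n) j) \<longlonglongrightarrow> 0"
  proof (rule Lim_null_comparison)
    show "(\<lambda>n. 2 * L2_norm {0..1} (\<lambda>x. g x - s n x)) \<longlonglongrightarrow> 0"
      using tendsto_mult_right_zero[OF lim] .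
    show "\<forall>\<^sub>F n in sequentially. norm (coef g j - coef (s n) j) \<le> 2 * L2_norm {0..1} (\<lambda>x. g x - s n x)"
      using norm_coef_le[OF L2_diff(1)[OF g s]] coef_diff[OF L2_absolutely_integrable[OF g] L2_absolutely_integrable[OF s]]
      by (intro always_eventually allI) metis
  qed
  from tendsto_diff[OF tendsto_const[of "coef g j"] this] show ?thesis by simp
qed

text \<open>The phases have modulus 1, so the series with the rotated coefficients converges
  uniformly and supplies a witness for the choice in \<open>exp_A\<close>. Coefficients are
  continuous in \<open>L^2\<close>, so every possible choice has the same ones.\<close>

lemma exp_A_coef:
  assumes f: "f \<in> L2 I01" and ae: "AE x in lebesgue_on {0..1}. f x = F x" and W: "W2 F F1 F2"
  shows "exp_A t f \<in> L2 I01" "ip (exp_A t f) (eigfun j) = exp (- \<i> * of_real (eigval j * t)) * coef F j"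
proof -
  define c where "c j = exp (- \<i> * complex_of_real (eigval j * t)) * coef F j" for j
  have nc: "norm (c j) = norm (coef F j)" for j by (simp add: c_def norm_mult)
  have cs: "summable (\<lambda>j. norm (c j))" using coef_summable[OF W] by (simp add: nc)
  define s where "s n x = (\<Sum>j<n. c j * eigfun j x)" for n x
  have sL: "s n \<in> L2 {0..1}" for n unfolding s_def by (intro continuous_imp_L2 continuous_intros)
  have s_eq: "(\<Sum>j<n. exp (- \<i> * complex_of_real (eigval j * t)) * ip f (eigfun j) * eigfun j x) = s n x" for n x
    by (simp add: s_def c_def ip_eigfun[OF f ae])
  obtain S where S: "continuous_on UNIV S" "\<And>x. (\<lambda>j. c j * eigfun j x) sums S x"
    "uniform_limit UNIV s S sequentially"
    unfolding s_def[abs_def] using eigfun_series_uniform[OF cs] by (elim exE conjE) simp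
  have SL: "S \<in> L2 {0..1}" using S(1) continuous_on_subset by (intro continuous_imp_L2) blast
  have "(\<lambda>n. L2_norm {0..1} (\<lambda>x. S x - s n x)) \<longlonglongrightarrow> 0"
  proof (rule tendstoI)
    fix e :: real assume e: "0 < e"
    have "\<forall>\<^sub>F n in sequentially. \<forall>x\<in>UNIV. dist (s n x) (S x) < e / 2"
      using S(3) e by (intro uniform_limitD) auto
    then show "\<forall>\<^sub>F n in sequentially. dist (L2_norm {0..1} (\<lambda>x. S x - s n x)) 0 < e"
    proof eventually_elim
      case (elim n)
      have "L2_norm {0..1} (\<lambda>x. S x - s n x) \<le> e / 2 * sqrt (1 - 0)"
        using elim e by (intro L2_norm_bound L2_diff(1) SL sL) (auto simp: dist_norm norm_minus_commute less_imp_le)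
      then show ?case using e by simp
    qed
  qed
  then have "\<exists>g. g \<in> L2 I01 \<and> (\<lambda>n. L2_norm I01 (\<lambda>x. g x - s n x)) \<longlonglongrightarrow> 0"
    using SL by (auto simp: L2_Ioo_eq_Icc)
  then have *: "exp_A t f \<in> L2 I01 \<and> (\<lambda>n. L2_norm I01 (\<lambda>x. exp_A t f x - s n x)) \<longlonglongrightarrow> 0"
    unfolding exp_A_def s_eq by (rule someI_ex)
  then show L: "exp_A t f \<in> L2 I01" by simp
  have "(\<lambda>n. coef (s n) j) \<longlonglongrightarrow> coef (exp_A t f) j"
    using * by (intro coef_L2_limit sL) (auto simp: L2_Ioo_eq_Icc)
  moreover have "(\<lambda>n. coef (s n) j) \<longlonglongrightarrow> coef S j"
    using \<open>(\<lambda>n. L2_norm {0..1} (\<lambda>x. S x - s n x)) \<longlonglongrightarrow> 0\<close> by (intro coef_L2_limit sL SL)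
  ultimately have "coef (exp_A t f) j = coef S j" by (rule LIMSEQ_unique)
  then show "ip (exp_A t f) (eigfun j) = exp (- \<i> * of_real (eigval j * t)) * coef F j"
    using coef_of_series[OF S(2) cs] ip_eigfun[OF L, of "exp_A t f"] by (simp add: c_def)
qed

section \<open>Bessel and Parseval relations, and the coefficient \<open>a_k\<close>\<close>

lemma norm_square_integral_cnj:
  assumes f: "f \<in> L2 {a..b}"
  shows "complex_of_real ((L2_norm {a..b} f)\<^sup>2) = integral {a..b} (\<lambda>x. f x * cnj (f x))"
proof -
  have "complex_of_real (integral {a..b} (\<lambda>x. (norm (f x))\<^sup>2)) = integral {a..b} (\<lambda>x. complex_of_real ((norm (f x))\<^sup>2))"
    using integral_linear[OF abs_integrable_imp_integrable[OF L2_norm_square_integral(1)[OF f]] bounded_linear_of_real[where 'a=complex]]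
    by (simp add: o_def)
  then show ?thesis unfolding L2_norm_square_integral(2)[OF f] complex_norm_square by simp
qed

text \<open>The weights \<open>N j\<close> are needed because the derivatives \<open>eigfun'\<close> are not normalised.\<close>

lemma Bessel_orthogonal:
  fixes e :: "nat \<Rightarrow> real \<Rightarrow> complex"
  assumes f: "f \<in> L2 {0..1}"
    and e: "\<And>j. continuous_on {0..1} (e j)" "\<And>j x. cnj (e j x) = e j x"
    and orth: "\<And>i j. integral {0..1} (\<lambda>x. e i x * e j x) = (if i = j then of_real (N j) else 0)"
    and N: "\<And>j. 0 \<le> N j"
    and b: "\<And>j. integral {0..1} (\<lambda>x. f x * e j x) = of_real (N j) * b j"
  shows "(\<Sum>j<n. N j * (norm (b j))\<^sup>2) \<le> (L2_norm {0..1} f)\<^sup>2"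
proof -
  \<comment> \<open>The conjugate of the orthogonal projection of \<open>f\<close>; pairing it with
    \<open>f\<close> without conjugation produces the squares \<open>|b j|^2\<close>.\<close>
  define s where "s x = (\<Sum>j<n. cnj (b j) * e j x)" for x
  define B where "B = (\<Sum>j<n. N j * (norm (b j))\<^sup>2)"
  have B0: "0 \<le> B" unfolding B_def by (intro sum_nonneg mult_nonneg_nonneg N) auto
  have sc: "continuous_on {0..1} s" unfolding s_def by (intro continuous_intros e)
  have sL: "s \<in> L2 {0..1}" by (rule continuous_imp_L2[OF sc])
  have eL: "e j \<in> L2 {0..1}" for j by (rule continuous_imp_L2[OF e(1)])
  have "integral {0..1} (\<lambda>x. f x * s x) = integral {0..1} (\<lambda>x. \<Sum>j<n. cnj (b j) * (f x * e j x))"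
    by (simp add: s_def sum_distrib_left mult_ac)
  also have "\<dots> = (\<Sum>j<n. integral {0..1} (\<lambda>x. cnj (b j) * (f x * e j x)))"
    by (intro integral_sum integrable_on_mult_right abs_integrable_imp_integrable L2_mult_absolutely_integrable f eL) auto
  also have "\<dots> = (\<Sum>j<n. of_real (N j) * (b j * cnj (b j)))"
    by (simp add: b) (simp add: mult_ac)
  also have "\<dots> = of_real B"
    unfolding B_def by (simp only: of_real_sum of_real_mult complex_norm_square)
  finally have 1: "integral {0..1} (\<lambda>x. f x * s x) = of_real B" .
  have "integral {0..1} (\<lambda>x. s x * cnj (s x)) = integral {0..1} (\<lambda>x. \<Sum>j<n. b j * (\<Sum>i<n. cnj (b i) * (e i x * e j x)))"
  proof (rule integral_cong)
    fix x
    have "cnj (s x) = (\<Sum>j<n. b j * e j x)" by (simp add: s_def e(2))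
    then have "s x * cnj (s x) = (\<Sum>j<n. b j * (s x * e j x))"
      by (simp only: sum_distrib_left mult.left_commute)
    also have "\<dots> = (\<Sum>j<n. b j * (\<Sum>i<n. cnj (b i) * (e i x * e j x)))"
      by (simp only: s_def sum_distrib_right mult.assoc)
    finally show "s x * cnj (s x) = (\<Sum>j<n. b j * (\<Sum>i<n. cnj (b i) * (e i x * e j x)))" .
  qed
  also have "\<dots> = (\<Sum>j<n. integral {0..1} (\<lambda>x. b j * (\<Sum>i<n. cnj (b i) * (e i x * e j x))))"
    by (intro integral_sum continuous_integrable_I continuous_intros e) auto
  also have "\<dots> = (\<Sum>j<n. b j * (\<Sum>i<n. cnj (b i) * integral {0..1} (\<lambda>x. e i x * e j x)))"
  proof (rule sum.cong[OF refl])
    fix j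
    have "integral {0..1} (\<lambda>x. \<Sum>i<n. cnj (b i) * (e i x * e j x)) = (\<Sum>i<n. integral {0..1} (\<lambda>x. cnj (b i) * (e i x * e j x)))"
      by (intro integral_sum continuous_integrable_I continuous_intros e) auto
    then show "integral {0..1} (\<lambda>x. b j * (\<Sum>i<n. cnj (b i) * (e i x * e j x))) = b j * (\<Sum>i<n. cnj (b i) * integral {0..1} (\<lambda>x. e i x * e j x))"
      by simp
  qed
  also have "\<dots> = (\<Sum>j<n. of_real (N j) * (b j * cnj (b j)))"
    by (intro sum.cong refl) (simp add: orth if_distrib mult_ac cong: if_cong)
  also have "\<dots> = of_real B"
    unfolding B_def by (simp only: of_real_sum of_real_mult complex_norm_square)
  finally have "complex_of_real ((L2_norm {0..1} s)\<^sup>2) = complex_of_real B"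
    unfolding norm_square_integral_cnj[OF sL] .
  then have 2: "(L2_norm {0..1} s)\<^sup>2 = B" by (simp only: of_real_eq_iff)
  \<comment> \<open>\<open>B\<close> is both the pairing of \<open>f\<close> with \<open>s\<close>
    and the squared norm of \<open>s\<close>, so one factor \<open>B\<close> cancels after
    squaring.\<close>
  have "B \<le> L2_norm {0..1} f * L2_norm {0..1} s"
    using L2_Cauchy_Schwarz_integral[OF f sL] B0 unfolding 1 by simp
  then have "B\<^sup>2 \<le> (L2_norm {0..1} f)\<^sup>2 * B"
    unfolding 2[symmetric] power_mult_distrib[symmetric] by (intro power_mono) auto
  then show ?thesis unfolding B_def[symmetric] using B0
    by (cases "B = 0") (auto simp: power2_eq_square)
qed

lemma Bessel_eigfun:
  assumes "f \<in> L2 {0..1}"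
  shows "(\<Sum>j<n. (norm (coef f j))\<^sup>2) \<le> (L2_norm {0..1} f)\<^sup>2"
  using Bessel_orthogonal[of f eigfun "\<lambda>_. 1" "coef f" n, OF assms continuous_on_eigfun cnj_eigfun]
  by (simp add: coef_eigfun[unfolded coef_def] coef_def)

text \<open>Bessel for the derivative: by \<open>eigval_coef\<close> the pairing of
  \<open>f1\<close> with \<open>eigfun' j\<close> is \<open>\<lambda>_j coef f j\<close>, and
  \<open>\<lambda>_j\<close> is the squared norm of \<open>eigfun' j\<close>.\<close>

lemma Bessel_eigfun':
  assumes f: "ac f f1 0 1" and f1: "f1 \<in> L2 {0..1}"
  shows "(\<Sum>j<n. eigval j * (norm (coef f j))\<^sup>2) \<le> (L2_norm {0..1} f1)\<^sup>2"
  using Bessel_orthogonal[of f1 eigfun' eigval "coef f" n, OF f1 continuous_on_eigfun' cnj_eigfun']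
  by (simp add: eigfun'_orthogonal eigval_coef[OF f] coef_eigfun)

text \<open>Minus the integral of \<open>cnj f * f2\<close> is computed twice, by parts and mode by
  mode with \<open>coef f2 j = - \<lambda>_j coef f j\<close>; both computations rest on the Neumann
  condition.\<close>

lemma deriv_norm_sums:
  assumes f: "W2 f f1 f2" and bc: "f1 0 = 0" "f1 1 = 0"
  shows "(\<lambda>j. eigval j * (norm (coef f j))\<^sup>2) sums (L2_norm {0..1} f1)\<^sup>2"
proof -
  note W = W2D[OF f]
  have c2: "coef f2 j = - of_real (eigval j) * coef f j" for j
    using eigval_coef[OF W(1), of j] integral_eigfun'[OF W(2), of j] bc by simp
  have "(\<lambda>j. coef (\<lambda>x. cnj (f x)) j * coef f2 j) sums integral {0..1} (\<lambda>x. cnj (f x) * f2 x)"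
    by (rule W2_pairing[OF W2_cnj[OF f] L2_absolutely_integrable[OF W(3)]])
  then have "(\<lambda>j. - of_real (eigval j * (norm (coef f j))\<^sup>2)) sums integral {0..1} (\<lambda>x. cnj (f x) * f2 x)"
    unfolding coef_cnj c2 by (simp only: of_real_mult complex_norm_square mult_minus_left mult_minus_right mult_ac)
  then have "(\<lambda>j. - (- of_real (eigval j * (norm (coef f j))\<^sup>2))) sums - integral {0..1} (\<lambda>x. cnj (f x) * f2 x)"
    by (rule sums_minus)
  moreover have "- integral {0..1} (\<lambda>x. cnj (f x) * f2 x) = complex_of_real ((L2_norm {0..1} f1)\<^sup>2)"
    using ac_by_parts[OF W(2) ac_cnj[OF W(1)]] bc norm_square_integral_cnj[OF W(7)] by (simp add: mult.commute)
  ultimately have "(\<lambda>j. complex_of_real (eigval j * (norm (coef f j))\<^sup>2)) sums complex_of_real ((L2_norm {0..1} f1)\<^sup>2)"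
    by simp
  then show ?thesis by (simp only: sums_of_real_iff)
qed

text \<open>With \<open>X = M \<phi>_k\<close>, the sum of
  \<open>\<lambda>_j coef M j coef X j\<close> is the integral of \<open>M1 X1\<close>: the boundary
  values in \<open>\<lambda>_j coef M j\<close> meet the pointwise expansion of \<open>X\<close> at
  the ends. Expanding \<open>X1\<close> leaves \<open>M1^2 \<phi>_k\<close> and
  \<open>M M1 \<phi>_k'\<close>, and the term with \<open>\<lambda>_k / 2\<close> cancels the
  latter.\<close>

lemma a_coeff_eq:
  fixes \<mu> :: "real \<Rightarrow> real"
  assumes mL: "(\<lambda>x. complex_of_real (\<mu> x)) \<in> L2 I01" and W: "W2 M M1 M2"
    and ae: "AE x in lebesgue_on {0..1}. complex_of_real (\<mu> x) = M x"
  shows "summable (\<lambda>j. norm (a_term \<mu> k j))"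
    and "a_coeff \<mu> k = integral {0..1} (\<lambda>x. M1 x * M1 x * eigfun k x)"
proof -
  note WM = W2D[OF W]
  define X where "X x = M x * eigfun k x" for x
  define X1 where "X1 x = M1 x * eigfun k x + M x * eigfun' k x" for x
  define X2 where "X2 x = M2 x * eigfun k x + 2 * M1 x * eigfun' k x + M x * (- of_real (eigval k) * eigfun k x)" for x
  have WX: "W2 X X1 X2" unfolding X_def[abs_def] X1_def[abs_def] X2_def[abs_def] by (rule W2_mult[OF W W2_eigfun])
  note WX' = W2D[OF WX]
  define h where "h x = complex_of_real (\<mu> x) * eigfun k x" for x
  have hL: "h \<in> L2 I01"
    using L2_mult_continuous[of _ 0 1, OF mL[unfolded L2_Ioo_eq_Icc] continuous_on_eigfun]
    by (simp add: L2_Ioo_eq_Icc h_def[abs_def] mult.commute)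
  have hae: "AE x in lebesgue_on {0..1}. h x = X x"
    using ae by eventually_elim (simp add: h_def X_def)
  have "ip (eigfun j) h = ip h (eigfun j)" for j
  proof -
    have "cnj (h x) = h x" for x by (simp add: h_def)
    then show ?thesis by (simp add: ip_def mult.commute)
  qed
  then have aterm: "a_term \<mu> k j = of_real (eigval j - eigval k / 2) * coef M j * coef X j" for j
    by (simp add: a_term_def ip_eigfun[OF mL ae] ip_eigfun[OF hL hae] h_def[abs_def, symmetric])
  have sX: "summable (\<lambda>j. norm (coef X j))" by (rule coef_summable[OF WX])
  have lM: "of_real (eigval j) * coef M j = M1 1 * eigfun j 1 - M1 0 * eigfun j 0 - coef M2 j" for j
    using eigval_coef[OF WM(1)] integral_eigfun'[OF WM(2)] by simp
  define K where "K = 2 * norm (M1 1) + 2 * norm (M1 0) + 2 * L2_norm {0..1} M2"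
  \<comment> \<open>Since \<open>\<lambda>_j coef M j\<close> is only bounded, summability comes
    from \<open>coef X j\<close>.\<close>
  have "norm (a_term \<mu> k j) \<le> (K + eigval k / 2 * (2 * L2_norm {0..1} M)) * norm (coef X j)" for j
  proof -
    have "a_term \<mu> k j = (of_real (eigval j) * coef M j - of_real (eigval k / 2) * coef M j) * coef X j"
      unfolding aterm by (simp add: algebra_simps)
    then have "norm (a_term \<mu> k j) = norm (of_real (eigval j) * coef M j - of_real (eigval k / 2) * coef M j) * norm (coef X j)"
      by (simp only: norm_mult)
    also have "norm (of_real (eigval j) * coef M j - of_real (eigval k / 2) * coef M j) \<le>
        norm (of_real (eigval j) * coef M j) + norm (complex_of_real (eigval k / 2) * coef M j)"
      by (rule norm_triangle_ineq4)
    also have "norm (of_real (eigval j) * coef M j) \<le> K" unfolding K_def by (rule eigval_coef_bound[OF W])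
    also have "norm (complex_of_real (eigval k / 2) * coef M j) \<le> eigval k / 2 * (2 * L2_norm {0..1} M)"
      unfolding norm_mult using norm_coef_le[OF WM(6)] by (intro mult_mono) auto
    finally show ?thesis by (simp add: mult_right_mono)
  qed
  then show "summable (\<lambda>j. norm (a_term \<mu> k j))"
    by (intro summable_comparison_test'[OF summable_mult[OF sX]]) simp
  have s1: "(\<lambda>j. coef X j * coef M2 j) sums integral {0..1} (\<lambda>x. X x * M2 x)"
    by (rule W2_pairing[OF WX L2_absolutely_integrable[OF WM(3)]])
  have e1: "(\<lambda>j. coef X j * eigfun j 1) sums X 1" and e0: "(\<lambda>j. coef X j * eigfun j 0) sums X 0"
    by (rule W2_expansion[OF WX], simp)+
  have "(\<lambda>j. M1 1 * (coef X j * eigfun j 1) - M1 0 * (coef X j * eigfun j 0) - coef X j * coef M2 j) sums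
      (M1 1 * X 1 - M1 0 * X 0 - integral {0..1} (\<lambda>x. X x * M2 x))"
    by (intro sums_diff sums_mult e1 e0 s1)
  moreover have "M1 1 * (coef X j * eigfun j 1) - M1 0 * (coef X j * eigfun j 0) - coef X j * coef M2 j
      = of_real (eigval j) * coef M j * coef X j" for j
    unfolding lM by (simp add: algebra_simps)
  moreover have "M1 1 * X 1 - M1 0 * X 0 - integral {0..1} (\<lambda>x. X x * M2 x) = integral {0..1} (\<lambda>x. M1 x * X1 x)"
    using ac_by_parts[OF WM(2) WX'(1)] by (simp add: mult.commute)
  ultimately have sA: "(\<lambda>j. of_real (eigval j) * coef M j * coef X j) sums integral {0..1} (\<lambda>x. M1 x * X1 x)"
    by simp
  have sB: "(\<lambda>j. of_real (eigval k / 2) * (coef M j * coef X j)) sums (of_real (eigval k / 2) * integral {0..1} (\<lambda>x. M x * X x))"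
    by (intro sums_mult W2_pairing[OF W W2_imp_abs_integrable[OF WX]])
  have "(\<lambda>j. a_term \<mu> k j) sums (integral {0..1} (\<lambda>x. M1 x * X1 x) - of_real (eigval k / 2) * integral {0..1} (\<lambda>x. M x * X x))"
    using sums_diff[OF sA sB] unfolding aterm by (simp add: algebra_simps)
  then have a: "a_coeff \<mu> k = integral {0..1} (\<lambda>x. M1 x * X1 x) - of_real (eigval k / 2) * integral {0..1} (\<lambda>x. M x * X x)"
    unfolding a_coeff_def by (rule sums_unique[symmetric])
  \<comment> \<open>The factor 1/2 in front of \<open>\<lambda>_k\<close> is accounted for by
    \<open>(M^2)' = 2 M M1\<close>.\<close>
  have MM: "ac (\<lambda>x. M x * M x) (\<lambda>x. M1 x * M x + M x * M1 x) 0 1" by (rule ac_mult[OF WM(1) WM(1)])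
  have "of_real (eigval k) * integral {0..1} (\<lambda>x. M x * X x) = of_real (eigval k) * coef (\<lambda>x. M x * M x) k"
    by (simp add: coef_def X_def mult.assoc)
  also have "\<dots> = integral {0..1} (\<lambda>x. (M1 x * M x + M x * M1 x) * eigfun' k x)"
    by (rule eigval_coef[OF MM])
  also have "\<dots> = integral {0..1} (\<lambda>x. 2 * (M x * M1 x * eigfun' k x))"
    by (rule integral_cong) (simp add: algebra_simps)
  also have "\<dots> = 2 * integral {0..1} (\<lambda>x. M x * M1 x * eigfun' k x)" by (rule integral_mult_right)
  finally have b: "of_real (eigval k / 2) * integral {0..1} (\<lambda>x. M x * X x) = integral {0..1} (\<lambda>x. M x * M1 x * eigfun' k x)"
    by simp
  have "integral {0..1} (\<lambda>x. M1 x * X1 x) = integral {0..1} (\<lambda>x. M1 x * M1 x * eigfun k x + M x * M1 x * eigfun' k x)"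
    by (rule integral_cong) (simp add: X1_def algebra_simps)
  also have "\<dots> = integral {0..1} (\<lambda>x. M1 x * M1 x * eigfun k x) + integral {0..1} (\<lambda>x. M x * M1 x * eigfun' k x)"
    by (intro integral_add continuous_integrable_I continuous_intros WM)
  finally show "a_coeff \<mu> k = integral {0..1} (\<lambda>x. M1 x * M1 x * eigfun k x)"
    unfolding a b by simp
qed

section \<open>Bilinear estimates over a triangle\<close>

text \<open>Dyadic decomposition of the triangle \<open>s < t\<close> into squares: the powers of the side lengths
  sum up to a geometric series.\<close>

lemma triangle_bound:
  fixes f g :: "nat \<Rightarrow> real \<Rightarrow> complex"
  assumes f: "\<And>j. f j absolutely_integrable_on {0..T}" and g: "\<And>j. g j absolutely_integrable_on {0..T}"
    and \<rho>: "\<rho> \<in> L2 {0..T}"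
    and fB: "\<And>j t. j < J \<Longrightarrow> t \<in> {0..T} \<Longrightarrow> norm (f j t) \<le> B * norm (\<rho> t :: real)"
    and gB: "\<And>j t. j < J \<Longrightarrow> t \<in> {0..T} \<Longrightarrow> norm (g j t) \<le> B * norm (\<rho> t)"
    and fK: "\<And>a b. 0 \<le> a \<Longrightarrow> a \<le> b \<Longrightarrow> b \<le> T \<Longrightarrow>
      (\<Sum>j<J. (norm (integral {a..b} (f j)))\<^sup>2) \<le> K * (b - a) powr \<nu> * integral {a..b} (\<lambda>t. (\<rho> t)\<^sup>2)"
    and gK: "\<And>a b. 0 \<le> a \<Longrightarrow> a \<le> b \<Longrightarrow> b \<le> T \<Longrightarrow>
      (\<Sum>j<J. (norm (integral {a..b} (g j)))\<^sup>2) \<le> K * (b - a) powr \<nu> * integral {a..b} (\<lambda>t. (\<rho> t)\<^sup>2)"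
    and nn: "0 \<le> K" "0 \<le> B" "0 < \<nu>" "0 \<le> T"
  shows "(\<Sum>j<J. norm (integral {0..T} (\<lambda>t. f j t * integral {0..t} (g j))))
    \<le> K / (1 - 2 powr (- \<nu>)) * T powr \<nu> * integral {0..T} (\<lambda>t. (\<rho> t)\<^sup>2)"
proof -
  define R where "R a b = integral {a..b} (\<lambda>t. (\<rho> t)\<^sup>2)" for a b
  \<comment> \<open>The sum of the geometric series with ratio \<open>2 powr (- \<nu>)\<close>,
    characterised by \<open>C * 2 powr (- \<nu>) + 1 = C\<close>: one bisection shrinks the bound
    for the two half-size triangles by the ratio and adds one square.\<close>
  define C where "C = 1 / (1 - 2 powr (- \<nu>))"
  define P where "P j a b = integral {a..b} (\<lambda>t. f j t * integral {a..t} (g j))" for j a b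
  have half: "2 powr (- \<nu>) < 1" using nn(3) by (simp add: powr_minus field_simps)
  have "C * (1 - 2 powr (- \<nu>)) = 1" using half nn(3) by (simp add: C_def)
  then have C: "C * 2 powr (- \<nu>) + 1 = C" by (simp add: algebra_simps)
  have C0: "0 \<le> C" using half by (simp add: C_def)
  have ri: "(\<lambda>t. (\<rho> t)\<^sup>2) absolutely_integrable_on {0..T}" using L2_norm_square_integral(1)[OF \<rho>] by simp
  have ri': "(\<lambda>t. (\<rho> t)\<^sup>2) integrable_on {a..b}" if "0 \<le> a" "b \<le> T" for a b
    by (rule abs_integrable_imp_integrable[OF abs_integrable_subinterval[OF ri that]])
  have R0: "0 \<le> R a b" if "0 \<le> a" "b \<le> T" for a b
    unfolding R_def by (rule integral_nonneg[OF ri'[OF that]]) simp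
  have Radd: "R a m + R m b = R a b" if "0 \<le> a" "a \<le> m" "m \<le> b" "b \<le> T" for a m b
    unfolding R_def using that by (intro Henstock_Kurzweil_Integration.integral_combine ri') auto
  have fi: "f j integrable_on {a..b}" "f j absolutely_integrable_on {a..b}"
    and gi: "g j integrable_on {a..b}" "g j absolutely_integrable_on {a..b}" if "0 \<le> a" "b \<le> T" for j a b
    using abs_integrable_subinterval[OF f that] abs_integrable_subinterval[OF g that]
    by (simp_all add: abs_integrable_imp_integrable)
  have gc: "continuous_on {a..b} (\<lambda>t. integral {a..t} (g j))" if "0 \<le> a" "b \<le> T" for j a b
    by (rule indefinite_integral_continuous_1[OF gi(1)[OF that]])
  have Pi: "(\<lambda>t. f j t * integral {a..t} (g j)) integrable_on {a..b}" if "0 \<le> a" "b \<le> T" for j a b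
    using abs_integrable_cont_mult[OF gc[OF that] fi(2)[OF that]]
    by (simp add: mult.commute abs_integrable_imp_integrable)
  \<comment> \<open>Cutting at \<open>m\<close> leaves two smaller triangles and the square where
    \<open>t\<close> lies above \<open>m\<close> and the inner variable below, on which the integral
    factorises.\<close>
  have split: "P j a b = P j a m + P j m b + integral {m..b} (f j) * integral {a..m} (g j)"
    if "0 \<le> a" "a \<le> m" "m \<le> b" "b \<le> T" for j a m b
  proof -
    have "P j a b = P j a m + integral {m..b} (\<lambda>t. f j t * integral {a..t} (g j))"
      unfolding P_def using that by (intro Henstock_Kurzweil_Integration.integral_combine[symmetric] Pi) auto
    also have "integral {m..b} (\<lambda>t. f j t * integral {a..t} (g j)) =
        integral {m..b} (\<lambda>t. f j t * integral {m..t} (g j) + f j t * integral {a..m} (g j))"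
    proof (rule integral_cong)
      fix t assume "t \<in> {m..b}"
      then have "integral {a..m} (g j) + integral {m..t} (g j) = integral {a..t} (g j)"
        using that by (intro Henstock_Kurzweil_Integration.integral_combine gi) auto
      then show "f j t * integral {a..t} (g j) = f j t * integral {m..t} (g j) + f j t * integral {a..m} (g j)"
        by (metis add.commute distrib_left)
    qed
    also have "\<dots> = P j m b + integral {m..b} (f j) * integral {a..m} (g j)"
      unfolding P_def using that
      by (subst integral_add) (auto intro!: Pi integrable_on_mult_left fi)
    finally show ?thesis by simp
  qed
  \<comment> \<open>A crude bound for a single \<open>j\<close>. Its factor \<open>b - a\<close>
    makes it negligible on very short intervals, whatever the number \<open>J\<close> of
    modes.\<close>
  have base: "norm (P j a b) \<le> B\<^sup>2 * (b - a) * R a b" if "0 \<le> a" "a \<le> b" "b \<le> T" "j < J" for j a b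
  proof -
    have rL: "\<rho> \<in> L2 {a..b}" using L2_subinterval(1)[OF \<rho>] that by simp
    define I where "I = integral {a..b} (\<lambda>t. norm (\<rho> t))"
    have ai: "(\<lambda>t. norm (\<rho> t)) integrable_on {a..b}"
      using L2_absolutely_integrable[OF rL] by (simp add: absolutely_integrable_on_def)
    have I0: "0 \<le> I" unfolding I_def by (rule integral_nonneg[OF ai]) simp
    have I2: "I\<^sup>2 \<le> (b - a) * R a b"
    proof -
      have "I \<le> sqrt (b - a) * L2_norm {a..b} \<rho>"
        unfolding I_def by (rule L2_norm_integral_norm_bound[OF rL that(2)])
      then have "I\<^sup>2 \<le> (sqrt (b - a) * L2_norm {a..b} \<rho>)\<^sup>2" using I0 by (intro power_mono)
      also have "\<dots> = (b - a) * R a b"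
        using that L2_norm_square_integral(2)[OF rL] by (simp add: power_mult_distrib R_def)
      finally show ?thesis .
    qed
    have gI: "norm (integral {a..t} (g j)) \<le> B * I" if t: "t \<in> {a..b}" for t
    proof -
      have at: "(\<lambda>t. norm (\<rho> t)) integrable_on {a..t}" using ai t by (auto intro: integrable_on_subinterval)
      have "norm (integral {a..t} (g j)) \<le> integral {a..t} (\<lambda>t. B * norm (\<rho> t))"
        using t \<open>0 \<le> a\<close> \<open>b \<le> T\<close> \<open>j < J\<close>
        by (intro Henstock_Kurzweil_Integration.integral_norm_bound_integral gi gB integrable_on_mult_right at) auto
      also have "\<dots> = B * integral {a..t} (\<lambda>t. norm (\<rho> t))" by (rule integral_mult_right)
      also have "\<dots> \<le> B * I"
        unfolding I_def using t nn(2) by (intro mult_left_mono integral_subset_le at ai) auto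
      finally show ?thesis .
    qed
    have "norm (P j a b) \<le> integral {a..b} (\<lambda>t. (B * (B * I)) * norm (\<rho> t))"
      unfolding P_def
    proof (rule Henstock_Kurzweil_Integration.integral_norm_bound_integral)
      show "(\<lambda>t. f j t * integral {a..t} (g j)) integrable_on {a..b}" using that by (intro Pi) auto
      show "(\<lambda>t. (B * (B * I)) * norm (\<rho> t)) integrable_on {a..b}" by (intro integrable_on_mult_right ai)
      fix t assume t: "t \<in> {a..b}"
      have "norm (f j t) * norm (integral {a..t} (g j)) \<le> (B * norm (\<rho> t)) * (B * I)"
        using t that nn(2) by (intro mult_mono fB gI) auto
      then show "norm (f j t * integral {a..t} (g j)) \<le> (B * (B * I)) * norm (\<rho> t)"
        by (simp add: norm_mult mult_ac)
    qed
    also have "\<dots> = (B * (B * I)) * I" unfolding I_def by (rule integral_mult_right)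
    also have "\<dots> = B\<^sup>2 * I\<^sup>2" by (simp add: power2_eq_square)
    also have "\<dots> \<le> B\<^sup>2 * ((b - a) * R a b)" using I2 by (intro mult_left_mono) auto
    finally show ?thesis by (simp add: mult.assoc)
  qed
  \<comment> \<open>The hypotheses on \<open>f\<close> and \<open>g\<close> weigh the two sides of
    the square with \<open>R m b\<close> and \<open>R a m\<close>, which add up to
    \<open>R a b\<close>; this additivity prevents a loss at each bisection.\<close>
  have cross: "(\<Sum>j<J. norm (integral {m..b} (f j) * integral {a..m} (g j))) \<le> K * (b - a) powr \<nu> * R a b"
    if "0 \<le> a" "a \<le> m" "m \<le> b" "b \<le> T" for a m b
  proof -
    have RR: "R m b \<le> R a b" "R a m \<le> R a b" using Radd[OF that] R0[of a m] R0[of m b] that by auto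
    have pw: "(b - m) powr \<nu> \<le> (b - a) powr \<nu>" "(m - a) powr \<nu> \<le> (b - a) powr \<nu>"
      using that nn(3) by (auto intro!: powr_mono2)
    have F: "(\<Sum>j<J. (norm (integral {m..b} (f j)))\<^sup>2) \<le> K * (b - a) powr \<nu> * R m b"
      using fK[of m b] that pw(1) R0[of m b] nn(1) unfolding R_def[symmetric]
      by (smt (verit) mult_left_mono mult_right_mono)
    have G: "(\<Sum>j<J. (norm (integral {a..m} (g j)))\<^sup>2) \<le> K * (b - a) powr \<nu> * R a m"
      using gK[of a m] that pw(2) R0[of a m] nn(1) unfolding R_def[symmetric]
      by (smt (verit) mult_left_mono mult_right_mono)
    have "(\<Sum>j<J. norm (integral {m..b} (f j) * integral {a..m} (g j))) \<le>
       (\<Sum>j<J. (norm (integral {m..b} (f j)))\<^sup>2 + (norm (integral {a..m} (g j)))\<^sup>2)"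
    proof (rule sum_mono)
      fix j
      have "0 \<le> norm (integral {m..b} (f j)) * norm (integral {a..m} (g j))" by simp
      then show "norm (integral {m..b} (f j) * integral {a..m} (g j)) \<le> (norm (integral {m..b} (f j)))\<^sup>2 + (norm (integral {a..m} (g j)))\<^sup>2"
        using sum_squares_bound[of "norm (integral {m..b} (f j))" "norm (integral {a..m} (g j))"]
        unfolding norm_mult mult.assoc by linarith
    qed
    also have "\<dots> \<le> K * (b - a) powr \<nu> * R m b + K * (b - a) powr \<nu> * R a m"
      unfolding sum.distrib by (rule add_mono[OF F G])
    also have "\<dots> = K * (b - a) powr \<nu> * R a b" unfolding Radd[OF that, symmetric] by (simp add: algebra_simps)
    finally show ?thesis .
  qed
  \<comment> \<open>After \<open>n\<close> bisections the crude bound is used only on triangles of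
    side \<open>(b - a) / 2^n\<close>, and its total contribution vanishes as \<open>n\<close> grows
    with \<open>J\<close> fixed; the squares sum up to the constant \<open>C\<close>.\<close>
  have claim: "(\<Sum>j<J. norm (P j a b)) \<le> real J * B\<^sup>2 * (1/2) ^ n * (b - a) * R a b + K * C * (b - a) powr \<nu> * R a b"
    if "0 \<le> a" "a \<le> b" "b \<le> T" for n a b
    using that
  proof (induction n arbitrary: a b)
    case 0
    have "(\<Sum>j<J. norm (P j a b)) \<le> (\<Sum>j<J. B\<^sup>2 * (b - a) * R a b)"
      using 0 by (intro sum_mono base) auto
    then have "(\<Sum>j<J. norm (P j a b)) \<le> real J * B\<^sup>2 * (b - a) * R a b" by (simp add: mult.assoc)
    moreover have "0 \<le> K * C * (b - a) powr \<nu> * R a b"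
      using 0 nn C0 R0[of a b] by (intro mult_nonneg_nonneg) auto
    ultimately show ?case by simp
  next
    case (Suc n)
    define m where "m = (a + b) / 2"
    define L where "L = b - a"
    have m: "0 \<le> a" "a \<le> m" "m \<le> b" "b \<le> T" "m - a = L / 2" "b - m = L / 2"
      using Suc.prems by (auto simp: m_def L_def field_simps)
    have L0: "0 \<le> L" using Suc.prems by (simp add: L_def)
    have pw: "(L / 2) powr \<nu> = 2 powr (- \<nu>) * L powr \<nu>"
      using L0 by (simp add: powr_divide powr_minus field_simps)
    have "(\<Sum>j<J. norm (P j a b)) \<le> (\<Sum>j<J. norm (P j a m) + norm (P j m b) + norm (integral {m..b} (f j) * integral {a..m} (g j)))"
      unfolding split[OF m(1-4)] by (intro sum_mono order_trans[OF norm_triangle_ineq] add_right_mono norm_triangle_ineq)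
    also have "\<dots> = (\<Sum>j<J. norm (P j a m)) + (\<Sum>j<J. norm (P j m b)) + (\<Sum>j<J. norm (integral {m..b} (f j) * integral {a..m} (g j)))"
      by (simp add: sum.distrib)
    also have "\<dots> \<le> (real J * B\<^sup>2 * (1/2) ^ n * (L / 2) * R a m + K * C * (L / 2) powr \<nu> * R a m)
       + (real J * B\<^sup>2 * (1/2) ^ n * (L / 2) * R m b + K * C * (L / 2) powr \<nu> * R m b)
       + K * L powr \<nu> * R a b"
      using Suc.IH[of a m] Suc.IH[of m b] cross[OF m(1-4)] m unfolding m(5,6) L_def[symmetric] by (intro add_mono) auto
    also have "\<dots> = real J * B\<^sup>2 * (1/2) ^ Suc n * L * (R a m + R m b) + K * (C * 2 powr (- \<nu>)) * L powr \<nu> * (R a m + R m b) + K * L powr \<nu> * R a b"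
      unfolding pw by (simp add: algebra_simps)
    also have "\<dots> = real J * B\<^sup>2 * (1/2) ^ Suc n * L * R a b + K * (C * 2 powr (- \<nu>) + 1) * L powr \<nu> * R a b"
      unfolding Radd[OF m(1-4)] by (simp add: algebra_simps)
    finally show ?case unfolding C L_def .
  qed
  have "(\<lambda>n. real J * B\<^sup>2 * (1/2) ^ n * (T - 0) * R 0 T + K * C * (T - 0) powr \<nu> * R 0 T) \<longlonglongrightarrow>
      real J * B\<^sup>2 * 0 * (T - 0) * R 0 T + K * C * (T - 0) powr \<nu> * R 0 T"
    by (intro tendsto_intros LIMSEQ_power_zero) auto
  then have "(\<Sum>j<J. norm (P j 0 T)) \<le> real J * B\<^sup>2 * 0 * (T - 0) * R 0 T + K * C * (T - 0) powr \<nu> * R 0 T"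
    by (rule LIMSEQ_le_const) (use claim[of 0 T] nn(4) in auto)
  then show ?thesis by (simp add: P_def R_def C_def)
qed

section \<open>The large sieve for the exponentials of the spectrum\<close>

lemma sum_dist_le_suminf:
  fixes g :: "nat \<Rightarrow> real"
  assumes g: "summable g" "\<And>n. 0 \<le> g n"
  shows "(\<Sum>l<J. g (if l \<le> j then j - l else l - j)) \<le> 2 * (\<Sum>n. g n)"
proof -
  let ?A = "{l. l < J \<and> l \<le> j}" and ?B = "{l. l < J \<and> \<not> l \<le> j}"
  \<comment> \<open>Every distance to \<open>j\<close> occurs at most once on either side of
    \<open>j\<close>.\<close>
  have "(\<Sum>l<J. g (if l \<le> j then j - l else l - j)) = (\<Sum>l\<in>?A. g (j - l)) + (\<Sum>l\<in>?B. g (l - j))"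
    by (simp add: if_distrib sum.If_cases Int_def Collect_neg_eq[symmetric] cong: if_cong)
  also have "(\<Sum>l\<in>?A. g (j - l)) = sum g ((\<lambda>l. j - l) ` ?A)"
    by (subst sum.reindex) (auto simp: inj_on_def)
  also have "\<dots> \<le> suminf g" using g by (intro sum_le_suminf) auto
  also have "(\<Sum>l\<in>?B. g (l - j)) = sum g ((\<lambda>l. l - j) ` ?B)"
    by (subst sum.reindex) (auto simp: inj_on_def)
  also have "\<dots> \<le> suminf g" using g by (intro sum_le_suminf) auto
  finally show ?thesis by simp
qed

text \<open>\<open>\<lambda>_j - \<lambda>_i = pi^2 (j - i) (j + i)\<close> and
  \<open>j + i \<ge> |j - i|\<close>: the spectral gaps grow quadratically in the index distance,
  which makes the rows of the Gram matrix summable.\<close>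

lemma eigval_gap:
  assumes "i \<noteq> j"
  shows "2 * (real (if i \<le> j then j - i else i - j))\<^sup>2 \<le> \<bar>eigval j - eigval i\<bar>"
proof -
  define n where "n = \<bar>real j - real i\<bar>"
  have n: "real (if i \<le> j then j - i else i - j) = n" by (auto simp: n_def of_nat_diff)
  have "2 \<le> pi * pi" using pi_gt3 mult_mono[of 2 pi 1 pi] by simp
  have "n \<le> real j + real i" by (auto simp: n_def)
  have "2 * n\<^sup>2 \<le> (pi * pi) * n\<^sup>2" using \<open>2 \<le> pi * pi\<close> by (intro mult_right_mono) auto
  also have "\<dots> \<le> (pi * pi) * (n * (real j + real i))"
    unfolding power2_eq_square using \<open>n \<le> real j + real i\<close> by (intro mult_left_mono) (simp_all add: n_def)
  also have "\<dots> = \<bar>(pi * pi) * ((real j - real i) * (real j + real i))\<bar>"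
    by (simp add: n_def abs_mult)
  also have "(pi * pi) * ((real j - real i) * (real j + real i)) = eigval j - eigval i"
    by (simp add: eigval_def power2_eq_square algebra_simps)
  finally show ?thesis unfolding n .
qed

text \<open>The trivial bound is good on short intervals, the oscillatory one for distant
  frequencies; \<open>sieve_row_sum\<close> interpolates between them.\<close>

lemma integral_cis_bound:
  assumes "a \<le> b"
  shows "norm (integral {a..b} (\<lambda>s. exp (\<i> * of_real (r * s)))) \<le> b - a"
    and "r \<noteq> 0 \<Longrightarrow> norm (integral {a..b} (\<lambda>s. exp (\<i> * of_real (r * s)))) \<le> 2 / \<bar>r\<bar>"
proof -
  have n: "norm (exp (\<i> * complex_of_real (r * s))) = 1" for s by (rule norm_exp_i_times)
  have c: "continuous_on {a..b} (\<lambda>s. exp (\<i> * complex_of_real (r * s)))" by (intro continuous_intros)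
  have "norm (integral {a..b} (\<lambda>s. exp (\<i> * complex_of_real (r * s)))) \<le> integral {a..b} (\<lambda>s. 1)"
    by (intro Henstock_Kurzweil_Integration.integral_norm_bound_integral continuous_integrable_I c) (simp_all only: n order_refl continuous_on_const)
  then show "norm (integral {a..b} (\<lambda>s. exp (\<i> * of_real (r * s)))) \<le> b - a"
    using assms by simp
  assume r: "r \<noteq> 0"
  have "((\<lambda>s. exp (\<i> * of_real (r * s))) has_integral
      exp (\<i> * of_real (r * b)) / (\<i> * of_real r) - exp (\<i> * of_real (r * a)) / (\<i> * of_real r)) {a..b}"
  proof (rule fundamental_theorem_of_calculus[OF assms])
    fix s
    have "((\<lambda>z. exp (\<i> * (of_real r * z)) / (\<i> * of_real r)) has_field_derivative exp (\<i> * (of_real r * of_real s))) (at (complex_of_real s))"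
      using r by (auto intro!: derivative_eq_intros simp: mult_ac)
    from has_vector_derivative_real_field[OF this]
    show "((\<lambda>s. exp (\<i> * complex_of_real (r * s)) / (\<i> * of_real r)) has_vector_derivative exp (\<i> * of_real (r * s))) (at s within {a..b})"
      by (simp add: o_def has_vector_derivative_at_within)
  qed
  then have "integral {a..b} (\<lambda>s. exp (\<i> * of_real (r * s))) = exp (\<i> * of_real (r * b)) / (\<i> * of_real r) - exp (\<i> * of_real (r * a)) / (\<i> * of_real r)"
    by (rule integral_unique)
  moreover have "norm (exp (\<i> * complex_of_real (r * b)) / (\<i> * of_real r) - exp (\<i> * of_real (r * a)) / (\<i> * of_real r))
     \<le> norm (exp (\<i> * complex_of_real (r * b)) / (\<i> * of_real r)) + norm (exp (\<i> * complex_of_real (r * a)) / (\<i> * of_real r))"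
    by (rule norm_triangle_ineq4)
  moreover have "\<dots> = 2 / \<bar>r\<bar>" unfolding norm_divide n by (simp add: norm_mult)
  ultimately show "norm (integral {a..b} (\<lambda>s. exp (\<i> * of_real (r * s)))) \<le> 2 / \<bar>r\<bar>" by simp
qed

text \<open>The exponent -3/2 is 3/4 of the decay -2 of the Gram matrix, the factor 2 counts the two
  sides of the diagonal. The diagonal entry is set to 1 by hand, as \<open>0 powr x\<close> is
  0.\<close>

definition sieve_const :: real where
  "sieve_const = 2 * (\<Sum>n. if n = 0 then 1 else real n powr (- 3 / 2))"

lemma sieve_summable: "summable (\<lambda>n. if n = 0 then 1 else real n powr (- 3 / 2))"
proof -
  have "summable (\<lambda>n. real n powr (- 3 / 2))" by (simp add: summable_real_powr_iff)
  then show ?thesis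
    by (rule summable_cong[THEN iffD1, rotated]) (auto intro: eventually_sequentiallyI[of 1])
qed

lemma sieve_const_nonneg: "0 \<le> sieve_const"
  unfolding sieve_const_def using sieve_summable by (auto intro!: mult_nonneg_nonneg suminf_nonneg)

text \<open>An entry at distance \<open>n\<close> from the diagonal is at most \<open>L\<close> and
  at most \<open>n^-2\<close>, hence at most \<open>L^(1/4) n^(-3/2)\<close>. This is where the
  power 1/4 of the time originates.\<close>

lemma sieve_row_sum:
  assumes ab: "a \<le> b" "b - a \<le> 1"
  shows "(\<Sum>l<J. norm (integral {a..b} (\<lambda>s. exp (\<i> * of_real ((eigval j - eigval l) * s)))))
    \<le> sieve_const * (b - a) powr (1/4)"
proof -
  define L where "L = b - a"
  define g :: "nat \<Rightarrow> real" where "g n = (if n = 0 then 1 else real n powr (- 3 / 2))" for n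
  have L: "0 \<le> L" "L \<le> 1" using ab by (auto simp: L_def)
  have le: "norm (integral {a..b} (\<lambda>s. exp (\<i> * of_real ((eigval j - eigval l) * s)))) \<le>
      L powr (1/4) * g (if l \<le> j then j - l else l - j)" (is "?I \<le> _") for l
  proof (cases "l = j")
    case True
    have "?I \<le> L" unfolding L_def by (rule integral_cis_bound(1)[OF ab(1)])
    also have "L \<le> L powr (1/4)"
    proof (cases "L = 0")
      case False
      then have "L powr 1 \<le> L powr (1/4)" using L by (intro powr_mono') auto
      then show ?thesis using L False by simp
    qed simp
    finally show ?thesis using True by (simp add: g_def)
  next
    case False
    define n where "n = (if l \<le> j then j - l else l - j)"
    have n: "n \<noteq> 0" using False by (auto simp: n_def)
    have gap: "2 * (real n)\<^sup>2 \<le> \<bar>eigval j - eigval l\<bar>" using eigval_gap[OF False] by (simp add: n_def)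
    have r: "eigval j - eigval l \<noteq> 0" using False by (simp add: eigval_eq_iff)
    have "?I \<le> 2 / \<bar>eigval j - eigval l\<bar>" by (rule integral_cis_bound(2)[OF ab(1) r])
    also have "\<dots> \<le> 2 / (2 * (real n)\<^sup>2)" using gap n r by (intro divide_left_mono mult_pos_pos) auto
    finally have 1: "?I \<le> 1 / (real n)\<^sup>2" by simp
    have 2: "?I \<le> L" unfolding L_def by (rule integral_cis_bound(1)[OF ab(1)])
    \<comment> \<open>The weight 3/4 keeps the exponent of \<open>n\<close> below -1, and what is
      left over is the gain in the length.\<close>
    have "?I powr 1 = ?I powr (1/4) * ?I powr (3/4)" unfolding powr_add[symmetric] by simp
    then have "?I = ?I powr (1/4) * ?I powr (3/4)" unfolding powr_one[OF norm_ge_zero] .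
    also have "\<dots> \<le> L powr (1/4) * (1 / (real n)\<^sup>2) powr (3/4)"
      by (rule mult_mono[OF powr_mono2[OF _ norm_ge_zero 2] powr_mono2[OF _ norm_ge_zero 1]]) simp_all
    also have "(1 / (real n)\<^sup>2) powr (3/4) = real n powr (- 3 / 2)"
    proof -
      have "(1 / (real n)\<^sup>2) = real n powr (- 2)" using n by (simp add: powr_minus divide_inverse)
      then show ?thesis by (simp add: powr_powr)
    qed
    finally show ?thesis unfolding n_def[symmetric] g_def using n by simp
  qed
  have "(\<Sum>l<J. norm (integral {a..b} (\<lambda>s. exp (\<i> * of_real ((eigval j - eigval l) * s))))) \<le>
     (\<Sum>l<J. L powr (1/4) * g (if l \<le> j then j - l else l - j))"
    by (rule sum_mono) (rule le)
  also have "\<dots> = L powr (1/4) * (\<Sum>l<J. g (if l \<le> j then j - l else l - j))" by (rule sum_distrib_left[symmetric])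
  also have "\<dots> \<le> L powr (1/4) * (2 * suminf g)"
    using sieve_summable by (intro mult_left_mono sum_dist_le_suminf) (auto simp: g_def[abs_def])
  finally show ?thesis by (simp add: L_def sieve_const_def g_def[abs_def] mult.commute)
qed

text \<open>Schur's test for the Gram matrix of the exponentials, and duality.\<close>

lemma large_sieve:
  fixes v :: "real \<Rightarrow> complex"
  assumes v: "v \<in> L2 {a..b}" and ab: "a \<le> b" "b - a \<le> 1"
  shows "(\<Sum>j<J. (norm (integral {a..b} (\<lambda>s. exp (\<i> * of_real (eigval j * s)) * v s)))\<^sup>2)
    \<le> sieve_const * (b - a) powr (1/4) * (L2_norm {a..b} v)\<^sup>2"
proof -
  define E where "E j s = exp (\<i> * complex_of_real (eigval j * s))" for j s
  define A where "A j = integral {a..b} (\<lambda>s. E j s * v s)" for j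
  \<comment> \<open>The dual function: its pairing with \<open>v\<close> is the sum \<open>Q\<close>
    to be bounded, and its norm involves the Gram matrix only.\<close>
  define w where "w s = (\<Sum>j<J. cnj (A j) * E j s)" for s
  define S where "S = sieve_const * (b - a) powr (1/4)"
  define Q where "Q = (\<Sum>j<J. (norm (A j))\<^sup>2)"
  define \<kappa> where "\<kappa> j l = norm (integral {a..b} (\<lambda>s. exp (\<i> * of_real ((eigval j - eigval l) * s))))" for j l
  have S0: "0 \<le> S" unfolding S_def using sieve_const_nonneg by simp
  have Q0: "0 \<le> Q" unfolding Q_def by (simp add: sum_nonneg)
  have cE[continuous_intros]: "continuous_on U (E j)" for U j
    unfolding E_def[abs_def] by (intro continuous_intros)
  have cw: "continuous_on {a..b} w" unfolding w_def by (intro continuous_intros)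
  have wL: "w \<in> L2 {a..b}" by (rule continuous_imp_L2[OF cw])
  have vi: "v absolutely_integrable_on {a..b}" by (rule L2_absolutely_integrable[OF v])
  have iE: "(\<lambda>s. E j s * v s) integrable_on {a..b}" for j
    by (rule abs_integrable_imp_integrable[OF abs_integrable_cont_mult[OF cE vi]])
  have "integral {a..b} (\<lambda>s. v s * w s) = integral {a..b} (\<lambda>s. \<Sum>j<J. cnj (A j) * (E j s * v s))"
    by (rule integral_cong) (simp add: w_def sum_distrib_left mult_ac)
  also have "\<dots> = (\<Sum>j<J. integral {a..b} (\<lambda>s. cnj (A j) * (E j s * v s)))"
    by (rule integral_sum) (auto intro: integrable_on_mult_right iE)
  also have "\<dots> = (\<Sum>j<J. cnj (A j) * A j)" by (simp add: A_def)
  also have "\<dots> = of_real Q"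
    unfolding Q_def of_real_sum complex_norm_square by (simp only: mult.commute)
  finally have 1: "integral {a..b} (\<lambda>s. v s * w s) = of_real Q" .
  have EE: "E j s * cnj (E l s) = exp (\<i> * of_real ((eigval j - eigval l) * s))" for j l s
    by (simp add: E_def exp_cnj exp_add[symmetric] algebra_simps)
  have "integral {a..b} (\<lambda>s. w s * cnj (w s)) =
      integral {a..b} (\<lambda>s. \<Sum>j<J. \<Sum>l<J. (cnj (A j) * A l) * exp (\<i> * of_real ((eigval j - eigval l) * s)))"
    unfolding EE[symmetric]
  proof (rule integral_cong)
    fix s
    have c: "cnj (w s) = (\<Sum>l<J. A l * cnj (E l s))" by (simp add: w_def)
    have "w s * cnj (w s) = (\<Sum>j<J. \<Sum>l<J. (cnj (A j) * E j s) * (A l * cnj (E l s)))"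
      unfolding c unfolding w_def by (rule sum_product)
    then show "w s * cnj (w s) = (\<Sum>j<J. \<Sum>l<J. (cnj (A j) * A l) * (E j s * cnj (E l s)))"
      by (simp only: mult_ac)
  qed
  also have "\<dots> = (\<Sum>j<J. integral {a..b} (\<lambda>s. \<Sum>l<J. (cnj (A j) * A l) * exp (\<i> * of_real ((eigval j - eigval l) * s))))"
    by (intro integral_sum continuous_integrable_I continuous_intros) auto
  also have "\<dots> = (\<Sum>j<J. \<Sum>l<J. (cnj (A j) * A l) * integral {a..b} (\<lambda>s. exp (\<i> * of_real ((eigval j - eigval l) * s))))"
  proof (rule sum.cong[OF refl])
    fix j
    have "integral {a..b} (\<lambda>s. \<Sum>l<J. (cnj (A j) * A l) * exp (\<i> * of_real ((eigval j - eigval l) * s)))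
      = (\<Sum>l<J. integral {a..b} (\<lambda>s. (cnj (A j) * A l) * exp (\<i> * of_real ((eigval j - eigval l) * s))))"
      by (intro integral_sum continuous_integrable_I continuous_intros) auto
    then show "integral {a..b} (\<lambda>s. \<Sum>l<J. (cnj (A j) * A l) * exp (\<i> * of_real ((eigval j - eigval l) * s)))
      = (\<Sum>l<J. (cnj (A j) * A l) * integral {a..b} (\<lambda>s. exp (\<i> * of_real ((eigval j - eigval l) * s))))"
      by (simp only: integral_mult_right)
  qed
  finally have "norm (complex_of_real ((L2_norm {a..b} w)\<^sup>2)) = norm (\<Sum>j<J. \<Sum>l<J. (cnj (A j) * A l) * integral {a..b} (\<lambda>s. exp (\<i> * of_real ((eigval j - eigval l) * s))))"
    unfolding norm_square_integral_cnj[OF wL] by simp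
  also have "\<dots> \<le> (\<Sum>j<J. \<Sum>l<J. norm (A j) * norm (A l) * \<kappa> j l)"
    by (intro sum_norm_le) (simp add: norm_mult \<kappa>_def)
  \<comment> \<open>Splitting the product into squares reduces the quadratic form to row sums and
    column sums of \<open>\<kappa>\<close>.\<close>
  also have "\<dots> \<le> (\<Sum>j<J. \<Sum>l<J. ((norm (A j))\<^sup>2 / 2 + (norm (A l))\<^sup>2 / 2) * \<kappa> j l)"
  proof (intro sum_mono mult_right_mono)
    fix j l show "norm (A j) * norm (A l) \<le> (norm (A j))\<^sup>2 / 2 + (norm (A l))\<^sup>2 / 2"
      using sum_squares_bound[of "norm (A j)" "norm (A l)"] by simp
  qed (simp add: \<kappa>_def)
  also have "\<dots> = (\<Sum>j<J. (norm (A j))\<^sup>2 / 2 * (\<Sum>l<J. \<kappa> j l)) + (\<Sum>j<J. \<Sum>l<J. (norm (A l))\<^sup>2 / 2 * \<kappa> j l)"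
    by (simp add: distrib_right sum.distrib sum_distrib_left)
  also have "(\<Sum>j<J. \<Sum>l<J. (norm (A l))\<^sup>2 / 2 * \<kappa> j l) = (\<Sum>l<J. (norm (A l))\<^sup>2 / 2 * (\<Sum>j<J. \<kappa> j l))"
    by (subst sum.swap) (simp add: sum_distrib_left)
  \<comment> \<open>Exchanging the two indices conjugates the integral, so \<open>\<kappa>\<close>
    is symmetric and column sums are row sums.\<close>
  also have "(\<Sum>l<J. (norm (A l))\<^sup>2 / 2 * (\<Sum>j<J. \<kappa> j l)) = (\<Sum>j<J. (norm (A j))\<^sup>2 / 2 * (\<Sum>l<J. \<kappa> j l))"
  proof -
    have "\<kappa> j l = \<kappa> l j" for j l
    proof -
      have "integral {a..b} (\<lambda>s. exp (\<i> * of_real ((eigval l - eigval j) * s))) = integral {a..b} (\<lambda>s. cnj (exp (\<i> * of_real ((eigval j - eigval l) * s))))"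
        by (rule integral_cong) (simp add: exp_cnj algebra_simps)
      then show ?thesis by (simp add: \<kappa>_def integral_cnj[symmetric])
    qed
    then show ?thesis by (intro sum.cong refl arg_cong2[where f="(*)"]) auto
  qed
  also have "(\<Sum>j<J. (norm (A j))\<^sup>2 / 2 * (\<Sum>l<J. \<kappa> j l)) + (\<Sum>j<J. (norm (A j))\<^sup>2 / 2 * (\<Sum>l<J. \<kappa> j l)) \<le>
      (\<Sum>j<J. (norm (A j))\<^sup>2 / 2 * S) + (\<Sum>j<J. (norm (A j))\<^sup>2 / 2 * S)"
    unfolding \<kappa>_def S_def by (intro add_mono sum_mono mult_left_mono sieve_row_sum ab) auto
  also have "\<dots> = Q * S" unfolding Q_def sum_distrib_right sum.distrib[symmetric] by (rule sum.cong) auto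
  finally have 2: "(L2_norm {a..b} w)\<^sup>2 \<le> Q * S" by (simp only: norm_of_real abs_power2)
  have "Q \<le> L2_norm {a..b} v * L2_norm {a..b} w"
    using L2_Cauchy_Schwarz_integral[OF v wL] Q0 unfolding 1 by simp
  then have "Q\<^sup>2 \<le> (L2_norm {a..b} v * L2_norm {a..b} w)\<^sup>2" using Q0 by (intro power_mono)
  also have "\<dots> \<le> (L2_norm {a..b} v)\<^sup>2 * (Q * S)"
    unfolding power_mult_distrib using 2 by (intro mult_left_mono) auto
  finally have "Q * Q \<le> Q * (S * (L2_norm {a..b} v)\<^sup>2)" by (simp add: power2_eq_square mult_ac)
  then have "Q \<le> S * (L2_norm {a..b} v)\<^sup>2"
    using Q0 S0 by (cases "Q = 0") (auto simp: mult_le_cancel_left)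
  then show ?thesis by (simp add: Q_def S_def A_def E_def)
qed

section \<open>The Duhamel formula in the eigenbasis\<close>

lemma coef_scale: "coef (\<lambda>x. c * f x) j = c * coef f j"
proof -
  have "coef (\<lambda>x. c * f x) j = integral {0..1} (\<lambda>x. c * (f x * eigfun j x))"
    by (simp add: coef_def mult.assoc)
  then show ?thesis by (simp add: coef_def)
qed

lemma coef_add:
  assumes "f absolutely_integrable_on {0..1}" "g absolutely_integrable_on {0..1}"
  shows "coef (\<lambda>x. f x + g x) j = coef f j + coef g j"
proof -
  have "(\<lambda>x. (-1) * g x) absolutely_integrable_on {0..1}"
    by (rule set_integrable_mult_right) (rule assms(2))
  from coef_diff[OF assms(1) this, of j] show ?thesis using coef_scale[of "-1" g j] by simp
qed

lemma coef_sum: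
  assumes "\<And>i. i \<in> I \<Longrightarrow> f i \<in> L2 {0..1}"
  shows "coef (\<lambda>x. \<Sum>i\<in>I. f i x) j = (\<Sum>i\<in>I. coef (f i) j)"
  using assms
proof (induction I rule: infinite_finite_induct)
  case (insert i I)
  have "coef (\<lambda>x. f i x + (\<Sum>i\<in>I. f i x)) j = coef (f i) j + coef (\<lambda>x. \<Sum>i\<in>I. f i x) j"
    using insert by (intro coef_add L2_absolutely_integrable L2_sum) auto
  then show ?case using insert by simp
qed (simp_all add: coef_def)

lemma integral_indicator_mult:
  fixes c :: complex
  assumes "A \<in> sets M" "emeasure M A < \<infinity>"
  shows "integrable M (\<lambda>s. indicator A s * c)" "(LINT s|M. indicator A s * c) = of_real (measure M A) * c"
proof -
  have eq: "(\<lambda>s. indicator A s * c) = (\<lambda>s. indicator A s *\<^sub>R c)" by (auto simp: indicator_def)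
  have i: "integrable M (indicat_real A)" using assms by simp
  show "integrable M (\<lambda>s. indicator A s * c)" unfolding eq using i by (rule integrable_scaleR_left)
  have "A \<inter> space M = A" using assms(1) by (metis sets.Int_space_eq2)
  then show "(LINT s|M. indicator A s * c) = of_real (measure M A) * c"
    unfolding eq using i by (simp add: scaleR_conv_of_real)
qed

text \<open>Taking a coefficient is linear and bounded on \<open>L^2\<close>, so it commutes with
  the approximation by simple functions. \<open>R n\<close> and \<open>S n\<close> are the images of
  the simple functions and of their integrals; both limits of \<open>S n\<close> must agree.\<close>

lemma has_L2_integral_coef:
  assumes F: "has_L2_integral (lebesgue_on {0..t}) F G"
    and k: "\<And>s. s \<in> {0..t} \<Longrightarrow> coef (F s) j = k s" and ki: "k absolutely_integrable_on {0..t}"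
  shows "coef G j = integral {0..t} k"
proof -
  let ?M = "lebesgue_on {0..t}"
  from F obtain N :: "nat \<Rightarrow> nat" and E :: "nat \<Rightarrow> nat \<Rightarrow> real set" and g :: "nat \<Rightarrow> nat \<Rightarrow> real \<Rightarrow> complex"
    where FL: "\<forall>s\<in>space ?M. F s \<in> L2 I01" and GL: "G \<in> L2 I01"
    and E: "\<forall>n. \<forall>m<N n. E n m \<in> sets ?M \<and> emeasure ?M (E n m) < \<infinity> \<and> g n m \<in> L2 I01"
    and int: "\<forall>n. integrable ?M (\<lambda>s. L2_norm I01 (\<lambda>x. F s x - (\<Sum>m<N n. indicator (E n m) s * g n m x)))"
    and lim1: "(\<lambda>n. LINT s|?M. L2_norm I01 (\<lambda>x. F s x - (\<Sum>m<N n. indicator (E n m) s * g n m x))) \<longlonglongrightarrow> 0"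
    and lim2: "(\<lambda>n. L2_norm I01 (\<lambda>x. G x - (\<Sum>m<N n. complex_of_real (measure ?M (E n m)) * g n m x))) \<longlonglongrightarrow> 0"
    unfolding has_L2_integral_def by blast
  note L2_Ioo_eq_Icc[simp]
  have gL: "g n m \<in> L2 {0..1}" if "m < N n" for n m using E that by auto
  define S where "S n = (\<Sum>m<N n. complex_of_real (measure ?M (E n m)) * coef (g n m) j)" for n
  define R where "R n s = (\<Sum>m<N n. indicator (E n m) s * coef (g n m) j)" for n s
  have Ri: "integrable ?M (R n)" for n
    unfolding R_def using E by (intro Bochner_Integration.integrable_sum integral_indicator_mult(1)) auto
  have RS: "(LINT s|?M. R n s) = S n" for n
  proof -
    have "(LINT s|?M. R n s) = (\<Sum>m<N n. LINT s|?M. indicator (E n m) s * coef (g n m) j)"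
      unfolding R_def using E by (intro Bochner_Integration.integral_sum integral_indicator_mult(1)) auto
    also have "\<dots> = S n" unfolding S_def
      using E by (intro sum.cong refl integral_indicator_mult(2)) auto
    finally show ?thesis .
  qed
  have kM: "integrable ?M k" using ki by (simp add: integrable_lebesgue_on_iff)
  have est: "norm (k s - R n s) \<le> 2 * L2_norm I01 (\<lambda>x. F s x - (\<Sum>m<N n. indicator (E n m) s * g n m x))"
    if "s \<in> {0..t}" for n s
  proof -
    have Fs: "F s \<in> L2 {0..1}" using FL that by auto
    have sL: "(\<lambda>x. \<Sum>m<N n. indicator (E n m) s * g n m x) \<in> L2 {0..1}"
      by (intro L2_sum L2_cmult gL) auto
    have "coef (\<lambda>x. F s x - (\<Sum>m<N n. indicator (E n m) s * g n m x)) j = coef (F s) j - coef (\<lambda>x. \<Sum>m<N n. indicator (E n m) s * g n m x) j"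
      by (intro coef_diff L2_absolutely_integrable Fs sL)
    also have "coef (\<lambda>x. \<Sum>m<N n. indicator (E n m) s * g n m x) j = (\<Sum>m<N n. coef (\<lambda>x. indicator (E n m) s * g n m x) j)"
      by (intro coef_sum L2_cmult gL) auto
    also have "\<dots> = R n s" by (simp add: R_def coef_scale)
    finally have "k s - R n s = coef (\<lambda>x. F s x - (\<Sum>m<N n. indicator (E n m) s * g n m x)) j"
      using k[OF that] by simp
    then show ?thesis using norm_coef_le[OF L2_diff(1)[OF Fs sL]] by simp
  qed
  have "(\<lambda>n. (LINT s|?M. k s) - S n) \<longlonglongrightarrow> 0"
  proof (rule Lim_null_comparison)
    show "(\<lambda>n. 2 * (LINT s|?M. L2_norm I01 (\<lambda>x. F s x - (\<Sum>m<N n. indicator (E n m) s * g n m x)))) \<longlonglongrightarrow> 0"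
      using tendsto_mult_right_zero[OF lim1] .
    have "norm ((LINT s|?M. k s) - S n) \<le> 2 * (LINT s|?M. L2_norm I01 (\<lambda>x. F s x - (\<Sum>m<N n. indicator (E n m) s * g n m x)))" for n
    proof -
      have "(LINT s|?M. k s) - S n = (LINT s|?M. k s - R n s)"
        unfolding RS[symmetric] by (rule Bochner_Integration.integral_diff[symmetric, OF kM Ri])
      also have "norm \<dots> \<le> (LINT s|?M. norm (k s - R n s))" by (rule integral_norm_bound)
      also have "\<dots> \<le> (LINT s|?M. 2 * L2_norm I01 (\<lambda>x. F s x - (\<Sum>m<N n. indicator (E n m) s * g n m x)))"
      proof (rule integral_mono)
        show "integrable ?M (\<lambda>s. norm (k s - R n s))"
          by (intro integrable_norm Bochner_Integration.integrable_diff kM Ri)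
        show "integrable ?M (\<lambda>s. 2 * L2_norm I01 (\<lambda>x. F s x - (\<Sum>m<N n. indicator (E n m) s * g n m x)))"
          using int by (intro integrable_mult_right) blast
      qed (use est in simp)
      also have "\<dots> = 2 * (LINT s|?M. L2_norm I01 (\<lambda>x. F s x - (\<Sum>m<N n. indicator (E n m) s * g n m x)))"
        by (rule integral_mult_right_zero)
      finally show ?thesis .
    qed
    then show "\<forall>\<^sub>F n in sequentially. norm ((LINT s|?M. k s) - S n) \<le> 2 * (LINT s|?M. L2_norm I01 (\<lambda>x. F s x - (\<Sum>m<N n. indicator (E n m) s * g n m x)))"
      by simp
  qed
  from tendsto_diff[OF tendsto_const[of "LINT s|?M. k s"] this]
  have S1: "S \<longlonglongrightarrow> (LINT s|?M. k s)" by simp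
  have "(\<lambda>n. coef (\<lambda>x. \<Sum>m<N n. complex_of_real (measure ?M (E n m)) * g n m x) j) \<longlonglongrightarrow> coef G j"
    using GL lim2 by (intro coef_L2_limit L2_sum L2_cmult gL) auto
  moreover have "coef (\<lambda>x. \<Sum>m<N n. complex_of_real (measure ?M (E n m)) * g n m x) j = S n" for n
    unfolding S_def by (subst coef_sum) (auto simp: coef_scale intro: L2_cmult gL)
  ultimately have "S \<longlonglongrightarrow> coef G j" by simp
  with S1 have "coef G j = (LINT s|?M. k s)" by (rule LIMSEQ_unique[rotated])
  then show ?thesis using LINT_Icc_eq_integral[OF ki] by simp
qed

lemma coef_cong_AE:
  assumes "AE x in lebesgue_on {0..1}. f x = g x"
  shows "coef f j = coef g j"
proof -
  have "AE x in lebesgue_on {0..1}. f x * eigfun j x = g x * eigfun j x"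
    using assms by eventually_elim simp
  then show ?thesis unfolding coef_def by (rule integral_cong_AE_lebesgue(1))
qed

lemma continuous_pairing:
  fixes \<Phi> :: "real \<Rightarrow> real \<Rightarrow> complex"
  assumes L: "\<And>t. t \<in> {0..T} \<Longrightarrow> \<Phi> t \<in> L2 {0..1}" and w: "w \<in> L2 {0..1}"
    and c: "\<And>t. t \<in> {0..T} \<Longrightarrow> ((\<lambda>s. L2_norm {0..1} (\<lambda>x. \<Phi> s x - \<Phi> t x)) \<longlongrightarrow> 0) (at t within {0..T})"
  shows "continuous_on {0..T} (\<lambda>t. integral {0..1} (\<lambda>x. \<Phi> t x * w x))"
  unfolding continuous_on
proof
  fix t assume t: "t \<in> {0..T}"
  have "((\<lambda>s. integral {0..1} (\<lambda>x. \<Phi> s x * w x) - integral {0..1} (\<lambda>x. \<Phi> t x * w x)) \<longlongrightarrow> 0) (at t within {0..T})"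
  proof (rule Lim_null_comparison)
    show "((\<lambda>s. L2_norm {0..1} (\<lambda>x. \<Phi> s x - \<Phi> t x) * L2_norm {0..1} w) \<longlongrightarrow> 0) (at t within {0..T})"
      by (rule tendsto_mult_left_zero[OF c[OF t]])
    have "norm (integral {0..1} (\<lambda>x. \<Phi> s x * w x) - integral {0..1} (\<lambda>x. \<Phi> t x * w x)) \<le>
        L2_norm {0..1} (\<lambda>x. \<Phi> s x - \<Phi> t x) * L2_norm {0..1} w" if s: "s \<in> {0..T}" for s
    proof -
      have "integral {0..1} (\<lambda>x. \<Phi> s x * w x) - integral {0..1} (\<lambda>x. \<Phi> t x * w x) = integral {0..1} (\<lambda>x. (\<Phi> s x - \<Phi> t x) * w x)"
        unfolding left_diff_distrib
        by (intro integral_diff[symmetric] abs_integrable_imp_integrable L2_mult_absolutely_integrable L s t w)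
      then show ?thesis
        using L2_Cauchy_Schwarz_integral[OF L2_diff(1)[OF L[OF s] L[OF t]] w] by simp
    qed
    then show "\<forall>\<^sub>F s in at t within {0..T}. norm (integral {0..1} (\<lambda>x. \<Phi> s x * w x) - integral {0..1} (\<lambda>x. \<Phi> t x * w x)) \<le>
        L2_norm {0..1} (\<lambda>x. \<Phi> s x - \<Phi> t x) * L2_norm {0..1} w"
      by (simp add: eventually_at_filter)
  qed
  then show "((\<lambda>t. integral {0..1} (\<lambda>x. \<Phi> t x * w x)) \<longlongrightarrow> integral {0..1} (\<lambda>x. \<Phi> t x * w x)) (at t within {0..T})"
    by (rule LIM_zero_cancel)
qed

lemma continuous_L2_norm:
  fixes \<Phi> :: "real \<Rightarrow> real \<Rightarrow> complex"
  assumes L: "\<And>t. t \<in> {0..T} \<Longrightarrow> \<Phi> t \<in> L2 {0..1}"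
    and c: "\<And>t. t \<in> {0..T} \<Longrightarrow> ((\<lambda>s. L2_norm {0..1} (\<lambda>x. \<Phi> s x - \<Phi> t x)) \<longlongrightarrow> 0) (at t within {0..T})"
  shows "continuous_on {0..T} (\<lambda>t. L2_norm {0..1} (\<Phi> t))"
  unfolding continuous_on
proof
  fix t assume t: "t \<in> {0..T}"
  have "((\<lambda>s. L2_norm {0..1} (\<Phi> s) - L2_norm {0..1} (\<Phi> t)) \<longlongrightarrow> 0) (at t within {0..T})"
  proof (rule Lim_null_comparison[OF _ c[OF t]])
    have "norm (L2_norm {0..1} (\<Phi> s) - L2_norm {0..1} (\<Phi> t)) \<le> L2_norm {0..1} (\<lambda>x. \<Phi> s x - \<Phi> t x)" if s: "s \<in> {0..T}" for s
    proof -
      have sym: "L2_norm {0..1} (\<lambda>x. \<Phi> t x - \<Phi> s x) = L2_norm {0..1} (\<lambda>x. \<Phi> s x - \<Phi> t x)"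
        by (simp add: L2_norm_def norm_minus_commute)
      have "L2_norm {0..1} (\<Phi> s) \<le> L2_norm {0..1} (\<lambda>x. \<Phi> s x - \<Phi> t x) + L2_norm {0..1} (\<Phi> t)"
        using L2_add(2)[OF L2_diff(1)[OF L[OF s] L[OF t]] L[OF t]] by simp
      moreover have "L2_norm {0..1} (\<Phi> t) \<le> L2_norm {0..1} (\<lambda>x. \<Phi> t x - \<Phi> s x) + L2_norm {0..1} (\<Phi> s)"
        using L2_add(2)[OF L2_diff(1)[OF L[OF t] L[OF s]] L[OF s]] by simp
      ultimately show ?thesis unfolding sym real_norm_def by linarith
    qed
    then show "\<forall>\<^sub>F s in at t within {0..T}. norm (L2_norm {0..1} (\<Phi> s) - L2_norm {0..1} (\<Phi> t)) \<le> L2_norm {0..1} (\<lambda>x. \<Phi> s x - \<Phi> t x)"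
      by (simp add: eventually_at_filter)
  qed
  then show "((\<lambda>t. L2_norm {0..1} (\<Phi> t)) \<longlongrightarrow> L2_norm {0..1} (\<Phi> t)) (at t within {0..T})"
    by (rule LIM_zero_cancel)
qed

text \<open>The solution stripped of choice operators and Bochner integrals: continuous
  representatives with their derivatives, continuity in time for each of the three, and the Duhamel
  formula mode by mode with initial datum \<open>eigfun 0\<close>.\<close>

locale controlled_flow =
  fixes M M1 M2 :: "real \<Rightarrow> complex" and T :: real and u :: "real \<Rightarrow> real"
    and \<Psi> \<Psi>1 \<Psi>2 :: "real \<Rightarrow> real \<Rightarrow> complex"
  assumes M: "W2 M M1 M2" and M_real: "x \<in> {0..1} \<Longrightarrow> cnj (M x) = M x"
    and T: "0 < T" "T \<le> 1"
    and u: "u \<in> L2 {0..T}" "L2_norm {0..T} u \<le> 1"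
    and \<Psi>: "t \<in> {0..T} \<Longrightarrow> W2 (\<Psi> t) (\<Psi>1 t) (\<Psi>2 t)"
    and bc: "t \<in> {0..T} \<Longrightarrow> \<Psi>1 t 0 = 0" "t \<in> {0..T} \<Longrightarrow> \<Psi>1 t 1 = 0"
    and unit: "t \<in> {0..T} \<Longrightarrow> L2_norm {0..1} (\<Psi> t) = 1"
    and cont: "t \<in> {0..T} \<Longrightarrow> ((\<lambda>s. L2_norm {0..1} (\<lambda>x. \<Psi> s x - \<Psi> t x)) \<longlongrightarrow> 0) (at t within {0..T})"
      "t \<in> {0..T} \<Longrightarrow> ((\<lambda>s. L2_norm {0..1} (\<lambda>x. \<Psi>1 s x - \<Psi>1 t x)) \<longlongrightarrow> 0) (at t within {0..T})"
      "t \<in> {0..T} \<Longrightarrow> ((\<lambda>s. L2_norm {0..1} (\<lambda>x. \<Psi>2 s x - \<Psi>2 t x)) \<longlongrightarrow> 0) (at t within {0..T})"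
    and Duhamel: "t \<in> {0..T} \<Longrightarrow> coef (\<Psi> t) j = exp (- \<i> * of_real (eigval j * t)) * coef (eigfun 0) j +
      \<i> * integral {0..t} (\<lambda>s. of_real (u s) * (exp (- \<i> * of_real (eigval j * (t - s))) * coef (\<lambda>x. M x * \<Psi> s x) j))"

lemma mild_solution_imp_controlled_flow:
  fixes \<mu> :: "real \<Rightarrow> real"
  assumes mL: "(\<lambda>x. complex_of_real (\<mu> x)) \<in> L2 I01" and W: "W2 M M1 M2"
    and ae: "AE x in lebesgue_on {0..1}. complex_of_real (\<mu> x) = M x"
    and Mr: "\<And>x. x \<in> {0..1} \<Longrightarrow> cnj (M x) = M x"
    and T: "0 < T" "T \<le> 1" and u: "u \<in> L2 {0<..<T}" "L2_norm {0<..<T} u \<le> 1"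
    and mild: "mild_solution T \<mu> u (eigfun 0) \<psi>"
  obtains \<Psi> \<Psi>1 \<Psi>2 where "controlled_flow M M1 M2 T u \<Psi> \<Psi>1 \<Psi>2"
    "\<And>t. t \<in> {0..T} \<Longrightarrow> AE x in lebesgue_on {0..1}. \<psi> t x = \<Psi> t x"
    "\<And>t. t \<in> {0..T} \<Longrightarrow> \<psi> t \<in> L2 {0..1}"
proof -
  note WM = W2D[OF W]
  \<comment> \<open>Triples, so that a single choice over \<open>t\<close> picks the representative
    together with its two derivatives.\<close>
  have "\<forall>t\<in>{0..T}. \<exists>P. W2 (fst P) (fst (snd P)) (snd (snd P)) \<and> (AE x in lebesgue_on {0..1}. \<psi> t x = fst P x)
      \<and> fst (snd P) 0 = 0 \<and> fst (snd P) 1 = 0"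
  proof
    fix t assume "t \<in> {0..T}"
    then have "\<psi> t \<in> H2N" using mild by (simp add: mild_solution_def)
    from H2N_W2[OF this] obtain F F1 F2 where "W2 F F1 F2" "AE x in lebesgue_on {0..1}. \<psi> t x = F x" "F1 0 = 0" "F1 1 = 0" .
    then show "\<exists>P. W2 (fst P) (fst (snd P)) (snd (snd P)) \<and> (AE x in lebesgue_on {0..1}. \<psi> t x = fst P x)
      \<and> fst (snd P) 0 = 0 \<and> fst (snd P) 1 = 0" by (intro exI[of _ "(F, F1, F2)"]) simp
  qed
  then obtain P where P: "\<forall>t\<in>{0..T}. W2 (fst (P t)) (fst (snd (P t))) (snd (snd (P t))) \<and> (AE x in lebesgue_on {0..1}. \<psi> t x = fst (P t) x)
      \<and> fst (snd (P t)) 0 = 0 \<and> fst (snd (P t)) 1 = 0"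
    by (rule bchoice[THEN exE])
  define \<Psi> where "\<Psi> t = fst (P t)" for t
  define \<Psi>1 where "\<Psi>1 t = fst (snd (P t))" for t
  define \<Psi>2 where "\<Psi>2 t = snd (snd (P t))" for t
  have \<Psi>: "W2 (\<Psi> t) (\<Psi>1 t) (\<Psi>2 t)" and \<psi>\<Psi>: "AE x in lebesgue_on {0..1}. \<psi> t x = \<Psi> t x"
    and bc: "\<Psi>1 t 0 = 0" "\<Psi>1 t 1 = 0" if "t \<in> {0..T}" for t
    using P that by (auto simp: \<Psi>_def \<Psi>1_def \<Psi>2_def)
  have \<psi>L: "\<psi> t \<in> L2 I01" if "t \<in> {0..T}" for t
    using mild that by (auto simp: mild_solution_def H2N_def H2_def)
  have diffW: "W2 (\<lambda>x. \<Psi> s x - \<Psi> t x) (\<lambda>x. \<Psi>1 s x - \<Psi>1 t x) (\<lambda>x. \<Psi>2 s x - \<Psi>2 t x)" if "s \<in> {0..T}" "t \<in> {0..T}" for s t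
    by (rule W2_diff[OF \<Psi>[OF that(1)] \<Psi>[OF that(2)]])
  have H2n: "H2_norm (\<lambda>x. \<psi> s x - \<psi> t x) = sqrt ((L2_norm {0..1} (\<lambda>x. \<Psi> s x - \<Psi> t x))\<^sup>2 +
      (L2_norm {0..1} (\<lambda>x. \<Psi>1 s x - \<Psi>1 t x))\<^sup>2 + (L2_norm {0..1} (\<lambda>x. \<Psi>2 s x - \<Psi>2 t x))\<^sup>2)"
    if "s \<in> {0..T}" "t \<in> {0..T}" for s t
  proof (rule H2_norm_W2[OF L2_diff(1)[OF \<psi>L[OF that(1)] \<psi>L[OF that(2)]] diffW[OF that]])
    show "AE x in lebesgue_on {0..1}. \<psi> s x - \<psi> t x = \<Psi> s x - \<Psi> t x"
      using \<psi>\<Psi>[OF that(1)] \<psi>\<Psi>[OF that(2)] by eventually_elim simp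
  qed
  have sqle: "L2_norm {0..1} (\<lambda>x. \<Psi> s x - \<Psi> t x) \<le> H2_norm (\<lambda>x. \<psi> s x - \<psi> t x)"
    "L2_norm {0..1} (\<lambda>x. \<Psi>1 s x - \<Psi>1 t x) \<le> H2_norm (\<lambda>x. \<psi> s x - \<psi> t x)"
    "L2_norm {0..1} (\<lambda>x. \<Psi>2 s x - \<Psi>2 t x) \<le> H2_norm (\<lambda>x. \<psi> s x - \<psi> t x)" if "s \<in> {0..T}" "t \<in> {0..T}" for s t
    unfolding H2n[OF that] by (auto intro!: real_le_rsqrt)
  have H2c: "((\<lambda>s. H2_norm (\<lambda>x. \<psi> s x - \<psi> t x)) \<longlongrightarrow> 0) (at t within {0..T})" if "t \<in> {0..T}" for t
    using mild that by (simp add: mild_solution_def)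
  have squeeze: "(f \<longlongrightarrow> 0) (at t within {0..T})"
    if "t \<in> {0..T}" "\<And>s. s \<in> {0..T} \<Longrightarrow> f s \<le> H2_norm (\<lambda>x. \<psi> s x - \<psi> t x)" "\<And>s. 0 \<le> f s" for f :: "real \<Rightarrow> real" and t
  proof (rule Lim_null_comparison[OF _ H2c[OF that(1)]])
    show "\<forall>\<^sub>F s in at t within {0..T}. norm (f s) \<le> H2_norm (\<lambda>x. \<psi> s x - \<psi> t x)"
      using that(2,3) by (simp add: eventually_at_filter)
  qed
  have cont: "((\<lambda>s. L2_norm {0..1} (\<lambda>x. \<Psi> s x - \<Psi> t x)) \<longlongrightarrow> 0) (at t within {0..T})"
      "((\<lambda>s. L2_norm {0..1} (\<lambda>x. \<Psi>1 s x - \<Psi>1 t x)) \<longlongrightarrow> 0) (at t within {0..T})"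
      "((\<lambda>s. L2_norm {0..1} (\<lambda>x. \<Psi>2 s x - \<Psi>2 t x)) \<longlongrightarrow> 0) (at t within {0..T})" if "t \<in> {0..T}" for t
    using that by (auto intro!: squeeze sqle)
  have unit: "L2_norm {0..1} (\<Psi> t) = 1" if t: "t \<in> {0..T}" for t
  proof -
    have "L2_norm {0..1} (\<Psi> t) = L2_norm {0..1} (\<psi> t)"
      using \<psi>L[OF t] W2D(6)[OF \<Psi>[OF t]] AE_eq_sym_trans[OF \<psi>\<Psi>[OF t], of "\<psi> t"]
      by (intro L2_norm_cong_AE L2_measurable) (auto simp: L2_Ioo_eq_Icc)
    then show ?thesis using mild t by (simp add: mild_solution_def L2_Ioo_eq_Icc)
  qed
  have e0: "W2 (eigfun 0) (eigfun' 0) (\<lambda>x. - of_real (eigval 0) * eigfun 0 x)" by (rule W2_eigfun)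
  have e0L: "eigfun 0 \<in> L2 I01" using W2D(6)[OF e0] by (simp add: L2_Ioo_eq_Icc)
  have Duhamel: "coef (\<Psi> t) j = exp (- \<i> * of_real (eigval j * t)) * coef (eigfun 0) j +
      \<i> * integral {0..t} (\<lambda>s. of_real (u s) * (exp (- \<i> * of_real (eigval j * (t - s))) * coef (\<lambda>x. M x * \<Psi> s x) j))"
    if t: "t \<in> {0..T}" for t j
  proof -
    let ?F = "\<lambda>s x. complex_of_real (u s) * exp_A (t - s) (\<lambda>y. complex_of_real (\<mu> y) * \<psi> s y) x"
    have "\<exists>G. has_L2_integral (lebesgue_on {0..t}) ?F G \<and>
        (AE x in lebesgue_on I01. \<psi> t x = exp_A t (eigfun 0) x + \<i> * G x)"
      using mild t unfolding mild_solution_def by blast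
    then obtain G where G: "has_L2_integral (lebesgue_on {0..t}) ?F G"
      and \<psi>G: "AE x in lebesgue_on I01. \<psi> t x = exp_A t (eigfun 0) x + \<i> * G x" by blast
    define k where "k s = of_real (u s) * (exp (- \<i> * of_real (eigval j * (t - s))) * coef (\<lambda>x. M x * \<Psi> s x) j)" for s
    have Fk: "coef (?F s) j = k s" if "s \<in> {0..t}" for s
    proof -
      have s: "s \<in> {0..T}" using that t by auto
      note W\<Psi> = W2_mult[OF W \<Psi>[OF s]]
      have a: "AE x in lebesgue_on {0..1}. complex_of_real (\<mu> x) * \<psi> s x = M x * \<Psi> s x"
        using ae \<psi>\<Psi>[OF s] by eventually_elim simp
      have fL: "(\<lambda>x. complex_of_real (\<mu> x) * \<psi> s x) \<in> L2 I01"
        unfolding L2_Ioo_eq_Icc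
      proof (rule L2_cong_AE[OF W2D(6)[OF W\<Psi>]])
        show "AE x in lebesgue_on {0..1}. M x * \<Psi> s x = complex_of_real (\<mu> x) * \<psi> s x"
          using a by eventually_elim simp
        show "(\<lambda>x. complex_of_real (\<mu> x) * \<psi> s x) \<in> borel_measurable (lebesgue_on {0..1})"
          using mL \<psi>L[OF s] by (intro borel_measurable_times L2_measurable) (auto simp: L2_Ioo_eq_Icc)
      qed simp
      note xA = exp_A_coef[OF fL a W\<Psi>]
      have "coef (exp_A (t - s) (\<lambda>y. complex_of_real (\<mu> y) * \<psi> s y)) j = exp (- \<i> * of_real (eigval j * (t - s))) * coef (\<lambda>x. M x * \<Psi> s x) j"
        using xA(2)[of "t - s" j] ip_eigfun[OF xA(1)[of "t - s"], of "exp_A (t - s) (\<lambda>y. complex_of_real (\<mu> y) * \<psi> s y)" j] by simp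
      then show ?thesis by (simp add: coef_scale k_def)
    qed
    have ki: "k absolutely_integrable_on {0..t}"
    proof -
      have "continuous_on {0..T} (\<lambda>s. integral {0..1} (\<lambda>x. \<Psi> s x * (M x * eigfun j x)))"
        by (rule continuous_pairing[OF W2D(6)[OF \<Psi>] _ cont(1)])
          (auto intro!: continuous_imp_L2 continuous_intros WM)
      then have c: "continuous_on {0..t} (\<lambda>s. coef (\<lambda>x. M x * \<Psi> s x) j)"
        using t unfolding coef_def by (auto simp: mult_ac intro: continuous_on_subset)
      have ui: "u absolutely_integrable_on {0..t}"
        using u(1) t by (intro abs_integrable_subinterval[OF L2_absolutely_integrable, of _ 0 T]) (auto simp: L2_Ioo_eq_Icc)
      have "(\<lambda>s. complex_of_real (u s)) absolutely_integrable_on {0..t}"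
        using absolutely_integrable_linear[OF ui bounded_linear_of_real] by (simp add: o_def)
      then have "(\<lambda>s. (exp (- \<i> * of_real (eigval j * (t - s))) * coef (\<lambda>x. M x * \<Psi> s x) j) * complex_of_real (u s)) absolutely_integrable_on {0..t}"
        by (intro abs_integrable_cont_mult continuous_intros c)
      then show ?thesis by (simp add: k_def[abs_def] mult.commute)
    qed
    have GL: "G \<in> L2 {0..1}" using G by (simp add: has_L2_integral_def L2_Ioo_eq_Icc)
    have xL: "exp_A t (eigfun 0) \<in> L2 {0..1}"
      using exp_A_coef(1)[OF e0L _ e0, where t=t] by (simp add: L2_Ioo_eq_Icc)
    have "ip (exp_A t (eigfun 0)) (eigfun j) = coef (exp_A t (eigfun 0)) j"
      by (rule ip_eigfun) (use xL in \<open>simp_all add: L2_Ioo_eq_Icc\<close>)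
    then have xj: "coef (exp_A t (eigfun 0)) j = exp (- \<i> * of_real (eigval j * t)) * coef (eigfun 0) j"
      using exp_A_coef(2)[OF e0L _ e0, where t=t and j=j] by simp
    have "AE x in lebesgue_on {0..1}. \<Psi> t x = exp_A t (eigfun 0) x + \<i> * G x"
      using \<psi>G[unfolded AE_Ioo_iff_Icc] \<psi>\<Psi>[OF t] by eventually_elim simp
    then have "coef (\<Psi> t) j = coef (\<lambda>x. exp_A t (eigfun 0) x + \<i> * G x) j" by (rule coef_cong_AE)
    also have "\<dots> = coef (exp_A t (eigfun 0)) j + \<i> * coef G j"
      by (subst coef_add) (auto intro!: L2_absolutely_integrable L2_cmult xL GL simp: coef_scale)
    also have "coef G j = integral {0..t} k" by (rule has_L2_integral_coef[OF G Fk ki])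
    finally show ?thesis unfolding xj k_def[abs_def] .
  qed
  have "controlled_flow M M1 M2 T u \<Psi> \<Psi>1 \<Psi>2"
    by unfold_locales (use W Mr T u \<Psi> bc unit cont Duhamel in \<open>auto simp: L2_Ioo_eq_Icc\<close>)
  then show ?thesis using that \<psi>\<Psi> \<psi>L by (simp add: L2_Ioo_eq_Icc)
qed

section \<open>The gauge-transformed flow\<close>

lemma norm_pairing_le:
  fixes w v :: "real \<Rightarrow> complex"
  assumes w: "w \<in> L2 {0..1}" and v: "continuous_on {0..1} v" "\<And>x. x \<in> {0..1} \<Longrightarrow> norm (v x) \<le> B" "0 \<le> B"
  shows "norm (integral {0..1} (\<lambda>x. w x * v x)) \<le> B * L2_norm {0..1} w"
proof -
  have vL: "v \<in> L2 {0..1}" by (rule continuous_imp_L2[OF v(1)])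
  have "norm (integral {0..1} (\<lambda>x. w x * v x)) \<le> L2_norm {0..1} w * L2_norm {0..1} v"
    by (rule L2_Cauchy_Schwarz_integral[OF w vL])
  also have "\<dots> \<le> L2_norm {0..1} w * B"
    using L2_norm_bound[OF vL v(2,3)] by (intro mult_left_mono) auto
  finally show ?thesis by (simp add: mult.commute)
qed

lemma continuous_bounded:
  fixes f :: "real \<Rightarrow> 'a::real_normed_vector"
  assumes "continuous_on {a..b} f"
  shows "\<exists>B\<ge>0. \<forall>x\<in>{a..b}. norm (f x) \<le> B"
proof -
  have "bounded (f ` {a..b})"
    by (intro compact_imp_bounded compact_continuous_image assms compact_Icc)
  then obtain B where "0 < B" "\<forall>y\<in>f ` {a..b}. norm y \<le> B" unfolding bounded_pos by blast
  then show ?thesis by (intro exI[of _ B]) auto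
qed

lemma pairing_limit:
  fixes w :: "real \<Rightarrow> complex" and v :: "nat \<Rightarrow> real \<Rightarrow> complex"
  assumes w: "w absolutely_integrable_on {0..1}" and v: "\<And>n. continuous_on {0..1} (v n)"
    and B: "\<And>n x. x \<in> {0..1} \<Longrightarrow> norm (v n x) \<le> B"
    and lim: "\<And>x. x \<in> {0..1} \<Longrightarrow> (\<lambda>n. v n x) \<longlonglongrightarrow> v' x"
  shows "(\<lambda>n. integral {0..1} (\<lambda>x. w x * v n x)) \<longlonglongrightarrow> integral {0..1} (\<lambda>x. w x * v' x)"
proof (rule dominated_convergence(2))
  show "(\<lambda>x. w x * v n x) integrable_on {0..1}" for n
    using abs_integrable_cont_mult[OF v w] by (simp add: mult.commute abs_integrable_imp_integrable)
  show "(\<lambda>x. B * norm (w x)) integrable_on {0..1}"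
    using w by (intro integrable_on_mult_right) (simp add: absolutely_integrable_on_def)
  show "norm (w x * v n x) \<le> B * norm (w x)" if "x \<in> {0..1}" for n x
    using mult_right_mono[OF B[OF that, of n], of "norm (w x)"] by (simp add: norm_mult mult.commute)
  show "(\<lambda>n. w x * v n x) \<longlonglongrightarrow> w x * v' x" if "x \<in> {0..1}" for x
    by (intro tendsto_intros lim that)
qed

lemma ac_power:
  fixes F :: "real \<Rightarrow> complex"
  assumes F: "ac F f a b"
  shows "ac (\<lambda>t. F t ^ k) (\<lambda>t. of_nat k * F t ^ (k - 1) * f t) a b"
proof (induction k)
  case 0
  show ?case using ac_const[of 1 a b] by simp
next
  case (Suc k)
  show ?case
    by (rule ac_cong[OF ac_mult[OF F Suc]]) (cases k; simp add: algebra_simps)+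
qed

lemma ac_exp: "ac (\<lambda>t. exp (c * complex_of_real t)) (\<lambda>t. c * exp (c * of_real t)) a b"
proof (rule ac_C1)
  show "((\<lambda>t. exp (c * complex_of_real t)) has_vector_derivative c * exp (c * of_real t)) (at t within {a..b})" for t
  proof -
    have "((\<lambda>z. exp (c * z)) has_field_derivative c * exp (c * of_real t)) (at (complex_of_real t))"
      by (auto intro!: derivative_eq_intros)
    from has_vector_derivative_real_field[OF this] show ?thesis
      by (simp add: o_def has_vector_derivative_at_within)
  qed
qed (intro continuous_intros)

definition pairing :: "(real \<Rightarrow> complex) \<Rightarrow> (real \<Rightarrow> real) \<Rightarrow> complex" where
  "pairing w \<eta> = integral {0..1} (\<lambda>x. w x * of_real (\<eta> x))"

lemma pairing_add:
  assumes "w \<in> L2 {0..1}" "continuous_on {0..1} f" "continuous_on {0..1} g"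
  shows "pairing w (\<lambda>x. f x + g x) = pairing w f + pairing w g"
proof -
  have i: "(\<lambda>x. w x * of_real (f x)) integrable_on {0..1}" if "continuous_on {0..1} f" for f
    using abs_integrable_cont_mult[OF continuous_on_of_real[OF that] L2_absolutely_integrable[OF assms(1)]]
    by (simp add: mult.commute abs_integrable_imp_integrable)
  show ?thesis using integral_add[OF i[OF assms(2)] i[OF assms(3)]] by (simp add: pairing_def distrib_left)
qed

lemma norm_pair_le:
  assumes "w \<in> L2 {0..1}" "continuous_on {0..1} \<eta>" "\<And>x. x \<in> {0..1} \<Longrightarrow> \<bar>\<eta> x\<bar> \<le> B" "0 \<le> B"
  shows "norm (pairing w \<eta>) \<le> B * L2_norm {0..1} w"
  unfolding pairing_def using assms by (intro norm_pairing_le continuous_on_of_real) auto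

section \<open>The equation tested against continuous functions\<close>

context controlled_flow
begin

lemma WM: "ac M M1 0 1" "ac M1 M2 0 1" "M2 \<in> L2 {0..1}" "continuous_on {0..1} M" "continuous_on {0..1} M1"
    "M \<in> L2 {0..1}" "M1 \<in> L2 {0..1}"
  using W2D[OF M] by auto

lemma W\<Psi>:
  assumes "t \<in> {0..T}"
  shows "ac (\<Psi> t) (\<Psi>1 t) 0 1" "ac (\<Psi>1 t) (\<Psi>2 t) 0 1" "\<Psi>2 t \<in> L2 {0..1}" "continuous_on {0..1} (\<Psi> t)"
    "continuous_on {0..1} (\<Psi>1 t)" "\<Psi> t \<in> L2 {0..1}" "\<Psi>1 t \<in> L2 {0..1}"
  using W2D[OF \<Psi>[OF assms]] by auto

definition U :: "real \<Rightarrow> real" where "U t = integral {0..t} u"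

lemma u_integrable: "u absolutely_integrable_on {0..T}" "(\<lambda>s. complex_of_real (u s)) absolutely_integrable_on {0..T}"
proof -
  show i: "u absolutely_integrable_on {0..T}" by (rule L2_absolutely_integrable[OF u(1)])
  show "(\<lambda>s. complex_of_real (u s)) absolutely_integrable_on {0..T}"
    using absolutely_integrable_linear[OF i bounded_linear_of_real] by (simp add: o_def)
qed

lemma ac_U: "ac (\<lambda>t. complex_of_real (U t)) (\<lambda>t. of_real (u t)) 0 T"
  unfolding U_def[abs_def] by (rule ac_linear[OF ac_primitive[OF u_integrable(1)] bounded_linear_of_real])

lemma U_0 [simp]: "U 0 = 0" by (simp add: U_def)

lemma continuous_U: "continuous_on {0..T} U"
  unfolding U_def[abs_def] by (rule indefinite_integral_continuous_1[OF abs_integrable_imp_integrable[OF u_integrable(1)]])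

lemma abs_U_le:
  assumes "t \<in> {0..T}"
  shows "\<bar>U t\<bar> \<le> sqrt T" "\<bar>U t\<bar> \<le> 1"
proof -
  have L: "u \<in> L2 {0..t}" "L2_norm {0..t} u \<le> L2_norm {0..T} u"
    using L2_subinterval[OF u(1), of 0 t] assms by auto
  have "\<bar>U t\<bar> \<le> sqrt (t - 0) * L2_norm {0..t} u"
    unfolding U_def real_norm_def[symmetric] by (rule L2_norm_integral_bound[OF L(1)]) (use assms in simp)
  also have "\<dots> \<le> sqrt T * 1"
    using assms L(2) u(2) by (intro mult_mono) auto
  finally show 1: "\<bar>U t\<bar> \<le> sqrt T" by simp
  also have "sqrt T \<le> 1" using T by simp
  finally show "\<bar>U t\<bar> \<le> 1" .
qed

lemma continuous_\<Psi>_pairing: "w \<in> L2 {0..1} \<Longrightarrow> continuous_on {0..T} (\<lambda>t. integral {0..1} (\<lambda>x. \<Psi> t x * w x))"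
  by (rule continuous_pairing[OF W\<Psi>(6) _ cont(1)])

lemma coef_\<Psi>2:
  assumes "t \<in> {0..T}"
  shows "coef (\<Psi>2 t) j = - of_real (eigval j) * coef (\<Psi> t) j"
  using eigval_coef[OF W\<Psi>(1)[OF assms], of j] integral_eigfun'[OF W\<Psi>(2)[OF assms], of j] bc[OF assms] by simp

lemma continuous_coef_M\<Psi>: "continuous_on {0..T} (\<lambda>t. coef (\<lambda>x. M x * \<Psi> t x) j)"
proof -
  have "continuous_on {0..T} (\<lambda>t. integral {0..1} (\<lambda>x. \<Psi> t x * (M x * eigfun j x)))"
    by (rule continuous_\<Psi>_pairing) (intro continuous_imp_L2 continuous_intros WM)
  then show ?thesis by (simp add: coef_def mult_ac)
qed

text \<open>Taking the phase out of the Duhamel integral leaves a primitive, to which the product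
  rule applies. The eigenvalue is hidden in \<open>coef (\<Psi>2 t) j\<close>, so that the identity
  is the same linear one for every mode and extends to combinations of modes.\<close>

lemma ac_coef:
  "ac (\<lambda>t. coef (\<Psi> t) j) (\<lambda>t. \<i> * coef (\<Psi>2 t) j + \<i> * of_real (u t) * coef (\<lambda>x. M x * \<Psi> t x) j) 0 T"
proof -
  define E where "E t = exp ((- \<i> * of_real (eigval j)) * complex_of_real t)" for t
  define v where "v s = (exp (\<i> * of_real (eigval j * s)) * coef (\<lambda>x. M x * \<Psi> s x) j) * complex_of_real (u s)" for s
  have vi: "v absolutely_integrable_on {0..T}"
    unfolding v_def[abs_def] by (intro abs_integrable_cont_mult continuous_intros continuous_coef_M\<Psi> u_integrable)
  have V: "ac (\<lambda>t. coef (eigfun 0) j + \<i> * integral {0..t} v) (\<lambda>t. 0 + \<i> * v t) 0 T"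
    by (intro ac_add ac_const ac_cmult ac_primitive vi)
  have cV: "coef (\<Psi> t) j = E t * (coef (eigfun 0) j + \<i> * integral {0..t} v)" if t: "t \<in> {0..T}" for t
  proof -
    have "integral {0..t} (\<lambda>s. of_real (u s) * (exp (- \<i> * of_real (eigval j * (t - s))) * coef (\<lambda>x. M x * \<Psi> s x) j))
        = integral {0..t} (\<lambda>s. E t * v s)"
    proof (rule integral_cong)
      fix s
      have "exp (- \<i> * complex_of_real (eigval j * (t - s))) = E t * exp (\<i> * of_real (eigval j * s))"
        unfolding E_def exp_add[symmetric] by (simp add: algebra_simps)
      then show "of_real (u s) * (exp (- \<i> * of_real (eigval j * (t - s))) * coef (\<lambda>x. M x * \<Psi> s x) j) = E t * v s"
        unfolding v_def by (simp only: mult_ac)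
    qed
    then have "integral {0..t} (\<lambda>s. of_real (u s) * (exp (- \<i> * of_real (eigval j * (t - s))) * coef (\<lambda>x. M x * \<Psi> s x) j))
        = E t * integral {0..t} v" by simp
    then show ?thesis
      using Duhamel[OF t, of j] by (simp add: E_def algebra_simps)
  qed
  have acE: "ac E (\<lambda>t. (- \<i> * of_real (eigval j)) * E t) 0 T"
    unfolding E_def[abs_def] by (rule ac_exp)
  show ?thesis
  proof (rule ac_cong[OF ac_mult[OF acE V]])
    fix t assume t: "t \<in> {0..T}"
    show "E t * (coef (eigfun 0) j + \<i> * integral {0..t} v) = coef (\<Psi> t) j" by (rule cV[OF t, symmetric])
    have "E t * exp (\<i> * of_real (eigval j * t)) = 1"
      unfolding E_def exp_add[symmetric] by simp
    then have Ev: "E t * v t = of_real (u t) * coef (\<lambda>x. M x * \<Psi> t x) j"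
      unfolding v_def by (metis (no_types, lifting) mult.assoc mult.commute mult_1)
    have "(- \<i> * of_real (eigval j)) * E t * (coef (eigfun 0) j + \<i> * integral {0..t} v) + E t * (0 + \<i> * v t)
      = (- \<i> * of_real (eigval j)) * coef (\<Psi> t) j + \<i> * (E t * v t)"
      unfolding cV[OF t] by (simp add: algebra_simps)
    also have "\<dots> = \<i> * coef (\<Psi>2 t) j + \<i> * of_real (u t) * coef (\<lambda>x. M x * \<Psi> t x) j"
      unfolding coef_\<Psi>2[OF t] Ev by (simp add: algebra_simps)
    finally show "(- \<i> * of_real (eigval j)) * E t * (coef (eigfun 0) j + \<i> * integral {0..t} v) + E t * (0 + \<i> * v t)
      = \<i> * coef (\<Psi>2 t) j + \<i> * of_real (u t) * coef (\<lambda>x. M x * \<Psi> t x) j" .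
  qed
qed

lemma L2_M\<Psi>: "t \<in> {0..T} \<Longrightarrow> (\<lambda>x. M x * \<Psi> t x) \<in> L2 {0..1}"
  by (intro L2_mult_continuous W\<Psi>(6) WM(4))

lemma ac_pair_cos_poly:
  "\<eta> \<in> cos_polys \<Longrightarrow> ac (\<lambda>t. pairing (\<Psi> t) \<eta>) (\<lambda>t. \<i> * pairing (\<Psi>2 t) \<eta> + \<i> * of_real (u t) * pairing (\<lambda>x. M x * \<Psi> t x) \<eta>) 0 T"
proof (induction rule: cos_polys.induct)
  case (base a j)
  define c where "c = (if j = 0 then complex_of_real a else complex_of_real (a / sqrt 2))"
  have e: "complex_of_real (a * cos (real j * pi * x)) = c * eigfun j x" for x
    by (simp add: c_def eigfun_def)
  have p: "pairing w (\<lambda>x. a * cos (real j * pi * x)) = c * coef w j" for w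
    unfolding pairing_def e coef_def by (simp only: mult.left_commute[of _ c] integral_mult_right)
  show ?case
    by (rule ac_cong[OF ac_cmult[OF ac_coef, of c j]]) (simp_all only: p, simp_all only: distrib_left mult_ac)
next
  case (add f g)
  show ?case
    by (rule ac_cong[OF ac_add[OF add.IH]])
      (simp_all add: pairing_add W\<Psi> L2_M\<Psi> cos_polys_continuous add.hyps algebra_simps)
qed

text \<open>These bounds depend on the solution and serve as dominating constants when limits are
  taken; estimates uniform in the control come with \<open>bounded_flow\<close>.\<close>

lemma flow_bounds:
  obtains K where "0 \<le> K" "\<And>x. x \<in> {0..1} \<Longrightarrow> norm (M x) \<le> K"
    "\<And>t. t \<in> {0..T} \<Longrightarrow> L2_norm {0..1} (\<Psi>2 t) \<le> K"
    "\<And>t. t \<in> {0..T} \<Longrightarrow> L2_norm {0..1} (\<lambda>x. M x * \<Psi> t x) \<le> K"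
proof -
  obtain A where A: "0 \<le> A" "\<And>x. x \<in> {0..1} \<Longrightarrow> norm (M x) \<le> A"
    using continuous_bounded[OF WM(4)] by blast
  obtain B where B: "0 \<le> B" "\<And>t. t \<in> {0..T} \<Longrightarrow> norm (L2_norm {0..1} (\<Psi>2 t)) \<le> B"
    using continuous_bounded[OF continuous_L2_norm[OF W\<Psi>(3) cont(3)]] by blast
  have "L2_norm {0..1} (\<lambda>x. M x * \<Psi> t x) \<le> A" if t: "t \<in> {0..T}" for t
    using L2_bounded_mult(2)[OF W\<Psi>(6)[OF t] L2_measurable[OF WM(6)] A(2) A(1)] unit[OF t] by simp
  then have 1: "L2_norm {0..1} (\<lambda>x. M x * \<Psi> t x) \<le> max A B" if "t \<in> {0..T}" for t
    using that by (auto simp: le_max_iff_disj)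
  have 2: "norm (M x) \<le> max A B" if "x \<in> {0..1}" for x using A(2)[OF that] by simp
  have 3: "L2_norm {0..1} (\<Psi>2 t) \<le> max A B" if "t \<in> {0..T}" for t using B(2)[OF that] by simp
  show ?thesis by (rule that[OF _ 2 3 1]) (simp_all add: A(1) le_max_iff_disj)
qed

text \<open>Uniform approximation of \<open>\<eta>\<close> by cosine polynomials. The freedom in
  \<open>\<eta>\<close> matters for the gauge, whose expansion tests the equation with
  \<open>m^k \<eta>\<close>.\<close>

lemma ac_pair:
  assumes \<eta>: "continuous_on {0..1} \<eta>"
  shows "ac (\<lambda>t. pairing (\<Psi> t) \<eta>) (\<lambda>t. \<i> * pairing (\<Psi>2 t) \<eta> + \<i> * of_real (u t) * pairing (\<lambda>x. M x * \<Psi> t x) \<eta>) 0 T"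
proof -
  obtain K where K: "0 \<le> K" "\<And>x. x \<in> {0..1} \<Longrightarrow> norm (M x) \<le> K"
    "\<And>t. t \<in> {0..T} \<Longrightarrow> L2_norm {0..1} (\<Psi>2 t) \<le> K"
    "\<And>t. t \<in> {0..T} \<Longrightarrow> L2_norm {0..1} (\<lambda>x. M x * \<Psi> t x) \<le> K"
    using flow_bounds by blast
  obtain X where X: "0 \<le> X" "\<And>x. x \<in> {0..1} \<Longrightarrow> norm (\<eta> x) \<le> X"
    using continuous_bounded[OF \<eta>] by blast
  have "\<exists>g. g \<in> cos_polys \<and> (\<forall>x\<in>{0..1}. \<bar>\<eta> x - g x\<bar> < inverse (real (Suc n)))" for n
    using cos_polys_dense[OF \<eta>, of "inverse (real (Suc n))"] by (metis inverse_positive_iff_positive of_nat_0_less_iff zero_less_Suc)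
  then obtain g where g: "\<And>n. g n \<in> cos_polys" "\<And>n x. x \<in> {0..1} \<Longrightarrow> \<bar>\<eta> x - g n x\<bar> < inverse (real (Suc n))"
    by metis
  have gc: "continuous_on {0..1} (g n)" for n by (rule cos_polys_continuous[OF g(1)])
  have gb: "\<bar>g n x\<bar> \<le> X + 1" if "x \<in> {0..1}" for n x
  proof -
    have "inverse (real (Suc n)) \<le> 1" by (simp add: inverse_le_1_iff)
    then show ?thesis using g(2)[OF that, of n] X(2)[OF that] unfolding real_norm_def by linarith
  qed
  have glim: "(\<lambda>n. complex_of_real (g n x)) \<longlonglongrightarrow> of_real (\<eta> x)" if "x \<in> {0..1}" for x
  proof (rule tendsto_of_real)
    have "(\<lambda>n. g n x - \<eta> x) \<longlonglongrightarrow> 0"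
      by (rule Lim_null_comparison[OF _ LIMSEQ_inverse_real_of_nat])
        (use g(2)[OF that] in \<open>auto simp: abs_minus_commute less_imp_le\<close>)
    then show "(\<lambda>n. g n x) \<longlonglongrightarrow> \<eta> x" by (rule LIM_zero_cancel)
  qed
  have plim: "(\<lambda>n. pairing w (g n)) \<longlonglongrightarrow> pairing w \<eta>" if "w \<in> L2 {0..1}" for w
    unfolding pairing_def
    by (rule pairing_limit[OF L2_absolutely_integrable[OF that], of _ "X + 1"])
      (use gb gc glim in \<open>auto intro: continuous_on_of_real\<close>)
  show ?thesis
  proof (rule ac_limit[OF ac_pair_cos_poly[OF g(1)]])
    show "(\<lambda>t. (X + 1) * K + (X + 1) * K * norm (u t)) integrable_on {0..T}"
      using u_integrable(1) by (intro integrable_add integrable_on_mult_right)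
        (auto intro!: continuous_integrable_I simp: absolutely_integrable_on_def)
    fix n t assume t: "t \<in> {0..T}"
    have "norm (pairing (\<Psi>2 t) (g n)) \<le> (X + 1) * L2_norm {0..1} (\<Psi>2 t)"
      using X(1) gb by (intro norm_pair_le W\<Psi> t gc) auto
    also have "\<dots> \<le> (X + 1) * K" using X(1) K(3)[OF t] by (intro mult_left_mono) auto
    finally have 1: "norm (pairing (\<Psi>2 t) (g n)) \<le> (X + 1) * K" .
    have "norm (pairing (\<lambda>x. M x * \<Psi> t x) (g n)) \<le> (X + 1) * L2_norm {0..1} (\<lambda>x. M x * \<Psi> t x)"
      using X(1) gb by (intro norm_pair_le L2_M\<Psi> t gc) auto
    also have "\<dots> \<le> (X + 1) * K" using X(1) K(4)[OF t] by (intro mult_left_mono) auto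
    finally have 2: "norm (pairing (\<lambda>x. M x * \<Psi> t x) (g n)) \<le> (X + 1) * K" .
    have "norm (\<i> * pairing (\<Psi>2 t) (g n) + \<i> * of_real (u t) * pairing (\<lambda>x. M x * \<Psi> t x) (g n))
      \<le> norm (\<i> * pairing (\<Psi>2 t) (g n)) + norm (\<i> * of_real (u t) * pairing (\<lambda>x. M x * \<Psi> t x) (g n))"
      by (rule norm_triangle_ineq)
    also have "\<dots> \<le> (X + 1) * K + norm (u t) * ((X + 1) * K)"
      using 1 2 by (auto simp: norm_mult intro!: add_mono mult_left_mono)
    finally show "norm (\<i> * pairing (\<Psi>2 t) (g n) + \<i> * of_real (u t) * pairing (\<lambda>x. M x * \<Psi> t x) (g n))
      \<le> (X + 1) * K + (X + 1) * K * norm (u t)" by (simp add: mult_ac)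
  next
    fix t assume t: "t \<in> {0..T}"
    show "(\<lambda>n. pairing (\<Psi> t) (g n)) \<longlonglongrightarrow> pairing (\<Psi> t) \<eta>" by (rule plim[OF W\<Psi>(6)[OF t]])
    show "(\<lambda>n. \<i> * pairing (\<Psi>2 t) (g n) + \<i> * of_real (u t) * pairing (\<lambda>x. M x * \<Psi> t x) (g n))
      \<longlonglongrightarrow> \<i> * pairing (\<Psi>2 t) \<eta> + \<i> * of_real (u t) * pairing (\<lambda>x. M x * \<Psi> t x) \<eta>"
      by (intro tendsto_intros plim W\<Psi>(3)[OF t] L2_M\<Psi>[OF t])
  qed
qed

end

lemma exp_pairing_tendsto:
  fixes w :: "real \<Rightarrow> complex"
  assumes w: "w \<in> L2 {0..1}" and m: "continuous_on {0..1} m" and \<eta>: "continuous_on {0..1} \<eta>"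
  shows "(\<lambda>n. \<Sum>k<n. c ^ k / fact k * pairing w (\<lambda>x. m x ^ k * \<eta> x)) \<longlonglongrightarrow>
    integral {0..1} (\<lambda>x. w x * (exp (c * of_real (m x)) * of_real (\<eta> x)))"
proof -
  obtain K where K: "0 \<le> K" "\<And>x. x \<in> {0..1} \<Longrightarrow> norm (m x) \<le> K"
    using continuous_bounded[OF m] by blast
  obtain X where X: "0 \<le> X" "\<And>x. x \<in> {0..1} \<Longrightarrow> norm (\<eta> x) \<le> X"
    using continuous_bounded[OF \<eta>] by blast
  define v where "v n x = (\<Sum>k<n. c ^ k / fact k * of_real (m x ^ k * \<eta> x))" for n x
  have vc: "continuous_on {0..1} (v n)" for n
    unfolding v_def[abs_def] by (intro continuous_intros m \<eta>) auto
  have wi: "w absolutely_integrable_on {0..1}" by (rule L2_absolutely_integrable[OF w])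
  have v_eq: "v n x = (\<Sum>k<n. (c * of_real (m x)) ^ k /\<^sub>R fact k) * of_real (\<eta> x)" for n x
    unfolding v_def sum_distrib_right
    by (intro sum.cong refl) (simp add: power_mult_distrib scaleR_conv_of_real divide_inverse)
  have lim: "(\<lambda>n. integral {0..1} (\<lambda>x. w x * v n x)) \<longlonglongrightarrow> integral {0..1} (\<lambda>x. w x * (exp (c * of_real (m x)) * of_real (\<eta> x)))"
  proof (rule pairing_limit[OF wi vc])
    show "norm (v n x) \<le> exp (norm c * K) * X" if "x \<in> {0..1}" for n x
    proof -
      have "norm (\<Sum>k<n. (c * of_real (m x)) ^ k /\<^sub>R fact k) \<le> (\<Sum>k<n. (norm c * K) ^ k /\<^sub>R fact k)"
      proof (rule sum_norm_le)
        fix k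
        have "norm (c * of_real (m x)) ^ k \<le> (norm c * K) ^ k"
          using K(2)[OF that] by (intro power_mono) (auto simp: norm_mult mult_left_mono)
        then show "norm ((c * of_real (m x)) ^ k /\<^sub>R fact k) \<le> (norm c * K) ^ k /\<^sub>R fact k"
          by (simp add: norm_power divide_inverse mult_left_mono)
      qed
      also have "\<dots> \<le> (\<Sum>k. (norm c * K) ^ k /\<^sub>R fact k)"
        using K(1) by (intro sum_le_suminf summable_exp_generic) auto
      also have "\<dots> = exp (norm c * K)" by (simp add: exp_def)
      finally show ?thesis
        unfolding v_eq norm_mult using X(2)[OF that] by (intro mult_mono) auto
    qed
    show "(\<lambda>n. v n x) \<longlonglongrightarrow> exp (c * of_real (m x)) * of_real (\<eta> x)" for x
      unfolding v_eq using exp_converges[of "c * complex_of_real (m x)"]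
      by (intro tendsto_mult tendsto_const) (simp add: sums_def)
  qed
  have "integral {0..1} (\<lambda>x. w x * v n x) = (\<Sum>k<n. c ^ k / fact k * pairing w (\<lambda>x. m x ^ k * \<eta> x))" for n
  proof -
    have i: "(\<lambda>x. w x * of_real (m x ^ k * \<eta> x)) integrable_on {0..1}" for k
    proof -
      have "continuous_on {0..1} (\<lambda>x. complex_of_real (m x ^ k * \<eta> x))" by (intro continuous_intros m \<eta>)
      from abs_integrable_cont_mult[OF this wi] show ?thesis
        by (simp only: mult.commute abs_integrable_imp_integrable)
    qed
    have "integral {0..1} (\<lambda>x. w x * v n x) = integral {0..1} (\<lambda>x. \<Sum>k<n. c ^ k / fact k * (w x * of_real (m x ^ k * \<eta> x)))"
      unfolding v_def sum_distrib_left by (simp only: mult.left_commute)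
    also have "\<dots> = (\<Sum>k<n. integral {0..1} (\<lambda>x. c ^ k / fact k * (w x * of_real (m x ^ k * \<eta> x))))"
      by (intro integral_sum integrable_on_mult_right i) auto
    also have "\<dots> = (\<Sum>k<n. c ^ k / fact k * pairing w (\<lambda>x. m x ^ k * \<eta> x))"
      by (simp only: integral_mult_right pairing_def)
    finally show ?thesis .
  qed
  with lim show ?thesis by simp
qed

context controlled_flow
begin

definition gauge :: "real \<Rightarrow> real \<Rightarrow> complex" where
  "gauge t x = exp (- \<i> * of_real (U t) * M x)"

lemma M_eq_Re: "x \<in> {0..1} \<Longrightarrow> M x = of_real (Re (M x))"
  using M_real[of x] by (simp add: complex_eq_iff)

text \<open>The power series of the exponential reduces the differentiation in time of
  \<open>\<langle>e\<^sup>-\<^sup>i\<^sup>U\<^sup>M \<Psi>, \<eta>\<rangle>\<close> to pairings with fixed functions; the terms containing \<open>u\<close> telescope.\<close>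

lemma ac_gauge:
  assumes \<eta>: "continuous_on {0..1} \<eta>"
  shows "ac (\<lambda>t. integral {0..1} (\<lambda>x. \<Psi> t x * (gauge t x * of_real (\<eta> x))))
    (\<lambda>t. \<i> * integral {0..1} (\<lambda>x. \<Psi>2 t x * (gauge t x * of_real (\<eta> x)))) 0 T"
proof -
  define m where "m x = Re (M x)" for x
  have m: "continuous_on {0..1} m" unfolding m_def[abs_def] by (intro continuous_intros WM)
  obtain K where K: "0 \<le> K" "\<And>x. x \<in> {0..1} \<Longrightarrow> norm (m x) \<le> K"
    using continuous_bounded[OF m] by blast
  obtain X where X: "0 \<le> X" "\<And>x. x \<in> {0..1} \<Longrightarrow> norm (\<eta> x) \<le> X"
    using continuous_bounded[OF \<eta>] by blast
  obtain B where B: "0 \<le> B" "\<And>t. t \<in> {0..T} \<Longrightarrow> L2_norm {0..1} (\<Psi>2 t) \<le> B"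
    by (rule flow_bounds) (rule that)
  define e where "e k x = m x ^ k * \<eta> x" for k x
  have ec: "continuous_on {0..1} (e k)" for k unfolding e_def[abs_def] by (intro continuous_intros m \<eta>)
  have eb: "\<bar>e k x\<bar> \<le> K ^ k * X" if "x \<in> {0..1}" for k x
    unfolding e_def abs_mult power_abs using K X that by (intro mult_mono power_mono) auto
  define P where "P k t = pairing (\<Psi> t) (e k)" for k t
  define Q where "Q k t = pairing (\<Psi>2 t) (e k)" for k t
  define a where "a k t = (- \<i> * complex_of_real (U t)) ^ k / fact k" for k t
  \<comment> \<open>Multiplication by the potential raises the power of \<open>m\<close> by one:
    this shift lets the terms with \<open>u\<close> telescope.\<close>
  have MP: "pairing (\<lambda>x. M x * \<Psi> t x) (e k) = P (Suc k) t" for k t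
    unfolding P_def pairing_def
  proof (rule integral_cong)
    fix x :: real assume "x \<in> {0..1}"
    then have "M x = of_real (m x)" using M_eq_Re by (simp add: m_def)
    then show "M x * \<Psi> t x * complex_of_real (e k x) = \<Psi> t x * complex_of_real (e (Suc k) x)"
      by (simp add: e_def)
  qed
  have acP: "ac (P k) (\<lambda>t. \<i> * Q k t + \<i> * of_real (u t) * P (Suc k) t) 0 T" for k
    using ac_pair[OF ec[of k]] unfolding MP P_def[symmetric] Q_def[symmetric] .
  \<comment> \<open>The derivative of the \<open>k\<close>-th term of the exponential series is the
    previous term times \<open>- \<i> u\<close>; the zeroth term is constant.\<close>
  define a' where "a' k t = (if k = 0 then 0 else - \<i> * of_real (u t) * a (k - 1) t)" for k t
  have aca: "ac (a k) (a' k) 0 T" for k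
  proof -
    have "ac (\<lambda>t. - \<i> * complex_of_real (U t)) (\<lambda>t. - \<i> * of_real (u t)) 0 T" by (rule ac_cmult[OF ac_U])
    from ac_cmult[OF ac_power[OF this, of k], of "1 / fact k"] show ?thesis
      by (rule ac_cong) (auto simp: a_def a'_def fact_reduce[of k] divide_inverse)
  qed
  define F where "F n t = (\<Sum>k<Suc n. a k t * P k t)" for n t
  \<comment> \<open>After telescoping, one term with \<open>u\<close> is left at the upper end of
    the partial sum; the factorial in \<open>a n\<close> sends it to 0.\<close>
  define f where "f n t = \<i> * (\<Sum>k<Suc n. a k t * Q k t) + \<i> * of_real (u t) * a n t * P (Suc n) t" for n t
  have acF: "ac (F n) (f n) 0 T" for n
  proof -
    have "ac (F n) (\<lambda>t. \<Sum>k<Suc n. a' k t * P k t + a k t * (\<i> * Q k t + \<i> * of_real (u t) * P (Suc k) t)) 0 T"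
      unfolding F_def[abs_def] by (intro ac_sum ac_mult aca acP) auto
    moreover have "(\<Sum>k<Suc n. a' k t * P k t + a k t * (\<i> * Q k t + \<i> * of_real (u t) * P (Suc k) t)) = f n t" for t
    proof (induction n)
      case 0
      show ?case by (simp add: f_def a'_def algebra_simps)
    next
      case (Suc n)
      have "a' (Suc n) t * P (Suc n) t = - (\<i> * of_real (u t) * a n t * P (Suc n) t)" by (simp add: a'_def)
      then show ?case using Suc by (simp add: f_def algebra_simps)
    qed
    ultimately show ?thesis by simp
  qed
  have ab: "norm (a k t) \<le> 1 / fact k" if "t \<in> {0..T}" for k t
    using power_le_one[of "\<bar>U t\<bar>" k] abs_U_le(2)[OF that]
    by (simp add: a_def norm_divide norm_power norm_mult divide_right_mono)
  have Qb: "norm (Q k t) \<le> K ^ k * (X * B)" if t: "t \<in> {0..T}" for k t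
  proof -
    have "norm (Q k t) \<le> (K ^ k * X) * L2_norm {0..1} (\<Psi>2 t)"
      unfolding Q_def using K X by (intro norm_pair_le W\<Psi>(3) t ec eb) auto
    also have "\<dots> \<le> (K ^ k * X) * B" using K X B(2)[OF t] by (intro mult_left_mono) auto
    finally show ?thesis by (simp add: mult.assoc)
  qed
  have Pb: "norm (P k t) \<le> K ^ k * X" if t: "t \<in> {0..T}" for k t
    unfolding P_def using K X norm_pair_le[OF W\<Psi>(6)[OF t] ec eb, of k] unit[OF t] by simp
  have aP: "norm (a n t * P (Suc n) t) \<le> (K ^ n / fact n) * (K * X)" if t: "t \<in> {0..T}" for n t
  proof -
    have "norm (a n t) * norm (P (Suc n) t) \<le> (1 / fact n) * (K ^ Suc n * X)"
      by (intro mult_mono ab[OF t] Pb[OF t]) auto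
    then show ?thesis by (simp add: norm_mult mult_ac)
  qed
  have Kfact: "K ^ n / fact n \<le> exp K" for n
    using power_le_fact_exp[OF K(1), of n] by (simp add: field_simps)
  have Qsum: "norm (\<Sum>k<n. a k t * Q k t) \<le> exp K * (X * B)" if t: "t \<in> {0..T}" for n t
  proof -
    have "norm (\<Sum>k<n. a k t * Q k t) \<le> (\<Sum>k<n. (K ^ k /\<^sub>R fact k) * (X * B))"
    proof (rule sum_norm_le)
      fix k
      have "norm (a k t) * norm (Q k t) \<le> (1 / fact k) * (K ^ k * (X * B))"
        by (intro mult_mono ab[OF t] Qb[OF t]) auto
      then show "norm (a k t * Q k t) \<le> (K ^ k /\<^sub>R fact k) * (X * B)"
        by (simp add: norm_mult divide_inverse mult_ac)
    qed
    also have "\<dots> = (\<Sum>k<n. K ^ k /\<^sub>R fact k) * (X * B)" by (rule sum_distrib_right[symmetric])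
    also have "\<dots> \<le> exp K * (X * B)"
      unfolding exp_def using K X B(1) by (intro mult_right_mono sum_le_suminf summable_exp_generic) auto
    finally show ?thesis .
  qed
  have explim: "(\<lambda>n. \<Sum>k<Suc n. a k t * pairing w (e k)) \<longlonglongrightarrow> integral {0..1} (\<lambda>x. w x * (gauge t x * of_real (\<eta> x)))"
    if "w \<in> L2 {0..1}" for w t
  proof -
    have "(\<lambda>n. \<Sum>k<n. a k t * pairing w (e k)) \<longlonglongrightarrow>
        integral {0..1} (\<lambda>x. w x * (exp ((- \<i> * of_real (U t)) * of_real (m x)) * of_real (\<eta> x)))"
      unfolding a_def e_def[abs_def] by (rule exp_pairing_tendsto[OF that m \<eta>])
    also have "integral {0..1} (\<lambda>x. w x * (exp ((- \<i> * of_real (U t)) * of_real (m x)) * of_real (\<eta> x))) =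
        integral {0..1} (\<lambda>x. w x * (gauge t x * of_real (\<eta> x)))"
      by (rule integral_cong) (simp add: gauge_def m_def M_eq_Re[symmetric])
    finally show ?thesis by (rule LIMSEQ_Suc)
  qed
  show ?thesis
  proof (rule ac_limit[OF acF])
    show "(\<lambda>t. exp K * (X * B) + (exp K * (K * X)) * norm (u t)) integrable_on {0..T}"
      using u_integrable(1) by (intro integrable_add integrable_on_mult_right)
        (auto intro!: continuous_integrable_I simp: absolutely_integrable_on_def)
    fix n t assume t: "t \<in> {0..T}"
    have "norm (f n t) \<le> norm (\<i> * (\<Sum>k<Suc n. a k t * Q k t)) + norm (\<i> * of_real (u t) * a n t * P (Suc n) t)"
      unfolding f_def by (rule norm_triangle_ineq)
    also have "\<dots> = norm (\<Sum>k<Suc n. a k t * Q k t) + norm (u t) * norm (a n t * P (Suc n) t)"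
      by (simp only: norm_mult norm_ii norm_of_real mult_1 mult.assoc real_norm_def)
    also have "\<dots> \<le> exp K * (X * B) + norm (u t) * (exp K * (K * X))"
    proof (intro add_mono Qsum t mult_left_mono)
      show "norm (a n t * P (Suc n) t) \<le> exp K * (K * X)"
        using aP[OF t, of n] Kfact[of n] K X by (smt (verit) mult_nonneg_nonneg mult_right_mono)
    qed simp
    finally show "norm (f n t) \<le> exp K * (X * B) + (exp K * (K * X)) * norm (u t)" by (simp add: mult_ac)
  next
    fix t assume t: "t \<in> {0..T}"
    show "(\<lambda>n. F n t) \<longlonglongrightarrow> integral {0..1} (\<lambda>x. \<Psi> t x * (gauge t x * of_real (\<eta> x)))"
      unfolding F_def P_def by (rule explim[OF W\<Psi>(6)[OF t]])
    have "(\<lambda>n. a n t * P (Suc n) t) \<longlonglongrightarrow> 0"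
    proof (rule Lim_null_comparison)
      have "(\<lambda>n. K ^ n /\<^sub>R fact n) \<longlonglongrightarrow> 0"
        by (rule summable_LIMSEQ_zero[OF summable_exp_generic])
      then have "(\<lambda>n. K ^ n / fact n) \<longlonglongrightarrow> 0" by (simp add: divide_inverse mult.commute)
      from tendsto_mult_left_zero[OF this] show "(\<lambda>n. (K ^ n / fact n) * (K * X)) \<longlonglongrightarrow> 0" .
      show "\<forall>\<^sub>F n in sequentially. norm (a n t * P (Suc n) t) \<le> (K ^ n / fact n) * (K * X)"
        by (intro always_eventually allI aP t)
    qed
    then have "(\<lambda>n. \<i> * (\<Sum>k<Suc n. a k t * Q k t) + \<i> * of_real (u t) * (a n t * P (Suc n) t)) \<longlonglongrightarrow>
        \<i> * integral {0..1} (\<lambda>x. \<Psi>2 t x * (gauge t x * of_real (\<eta> x))) + \<i> * of_real (u t) * 0"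
      unfolding Q_def by (intro tendsto_intros explim W\<Psi>(3)[OF t])
    then show "(\<lambda>n. f n t) \<longlonglongrightarrow> \<i> * integral {0..1} (\<lambda>x. \<Psi>2 t x * (gauge t x * of_real (\<eta> x)))"
      by (simp add: f_def mult.assoc)
  qed
qed

end

section \<open>The source terms of the gauge-transformed modes\<close>

context controlled_flow
begin

definition G :: "real \<Rightarrow> real \<Rightarrow> complex" where
  "G t x = gauge t x * \<Psi> t x"

text \<open>The space derivative of \<open>G t\<close>. At the two ends \<open>\<Psi>1\<close>
  vanishes and \<open>- \<i> U M1 G\<close> remains: the gauge destroys the Neumann condition, which
  is the origin of all boundary terms below.\<close>

definition G1 :: "real \<Rightarrow> real \<Rightarrow> complex" where
  "G1 t x = gauge t x * (\<Psi>1 t x - \<i> * of_real (U t) * M1 x * \<Psi> t x)"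

lemma W2_gauge: "\<exists>g2. W2 (gauge t) (\<lambda>x. - \<i> * of_real (U t) * M1 x * gauge t x) g2"
  using W2_exp[OF M, of "- \<i> * of_real (U t)"] unfolding gauge_def[abs_def] by blast

lemma continuous_gauge: "continuous_on {0..1} (gauge t)"
  using W2_gauge W2D(4) by blast

lemma W2_G:
  assumes t: "t \<in> {0..T}"
  obtains G2 where "W2 (G t) (G1 t) G2"
proof -
  obtain g2 where g2: "W2 (gauge t) (\<lambda>x. - \<i> * of_real (U t) * M1 x * gauge t x) g2" using W2_gauge by blast
  have "(\<lambda>x. gauge t x * \<Psi> t x) = G t" by (simp add: G_def[abs_def])
  moreover have "(\<lambda>x. (- \<i> * of_real (U t) * M1 x * gauge t x) * \<Psi> t x + gauge t x * \<Psi>1 t x) = G1 t"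
    by (auto simp: G1_def[abs_def] algebra_simps)
  ultimately show ?thesis using that W2_mult[OF g2 \<Psi>[OF t]] by simp
qed

text \<open>The second derivative never enters an estimate; \<open>SOME\<close> gives it a name, so
  that the lemma can be composed with expansion results.\<close>

lemma W2_G1:
  assumes t: "t \<in> {0..T}"
  shows "W2 (\<lambda>x. G t x - 1) (G1 t) (SOME G2. W2 (G t) (G1 t) G2)"
proof -
  have "\<exists>G2. W2 (G t) (G1 t) G2" by (rule W2_G[OF t]) blast
  then have "W2 (G t) (G1 t) (SOME G2. W2 (G t) (G1 t) G2)" by (rule someI_ex)
  from W2_diff[OF this W2_const[of 1]] show ?thesis by simp
qed

lemma WG:
  assumes "t \<in> {0..T}"
  shows "ac (G t) (G1 t) 0 1" "continuous_on {0..1} (G t)" "continuous_on {0..1} (G1 t)"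
    "G t \<in> L2 {0..1}" "G1 t \<in> L2 {0..1}"
proof -
  obtain G2 where W: "W2 (G t) (G1 t) G2" by (rule W2_G[OF assms])
  show "ac (G t) (G1 t) 0 1" "continuous_on {0..1} (G t)" "continuous_on {0..1} (G1 t)"
    "G t \<in> L2 {0..1}" "G1 t \<in> L2 {0..1}" by (rule W2D[OF W])+
qed

definition z :: "nat \<Rightarrow> real \<Rightarrow> complex" where
  "z j t = coef (\<lambda>x. G t x - 1) j"

lemma z_eq: "t \<in> {0..T} \<Longrightarrow> z j t = coef (G t) j - coef (\<lambda>_. 1) j"
  unfolding z_def
  by (rule coef_diff[OF L2_absolutely_integrable[OF WG(4)] absolutely_integrable_continuous_real]) simp_all

lemma coef_one: "coef (\<lambda>_. 1) j = (if j = 0 then 1 else 0)"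
proof -
  have "eigfun 0 = (\<lambda>_. 1)" by (simp add: eigfun_def[abs_def])
  then show ?thesis using coef_eigfun[of 0 j] by (cases j) simp_all
qed

text \<open>The source in the equation \<open>c' = - \<i> \<lambda>_j c + q j\<close> for
  \<open>c = coef (G t) j\<close>: a term with one explicit factor \<open>U\<close> and one with
  \<open>U^2\<close>, the control itself being absent.\<close>

definition q :: "nat \<Rightarrow> real \<Rightarrow> complex" where
  "q j t = of_real (U t) * integral {0..1} (\<lambda>x. M1 x * (G t x * eigfun' j x - G1 t x * eigfun j x))
    - \<i> * (of_real (U t))\<^sup>2 * integral {0..1} (\<lambda>x. M1 x * M1 x * G t x * eigfun j x)"

text \<open>One integration by parts in space, whose boundary terms vanish by the Neumann condition
  on \<open>\<Psi>\<close>; then \<open>\<Psi>1 * gauge = G1 + \<i> U M1 G\<close> expresses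
  everything through \<open>G\<close>.\<close>

lemma gauge_rhs:
  assumes t: "t \<in> {0..T}"
  shows "\<i> * integral {0..1} (\<lambda>x. \<Psi>2 t x * (gauge t x * eigfun j x)) = - \<i> * of_real (eigval j) * coef (G t) j + q j t"
proof -
  let ?U = "complex_of_real (U t)"
  note c = WG[OF t] W\<Psi>(4,5)[OF t] WM(4,5) continuous_gauge
  obtain g2 where g2: "W2 (gauge t) (\<lambda>x. - \<i> * ?U * M1 x * gauge t x) g2" using W2_gauge by blast
  have e: "ac (\<lambda>x. gauge t x * eigfun j x) (\<lambda>x. (- \<i> * ?U * M1 x * gauge t x) * eigfun j x + gauge t x * eigfun' j x) 0 1"
    by (rule ac_mult[OF W2D(1)[OF g2] ac_eigfun])
  have "integral {0..1} (\<lambda>x. \<Psi>2 t x * (gauge t x * eigfun j x)) =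
      - integral {0..1} (\<lambda>x. \<Psi>1 t x * ((- \<i> * ?U * M1 x * gauge t x) * eigfun j x + gauge t x * eigfun' j x))"
    using ac_by_parts[OF W\<Psi>(2)[OF t] e] bc[OF t] by simp
  also have "integral {0..1} (\<lambda>x. \<Psi>1 t x * ((- \<i> * ?U * M1 x * gauge t x) * eigfun j x + gauge t x * eigfun' j x)) =
      integral {0..1} (\<lambda>x. G1 t x * eigfun' j x + (\<i> * ?U) * (M1 x * (G t x * eigfun' j x - G1 t x * eigfun j x)) +
        ?U\<^sup>2 * (M1 x * M1 x * G t x * eigfun j x))"
  proof (rule integral_cong)
    fix x
    have "\<Psi>1 t x * gauge t x = G1 t x + \<i> * ?U * M1 x * G t x" by (simp add: G1_def G_def algebra_simps)
    moreover have "\<Psi>1 t x * ((- \<i> * ?U * M1 x * gauge t x) * eigfun j x + gauge t x * eigfun' j x)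
        = (\<Psi>1 t x * gauge t x) * (eigfun' j x - \<i> * ?U * M1 x * eigfun j x)"
      by (simp add: algebra_simps)
    ultimately have "\<Psi>1 t x * ((- \<i> * ?U * M1 x * gauge t x) * eigfun j x + gauge t x * eigfun' j x)
        = (G1 t x + \<i> * ?U * M1 x * G t x) * (eigfun' j x - \<i> * ?U * M1 x * eigfun j x)"
      by simp
    also have "\<dots> = G1 t x * eigfun' j x + (\<i> * ?U) * (M1 x * (G t x * eigfun' j x - G1 t x * eigfun j x)) +
        ?U\<^sup>2 * (M1 x * M1 x * G t x * eigfun j x)"
      by (simp add: power2_eq_square algebra_simps)
    finally show "\<Psi>1 t x * ((- \<i> * ?U * M1 x * gauge t x) * eigfun j x + gauge t x * eigfun' j x) =
        G1 t x * eigfun' j x + (\<i> * ?U) * (M1 x * (G t x * eigfun' j x - G1 t x * eigfun j x)) +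
        ?U\<^sup>2 * (M1 x * M1 x * G t x * eigfun j x)" .
  qed
  also have "\<dots> = integral {0..1} (\<lambda>x. G1 t x * eigfun' j x) +
      (\<i> * ?U) * integral {0..1} (\<lambda>x. M1 x * (G t x * eigfun' j x - G1 t x * eigfun j x)) +
      ?U\<^sup>2 * integral {0..1} (\<lambda>x. M1 x * M1 x * G t x * eigfun j x)"
  proof -
    have i: "(\<lambda>x. G1 t x * eigfun' j x) integrable_on {0..1}"
      "(\<lambda>x. (\<i> * ?U) * (M1 x * (G t x * eigfun' j x - G1 t x * eigfun j x))) integrable_on {0..1}"
      "(\<lambda>x. ?U\<^sup>2 * (M1 x * M1 x * G t x * eigfun j x)) integrable_on {0..1}"
      by (intro continuous_integrable_I continuous_intros c)+
    show ?thesis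
      by (simp only: integral_add[OF integrable_add[OF i(1,2)] i(3)] integral_add[OF i(1,2)] integral_mult_right)
  qed
  also have "integral {0..1} (\<lambda>x. G1 t x * eigfun' j x) = of_real (eigval j) * coef (G t) j"
    by (rule eigval_coef[OF WG(1)[OF t], symmetric])
  finally have eq: "integral {0..1} (\<lambda>x. \<Psi>2 t x * (gauge t x * eigfun j x)) = - (of_real (eigval j) * coef (G t) j +
      (\<i> * ?U) * integral {0..1} (\<lambda>x. M1 x * (G t x * eigfun' j x - G1 t x * eigfun j x)) +
      ?U\<^sup>2 * integral {0..1} (\<lambda>x. M1 x * M1 x * G t x * eigfun j x))" .
  show ?thesis unfolding eq q_def by (simp add: algebra_simps)
qed

lemma ac_coef_G: "ac (\<lambda>t. coef (G t) j) (\<lambda>t. - \<i> * of_real (eigval j) * coef (G t) j + q j t) 0 T"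
proof -
  define \<eta> where "\<eta> x = (if j = 0 then 1 else sqrt 2 * cos (real j * pi * x))" for x
  have e: "complex_of_real (\<eta> x) = eigfun j x" for x by (simp add: \<eta>_def eigfun_of_real)
  have "continuous_on {0..1} \<eta>" unfolding \<eta>_def[abs_def] by (cases "j = 0") (auto intro!: continuous_intros)
  from ac_gauge[OF this] show ?thesis
  proof (rule ac_cong)
    show "integral {0..1} (\<lambda>x. \<Psi> t x * (gauge t x * complex_of_real (\<eta> x))) = coef (G t) j" for t
      unfolding e coef_def G_def by (simp only: mult_ac)
    show "\<i> * integral {0..1} (\<lambda>x. \<Psi>2 t x * (gauge t x * complex_of_real (\<eta> x))) =
      - \<i> * of_real (eigval j) * coef (G t) j + q j t" if "t \<in> {0..T}" for t
      unfolding e by (rule gauge_rhs[OF that])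
  qed
qed

text \<open>Integrability in time is read off from the equation: \<open>q j\<close> is the density
  of an absolutely continuous function minus a continuous one. A study of \<open>G1\<close> as a
  function of time is thereby avoided.\<close>

lemma q_integrable: "q j absolutely_integrable_on {0..T}"
proof -
  have a: "(\<lambda>t. - \<i> * of_real (eigval j) * coef (G t) j) absolutely_integrable_on {0..T}"
    by (intro absolutely_integrable_continuous_real continuous_intros ac_continuous[OF ac_coef_G])
  have "(\<lambda>t. (- \<i> * of_real (eigval j) * coef (G t) j + q j t) - (- \<i> * of_real (eigval j) * coef (G t) j)) absolutely_integrable_on {0..T}"
    by (rule set_integral_diff(1)[OF ac_absolutely_integrable[OF ac_coef_G] a])
  then show ?thesis by simp
qed

text \<open>Variation of constants; \<open>z j 0 = 0\<close> because \<open>U 0 = 0\<close> and the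
  initial state is the constant 1.\<close>

lemma z_formula:
  assumes t: "t \<in> {0..T}"
  shows "z j t = exp (- \<i> * of_real (eigval j * t)) * integral {0..t} (\<lambda>s. exp (\<i> * of_real (eigval j * s)) * q j s)"
proof -
  define E where "E t = exp ((\<i> * of_real (eigval j)) * complex_of_real t)" for t
  \<comment> \<open>Subtracting 1 from \<open>G\<close> leaves the equation unchanged, because the
    constant function occupies the mode with eigenvalue 0.\<close>
  have lam1: "of_real (eigval j) * coef (\<lambda>_. 1) j = 0" by (simp add: coef_one)
  have acz: "ac (z j) (\<lambda>t. - \<i> * of_real (eigval j) * z j t + q j t) 0 T"
  proof (rule ac_cong[OF ac_diff[OF ac_coef_G[of j] ac_const[of "coef (\<lambda>_. 1) j"]]])
    fix t assume t: "t \<in> {0..T}"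
    show "coef (G t) j - coef (\<lambda>_. 1) j = z j t" by (rule z_eq[OF t, symmetric])
    show "- \<i> * of_real (eigval j) * coef (G t) j + q j t - 0 = - \<i> * of_real (eigval j) * z j t + q j t"
      unfolding z_eq[OF t] right_diff_distrib using lam1 by (simp add: mult.assoc)
  qed
  have acE: "ac E (\<lambda>t. (\<i> * of_real (eigval j)) * E t) 0 T" unfolding E_def[abs_def] by (rule ac_exp)
  have "ac (\<lambda>t. E t * z j t) (\<lambda>t. E t * q j t) 0 T"
    by (rule ac_cong[OF ac_mult[OF acE acz]]) (simp_all add: algebra_simps)
  from ac_eq[OF this t] have 1: "E t * z j t = E 0 * z j 0 + integral {0..t} (\<lambda>s. E s * q j s)" .
  have "z j 0 = coef (\<Psi> 0) j - coef (\<lambda>_. 1) j"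
    using z_eq[of 0 j] T by (simp add: G_def[abs_def] gauge_def)
  also have "coef (\<Psi> 0) j = coef (eigfun 0) j" using Duhamel[of 0 j] T by simp
  finally have z0: "z j 0 = 0" by (simp add: eigfun_def[abs_def])
  have "z j t = exp (- \<i> * of_real (eigval j * t)) * (E t * z j t)"
    unfolding mult.assoc[symmetric] E_def exp_add[symmetric] by (simp add: algebra_simps)
  then show ?thesis unfolding 1 z0 by (simp add: E_def mult.assoc)
qed

text \<open>Here the derivative is moved away from \<open>eigfun' j\<close>, which grows with
  \<open>j\<close>. The price is boundary values; the gain is a form with bounds uniform in
  \<open>j\<close>.\<close>

lemma q_boundary_form:
  assumes t: "t \<in> {0..T}"
  shows "integral {0..1} (\<lambda>x. M1 x * (G t x * eigfun' j x - G1 t x * eigfun j x)) =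
    M1 1 * G t 1 * eigfun j 1 - M1 0 * G t 0 * eigfun j 0 - coef (\<lambda>x. G t x * M2 x + 2 * M1 x * G1 t x) j"
proof -
  note c = WG[OF t] WM(4,5)
  have mg: "ac (\<lambda>x. M1 x * G t x) (\<lambda>x. M2 x * G t x + M1 x * G1 t x) 0 1" by (rule ac_mult[OF WM(2) WG(1)[OF t]])
  have i: "(\<lambda>x. M1 x * G t x * eigfun' j x) integrable_on {0..1}" "(\<lambda>x. M1 x * G1 t x * eigfun j x) integrable_on {0..1}"
    by (intro continuous_integrable_I continuous_intros c)+
  have a: "(\<lambda>x. M2 x * G t x + M1 x * G1 t x) absolutely_integrable_on {0..1}" by (rule ac_absolutely_integrable[OF mg])
  have b: "(\<lambda>x. M1 x * G1 t x) absolutely_integrable_on {0..1}"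
    by (intro absolutely_integrable_continuous_real continuous_intros c)
  have "integral {0..1} (\<lambda>x. M1 x * (G t x * eigfun' j x - G1 t x * eigfun j x))
     = integral {0..1} (\<lambda>x. M1 x * G t x * eigfun' j x) - integral {0..1} (\<lambda>x. M1 x * G1 t x * eigfun j x)"
    by (simp only: right_diff_distrib mult.assoc[symmetric] integral_diff[OF i])
  also have "integral {0..1} (\<lambda>x. M1 x * G t x * eigfun' j x) = M1 1 * G t 1 * eigfun j 1 - M1 0 * G t 0 * eigfun j 0 - coef (\<lambda>x. M2 x * G t x + M1 x * G1 t x) j"
    by (rule integral_eigfun'[OF mg])
  also have "integral {0..1} (\<lambda>x. M1 x * G1 t x * eigfun j x) = coef (\<lambda>x. M1 x * G1 t x) j" by (simp add: coef_def)
  also have "M1 1 * G t 1 * eigfun j 1 - M1 0 * G t 0 * eigfun j 0 - coef (\<lambda>x. M2 x * G t x + M1 x * G1 t x) j - coef (\<lambda>x. M1 x * G1 t x) j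
    = M1 1 * G t 1 * eigfun j 1 - M1 0 * G t 0 * eigfun j 0 - coef (\<lambda>x. (M2 x * G t x + M1 x * G1 t x) + M1 x * G1 t x) j"
    by (simp only: coef_add[OF a b]) simp
  finally show ?thesis by (simp add: algebra_simps)
qed

text \<open>The factor of \<open>U\<close> in the source, with the derivative moved away from
  \<open>f\<close> instead: for the fixed mode \<open>k\<close> the size of \<open>eigfun' k\<close>
  is harmless, and the functional sees only values of \<open>f\<close>, including those at the
  ends.\<close>

definition \<beta> :: "nat \<Rightarrow> (real \<Rightarrow> complex) \<Rightarrow> complex" where
  "\<beta> k f = integral {0..1} (\<lambda>x. f x * (2 * M1 x * eigfun' k x + M2 x * eigfun k x))
    - f 1 * (M1 1 * eigfun k 1) + f 0 * (M1 0 * eigfun k 0)"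

lemma \<beta>_weight: "(\<lambda>x. 2 * M1 x * eigfun' k x + M2 x * eigfun k x) \<in> L2 {0..1}"
proof (rule L2_add(1))
  show "(\<lambda>x. 2 * M1 x * eigfun' k x) \<in> L2 {0..1}" by (intro continuous_imp_L2 continuous_intros WM)
  show "(\<lambda>x. M2 x * eigfun k x) \<in> L2 {0..1}"
    using L2_mult_continuous[OF WM(3) continuous_on_eigfun] by (simp add: mult.commute)
qed

lemma \<beta>_eq:
  assumes f: "ac f f1 0 1" and f1: "continuous_on {0..1} f1"
  shows "integral {0..1} (\<lambda>x. M1 x * (f x * eigfun' k x - f1 x * eigfun k x)) = \<beta> k f"
proof -
  note c = ac_continuous[OF f] f1 WM(4,5)
  have me: "ac (\<lambda>x. M1 x * eigfun k x) (\<lambda>x. M2 x * eigfun k x + M1 x * eigfun' k x) 0 1"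
    by (rule ac_mult[OF WM(2) ac_eigfun])
  have i: "(\<lambda>x. f x * (M1 x * eigfun' k x)) integrable_on {0..1}" "(\<lambda>x. f1 x * (M1 x * eigfun k x)) integrable_on {0..1}"
    by (intro continuous_integrable_I continuous_intros c)+
  have i3: "(\<lambda>x. f x * (M2 x * eigfun k x + M1 x * eigfun' k x)) integrable_on {0..1}"
    by (intro abs_integrable_imp_integrable abs_integrable_cont_mult ac_absolutely_integrable[OF me] c)
  have "integral {0..1} (\<lambda>x. M1 x * (f x * eigfun' k x - f1 x * eigfun k x)) =
      integral {0..1} (\<lambda>x. f x * (M1 x * eigfun' k x) - f1 x * (M1 x * eigfun k x))"
    by (rule integral_cong) (simp add: algebra_simps)
  also have "\<dots> = integral {0..1} (\<lambda>x. f x * (M1 x * eigfun' k x)) - integral {0..1} (\<lambda>x. f1 x * (M1 x * eigfun k x))"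
    by (rule integral_diff[OF i])
  also have "integral {0..1} (\<lambda>x. f1 x * (M1 x * eigfun k x)) =
     f 1 * (M1 1 * eigfun k 1) - f 0 * (M1 0 * eigfun k 0) - integral {0..1} (\<lambda>x. f x * (M2 x * eigfun k x + M1 x * eigfun' k x))"
    by (rule ac_by_parts[OF f me]) simp
  also have "integral {0..1} (\<lambda>x. f x * (M1 x * eigfun' k x)) -
     (f 1 * (M1 1 * eigfun k 1) - f 0 * (M1 0 * eigfun k 0) - integral {0..1} (\<lambda>x. f x * (M2 x * eigfun k x + M1 x * eigfun' k x)))
     = integral {0..1} (\<lambda>x. f x * (M1 x * eigfun' k x) + f x * (M2 x * eigfun k x + M1 x * eigfun' k x))
      - f 1 * (M1 1 * eigfun k 1) + f 0 * (M1 0 * eigfun k 0)"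
    by (simp add: integral_add[OF i(1) i3])
  also have "integral {0..1} (\<lambda>x. f x * (M1 x * eigfun' k x) + f x * (M2 x * eigfun k x + M1 x * eigfun' k x)) =
      integral {0..1} (\<lambda>x. f x * (2 * M1 x * eigfun' k x + M2 x * eigfun k x))"
    by (rule integral_cong) (simp add: algebra_simps)
  finally show ?thesis by (simp add: \<beta>_def)
qed

text \<open>For the constant 1 the integral in \<open>\<beta>_eq\<close> is that of
  \<open>M1 * eigfun' k\<close>, that is \<open>\<lambda>_k coef M k\<close>.\<close>

lemma \<beta>_one: "coef M k = 0 \<Longrightarrow> \<beta> k (\<lambda>_. 1) = 0"
  using \<beta>_eq[OF ac_const[of 1], of k] eigval_coef[OF WM(1), of k] by simp

lemma \<beta>_diff:
  assumes "continuous_on {0..1} f" "continuous_on {0..1} g"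
  shows "\<beta> k (\<lambda>x. f x - g x) = \<beta> k f - \<beta> k g"
proof -
  have i: "(\<lambda>x. f x * (2 * M1 x * eigfun' k x + M2 x * eigfun k x)) integrable_on {0..1}" if "continuous_on {0..1} f" for f
    by (intro abs_integrable_imp_integrable abs_integrable_cont_mult that L2_absolutely_integrable[OF \<beta>_weight])
  show ?thesis unfolding \<beta>_def left_diff_distrib integral_diff[OF i[OF assms(1)] i[OF assms(2)]] by (simp add: algebra_simps)
qed

text \<open>The integral part is expanded by termwise pairing, the boundary values by the pointwise
  convergence of the cosine series at the two ends.\<close>

lemma \<beta>_expansion:
  assumes f: "W2 f f1 f2"
  shows "(\<lambda>j. coef f j * \<beta> k (eigfun j)) sums \<beta> k f"
proof -
  define w where "w x = 2 * M1 x * eigfun' k x + M2 x * eigfun k x" for x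
  have wi: "w absolutely_integrable_on {0..1}" unfolding w_def[abs_def] by (rule L2_absolutely_integrable[OF \<beta>_weight])
  have cw: "coef w j = integral {0..1} (\<lambda>x. eigfun j x * w x)" for j
    unfolding coef_def by (rule integral_cong) (rule mult.commute)
  have "(\<lambda>j. coef f j * coef w j - coef f j * eigfun j 1 * (M1 1 * eigfun k 1) + coef f j * eigfun j 0 * (M1 0 * eigfun k 0)) sums
    (integral {0..1} (\<lambda>x. f x * w x) - f 1 * (M1 1 * eigfun k 1) + f 0 * (M1 0 * eigfun k 0))"
    by (intro sums_add sums_diff sums_mult2 W2_pairing[OF f wi] W2_expansion[OF f]) auto
  then show ?thesis unfolding \<beta>_def w_def[symmetric] cw[symmetric] by (simp add: algebra_simps)
qed

end

section \<open>Bounds that are uniform in the control\<close>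

lemma norm_exp_i_minus_1: "norm (exp (\<i> * of_real \<theta>) - 1) \<le> \<bar>\<theta>\<bar>"
proof -
  have "exp (\<i> * complex_of_real \<theta>) - 1 = integral {0..1} (\<lambda>s. (\<i> * of_real \<theta>) * exp ((\<i> * of_real \<theta>) * complex_of_real s))"
    using ac_eq[OF ac_exp[of "\<i> * of_real \<theta>" 0 1], of 1] by simp
  also have "norm \<dots> \<le> integral {0..1} (\<lambda>s::real. \<bar>\<theta>\<bar>)"
  proof (rule Henstock_Kurzweil_Integration.integral_norm_bound_integral)
    show "norm ((\<i> * of_real \<theta>) * exp ((\<i> * of_real \<theta>) * complex_of_real s)) \<le> \<bar>\<theta>\<bar>" for s
      using norm_exp_i_times[of "\<theta> * s"] by (simp add: norm_mult mult.assoc)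
  qed (intro continuous_integrable_I continuous_intros)+
  finally show ?thesis by simp
qed

lemma norm_exp_i_minus_linear: "norm (exp (\<i> * of_real \<theta>) - 1 - \<i> * of_real \<theta>) \<le> \<theta>\<^sup>2"
proof -
  let ?c = "\<i> * complex_of_real \<theta>"
  have i: "(\<lambda>s. ?c * exp (?c * complex_of_real s)) integrable_on {0..1}" "(\<lambda>s::real. ?c) integrable_on {0..1}"
    by (intro continuous_integrable_I continuous_intros)+
  have "exp ?c - 1 - ?c = integral {0..1} (\<lambda>s. ?c * exp (?c * complex_of_real s)) - integral {0..1} (\<lambda>s::real. ?c)"
    using ac_eq[OF ac_exp[of ?c 0 1], of 1] by simp
  also have "\<dots> = integral {0..1} (\<lambda>s. ?c * exp (?c * complex_of_real s) - ?c)"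
    by (rule integral_diff[OF i, symmetric])
  also have "norm \<dots> \<le> integral {0..1} (\<lambda>s::real. \<theta>\<^sup>2)"
  proof (rule Henstock_Kurzweil_Integration.integral_norm_bound_integral)
    fix s :: real assume s: "s \<in> {0..1}"
    have "?c * exp (?c * complex_of_real s) - ?c = ?c * (exp (\<i> * of_real (\<theta> * s)) - 1)"
      by (simp add: algebra_simps)
    then have "norm (?c * exp (?c * complex_of_real s) - ?c) = \<bar>\<theta>\<bar> * norm (exp (\<i> * of_real (\<theta> * s)) - 1)"
      by (simp add: norm_mult)
    also have "\<dots> \<le> \<bar>\<theta>\<bar> * \<bar>\<theta> * s\<bar>" by (intro mult_left_mono norm_exp_i_minus_1) simp
    also have "\<dots> \<le> \<bar>\<theta>\<bar> * \<bar>\<theta>\<bar>" using s by (intro mult_left_mono) (auto simp: abs_mult mult_left_le)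
    finally show "norm (?c * exp (?c * complex_of_real s) - ?c) \<le> \<theta>\<^sup>2" by (simp add: power2_eq_square)
  qed (intro integrable_diff[OF i] continuous_integrable_I continuous_intros)+
  finally show ?thesis by simp
qed

text \<open>\<open>coef f 0\<close> is the mean of \<open>f\<close>, and the oscillation of
  \<open>f\<close> is at most the \<open>L^1\<close> norm of \<open>f1\<close>.\<close>

lemma ac_near_mean:
  fixes f f1 :: "real \<Rightarrow> complex"
  assumes f: "ac f f1 0 1" and f1: "f1 \<in> L2 {0..1}" and x: "x \<in> {0..1}"
  shows "norm (f x - coef f 0) \<le> L2_norm {0..1} f1"
proof -
  have i: "f1 integrable_on {a..b}" "(\<lambda>x. norm (f1 x)) integrable_on {a..b}" if "0 \<le> a" "b \<le> 1" for a b
    using abs_integrable_subinterval[OF L2_absolutely_integrable[OF f1] that] by (auto simp: absolutely_integrable_on_def)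
  have osc': "norm (f y - f x) \<le> L2_norm {0..1} f1" if "0 \<le> x" "x \<le> y" "y \<le> 1" for x y
  proof -
    have "f y - f x = integral {x..y} f1" by (rule ac_diff_eq[OF f that])
    also have "norm \<dots> \<le> integral {x..y} (\<lambda>s. norm (f1 s))"
      using that by (intro Henstock_Kurzweil_Integration.integral_norm_bound_integral i) auto
    also have "\<dots> \<le> integral {0..1} (\<lambda>s. norm (f1 s))"
      using that by (intro integral_subset_le i) auto
    also have "\<dots> \<le> L2_norm {0..1} f1"
      using L2_norm_integral_norm_bound[OF f1] by simp
    finally show ?thesis .
  qed
  have osc: "norm (f x - f y) \<le> L2_norm {0..1} f1" if y: "y \<in> {0..1}" for y
  proof (cases "x \<le> y")
    case True
    then show ?thesis using osc'[of x y] x y by (simp add: norm_minus_commute)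
  next
    case False
    then show ?thesis using osc'[of y x] x y by simp
  qed
  have c: "continuous_on {0..1} f" by (rule ac_continuous[OF f])
  have "coef f 0 = integral {0..1} f" by (simp add: coef_def eigfun_def)
  then have "f x - coef f 0 = integral {0..1} (\<lambda>y::real. f x) - integral {0..1} (\<lambda>y. f y)" by simp
  also have "\<dots> = integral {0..1} (\<lambda>y. f x - f y)"
    by (intro integral_diff[symmetric] continuous_integrable_I continuous_intros c)
  also have "norm \<dots> \<le> integral {0..1} (\<lambda>y::real. L2_norm {0..1} f1)"
    by (intro Henstock_Kurzweil_Integration.integral_norm_bound_integral continuous_integrable_I continuous_intros c osc)
  finally show ?thesis by simp
qed

text \<open>\<open>K\<close> is shared by all controls, so every estimate in this locale is uniform
  in \<open>u\<close> and in the solution. \<open>1 \<le> K\<close> lets lower powers of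
  \<open>K\<close> be absorbed into higher ones, and the smallness of \<open>K sqrt T\<close> closes
  the energy estimate.\<close>

locale bounded_flow = controlled_flow +
  fixes K :: real
  assumes K: "1 \<le> K" "x \<in> {0..1} \<Longrightarrow> norm (M x) \<le> K" "x \<in> {0..1} \<Longrightarrow> norm (M1 x) \<le> K" "L2_norm {0..1} M2 \<le> K"
    and small: "K * sqrt T \<le> 1 / 2"
begin

lemma K0: "0 \<le> K" using K(1) by simp

text \<open>Cauchy-Schwarz in time: the control has norm at most 1 and the phases have modulus
  1.\<close>

lemma Duhamel_bound:
  assumes t: "t \<in> {0..T}"
  shows "(norm (integral {0..t} (\<lambda>s. of_real (u s) * (exp (- \<i> * of_real (eigval j * (t - s))) * coef (\<lambda>x. M x * \<Psi> s x) j))))\<^sup>2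
    \<le> integral {0..t} (\<lambda>s. (norm (coef (\<lambda>x. M x * \<Psi> s x) j))\<^sup>2)"
proof -
  have uL: "u \<in> L2 {0..t}" "L2_norm {0..t} u \<le> 1"
    using L2_subinterval[OF u(1), of 0 t] u(2) t by auto
  have uC: "(\<lambda>s. complex_of_real (u s)) \<in> L2 {0..t}" "L2_norm {0..t} (\<lambda>s. complex_of_real (u s)) \<le> 1"
    using uL by (auto simp: L2_def L2_norm_def)
  have c: "continuous_on {0..t} (\<lambda>s. coef (\<lambda>x. M x * \<Psi> s x) j)"
    using continuous_on_subset[OF continuous_coef_M\<Psi>] t by auto
  let ?v = "\<lambda>s. exp (- \<i> * of_real (eigval j * (t - s))) * coef (\<lambda>x. M x * \<Psi> s x) j"
  have vL: "?v \<in> L2 {0..t}" by (intro continuous_imp_L2 continuous_intros c)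
  have nv: "norm (?v s) = norm (coef (\<lambda>x. M x * \<Psi> s x) j)" for s
    using norm_exp_i_times[of "- eigval j * (t - s)"] by (simp add: norm_mult)
  have "norm (integral {0..t} (\<lambda>s. of_real (u s) * ?v s)) \<le> L2_norm {0..t} (\<lambda>s. complex_of_real (u s)) * L2_norm {0..t} ?v"
    by (rule L2_Cauchy_Schwarz_integral[OF uC(1) vL])
  also have "\<dots> \<le> 1 * L2_norm {0..t} ?v" by (intro mult_right_mono uC(2)) simp
  finally have "(norm (integral {0..t} (\<lambda>s. of_real (u s) * ?v s)))\<^sup>2 \<le> (L2_norm {0..t} ?v)\<^sup>2"
    by (intro power_mono) auto
  also have "\<dots> = integral {0..t} (\<lambda>s. (norm (coef (\<lambda>x. M x * \<Psi> s x) j))\<^sup>2)"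
    unfolding L2_norm_square_integral(2)[OF vL] nv ..
  finally show ?thesis .
qed

text \<open>\<open>Duhamel_bound\<close> times \<open>\<lambda>_j\<close>, summed over the modes.
  The initial datum sits in mode 0 and drops out. On the left stands Parseval for
  \<open>\<Psi>1\<close>; on the right Bessel is used, as \<open>M \<Psi>\<close> need not satisfy
  the Neumann condition.\<close>

lemma energy_bound:
  assumes S: "\<And>s. s \<in> {0..T} \<Longrightarrow> L2_norm {0..1} (\<Psi>1 s) \<le> S" and t: "t \<in> {0..T}"
  shows "(L2_norm {0..1} (\<Psi>1 t))\<^sup>2 \<le> T * (K * (1 + S))\<^sup>2"
proof -
  let ?d = "\<lambda>s j. coef (\<lambda>x. M x * \<Psi> s x) j"
  have mode: "eigval j * (norm (coef (\<Psi> t) j))\<^sup>2 \<le> integral {0..t} (\<lambda>s. eigval j * (norm (?d s j))\<^sup>2)" for j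
  proof (cases "j = 0")
    case False
    have "coef (eigfun 0) j = 0" using False by (simp add: coef_eigfun)
    then have "norm (coef (\<Psi> t) j) = norm (integral {0..t} (\<lambda>s. of_real (u s) * (exp (- \<i> * of_real (eigval j * (t - s))) * ?d s j)))"
      using Duhamel[OF t, of j] by (simp add: norm_mult)
    then have "eigval j * (norm (coef (\<Psi> t) j))\<^sup>2 \<le> eigval j * integral {0..t} (\<lambda>s. (norm (?d s j))\<^sup>2)"
      using Duhamel_bound[OF t, of j] by (intro mult_left_mono) auto
    then show ?thesis by simp
  qed simp
  have c: "continuous_on {0..t} (\<lambda>s. ?d s j)" for j
    using continuous_on_subset[OF continuous_coef_M\<Psi>] t by auto
  have b: "(\<Sum>j<n. eigval j * (norm (?d s j))\<^sup>2) \<le> (K * (1 + S))\<^sup>2" if s: "s \<in> {0..t}" for n s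
  proof -
    have s': "s \<in> {0..T}" using s t by auto
    have a: "ac (\<lambda>x. M x * \<Psi> s x) (\<lambda>x. M1 x * \<Psi> s x + M x * \<Psi>1 s x) 0 1"
      by (rule ac_mult[OF WM(1) W\<Psi>(1)[OF s']])
    have L1: "(\<lambda>x. M1 x * \<Psi> s x) \<in> L2 {0..1}" "L2_norm {0..1} (\<lambda>x. M1 x * \<Psi> s x) \<le> K * 1"
      using L2_bounded_mult[OF W\<Psi>(6)[OF s'] L2_measurable[OF WM(7)] K(3)] unit[OF s'] K0 by auto
    have L2: "(\<lambda>x. M x * \<Psi>1 s x) \<in> L2 {0..1}" "L2_norm {0..1} (\<lambda>x. M x * \<Psi>1 s x) \<le> K * L2_norm {0..1} (\<Psi>1 s)"
      using L2_bounded_mult[OF W\<Psi>(7)[OF s'] L2_measurable[OF WM(6)] K(2)] K0 by auto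
    have "(\<Sum>j<n. eigval j * (norm (?d s j))\<^sup>2) \<le> (L2_norm {0..1} (\<lambda>x. M1 x * \<Psi> s x + M x * \<Psi>1 s x))\<^sup>2"
      by (rule Bessel_eigfun'[OF a L2_add(1)[OF L1(1) L2(1)]])
    also have "\<dots> \<le> (K * (1 + S))\<^sup>2"
    proof (rule power_mono)
      have "L2_norm {0..1} (\<lambda>x. M1 x * \<Psi> s x + M x * \<Psi>1 s x) \<le> K * 1 + K * L2_norm {0..1} (\<Psi>1 s)"
        using L2_add(2)[OF L1(1) L2(1)] L1(2) L2(2) by linarith
      also have "\<dots> \<le> K * 1 + K * S" using S[OF s'] K0 by (intro add_left_mono mult_left_mono)
      finally show "L2_norm {0..1} (\<lambda>x. M1 x * \<Psi> s x + M x * \<Psi>1 s x) \<le> K * (1 + S)" by (simp add: algebra_simps)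
    qed simp
    finally show ?thesis .
  qed
  have "(\<Sum>j<n. eigval j * (norm (coef (\<Psi> t) j))\<^sup>2) \<le> T * (K * (1 + S))\<^sup>2" for n
  proof -
    have "(\<Sum>j<n. eigval j * (norm (coef (\<Psi> t) j))\<^sup>2) \<le> (\<Sum>j<n. integral {0..t} (\<lambda>s. eigval j * (norm (?d s j))\<^sup>2))"
      by (rule sum_mono) (rule mode)
    also have "\<dots> = integral {0..t} (\<lambda>s. \<Sum>j<n. eigval j * (norm (?d s j))\<^sup>2)"
      by (intro integral_sum[symmetric] continuous_integrable_I continuous_intros c) auto
    also have "\<dots> \<le> integral {0..t} (\<lambda>s. (K * (1 + S))\<^sup>2)"
      by (intro integral_le continuous_integrable_I continuous_intros c b)
    also have "\<dots> = t * (K * (1 + S))\<^sup>2" using t by simp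
    also have "\<dots> \<le> T * (K * (1 + S))\<^sup>2" using t by (intro mult_right_mono) auto
    finally show ?thesis .
  qed
  moreover have "(\<lambda>n. \<Sum>j<n. eigval j * (norm (coef (\<Psi> t) j))\<^sup>2) \<longlonglongrightarrow> (L2_norm {0..1} (\<Psi>1 t))\<^sup>2"
    using deriv_norm_sums[OF \<Psi>[OF t] bc[OF t]] by (simp add: sums_def)
  ultimately show ?thesis by (intro LIMSEQ_le_const2) auto
qed

text \<open>With \<open>S\<close> the maximum over time, finite by continuity, the energy bound
  reads \<open>S \<le> K sqrt T (1 + S)\<close>, and \<open>small\<close> absorbs the term with
  \<open>S\<close>.\<close>

lemma \<Psi>1_bound:
  assumes t: "t \<in> {0..T}"
  shows "L2_norm {0..1} (\<Psi>1 t) \<le> 2 * K * sqrt T"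
proof -
  have "\<exists>t0\<in>{0..T}. \<forall>t\<in>{0..T}. L2_norm {0..1} (\<Psi>1 t) \<le> L2_norm {0..1} (\<Psi>1 t0)"
    using T by (intro continuous_attains_sup continuous_L2_norm W\<Psi>(7) cont(2)) auto
  then obtain t0 where t0: "t0 \<in> {0..T}" "\<And>t. t \<in> {0..T} \<Longrightarrow> L2_norm {0..1} (\<Psi>1 t) \<le> L2_norm {0..1} (\<Psi>1 t0)"
    by blast
  define S where "S = L2_norm {0..1} (\<Psi>1 t0)"
  have S0: "0 \<le> S" by (simp add: S_def)
  have "S\<^sup>2 \<le> T * (K * (1 + S))\<^sup>2"
    unfolding S_def by (rule energy_bound[OF t0(2) t0(1)])
  also have "\<dots> = (sqrt T * (K * (1 + S)))\<^sup>2" using T by (simp add: power_mult_distrib)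
  finally have "S \<le> sqrt T * (K * (1 + S))"
    by (rule power2_le_imp_le) (use S0 K0 T in simp)
  also have "\<dots> = K * sqrt T + (K * sqrt T) * S" by (simp add: algebra_simps)
  also have "\<dots> \<le> K * sqrt T + (1 / 2) * S" using small S0 by (intro add_left_mono mult_right_mono)
  finally have "S \<le> 2 * K * sqrt T" by simp
  then show ?thesis using t0(2)[OF t] by (simp add: S_def)
qed

text \<open>The oscillation in space and the deviation of the mean from 1 contribute
  \<open>2 K sqrt T\<close> each.\<close>

lemma \<Psi>_near_1:
  assumes t: "t \<in> {0..T}" and x: "x \<in> {0..1}"
  shows "norm (\<Psi> t x - 1) \<le> 4 * K * sqrt T"
proof -
  have 1: "norm (\<Psi> t x - coef (\<Psi> t) 0) \<le> 2 * K * sqrt T"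
    using ac_near_mean[OF W\<Psi>(1)[OF t] W\<Psi>(7)[OF t] x] \<Psi>1_bound[OF t] by linarith
  have "coef (\<Psi> t) 0 - 1 = \<i> * integral {0..t} (\<lambda>s. of_real (u s) * (exp (- \<i> * of_real (eigval 0 * (t - s))) * coef (\<lambda>x. M x * \<Psi> s x) 0))"
    using Duhamel[OF t, of 0] by (simp add: coef_eigfun)
  then have "(norm (coef (\<Psi> t) 0 - 1))\<^sup>2 \<le> integral {0..t} (\<lambda>s. (norm (coef (\<lambda>x. M x * \<Psi> s x) 0))\<^sup>2)"
    using Duhamel_bound[OF t, of 0] by (simp add: norm_mult)
  also have "\<dots> \<le> integral {0..t} (\<lambda>s. (2 * K)\<^sup>2)"
  proof (rule integral_le)
    have "continuous_on {0..t} (\<lambda>s. coef (\<lambda>x. M x * \<Psi> s x) 0)"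
      using continuous_on_subset[OF continuous_coef_M\<Psi>] t by auto
    then show "(\<lambda>s. (norm (coef (\<lambda>x. M x * \<Psi> s x) 0))\<^sup>2) integrable_on {0..t}"
      by (intro continuous_integrable_I continuous_intros)
    fix s assume "s \<in> {0..t}"
    then have s: "s \<in> {0..T}" using t by auto
    have "L2_norm {0..1} (\<lambda>x. M x * \<Psi> s x) \<le> K * 1"
      using L2_bounded_mult(2)[OF W\<Psi>(6)[OF s] L2_measurable[OF WM(6)] K(2) K0] unit[OF s] by simp
    then have "norm (coef (\<lambda>x. M x * \<Psi> s x) 0) \<le> 2 * K"
      using norm_coef_le[OF L2_M\<Psi>[OF s], of 0] by simp
    then show "(norm (coef (\<lambda>x. M x * \<Psi> s x) 0))\<^sup>2 \<le> (2 * K)\<^sup>2" by (intro power_mono) auto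
  qed (intro continuous_integrable_I continuous_intros)
  also have "\<dots> = t * (2 * K)\<^sup>2" using t by simp
  also have "\<dots> \<le> T * (2 * K)\<^sup>2" using t by (intro mult_right_mono) auto
  also have "\<dots> = (2 * K * sqrt T)\<^sup>2" using T by (simp add: power_mult_distrib)
  finally have 2: "norm (coef (\<Psi> t) 0 - 1) \<le> 2 * K * sqrt T"
    by (rule power2_le_imp_le) (use K0 T in simp)
  have "norm (\<Psi> t x - 1) \<le> norm (\<Psi> t x - coef (\<Psi> t) 0) + norm (coef (\<Psi> t) 0 - 1)"
    using norm_triangle_ineq[of "\<Psi> t x - coef (\<Psi> t) 0" "coef (\<Psi> t) 0 - 1"] by simp
  then show ?thesis using 1 2 by linarith
qed

lemma gauge_eq: "x \<in> {0..1} \<Longrightarrow> gauge t x = exp (\<i> * of_real (- U t * Re (M x)))"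
  using M_eq_Re[of x] by (simp add: gauge_def mult.assoc)

lemma norm_gauge: "x \<in> {0..1} \<Longrightarrow> norm (gauge t x) = 1"
  unfolding gauge_eq by (rule norm_exp_i_times)

lemma gauge_near_1:
  assumes x: "x \<in> {0..1}"
  shows "norm (gauge t x - 1) \<le> K * \<bar>U t\<bar>"
    and "norm (gauge t x - 1 + \<i> * of_real (U t) * M x) \<le> K\<^sup>2 * (U t)\<^sup>2"
proof -
  let ?\<theta> = "- U t * Re (M x)"
  have r: "\<bar>Re (M x)\<bar> \<le> K" using K(2)[OF x] abs_Re_le_cmod order_trans by blast
  then have th: "\<bar>?\<theta>\<bar> \<le> K * \<bar>U t\<bar>" by (simp add: abs_mult mult_right_mono mult.commute)
  show "norm (gauge t x - 1) \<le> K * \<bar>U t\<bar>"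
    unfolding gauge_eq[OF x] using norm_exp_i_minus_1[of ?\<theta>] th by linarith
  have "gauge t x - 1 + \<i> * of_real (U t) * M x = exp (\<i> * of_real ?\<theta>) - 1 - \<i> * of_real ?\<theta>"
    unfolding gauge_eq[OF x] by (subst M_eq_Re[OF x]) simp
  then have "norm (gauge t x - 1 + \<i> * of_real (U t) * M x) \<le> ?\<theta>\<^sup>2"
    using norm_exp_i_minus_linear[of ?\<theta>] by (simp only:)
  also have "?\<theta>\<^sup>2 = \<bar>?\<theta>\<bar>\<^sup>2" by (rule power2_abs[symmetric])
  also have "\<dots> \<le> (K * \<bar>U t\<bar>)\<^sup>2" using th by (rule power_mono) simp
  finally show "norm (gauge t x - 1 + \<i> * of_real (U t) * M x) \<le> K\<^sup>2 * (U t)\<^sup>2"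
    by (simp add: power_mult_distrib)
qed

lemma G_near_1:
  assumes t: "t \<in> {0..T}" and x: "x \<in> {0..1}"
  shows "norm (G t x - 1) \<le> 5 * K * sqrt T" "norm (G t x) \<le> 4"
proof -
  have "G t x - 1 = gauge t x * (\<Psi> t x - 1) + (gauge t x - 1)" by (simp add: G_def algebra_simps)
  then have "norm (G t x - 1) \<le> norm (gauge t x * (\<Psi> t x - 1)) + norm (gauge t x - 1)"
    by (metis norm_triangle_ineq)
  also have "\<dots> \<le> 4 * K * sqrt T + K * \<bar>U t\<bar>"
    using \<Psi>_near_1[OF t x] gauge_near_1(1)[OF x, of t] norm_gauge[OF x, of t] by (simp add: norm_mult)
  also have "\<dots> \<le> 4 * K * sqrt T + K * sqrt T" using abs_U_le(1)[OF t] K0 by (intro add_left_mono mult_left_mono)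
  finally show 1: "norm (G t x - 1) \<le> 5 * K * sqrt T" by simp
  have "norm (G t x) \<le> norm (G t x - 1) + 1" using norm_triangle_ineq[of "G t x - 1" 1] by simp
  \<comment> \<open>By \<open>small\<close>, the first estimate is at most 5/2.\<close>
  then show "norm (G t x) \<le> 4" using 1 small by simp
qed

lemma G1_bound:
  assumes t: "t \<in> {0..T}"
  shows "L2_norm {0..1} (G1 t) \<le> 2"
proof -
  have a: "L2_norm {0..1} (\<lambda>x. M1 x * \<Psi> t x) \<le> K * 1"
    using L2_bounded_mult(2)[OF W\<Psi>(6)[OF t] L2_measurable[OF WM(7)] K(3) K0] unit[OF t] by simp
  have aL: "(\<lambda>x. M1 x * \<Psi> t x) \<in> L2 {0..1}" by (intro L2_mult_continuous W\<Psi>(6)[OF t] WM(5))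
  let ?h = "\<lambda>x. \<Psi>1 t x - \<i> * of_real (U t) * (M1 x * \<Psi> t x)"
  have hL: "?h \<in> L2 {0..1}" by (intro L2_diff(1) L2_cmult(1) aL W\<Psi>(7)[OF t])
  have "L2_norm {0..1} ?h \<le> L2_norm {0..1} (\<Psi>1 t) + L2_norm {0..1} (\<lambda>x. \<i> * of_real (U t) * (M1 x * \<Psi> t x))"
    by (intro L2_diff(2) L2_cmult(1) aL W\<Psi>(7)[OF t])
  also have "L2_norm {0..1} (\<lambda>x. \<i> * of_real (U t) * (M1 x * \<Psi> t x)) = \<bar>U t\<bar> * L2_norm {0..1} (\<lambda>x. M1 x * \<Psi> t x)"
    by (simp add: L2_cmult(2)[OF aL] norm_mult)
  also have "\<dots> \<le> sqrt T * (K * 1)" using abs_U_le(1)[OF t] a T by (intro mult_mono) auto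
  \<comment> \<open>Three times \<open>K sqrt T\<close>, hence at most 3/2.\<close>
  also have "L2_norm {0..1} (\<Psi>1 t) + sqrt T * (K * 1) \<le> 2"
  proof -
    have "L2_norm {0..1} (\<Psi>1 t) \<le> 2 * (K * sqrt T)" using \<Psi>1_bound[OF t] by (simp add: mult.assoc)
    moreover have "sqrt T * (K * 1) = K * sqrt T" by simp
    ultimately show ?thesis using small by linarith
  qed
  finally have h: "L2_norm {0..1} ?h \<le> 2" by simp
  have "G1 t = (\<lambda>x. gauge t x * ?h x)" by (auto simp: G1_def mult.assoc)
  moreover have "L2_norm {0..1} (\<lambda>x. gauge t x * ?h x) \<le> 1 * L2_norm {0..1} ?h"
    by (rule L2_bounded_mult(2)[OF hL continuous_imp_measurable_on_sets_lebesgue[OF continuous_gauge]]) (simp_all add: norm_gauge)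
  ultimately show ?thesis using h by simp
qed

end

section \<open>The boundary term of the quadratic form\<close>

lemma large_sieve_neg:
  fixes v :: "real \<Rightarrow> complex"
  assumes v: "v \<in> L2 {a..b}" and ab: "a \<le> b" "b - a \<le> 1"
  shows "(\<Sum>j<J. (norm (integral {a..b} (\<lambda>s. exp (- \<i> * of_real (eigval j * s)) * v s)))\<^sup>2)
    \<le> sieve_const * (b - a) powr (1/4) * (L2_norm {a..b} v)\<^sup>2"
proof -
  have e: "norm (integral {a..b} (\<lambda>s. exp (- \<i> * of_real (eigval j * s)) * v s)) =
      norm (integral {a..b} (\<lambda>s. exp (\<i> * of_real (eigval j * s)) * cnj (v s)))" for j
  proof -
    have "integral {a..b} (\<lambda>s. exp (- \<i> * of_real (eigval j * s)) * v s) =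
        integral {a..b} (\<lambda>s. cnj (exp (\<i> * of_real (eigval j * s)) * cnj (v s)))"
      by (rule integral_cong) (simp add: exp_cnj)
    then show ?thesis by (simp only: integral_cnj[symmetric] complex_mod_cnj)
  qed
  have n: "L2_norm {a..b} (\<lambda>x. cnj (v x)) = L2_norm {a..b} v" by (simp add: L2_norm_def)
  show ?thesis unfolding e using large_sieve[OF L2_cnj[OF v] ab, of J] unfolding n .
qed

context bounded_flow
begin

text \<open>A point value is controlled by the mean and the derivative. Continuity of the boundary
  values in time is what allows the large sieve to be applied to them.\<close>

lemma continuous_\<Psi>_at:
  assumes x: "x \<in> {0..1}"
  shows "continuous_on {0..T} (\<lambda>s. \<Psi> s x)"
  unfolding continuous_on
proof
  fix t assume t: "t \<in> {0..T}"
  have "((\<lambda>s. \<Psi> s x - \<Psi> t x) \<longlongrightarrow> 0) (at t within {0..T})"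
  proof (rule Lim_null_comparison)
    have "((\<lambda>s. 2 * L2_norm {0..1} (\<lambda>x. \<Psi> s x - \<Psi> t x) + L2_norm {0..1} (\<lambda>x. \<Psi>1 s x - \<Psi>1 t x)) \<longlongrightarrow> 2 * 0 + 0) (at t within {0..T})"
      by (intro tendsto_intros cont t)
    then show "((\<lambda>s. 2 * L2_norm {0..1} (\<lambda>x. \<Psi> s x - \<Psi> t x) + L2_norm {0..1} (\<lambda>x. \<Psi>1 s x - \<Psi>1 t x)) \<longlongrightarrow> 0) (at t within {0..T})"
      by simp
    have "norm (\<Psi> s x - \<Psi> t x) \<le> 2 * L2_norm {0..1} (\<lambda>x. \<Psi> s x - \<Psi> t x) + L2_norm {0..1} (\<lambda>x. \<Psi>1 s x - \<Psi>1 t x)" if s: "s \<in> {0..T}" for s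
    proof -
      let ?D = "\<lambda>x. \<Psi> s x - \<Psi> t x"
      have "norm (?D x) \<le> norm (?D x - coef ?D 0) + norm (coef ?D 0)"
        using norm_triangle_ineq[of "?D x - coef ?D 0" "coef ?D 0"] by simp
      moreover have "norm (?D x - coef ?D 0) \<le> L2_norm {0..1} (\<lambda>x. \<Psi>1 s x - \<Psi>1 t x)"
        by (rule ac_near_mean[OF ac_diff[OF W\<Psi>(1)[OF s] W\<Psi>(1)[OF t]] L2_diff(1)[OF W\<Psi>(7)[OF s] W\<Psi>(7)[OF t]] x])
      moreover have "norm (coef ?D 0) \<le> 2 * L2_norm {0..1} ?D"
        by (rule norm_coef_le[OF L2_diff(1)[OF W\<Psi>(6)[OF s] W\<Psi>(6)[OF t]]])
      ultimately show ?thesis by linarith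
    qed
    then show "\<forall>\<^sub>F s in at t within {0..T}. norm (\<Psi> s x - \<Psi> t x) \<le> 2 * L2_norm {0..1} (\<lambda>x. \<Psi> s x - \<Psi> t x) + L2_norm {0..1} (\<lambda>x. \<Psi>1 s x - \<Psi>1 t x)"
      by (simp add: eventually_at_filter)
  qed
  then show "((\<lambda>s. \<Psi> s x) \<longlongrightarrow> \<Psi> t x) (at t within {0..T})" by (rule LIM_zero_cancel)
qed

lemma continuous_G_at:
  assumes x: "x \<in> {0..1}"
  shows "continuous_on {0..T} (\<lambda>s. G s x)"
  unfolding G_def gauge_def by (intro continuous_intros continuous_\<Psi>_at[OF x] continuous_U)

text \<open>What remains of the source besides boundary values, after division by
  \<open>- U\<close>: a function bounded in \<open>L^2\<close> uniformly in time, whose coefficients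
  are therefore square summable by Bessel.\<close>

definition R :: "real \<Rightarrow> real \<Rightarrow> complex" where
  "R t x = (G t x * M2 x + 2 * M1 x * G1 t x) + \<i> * of_real (U t) * (M1 x * M1 x * G t x)"

lemma R_L2:
  assumes t: "t \<in> {0..T}"
  shows "R t \<in> L2 {0..1}" "L2_norm {0..1} (R t) \<le> 12 * K\<^sup>2"
proof -
  note c = WG(2,3)[OF t] WM(4,5)
  have K2: "K \<le> K\<^sup>2" using K(1) by (simp add: power2_eq_square)
  have a: "(\<lambda>x. G t x * M2 x) \<in> L2 {0..1}" "L2_norm {0..1} (\<lambda>x. G t x * M2 x) \<le> 4 * L2_norm {0..1} M2"
    using L2_bounded_mult[OF WM(3) continuous_imp_measurable_on_sets_lebesgue[OF WG(2)[OF t]] G_near_1(2)[OF t]] by auto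
  have b0: "(\<lambda>x. M1 x * G1 t x) \<in> L2 {0..1}" "L2_norm {0..1} (\<lambda>x. M1 x * G1 t x) \<le> K * L2_norm {0..1} (G1 t)"
    using L2_bounded_mult[OF WG(5)[OF t] L2_measurable[OF WM(7)] K(3)] K0 by auto
  have b: "(\<lambda>x. 2 * M1 x * G1 t x) \<in> L2 {0..1}" "L2_norm {0..1} (\<lambda>x. 2 * M1 x * G1 t x) = 2 * L2_norm {0..1} (\<lambda>x. M1 x * G1 t x)"
    using L2_cmult[OF b0(1), of 2] by (simp_all add: mult.assoc)
  have dL: "(\<lambda>x. M1 x * M1 x * G t x) \<in> L2 {0..1}" by (intro continuous_imp_L2 continuous_intros c)
  have d: "L2_norm {0..1} (\<lambda>x. M1 x * M1 x * G t x) \<le> (K * K * 4) * sqrt (1 - 0)"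
  proof (rule L2_norm_bound[OF dL])
    fix x :: real assume x: "x \<in> {0..1}"
    show "norm (M1 x * M1 x * G t x) \<le> K * K * 4"
      unfolding norm_mult using K(3)[OF x] G_near_1(2)[OF t x] K0 by (intro mult_mono) auto
  qed (use K0 in auto)
  have eL: "(\<lambda>x. \<i> * of_real (U t) * (M1 x * M1 x * G t x)) \<in> L2 {0..1}"
    and e: "L2_norm {0..1} (\<lambda>x. \<i> * of_real (U t) * (M1 x * M1 x * G t x)) = \<bar>U t\<bar> * L2_norm {0..1} (\<lambda>x. M1 x * M1 x * G t x)"
    using L2_cmult[OF dL, of "\<i> * of_real (U t)"] by (auto simp: norm_mult)
  have "L2_norm {0..1} (\<lambda>x. \<i> * of_real (U t) * (M1 x * M1 x * G t x)) \<le> 1 * L2_norm {0..1} (\<lambda>x. M1 x * M1 x * G t x)"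
    unfolding e using abs_U_le(2)[OF t] by (intro mult_right_mono) auto
  then have e': "L2_norm {0..1} (\<lambda>x. \<i> * of_real (U t) * (M1 x * M1 x * G t x)) \<le> 4 * K\<^sup>2"
    using d by (simp add: power2_eq_square)
  show "R t \<in> L2 {0..1}" unfolding R_def[abs_def] by (intro L2_add(1) a b eL)
  have "L2_norm {0..1} (R t) \<le> L2_norm {0..1} (\<lambda>x. G t x * M2 x + 2 * M1 x * G1 t x) + L2_norm {0..1} (\<lambda>x. \<i> * of_real (U t) * (M1 x * M1 x * G t x))"
    unfolding R_def[abs_def] by (intro L2_add a b eL)
  also have "L2_norm {0..1} (\<lambda>x. G t x * M2 x + 2 * M1 x * G1 t x) \<le> L2_norm {0..1} (\<lambda>x. G t x * M2 x) + L2_norm {0..1} (\<lambda>x. 2 * M1 x * G1 t x)"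
    by (intro L2_add a b)
  also have "\<dots> \<le> 4 * K + 2 * (K * 2)"
  proof (intro add_mono)
    show "L2_norm {0..1} (\<lambda>x. G t x * M2 x) \<le> 4 * K" using a(2) K(4) by linarith
    have "K * L2_norm {0..1} (G1 t) \<le> K * 2" by (intro mult_left_mono G1_bound t K0)
    then show "L2_norm {0..1} (\<lambda>x. 2 * M1 x * G1 t x) \<le> 2 * (K * 2)" unfolding b(2) using b0(2) by linarith
  qed
  \<comment> \<open>The three parts contribute \<open>4 K\<close>, \<open>4 K\<close> and
    \<open>4 K^2\<close>, and \<open>K \<le> K^2\<close>.\<close>
  finally show "L2_norm {0..1} (R t) \<le> 12 * K\<^sup>2" using e' K2 by linarith
qed

lemma q_eq:
  assumes t: "t \<in> {0..T}"
  shows "q j t = of_real (U t) * (M1 1 * G t 1 * eigfun j 1 - M1 0 * G t 0 * eigfun j 0 - coef (R t) j)"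
proof -
  note c = WG(2,3)[OF t] WM(4,5)
  have a: "(\<lambda>x. G t x * M2 x + 2 * M1 x * G1 t x) absolutely_integrable_on {0..1}"
  proof (rule set_integral_add(1))
    show "(\<lambda>x. G t x * M2 x) absolutely_integrable_on {0..1}"
      by (rule abs_integrable_cont_mult[OF WG(2)[OF t] L2_absolutely_integrable[OF WM(3)]])
  qed (intro absolutely_integrable_continuous_real continuous_intros c)
  have b: "(\<lambda>x. \<i> * of_real (U t) * (M1 x * M1 x * G t x)) absolutely_integrable_on {0..1}"
    by (intro absolutely_integrable_continuous_real continuous_intros c)
  have "coef (R t) j = coef (\<lambda>x. G t x * M2 x + 2 * M1 x * G1 t x) j + \<i> * of_real (U t) * coef (\<lambda>x. M1 x * M1 x * G t x) j"
    unfolding R_def[abs_def] coef_add[OF a b] coef_scale ..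
  moreover have "integral {0..1} (\<lambda>x. M1 x * M1 x * G t x * eigfun j x) = coef (\<lambda>x. M1 x * M1 x * G t x) j"
    by (simp add: coef_def)
  ultimately show ?thesis
    unfolding q_def q_boundary_form[OF t] by (simp add: power2_eq_square algebra_simps)
qed

lemma q_bound:
  assumes t: "t \<in> {0..T}"
  shows "norm (q j t) \<le> 40 * K\<^sup>2 * \<bar>U t\<bar>"
proof -
  have K2: "K \<le> K\<^sup>2" using K(1) by (simp add: power2_eq_square)
  have v: "norm (M1 x * G t x * eigfun j x) \<le> (K * 4) * 2" if "x \<in> {0..1}" for x
    unfolding norm_mult using K(3)[OF that] G_near_1(2)[OF t that] K0 by (intro mult_mono norm_eigfun_le) auto
  have r: "norm (coef (R t) j) \<le> 2 * (12 * K\<^sup>2)"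
    using norm_coef_le[OF R_L2(1)[OF t], of j] R_L2(2)[OF t] by linarith
  have "norm (M1 1 * G t 1 * eigfun j 1 - M1 0 * G t 0 * eigfun j 0 - coef (R t) j) \<le>
     norm (M1 1 * G t 1 * eigfun j 1) + norm (M1 0 * G t 0 * eigfun j 0) + norm (coef (R t) j)"
    by (meson add_right_mono norm_triangle_ineq4 order_trans)
  \<comment> \<open>Each boundary value contributes \<open>8 K\<close>, the coefficient of
    \<open>R\<close> at most \<open>24 K^2\<close>.\<close>
  also have "\<dots> \<le> 40 * K\<^sup>2" using v[of 1] v[of 0] r K2 by simp
  finally have "norm (M1 1 * G t 1 * eigfun j 1 - M1 0 * G t 0 * eigfun j 0 - coef (R t) j) \<le> 40 * K\<^sup>2" .
  then have "\<bar>U t\<bar> * norm (M1 1 * G t 1 * eigfun j 1 - M1 0 * G t 0 * eigfun j 0 - coef (R t) j) \<le> \<bar>U t\<bar> * (40 * K\<^sup>2)"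
    by (rule mult_left_mono) simp
  then have "norm (q j t) \<le> \<bar>U t\<bar> * (40 * K\<^sup>2)"
    unfolding q_eq[OF t] by (simp only: norm_mult norm_of_real)
  then show ?thesis by (simp only: mult.commute)
qed

lemma U_L2: "U \<in> L2 {0..T}"
  by (rule continuous_imp_L2[OF continuous_U])

text \<open>The 3 comes from squaring three terms; 128 is 2 ends times 4 for the square of an
  eigenfunction times 16 for the square of \<open>4 K\<close>; 144 is the square of the constant in
  \<open>R_L2\<close>.\<close>

definition Cq :: real where "Cq = 3 * (128 * sieve_const + 144) * K ^ 4"

text \<open>In the boundary part, \<open>eigfun j\<close> at an end multiplies a function of time
  that is independent of \<open>j\<close>, so the large sieve applies. The part with
  \<open>R\<close> is square summable in \<open>j\<close> at each time by Bessel; Cauchy-Schwarz in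
  time then gains a full factor \<open>L\<close>.\<close>

lemma q_sieve:
  assumes ab: "0 \<le> a" "a \<le> b" "b \<le> T"
  shows "(\<Sum>j<J. (norm (integral {a..b} (\<lambda>s. exp (\<i> * of_real (eigval j * s)) * q j s)))\<^sup>2)
    \<le> Cq * (b - a) powr (1/4) * integral {a..b} (\<lambda>s. (U s)\<^sup>2)"
proof -
  define L where "L = b - a"
  define S where "S = sieve_const"
  define N where "N = integral {a..b} (\<lambda>s. (U s)\<^sup>2)"
  define E where "E j s = exp (\<i> * complex_of_real (eigval j * s))" for j s
  have sub: "{a..b} \<subseteq> {0..T}" using ab by auto
  have L: "0 \<le> L" "L \<le> 1" "b - a \<le> 1" using ab T by (auto simp: L_def)
  have S0: "0 \<le> S" unfolding S_def by (rule sieve_const_nonneg)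
  have Uc: "continuous_on {a..b} U" by (rule continuous_on_subset[OF continuous_U sub])
  have Ui: "(\<lambda>s. (U s)\<^sup>2) integrable_on {a..b}" by (intro continuous_integrable_I continuous_intros Uc)
  have N0: "0 \<le> N" unfolding N_def by (rule integral_nonneg[OF Ui]) simp
  have cE: "continuous_on {a..b} (E j)" for j unfolding E_def[abs_def] by (intro continuous_intros)
  define v where "v x s = complex_of_real (U s) * (M1 x * G s x)" for x s
  have vc: "continuous_on {a..b} (v x)" if "x \<in> {0..1}" for x
    unfolding v_def[abs_def]
    by (intro continuous_on_mult continuous_on_of_real Uc continuous_on_const continuous_on_subset[OF continuous_G_at[OF that] sub])
  have vN: "(L2_norm {a..b} (v x))\<^sup>2 \<le> 16 * K\<^sup>2 * N" if x: "x \<in> {0..1}" for x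
  proof -
    have "(L2_norm {a..b} (v x))\<^sup>2 = integral {a..b} (\<lambda>s. (norm (v x s))\<^sup>2)"
      by (rule L2_norm_square_integral(2)[OF continuous_imp_L2[OF vc[OF x]]])
    also have "\<dots> \<le> integral {a..b} (\<lambda>s. 16 * K\<^sup>2 * (U s)\<^sup>2)"
    proof (rule integral_le)
      show "(\<lambda>s. (norm (v x s))\<^sup>2) integrable_on {a..b}" by (intro continuous_integrable_I continuous_intros vc x)
      show "(\<lambda>s. 16 * K\<^sup>2 * (U s)\<^sup>2) integrable_on {a..b}" by (intro integrable_on_mult_right Ui)
      fix s assume s: "s \<in> {a..b}"
      have "norm (M1 x) * norm (G s x) \<le> K * 4"
        using K(3)[OF x] G_near_1(2)[OF subsetD[OF sub s] x] K0 by (intro mult_mono) auto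
      then have "norm (v x s) \<le> \<bar>U s\<bar> * (K * 4)"
        unfolding v_def norm_mult by (simp add: mult_left_mono)
      then have "(norm (v x s))\<^sup>2 \<le> (\<bar>U s\<bar> * (K * 4))\<^sup>2" by (intro power_mono) auto
      then show "(norm (v x s))\<^sup>2 \<le> 16 * K\<^sup>2 * (U s)\<^sup>2" by (simp add: power_mult_distrib mult_ac)
    qed
    also have "\<dots> = 16 * K\<^sup>2 * N" by (simp add: N_def)
    finally show ?thesis .
  qed
  have vS: "(\<Sum>j<J. (norm (integral {a..b} (\<lambda>s. E j s * v x s)))\<^sup>2) \<le> S * L powr (1/4) * (16 * K\<^sup>2 * N)" if x: "x \<in> {0..1}" for x
  proof -
    have "(\<Sum>j<J. (norm (integral {a..b} (\<lambda>s. E j s * v x s)))\<^sup>2) \<le> S * L powr (1/4) * (L2_norm {a..b} (v x))\<^sup>2"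
      unfolding E_def S_def L_def by (rule large_sieve[OF continuous_imp_L2[OF vc[OF x]] ab(2) L(3)])
    also have "\<dots> \<le> S * L powr (1/4) * (16 * K\<^sup>2 * N)" using S0 by (intro mult_left_mono vN x) auto
    finally show ?thesis .
  qed
  define r where "r j s = of_real (U s) * coef (R s) j" for j s
  have q_r: "q j s = eigfun j 1 * v 1 s - eigfun j 0 * v 0 s - r j s" if "s \<in> {a..b}" for j s
    using q_eq[OF subsetD[OF sub that], of j] by (simp add: v_def r_def algebra_simps)
  have qi: "q j absolutely_integrable_on {a..b}" for j
    using ab by (intro abs_integrable_subinterval[OF q_integrable]) auto
  have ci: "(\<lambda>s. eigfun j 1 * v 1 s - eigfun j 0 * v 0 s) absolutely_integrable_on {a..b}" for j
    by (intro absolutely_integrable_continuous_real continuous_intros vc) auto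
  \<comment> \<open>As for \<open>q j\<close>, regularity in time is inferred from the
    decomposition: \<open>r j\<close> is the boundary part minus \<open>q j\<close>.\<close>
  have ri: "r j absolutely_integrable_on {a..b}" for j
  proof -
    have "(\<lambda>s. (eigfun j 1 * v 1 s - eigfun j 0 * v 0 s) - q j s) absolutely_integrable_on {a..b}"
      using ci qi by (rule set_integral_diff(1))
    then show ?thesis
      by (rule integral_cong_AE_lebesgue(2)[rotated]) (rule AE_I2, simp add: q_r)
  qed
  have rsum: "(\<Sum>j<J. (norm (r j s))\<^sup>2) \<le> 144 * K ^ 4 * (U s)\<^sup>2" if s: "s \<in> {a..b}" for s
  proof -
    note s' = subsetD[OF sub s]
    have "(\<Sum>j<J. (norm (r j s))\<^sup>2) = (U s)\<^sup>2 * (\<Sum>j<J. (norm (coef (R s) j))\<^sup>2)"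
      by (simp add: r_def norm_mult power_mult_distrib sum_distrib_left)
    also have "\<dots> \<le> (U s)\<^sup>2 * (L2_norm {0..1} (R s))\<^sup>2"
      by (intro mult_left_mono Bessel_eigfun R_L2 s') simp
    also have "\<dots> \<le> (U s)\<^sup>2 * (12 * K\<^sup>2)\<^sup>2"
      by (intro mult_left_mono power_mono R_L2 s') simp_all
    finally show ?thesis by (simp add: power_mult_distrib mult_ac)
  qed
  have rL: "r j \<in> L2 {a..b}" if "j < J" for j
  proof -
    have m: "r j \<in> borel_measurable (lebesgue_on {a..b})"
      using ri[of j] by (intro borel_measurable_integrable) (simp add: integrable_lebesgue_on_iff)
    have "integrable (lebesgue_on {a..b}) (\<lambda>s. (norm (r j s))\<^sup>2)"
    proof (rule Bochner_Integration.integrable_bound)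
      show "integrable (lebesgue_on {a..b}) (\<lambda>s. 144 * K ^ 4 * (U s)\<^sup>2)"
        unfolding integrable_lebesgue_on_iff[of "{a..b}", simplified]
        by (intro absolutely_integrable_continuous_real continuous_intros Uc)
      show "(\<lambda>s. (norm (r j s))\<^sup>2) \<in> borel_measurable (lebesgue_on {a..b})" using m by measurable
      show "AE s in lebesgue_on {a..b}. norm ((norm (r j s))\<^sup>2) \<le> norm (144 * K ^ 4 * (U s)\<^sup>2)"
      proof (rule AE_I2)
        fix s assume "s \<in> space (lebesgue_on {a..b})"
        then have s: "s \<in> {a..b}" by simp
        have "(norm (r j s))\<^sup>2 \<le> (\<Sum>j<J. (norm (r j s))\<^sup>2)" using that by (intro member_le_sum) auto
        then show "norm ((norm (r j s))\<^sup>2) \<le> norm (144 * K ^ 4 * (U s)\<^sup>2)" using rsum[OF s] by simp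
      qed
    qed
    with m show ?thesis by (simp add: L2_def)
  qed
  have L14: "L \<le> L powr (1/4)"
  proof (cases "L = 0")
    case False
    then have "L powr 1 \<le> L powr (1/4)" using L by (intro powr_mono') auto
    then show ?thesis using L False by simp
  qed simp
  have rS: "(\<Sum>j<J. (norm (integral {a..b} (\<lambda>s. E j s * r j s)))\<^sup>2) \<le> L powr (1/4) * (144 * K ^ 4 * N)"
  proof -
    have "(\<Sum>j<J. (norm (integral {a..b} (\<lambda>s. E j s * r j s)))\<^sup>2) \<le> (\<Sum>j<J. L * integral {a..b} (\<lambda>s. (norm (r j s))\<^sup>2))"
    proof (rule sum_mono)
      fix j assume "j \<in> {..<J}"
      then have rj: "r j \<in> L2 {a..b}" using rL by simp
      have nE: "norm (E j s) = 1" for s unfolding E_def by (rule norm_exp_i_times)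
      have ErL: "(\<lambda>s. E j s * r j s) \<in> L2 {a..b}" by (rule L2_mult_continuous[OF rj cE])
      have Er: "L2_norm {a..b} (\<lambda>s. E j s * r j s) = L2_norm {a..b} (r j)"
        by (simp add: L2_norm_def norm_mult nE)
      have "norm (integral {a..b} (\<lambda>s. E j s * r j s)) \<le> sqrt (b - a) * L2_norm {a..b} (\<lambda>s. E j s * r j s)"
        by (rule L2_norm_integral_bound[OF ErL ab(2)])
      then have "(norm (integral {a..b} (\<lambda>s. E j s * r j s)))\<^sup>2 \<le> (sqrt (b - a) * L2_norm {a..b} (r j))\<^sup>2"
        unfolding Er by (intro power_mono) auto
      also have "\<dots> = L * integral {a..b} (\<lambda>s. (norm (r j s))\<^sup>2)"
        using L(1) by (simp add: power_mult_distrib L2_norm_square_integral(2)[OF rj] L_def)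
      finally show "(norm (integral {a..b} (\<lambda>s. E j s * r j s)))\<^sup>2 \<le> L * integral {a..b} (\<lambda>s. (norm (r j s))\<^sup>2)" .
    qed
    also have "\<dots> = L * integral {a..b} (\<lambda>s. \<Sum>j<J. (norm (r j s))\<^sup>2)"
      by (subst integral_sum) (auto simp: sum_distrib_left intro!: abs_integrable_imp_integrable L2_norm_square_integral(1) rL)
    also have "\<dots> \<le> L * integral {a..b} (\<lambda>s. 144 * K ^ 4 * (U s)\<^sup>2)"
    proof (intro mult_left_mono integral_le rsum L)
      show "(\<lambda>s. \<Sum>j<J. (norm (r j s))\<^sup>2) integrable_on {a..b}"
        by (intro integrable_sum abs_integrable_imp_integrable L2_norm_square_integral(1) rL) auto
      show "(\<lambda>s. 144 * K ^ 4 * (U s)\<^sup>2) integrable_on {a..b}" by (intro integrable_on_mult_right Ui)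
    qed
    also have "\<dots> = L * (144 * K ^ 4 * N)" by (simp add: N_def)
    also have "\<dots> \<le> L powr (1/4) * (144 * K ^ 4 * N)" using L14 N0 by (intro mult_right_mono) auto
    finally show ?thesis .
  qed
  have three: "(norm (integral {a..b} (\<lambda>s. E j s * q j s)))\<^sup>2 \<le>
      3 * (4 * (norm (integral {a..b} (\<lambda>s. E j s * v 1 s)))\<^sup>2 + 4 * (norm (integral {a..b} (\<lambda>s. E j s * v 0 s)))\<^sup>2
        + (norm (integral {a..b} (\<lambda>s. E j s * r j s)))\<^sup>2)" for j
  proof -
    define X where "X = integral {a..b} (\<lambda>s. E j s * v 1 s)"
    define Y where "Y = integral {a..b} (\<lambda>s. E j s * v 0 s)"
    define Z where "Z = integral {a..b} (\<lambda>s. E j s * r j s)"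
    have iv: "(\<lambda>s. E j s * v x s) integrable_on {a..b}" if "x \<in> {0..1}" for x
      by (intro continuous_integrable_I continuous_on_mult cE vc that)
    have ir: "(\<lambda>s. E j s * r j s) integrable_on {a..b}"
      by (rule abs_integrable_imp_integrable[OF abs_integrable_cont_mult[OF cE ri]])
    have i1: "(\<lambda>s. eigfun j 1 * (E j s * v 1 s)) integrable_on {a..b}" "(\<lambda>s. eigfun j 0 * (E j s * v 0 s)) integrable_on {a..b}"
      by (intro integrable_on_mult_right iv; simp)+
    have "integral {a..b} (\<lambda>s. E j s * q j s) = integral {a..b} (\<lambda>s. eigfun j 1 * (E j s * v 1 s) - eigfun j 0 * (E j s * v 0 s) - E j s * r j s)"
      by (rule integral_cong) (simp add: q_r algebra_simps)
    also have "\<dots> = eigfun j 1 * X - eigfun j 0 * Y - Z"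
      by (simp only: integral_diff[OF integrable_diff[OF i1] ir] integral_diff[OF i1] integral_mult_right X_def Y_def Z_def)
    finally have "norm (integral {a..b} (\<lambda>s. E j s * q j s)) \<le> norm (eigfun j 1 * X) + norm (eigfun j 0 * Y) + norm Z"
      by (metis add_right_mono norm_triangle_ineq4 order_trans)
    also have "\<dots> \<le> 2 * norm X + 2 * norm Y + norm Z"
      unfolding norm_mult by (intro add_mono mult_right_mono norm_eigfun_le) auto
    finally have "(norm (integral {a..b} (\<lambda>s. E j s * q j s)))\<^sup>2 \<le> (2 * norm X + 2 * norm Y + norm Z)\<^sup>2"
      by (intro power_mono) auto
    also have "\<dots> \<le> 3 * ((2 * norm X)\<^sup>2 + (2 * norm Y)\<^sup>2 + (norm Z)\<^sup>2)"
      using sum_squares_bound[of "2 * norm X" "2 * norm Y"] sum_squares_bound[of "2 * norm X" "norm Z"] sum_squares_bound[of "2 * norm Y" "norm Z"]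
      by (simp add: power2_eq_square algebra_simps)
    finally show ?thesis by (simp add: X_def Y_def Z_def power_mult_distrib)
  qed
  have "(\<Sum>j<J. (norm (integral {a..b} (\<lambda>s. E j s * q j s)))\<^sup>2) \<le>
     (\<Sum>j<J. 3 * (4 * (norm (integral {a..b} (\<lambda>s. E j s * v 1 s)))\<^sup>2 + 4 * (norm (integral {a..b} (\<lambda>s. E j s * v 0 s)))\<^sup>2
        + (norm (integral {a..b} (\<lambda>s. E j s * r j s)))\<^sup>2))"
    by (rule sum_mono) (rule three)
  also have "\<dots> = 3 * (4 * (\<Sum>j<J. (norm (integral {a..b} (\<lambda>s. E j s * v 1 s)))\<^sup>2) + 4 * (\<Sum>j<J. (norm (integral {a..b} (\<lambda>s. E j s * v 0 s)))\<^sup>2)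
        + (\<Sum>j<J. (norm (integral {a..b} (\<lambda>s. E j s * r j s)))\<^sup>2))"
    by (simp only: sum_distrib_left[symmetric] sum.distrib)
  also have "\<dots> \<le> 3 * (4 * (S * L powr (1/4) * (16 * K\<^sup>2 * N)) + 4 * (S * L powr (1/4) * (16 * K\<^sup>2 * N)) + L powr (1/4) * (144 * K ^ 4 * N))"
    by (intro mult_left_mono add_mono vS rS) auto
  also have "\<dots> = 3 * (128 * S) * K\<^sup>2 * (L powr (1/4) * N) + 3 * 144 * K ^ 4 * (L powr (1/4) * N)"
    by (simp add: algebra_simps)
  also have "\<dots> \<le> 3 * (128 * S) * K ^ 4 * (L powr (1/4) * N) + 3 * 144 * K ^ 4 * (L powr (1/4) * N)"
    using K(1) S0 N0 by (intro add_mono mult_right_mono mult_left_mono power_increasing) auto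
  also have "\<dots> = Cq * L powr (1/4) * N" by (simp add: Cq_def S_def algebra_simps)
  finally show ?thesis by (simp add: E_def N_def L_def)
qed

end

section \<open>The functional \<open>\<beta>\<close> on the deviation \<open>G - 1\<close>\<close>

lemma norm_eigfun'_le: "norm (eigfun' k x) \<le> 2 * (real k * pi)"
proof -
  have "\<bar>sqrt 2 * (real k * pi) * sin (real k * pi * x)\<bar> \<le> 2 * (real k * pi) * 1"
    unfolding abs_mult by (intro mult_mono) (auto simp: real_le_lsqrt)
  then show ?thesis by (simp add: eigfun'_def norm_mult abs_mult)
qed

definition gap_sum :: real where "gap_sum = (\<Sum>n. inverse ((real (Suc n))\<^sup>2))"

lemma gap_summable: "summable (\<lambda>n. inverse ((real (Suc n))\<^sup>2))"
  using inverse_power_summable[of 2, where 'a=real] by (subst summable_Suc_iff) simp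

text \<open>For an \<open>H\<^sup>1\<close> function the coefficients are summable since \<open>\<bar>c\<^sub>j\<bar> \<le> 1 / \<lambda>\<^sub>j + \<lambda>\<^sub>j \<bar>c\<^sub>j\<bar>\<^sup>2\<close>.\<close>

lemma coef_abs_sum_bound:
  assumes f: "ac f f1 0 1" and f1: "f1 \<in> L2 {0..1}" and fL: "f \<in> L2 {0..1}"
  shows "(\<Sum>j<n. norm (coef f j)) \<le> 2 * L2_norm {0..1} f + gap_sum + (L2_norm {0..1} f1)\<^sup>2"
proof -
  have le: "norm (coef f (Suc j)) \<le> inverse ((real (Suc j))\<^sup>2) + eigval (Suc j) * (norm (coef f (Suc j)))\<^sup>2" for j
  proof -
    define l where "l = eigval (Suc j)"
    define c where "c = norm (coef f (Suc j))"
    have "(real (Suc j))\<^sup>2 * 1 \<le> (real (Suc j))\<^sup>2 * pi\<^sup>2"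
      using pi_gt3 by (intro mult_left_mono) (auto intro: one_le_power)
    then have l1: "(real (Suc j))\<^sup>2 \<le> l" by (simp only: l_def eigval_def power_mult_distrib mult_1_right)
    then have l0: "0 < l" by (rule less_le_trans[rotated]) simp
    have "2 * c \<le> 1 / l + l * c\<^sup>2"
    proof -
      have "0 \<le> (1 - l * c)\<^sup>2" by simp
      then have "2 * (l * c) \<le> 1 + (l * c)\<^sup>2" by (simp add: power2_diff)
      then have "2 * c \<le> (1 + (l * c)\<^sup>2) / l" using l0 by (simp add: pos_le_divide_eq mult_ac)
      also have "\<dots> = 1 / l + l * c\<^sup>2" using l0 by (simp add: power2_eq_square add_divide_distrib)
      finally show ?thesis .
    qed
    moreover have "0 \<le> c" by (simp add: c_def)
    moreover have "1 / l \<le> inverse ((real (Suc j))\<^sup>2)"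
      using l1 by (simp add: inverse_eq_divide frac_le)
    ultimately show ?thesis unfolding l_def[symmetric] c_def[symmetric] by linarith
  qed
  have "(\<Sum>j<n. norm (coef f j)) \<le> (\<Sum>j<Suc n. norm (coef f j))" by simp
  also have "\<dots> = norm (coef f 0) + (\<Sum>j<n. norm (coef f (Suc j)))" by (rule sum.lessThan_Suc_shift)
  also have "(\<Sum>j<n. norm (coef f (Suc j))) \<le> (\<Sum>j<n. inverse ((real (Suc j))\<^sup>2) + eigval (Suc j) * (norm (coef f (Suc j)))\<^sup>2)"
    by (rule sum_mono) (rule le)
  also have "\<dots> = (\<Sum>j<n. inverse ((real (Suc j))\<^sup>2)) + (\<Sum>j<n. eigval (Suc j) * (norm (coef f (Suc j)))\<^sup>2)"
    by (rule sum.distrib)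
  also have "(\<Sum>j<n. inverse ((real (Suc j))\<^sup>2)) \<le> gap_sum"
    unfolding gap_sum_def by (rule sum_le_suminf[OF gap_summable]) auto
  also have "(\<Sum>j<n. eigval (Suc j) * (norm (coef f (Suc j)))\<^sup>2) = (\<Sum>j<Suc n. eigval j * (norm (coef f j))\<^sup>2)"
    unfolding sum.lessThan_Suc_shift by simp
  also have "\<dots> \<le> (L2_norm {0..1} f1)\<^sup>2" by (rule Bessel_eigfun'[OF f f1])
  finally show ?thesis using norm_coef_le[OF fL, of 0] by simp
qed

context bounded_flow
begin

definition C\<beta> :: "nat \<Rightarrow> real" where "C\<beta> k = K * (8 * (real k * pi) + 16)"

lemma C\<beta>_nonneg: "0 \<le> C\<beta> k"
  using K0 by (simp add: C\<beta>_def)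

text \<open>Uniform in \<open>j\<close> but without decay, because the boundary values of
  \<open>eigfun j\<close> do not decay. Estimates of single modes by \<open>U\<close> thus cannot be
  summed, and square summation by the sieve takes their place.\<close>

lemma \<beta>_eigfun_bound: "norm (\<beta> k (eigfun j)) \<le> C\<beta> k"
proof -
  let ?w1 = "\<lambda>x. 2 * M1 x * eigfun' k x" and ?w2 = "\<lambda>x. M2 x * eigfun k x"
  have w1: "?w1 \<in> L2 {0..1}" by (intro continuous_imp_L2 continuous_intros WM)
  have "L2_norm {0..1} ?w1 \<le> (2 * K * (2 * (real k * pi))) * sqrt (1 - 0)"
  proof (rule L2_norm_bound[OF w1])
    show "norm (2 * M1 x * eigfun' k x) \<le> 2 * K * (2 * (real k * pi))" if "x \<in> {0..1}" for x
      unfolding norm_mult using K(3)[OF that] norm_eigfun'_le[of k x] K0 by (intro mult_mono) auto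
  qed (use K0 in auto)
  then have n1: "L2_norm {0..1} ?w1 \<le> 4 * K * (real k * pi)" by simp
  have w2: "?w2 \<in> L2 {0..1}" "L2_norm {0..1} ?w2 \<le> 2 * L2_norm {0..1} M2"
    using L2_bounded_mult[OF WM(3) continuous_imp_measurable_on_sets_lebesgue[OF continuous_on_eigfun] norm_eigfun_le, of k]
    by (auto simp: mult.commute)
  have n: "L2_norm {0..1} (\<lambda>x. ?w1 x + ?w2 x) \<le> 4 * K * (real k * pi) + 2 * K"
    using L2_add(2)[OF w1 w2(1)] n1 w2(2) K(4) by linarith
  have "integral {0..1} (\<lambda>x. eigfun j x * (?w1 x + ?w2 x)) = coef (\<lambda>x. ?w1 x + ?w2 x) j"
    unfolding coef_def by (rule integral_cong) (rule mult.commute)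
  then have i: "norm (integral {0..1} (\<lambda>x. eigfun j x * (?w1 x + ?w2 x))) \<le> 2 * (4 * K * (real k * pi) + 2 * K)"
    using norm_coef_le[OF L2_add(1)[OF w1 w2(1)], of j] n by simp
  have b: "norm (eigfun j x * (M1 x * eigfun k x)) \<le> 2 * (K * 2)" if "x \<in> {0..1}" for x
    unfolding norm_mult using K(3)[OF that] norm_eigfun_le K0 by (intro mult_mono) auto
  have "norm (\<beta> k (eigfun j)) \<le> norm (integral {0..1} (\<lambda>x. eigfun j x * (?w1 x + ?w2 x))) + norm (eigfun j 1 * (M1 1 * eigfun k 1)) + norm (eigfun j 0 * (M1 0 * eigfun k 0))"
    unfolding \<beta>_def by (meson add_right_mono norm_triangle_ineq norm_triangle_ineq4 order_trans)
  also have "\<dots> \<le> 2 * (4 * K * (real k * pi) + 2 * K) + 2 * (K * 2) + 2 * (K * 2)"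
    using i b[of 1] b[of 0] by (intro add_mono) auto
  also have "\<dots> \<le> C\<beta> k" using K0 by (simp add: C\<beta>_def algebra_simps)
  finally show ?thesis .
qed

text \<open>The numerator dominates the sieve constants of both factors of the bilinear form; the
  denominator is the geometric series of \<open>triangle_bound\<close> with exponent 1/4.\<close>

definition CQ :: "nat \<Rightarrow> real" where
  "CQ k = (Cq + (C\<beta> k)\<^sup>2 * sieve_const) / (1 - 2 powr (- (1/4)))"

text \<open>Inserting \<open>z_formula\<close> gives bilinear integrals over the triangle. The outer
  factors are \<open>e\<close> times exponentials, covered by \<open>large_sieve_neg\<close>; the
  inner ones carry the sources, covered by \<open>q_sieve\<close>. The bound is independent of
  \<open>J\<close>.\<close>

lemma Q_partial_bound:
  "norm (integral {0..T} (\<lambda>t. exp (\<i> * of_real (eigval k * t)) * of_real (U t) * (\<Sum>j<J. z j t * \<beta> k (eigfun j))))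
    \<le> CQ k * T powr (1/4) * integral {0..T} (\<lambda>t. (U t)\<^sup>2)"
proof -
  define e where "e t = exp (\<i> * complex_of_real (eigval k * t)) * of_real (U t)" for t
  define f where "f j t = \<beta> k (eigfun j) * (exp (- \<i> * of_real (eigval j * t)) * e t)" for j t
  define g where "g j s = exp (\<i> * of_real (eigval j * s)) * q j s" for j s
  have ec: "continuous_on {0..T} e" unfolding e_def[abs_def] by (intro continuous_intros continuous_U)
  have ne: "norm (e t) = \<bar>U t\<bar>" for t
    unfolding e_def norm_mult norm_exp_i_times by simp
  have nexp: "norm (exp (- \<i> * complex_of_real (eigval j * t))) = 1" for j t
    using norm_exp_i_times[of "- (eigval j * t)"] by simp
  have fc: "continuous_on {0..T} (f j)" for j unfolding f_def[abs_def] by (intro continuous_intros ec)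
  have fi: "f j absolutely_integrable_on {0..T}" for j by (rule absolutely_integrable_continuous_real[OF fc])
  have gi: "g j absolutely_integrable_on {0..T}" for j
    unfolding g_def[abs_def] by (intro abs_integrable_cont_mult q_integrable continuous_intros)
  have sc: "0 \<le> sieve_const" by (rule sieve_const_nonneg)
  have Cq0: "0 \<le> Cq" using sc by (simp add: Cq_def)
  have U2: "0 \<le> integral {a..b} (\<lambda>t. (U t)\<^sup>2)" if "0 \<le> a" "b \<le> T" for a b
  proof (rule integral_nonneg)
    show "(\<lambda>t. (U t)\<^sup>2) integrable_on {a..b}"
      by (intro continuous_integrable_I continuous_intros continuous_on_subset[OF continuous_U]) (use that in auto)
  qed simp
  have S: "(\<Sum>j<J. norm (integral {0..T} (\<lambda>t. f j t * integral {0..t} (g j))))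
    \<le> (Cq + (C\<beta> k)\<^sup>2 * sieve_const) / (1 - 2 powr (- (1/4))) * T powr (1/4) * integral {0..T} (\<lambda>t. (U t)\<^sup>2)"
  \<comment> \<open>A pointwise bound for both families at once: \<open>C\<beta> k\<close> serves
    the outer factors, \<open>40 K^2\<close> the inner ones.\<close>
  proof (rule triangle_bound[where B="C\<beta> k + 40 * K\<^sup>2"])
    show "norm (f j t) \<le> (C\<beta> k + 40 * K\<^sup>2) * norm (U t)" for j t
    proof -
      have "norm (f j t) = norm (\<beta> k (eigfun j)) * \<bar>U t\<bar>"
        unfolding f_def norm_mult[of "\<beta> k (eigfun j)"] norm_mult[of "exp _"] nexp ne by simp
      also have "\<dots> \<le> (C\<beta> k + 40 * K\<^sup>2) * \<bar>U t\<bar>"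
        using \<beta>_eigfun_bound[of k j] by (intro mult_right_mono) (auto intro: order_trans)
      finally show ?thesis by simp
    qed
    show "norm (g j t) \<le> (C\<beta> k + 40 * K\<^sup>2) * norm (U t)" if "t \<in> {0..T}" for j t
    proof -
      have "norm (g j t) = norm (q j t)" unfolding g_def norm_mult norm_exp_i_times by simp
      also have "\<dots> \<le> 40 * K\<^sup>2 * \<bar>U t\<bar>" by (rule q_bound[OF that])
      also have "\<dots> \<le> (C\<beta> k + 40 * K\<^sup>2) * \<bar>U t\<bar>" using C\<beta>_nonneg by (intro mult_right_mono) auto
      finally show ?thesis by simp
    qed
    fix a b assume ab: "0 \<le> a" "a \<le> b" "b \<le> T"
    let ?N = "integral {a..b} (\<lambda>t. (U t)\<^sup>2)"
    have N0: "0 \<le> ?N" using U2 ab by simp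
    have sub: "{a..b} \<subseteq> {0..T}" using ab by auto
    have eL: "e \<in> L2 {a..b}" by (rule continuous_imp_L2[OF continuous_on_subset[OF ec sub]])
    have en: "(L2_norm {a..b} e)\<^sup>2 = ?N"
      unfolding L2_norm_square_integral(2)[OF eL] ne by simp
    have "(\<Sum>j<J. (norm (integral {a..b} (f j)))\<^sup>2) \<le> (\<Sum>j<J. (C\<beta> k)\<^sup>2 * (norm (integral {a..b} (\<lambda>s. exp (- \<i> * of_real (eigval j * s)) * e s)))\<^sup>2)"
    proof (rule sum_mono)
      fix j
      have "integral {a..b} (f j) = \<beta> k (eigfun j) * integral {a..b} (\<lambda>s. exp (- \<i> * of_real (eigval j * s)) * e s)"
        unfolding f_def[abs_def] by (rule integral_mult_right)
      then have "(norm (integral {a..b} (f j)))\<^sup>2 = (norm (\<beta> k (eigfun j)))\<^sup>2 * (norm (integral {a..b} (\<lambda>s. exp (- \<i> * of_real (eigval j * s)) * e s)))\<^sup>2"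
        by (simp only: norm_mult power_mult_distrib)
      also have "\<dots> \<le> (C\<beta> k)\<^sup>2 * (norm (integral {a..b} (\<lambda>s. exp (- \<i> * of_real (eigval j * s)) * e s)))\<^sup>2"
        by (intro mult_right_mono power_mono \<beta>_eigfun_bound) auto
      finally show "(norm (integral {a..b} (f j)))\<^sup>2 \<le> (C\<beta> k)\<^sup>2 * (norm (integral {a..b} (\<lambda>s. exp (- \<i> * of_real (eigval j * s)) * e s)))\<^sup>2" .
    qed
    also have "\<dots> = (C\<beta> k)\<^sup>2 * (\<Sum>j<J. (norm (integral {a..b} (\<lambda>s. exp (- \<i> * of_real (eigval j * s)) * e s)))\<^sup>2)"
      by (rule sum_distrib_left[symmetric])
    also have "\<dots> \<le> (C\<beta> k)\<^sup>2 * (sieve_const * (b - a) powr (1/4) * (L2_norm {a..b} e)\<^sup>2)"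
      using ab T by (intro mult_left_mono large_sieve_neg eL) auto
    also have "\<dots> = ((C\<beta> k)\<^sup>2 * sieve_const) * (b - a) powr (1/4) * ?N" by (simp add: en)
    also have "\<dots> \<le> (Cq + (C\<beta> k)\<^sup>2 * sieve_const) * (b - a) powr (1/4) * ?N"
      using Cq0 N0 by (intro mult_right_mono) auto
    finally show "(\<Sum>j<J. (norm (integral {a..b} (f j)))\<^sup>2) \<le> (Cq + (C\<beta> k)\<^sup>2 * sieve_const) * (b - a) powr (1/4) * ?N" .
    have "(\<Sum>j<J. (norm (integral {a..b} (g j)))\<^sup>2) \<le> Cq * (b - a) powr (1/4) * ?N"
      unfolding g_def[abs_def] by (rule q_sieve[OF ab])
    also have "\<dots> \<le> (Cq + (C\<beta> k)\<^sup>2 * sieve_const) * (b - a) powr (1/4) * ?N"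
      using sc N0 by (intro mult_right_mono) auto
    finally show "(\<Sum>j<J. (norm (integral {a..b} (g j)))\<^sup>2) \<le> (Cq + (C\<beta> k)\<^sup>2 * sieve_const) * (b - a) powr (1/4) * ?N" .
  next
    show "0 \<le> C\<beta> k + 40 * K\<^sup>2" using C\<beta>_nonneg[of k] by simp
    show "0 \<le> Cq + (C\<beta> k)\<^sup>2 * sieve_const" using Cq0 sc by simp
  qed (use fi gi U_L2 T in auto)
  have eq: "integral {0..T} (\<lambda>t. exp (\<i> * of_real (eigval k * t)) * of_real (U t) * (\<Sum>j<J. z j t * \<beta> k (eigfun j)))
    = (\<Sum>j<J. integral {0..T} (\<lambda>t. f j t * integral {0..t} (g j)))"
  proof -
    have "integral {0..T} (\<lambda>t. exp (\<i> * of_real (eigval k * t)) * of_real (U t) * (\<Sum>j<J. z j t * \<beta> k (eigfun j)))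
      = integral {0..T} (\<lambda>t. \<Sum>j<J. f j t * integral {0..t} (g j))"
    proof (rule integral_cong)
      fix t assume t: "t \<in> {0..T}"
      have "exp (\<i> * of_real (eigval k * t)) * of_real (U t) * (\<Sum>j<J. z j t * \<beta> k (eigfun j)) = (\<Sum>j<J. e t * (z j t * \<beta> k (eigfun j)))"
        unfolding e_def by (rule sum_distrib_left)
      also have "\<dots> = (\<Sum>j<J. f j t * integral {0..t} (g j))"
        unfolding z_formula[OF t] f_def g_def[abs_def] by (simp only: mult_ac)
      finally show "exp (\<i> * of_real (eigval k * t)) * of_real (U t) * (\<Sum>j<J. z j t * \<beta> k (eigfun j)) = (\<Sum>j<J. f j t * integral {0..t} (g j))" .
    qed
    also have "\<dots> = (\<Sum>j<J. integral {0..T} (\<lambda>t. f j t * integral {0..t} (g j)))"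
    proof (rule integral_sum)
      have "continuous_on {0..T} (\<lambda>t. integral {0..t} (g j))" for j
        by (rule indefinite_integral_continuous_1[OF abs_integrable_imp_integrable[OF gi]])
      then show "(\<lambda>t. f j t * integral {0..t} (g j)) integrable_on {0..T}" for j
        by (intro continuous_integrable_I continuous_on_mult fc)
    qed simp
    finally show ?thesis .
  qed
  show ?thesis
    unfolding CQ_def eq by (rule order_trans[OF norm_sum S])
qed

text \<open>The limit in \<open>J\<close> by dominated convergence. Domination comes from the
  \<open>H^1\<close> bound on \<open>G - 1\<close>, which makes its coefficients absolutely
  summable; the quantitative bound is inherited from the partial sums.\<close>

lemma Q_bound:
  "norm (integral {0..T} (\<lambda>t. exp (\<i> * of_real (eigval k * t)) * of_real (U t) * \<beta> k (\<lambda>x. G t x - 1)))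
    \<le> CQ k * T powr (1/4) * integral {0..T} (\<lambda>t. (U t)\<^sup>2)"
    and Q_integrable: "(\<lambda>t. exp (\<i> * of_real (eigval k * t)) * of_real (U t) * \<beta> k (\<lambda>x. G t x - 1)) integrable_on {0..T}"
proof -
  let ?F = "\<lambda>J t. exp (\<i> * of_real (eigval k * t)) * of_real (U t) * (\<Sum>j<J. z j t * \<beta> k (eigfun j))"
  \<comment> \<open>From \<open>coef_abs_sum_bound\<close>: \<open>G - 1\<close> has norm at most 5
    and \<open>G1\<close> at most 2, whence 10 and 4; moreover \<open>|U| \<le> 1\<close>.\<close>
  let ?B = "(10 + gap_sum + 4) * C\<beta> k"
  have zc: "continuous_on {0..T} (z j)" for j
  proof -
    have "continuous_on {0..T} (\<lambda>t. coef (G t) j - coef (\<lambda>_. 1) j)"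
      by (intro continuous_intros ac_continuous[OF ac_coef_G])
    then show ?thesis by (rule continuous_on_eq) (simp add: z_eq)
  qed
  have Fi: "?F J integrable_on {0..T}" for J
    by (intro continuous_integrable_I continuous_intros continuous_U zc)
  have Fb: "norm (?F J t) \<le> ?B" if t: "t \<in> {0..T}" for J t
  proof -
    have fL: "(\<lambda>x. G t x - 1) \<in> L2 {0..1}" by (intro continuous_imp_L2 continuous_intros WG[OF t])
    have "norm (G t x - 1) \<le> 5" if "x \<in> {0..1}" for x
      using norm_triangle_ineq4[of "G t x" 1] G_near_1(2)[OF t that] by simp
    then have n: "L2_norm {0..1} (\<lambda>x. G t x - 1) \<le> 5" using L2_norm_bound[OF fL, of 5] by simp
    have "norm (\<Sum>j<J. z j t * \<beta> k (eigfun j)) \<le> (\<Sum>j<J. norm (z j t) * C\<beta> k)"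
      by (rule sum_norm_le) (simp add: norm_mult mult_left_mono \<beta>_eigfun_bound)
    also have "\<dots> = (\<Sum>j<J. norm (z j t)) * C\<beta> k" by (rule sum_distrib_right[symmetric])
    also have "\<dots> \<le> (2 * L2_norm {0..1} (\<lambda>x. G t x - 1) + gap_sum + (L2_norm {0..1} (G1 t))\<^sup>2) * C\<beta> k"
      unfolding z_def
      by (intro mult_right_mono coef_abs_sum_bound W2D(1)[OF W2_G1[OF t]] WG(5)[OF t] fL C\<beta>_nonneg)
    also have "\<dots> \<le> ?B"
    proof (intro mult_right_mono add_mono C\<beta>_nonneg)
      show "(L2_norm {0..1} (G1 t))\<^sup>2 \<le> 4" using power_mono[OF G1_bound[OF t], of 2] by simp
    qed (use n in auto)
    finally have s: "norm (\<Sum>j<J. z j t * \<beta> k (eigfun j)) \<le> ?B" .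
    have "norm (?F J t) = \<bar>U t\<bar> * norm (\<Sum>j<J. z j t * \<beta> k (eigfun j))"
      unfolding norm_mult norm_exp_i_times by simp
    also have "\<dots> \<le> 1 * norm (\<Sum>j<J. z j t * \<beta> k (eigfun j))"
      by (intro mult_right_mono abs_U_le(2)[OF t]) simp
    finally show ?thesis using s by simp
  qed
  have Fl: "(\<lambda>J. ?F J t) \<longlonglongrightarrow> exp (\<i> * of_real (eigval k * t)) * of_real (U t) * \<beta> k (\<lambda>x. G t x - 1)" if t: "t \<in> {0..T}" for t
    using \<beta>_expansion[OF W2_G1[OF t], of k] unfolding z_def sums_def by (intro tendsto_intros)
  have Bi: "(\<lambda>t::real. ?B) integrable_on {0..T}" by (intro continuous_integrable_I continuous_intros)
  show "(\<lambda>t. exp (\<i> * of_real (eigval k * t)) * of_real (U t) * \<beta> k (\<lambda>x. G t x - 1)) integrable_on {0..T}"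
    by (rule dominated_convergence(1)[OF Fi Bi Fb Fl])
  have "(\<lambda>J. integral {0..T} (?F J)) \<longlonglongrightarrow> integral {0..T} (\<lambda>t. exp (\<i> * of_real (eigval k * t)) * of_real (U t) * \<beta> k (\<lambda>x. G t x - 1))"
    by (rule dominated_convergence(2)[OF Fi Bi Fb Fl])
  from tendsto_norm[OF this]
  show "norm (integral {0..T} (\<lambda>t. exp (\<i> * of_real (eigval k * t)) * of_real (U t) * \<beta> k (\<lambda>x. G t x - 1)))
    \<le> CQ k * T powr (1/4) * integral {0..T} (\<lambda>t. (U t)\<^sup>2)"
    by (rule Lim_bounded[where M=0]) (intro allI impI Q_partial_bound)
qed

end

section \<open>The quadratic estimate\<close>

context bounded_flow
begin

definition N2 :: real where "N2 = integral {0..T} (\<lambda>t. (U t)\<^sup>2)"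

definition E1 :: real where "E1 = L2_norm {0..1} (\<lambda>x. \<Psi> T x - 1)"

lemma N2_nonneg: "0 \<le> N2"
  unfolding N2_def by (rule integral_nonneg) (auto intro!: continuous_integrable_I continuous_intros continuous_U)

lemma T_mem: "T \<in> {0..T}"
  using T by simp

lemma T_powr: "sqrt T \<le> T powr (1/4)" "T \<le> T powr (1/4)"
proof -
  have "T powr (1/2) \<le> T powr (1/4)" using T by (intro powr_mono') auto
  then show "sqrt T \<le> T powr (1/4)" using T by (simp add: powr_half_sqrt)
  have "T powr 1 = T" using T by simp
  moreover have "T powr 1 \<le> T powr (1/4)" using T by (intro powr_mono') auto
  ultimately show "T \<le> T powr (1/4)" by linarith
qed

lemma norm_coef_le_sup:
  assumes f: "continuous_on {0..1} f" "\<And>x. x \<in> {0..1} \<Longrightarrow> norm (f x) \<le> B" "0 \<le> B"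
  shows "norm (coef f j) \<le> 2 * B"
  using norm_coef_le[OF continuous_imp_L2[OF f(1)], of j] L2_norm_bound[OF continuous_imp_L2[OF f(1)] f(2,3)] by simp

text \<open>Since \<open>\<beta>\<close> vanishes on constants, the linear part of the source is
  \<open>U \<beta>(G - 1)\<close>, estimated by \<open>Q_bound\<close>. In the quadratic part both
  \<open>G\<close> and the phase may be replaced by 1, at an error of order
  \<open>sqrt T\<close>.\<close>

lemma quadratic_expansion:
  assumes k: "coef M k = 0"
  shows "norm (z k T + \<i> * integral {0..1} (\<lambda>x. M1 x * M1 x * eigfun k x) * of_real N2)
    \<le> (CQ k + 10 * K ^ 3 + 2 * K\<^sup>2 * eigval k) * T powr (1/4) * N2"
proof -
  define a where "a = integral {0..1} (\<lambda>x. M1 x * M1 x * eigfun k x)"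
  define X where "X s = integral {0..1} (\<lambda>x. M1 x * M1 x * G s x * eigfun k x)" for s
  define e where "e s = exp (\<i> * complex_of_real (eigval k * s))" for s
  define Q where "Q = integral {0..T} (\<lambda>t. e t * of_real (U t) * \<beta> k (\<lambda>x. G t x - 1))"
  \<comment> \<open>The first summand comes from \<open>|G - 1| \<le> 5 K sqrt T\<close>, the second
    from the deviation of the phase from 1 over a time of length \<open>T\<close>.\<close>
  define D where "D = (10 * K ^ 3 + 2 * K\<^sup>2 * eigval k) * sqrt T"
  have qk: "q k s = of_real (U s) * \<beta> k (\<lambda>x. G s x - 1) - \<i> * (of_real (U s))\<^sup>2 * X s" if s: "s \<in> {0..T}" for s
  proof -
    have "\<beta> k (\<lambda>x. G s x - 1) = \<beta> k (G s) - \<beta> k (\<lambda>_. 1)" by (rule \<beta>_diff[OF WG(2)[OF s]]) simp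
    then show ?thesis
      unfolding q_def \<beta>_eq[OF WG(1,3)[OF s]] \<beta>_one[OF k] X_def by simp
  qed
  have ec: "continuous_on {0..T} e" unfolding e_def[abs_def] by (intro continuous_intros)
  have qi: "(\<lambda>s. e s * q k s) integrable_on {0..T}"
    by (rule abs_integrable_imp_integrable[OF abs_integrable_cont_mult[OF ec q_integrable]])
  have Qi: "(\<lambda>t. e t * of_real (U t) * \<beta> k (\<lambda>x. G t x - 1)) integrable_on {0..T}"
    unfolding e_def by (rule Q_integrable)
  have XU: "e s * of_real (U s) * \<beta> k (\<lambda>x. G s x - 1) - e s * q k s = \<i> * (e s * (of_real (U s))\<^sup>2 * X s)" if "s \<in> {0..T}" for s
    unfolding qk[OF that] by (simp add: algebra_simps)
  \<comment> \<open>Integrability in time of the quadratic part is again inferred from the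
    decomposition of the source.\<close>
  have Xi': "(\<lambda>s. \<i> * (e s * (of_real (U s))\<^sup>2 * X s)) integrable_on {0..T}"
    by (rule integrable_eq[OF integrable_diff[OF Qi qi]]) (rule XU)
  have Xi: "(\<lambda>s. e s * (of_real (U s))\<^sup>2 * X s) integrable_on {0..T}"
    using integrable_on_mult_right[OF Xi', of "- \<i>"] by simp
  have "integral {0..T} (\<lambda>s. \<i> * (e s * (of_real (U s))\<^sup>2 * X s)) = Q - integral {0..T} (\<lambda>s. e s * q k s)"
    unfolding Q_def integral_diff[OF Qi qi, symmetric] by (rule integral_cong) (rule XU[symmetric])
  then have iq: "integral {0..T} (\<lambda>s. e s * q k s) = Q - \<i> * integral {0..T} (\<lambda>s. e s * (of_real (U s))\<^sup>2 * X s)"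
    by (simp add: algebra_simps)
  define c where "c = exp (- \<i> * complex_of_real (eigval k * T))"
  have nc: "norm c = 1" unfolding c_def using norm_exp_i_times[of "- (eigval k * T)"] by simp
  have U2i: "(\<lambda>s. (U s)\<^sup>2) integrable_on {0..T}" by (intro continuous_integrable_I continuous_intros continuous_U)
  have Ui: "(\<lambda>s. a * (complex_of_real (U s))\<^sup>2) integrable_on {0..T}" by (intro continuous_integrable_I continuous_intros continuous_U)
  have aN: "integral {0..T} (\<lambda>s. a * (complex_of_real (U s))\<^sup>2) = a * of_real N2"
    unfolding N2_def using integral_linear[OF U2i bounded_linear_of_real[where 'a=complex]] by (simp add: o_def)
  have zk: "z k T = c * Q - \<i> * integral {0..T} (\<lambda>s. c * (e s * (of_real (U s))\<^sup>2 * X s))"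
    using z_formula[OF T_mem, of k] unfolding e_def[symmetric] c_def[symmetric] iq by (simp add: algebra_simps)
  have "z k T + \<i> * a * of_real N2 = c * Q - \<i> * (integral {0..T} (\<lambda>s. c * (e s * (of_real (U s))\<^sup>2 * X s)) - integral {0..T} (\<lambda>s. a * (complex_of_real (U s))\<^sup>2))"
    unfolding zk aN by (simp add: algebra_simps)
  also have "integral {0..T} (\<lambda>s. c * (e s * (of_real (U s))\<^sup>2 * X s)) - integral {0..T} (\<lambda>s. a * (complex_of_real (U s))\<^sup>2)
     = integral {0..T} (\<lambda>s. c * (e s * (of_real (U s))\<^sup>2 * X s) - a * (of_real (U s))\<^sup>2)"
    by (rule integral_diff[symmetric, OF integrable_on_mult_right[OF Xi] Ui])
  finally have "norm (z k T + \<i> * a * of_real N2) \<le> norm (c * Q) +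
      norm (\<i> * integral {0..T} (\<lambda>s. c * (e s * (of_real (U s))\<^sup>2 * X s) - a * (of_real (U s))\<^sup>2))"
    by (simp only: norm_triangle_ineq4)
  also have "\<dots> = norm Q + norm (integral {0..T} (\<lambda>s. c * (e s * (of_real (U s))\<^sup>2 * X s) - a * (of_real (U s))\<^sup>2))"
    by (simp add: norm_mult nc)
  also have "norm (integral {0..T} (\<lambda>s. c * (e s * (of_real (U s))\<^sup>2 * X s) - a * (of_real (U s))\<^sup>2)) \<le> integral {0..T} (\<lambda>s. D * (U s)\<^sup>2)"
  proof (rule Henstock_Kurzweil_Integration.integral_norm_bound_integral)
    show "(\<lambda>s. c * (e s * (of_real (U s))\<^sup>2 * X s) - a * (of_real (U s))\<^sup>2) integrable_on {0..T}"
      by (rule integrable_diff[OF integrable_on_mult_right[OF Xi] Ui])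
    show "(\<lambda>s. D * (U s)\<^sup>2) integrable_on {0..T}" by (rule integrable_on_mult_right[OF U2i])
    fix s assume s: "s \<in> {0..T}"
    note cs = WG(2)[OF s] WM(5)
    have i: "(\<lambda>x. M1 x * M1 x * G s x * eigfun k x) integrable_on {0..1}" "(\<lambda>x. M1 x * M1 x * eigfun k x) integrable_on {0..1}"
      by (intro continuous_integrable_I continuous_intros cs)+
    have "X s - a = coef (\<lambda>x. M1 x * M1 x * (G s x - 1)) k"
      unfolding X_def a_def coef_def integral_diff[OF i, symmetric] by (rule integral_cong) (simp add: algebra_simps)
    also have "norm \<dots> \<le> 2 * (K * K * (5 * K * sqrt T))"
    proof (rule norm_coef_le_sup)
      show "continuous_on {0..1} (\<lambda>x. M1 x * M1 x * (G s x - 1))" by (intro continuous_intros cs)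
      show "norm (M1 x * M1 x * (G s x - 1)) \<le> K * K * (5 * K * sqrt T)" if "x \<in> {0..1}" for x
        unfolding norm_mult using K(3)[OF that] G_near_1(1)[OF s that] K0 by (intro mult_mono) auto
    qed (use K0 T in simp)
    finally have Xa: "norm (X s - a) \<le> 10 * K ^ 3 * sqrt T" by (simp add: power3_eq_cube mult_ac)
    have na: "norm a \<le> 2 * K\<^sup>2"
    proof -
      have "a = coef (\<lambda>x. M1 x * M1 x) k" by (simp add: a_def coef_def)
      also have "norm \<dots> \<le> 2 * (K * K)"
      proof (rule norm_coef_le_sup)
        show "continuous_on {0..1} (\<lambda>x. M1 x * M1 x)" by (intro continuous_intros cs)
        show "norm (M1 x * M1 x) \<le> K * K" if "x \<in> {0..1}" for x
          unfolding norm_mult using K(3)[OF that] K0 by (intro mult_mono) auto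
      qed (use K0 in simp)
      finally show ?thesis by (simp add: power2_eq_square)
    qed
    have ce: "c * e s = exp (\<i> * of_real (eigval k * (s - T)))"
      unfolding c_def e_def exp_add[symmetric] by (simp add: algebra_simps)
    have nce: "norm (c * e s) = 1" unfolding ce by (rule norm_exp_i_times)
    have "norm (c * e s - 1) \<le> \<bar>eigval k * (s - T)\<bar>" unfolding ce by (rule norm_exp_i_minus_1)
    also have "\<dots> \<le> eigval k * sqrt T"
    proof -
      have "T \<le> sqrt T" using T real_sqrt_le_mono[of T 1] mult_left_mono[of "sqrt T" 1 "sqrt T"] by simp
      then show ?thesis using s by (simp add: abs_mult mult_left_mono)
    qed
    finally have c1: "norm (c * e s - 1) \<le> eigval k * sqrt T" .
    have "c * e s * X s - a = (c * e s) * (X s - a) + a * (c * e s - 1)" by (simp add: algebra_simps)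
    then have "norm (c * e s * X s - a) \<le> norm ((c * e s) * (X s - a)) + norm (a * (c * e s - 1))"
      by (simp only: norm_triangle_ineq)
    also have "\<dots> \<le> 10 * K ^ 3 * sqrt T + 2 * K\<^sup>2 * (eigval k * sqrt T)"
    proof (rule add_mono)
      show "norm ((c * e s) * (X s - a)) \<le> 10 * K ^ 3 * sqrt T" using Xa by (simp only: norm_mult[of "c * e s"] nce mult_1)
      show "norm (a * (c * e s - 1)) \<le> 2 * K\<^sup>2 * (eigval k * sqrt T)"
        unfolding norm_mult[of a] using na c1 by (intro mult_mono) auto
    qed
    also have "\<dots> = D" by (simp add: D_def algebra_simps)
    finally have cD: "norm (c * e s * X s - a) \<le> D" .
    have "c * (e s * (of_real (U s))\<^sup>2 * X s) - a * (of_real (U s))\<^sup>2 = (c * e s * X s - a) * of_real ((U s)\<^sup>2)"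
      by (simp add: algebra_simps)
    then have "norm (c * (e s * (of_real (U s))\<^sup>2 * X s) - a * (of_real (U s))\<^sup>2) = norm (c * e s * X s - a) * (U s)\<^sup>2"
      by (simp only: norm_mult norm_of_real abs_power2)
    also have "\<dots> \<le> D * (U s)\<^sup>2" using cD by (rule mult_right_mono) simp
    finally show "norm (c * (e s * (of_real (U s))\<^sup>2 * X s) - a * (of_real (U s))\<^sup>2) \<le> D * (U s)\<^sup>2" .
  qed
  also have "integral {0..T} (\<lambda>s. D * (U s)\<^sup>2) = D * N2" by (simp add: N2_def)
  also have "norm Q \<le> CQ k * T powr (1/4) * N2" unfolding Q_def e_def N2_def by (rule Q_bound)
  also have "D * N2 \<le> (10 * K ^ 3 + 2 * K\<^sup>2 * eigval k) * T powr (1/4) * N2"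
    unfolding D_def using T_powr(1) K0 N2_nonneg by (intro mult_right_mono mult_left_mono) auto
  finally show ?thesis unfolding a_def by (simp add: algebra_simps)
qed

lemma coef_gauge_remainder:
  "norm (coef (\<lambda>x. gauge t x - 1 + \<i> * of_real (U t) * M x) j) \<le> 2 * (K\<^sup>2 * (U t)\<^sup>2)"
  by (intro norm_coef_le_sup gauge_near_1(2) continuous_intros continuous_gauge WM(4)) simp_all

lemma coef_gauge_expansion:
  shows "coef (\<lambda>x. gauge t x - 1) j = coef (\<lambda>x. gauge t x - 1 + \<i> * of_real (U t) * M x) j - \<i> * of_real (U t) * coef M j"
proof -
  have a: "(\<lambda>x. gauge t x - 1) absolutely_integrable_on {0..1}" "(\<lambda>x. \<i> * of_real (U t) * M x) absolutely_integrable_on {0..1}"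
    by (intro absolutely_integrable_continuous_real continuous_intros continuous_gauge WM(4))+
  show ?thesis unfolding coef_add[OF a] coef_scale by simp
qed

text \<open>In mode \<open>j\<close> the linear part of \<open>gauge - 1\<close> is
  \<open>- \<i> U(T) coef M j\<close>. Everything else in \<open>z j T\<close> is small: the
  coefficient of \<open>gauge * (\<Psi> - 1)\<close> is bounded by \<open>E1\<close>, and
  \<open>z j T\<close> itself by \<open>sqrt (T * N2)\<close>. The 8 stems from the halved left-hand
  side and the square of a sum of two terms.\<close>

lemma control_endpoint:
  assumes c: "0 < norm (coef M j)" and T_small: "4 * K\<^sup>2 * sqrt T \<le> norm (coef M j)"
  shows "(U T)\<^sup>2 \<le> 8 / (norm (coef M j))\<^sup>2 * (4 * E1\<^sup>2 + 1600 * K ^ 4 * (T * N2))"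
proof -
  define c where "c = norm (coef M j)"
  note WT = W\<Psi>(4,5)[OF T_mem] WM(4) continuous_gauge
  have sq: "(p + q)\<^sup>2 \<le> 2 * (p\<^sup>2 + q\<^sup>2)" for p q :: real
  proof -
    have "0 \<le> (p - q)\<^sup>2" by simp
    then show ?thesis by (simp add: power2_sum power2_diff)
  qed
  have z: "norm (z j T) \<le> 40 * K\<^sup>2 * (sqrt T * sqrt N2)"
  proof -
    have "norm (z j T) = norm (integral {0..T} (\<lambda>s. exp (\<i> * of_real (eigval j * s)) * q j s))"
      unfolding z_formula[OF T_mem] norm_mult using norm_exp_i_times[of "- (eigval j * T)"] by simp
    also have "\<dots> \<le> integral {0..T} (\<lambda>s. 40 * K\<^sup>2 * norm (U s))"
    proof (rule Henstock_Kurzweil_Integration.integral_norm_bound_integral)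
      show "(\<lambda>s. exp (\<i> * of_real (eigval j * s)) * q j s) integrable_on {0..T}"
        by (intro abs_integrable_imp_integrable abs_integrable_cont_mult q_integrable continuous_intros)
      show "(\<lambda>s. 40 * K\<^sup>2 * norm (U s)) integrable_on {0..T}"
        by (intro continuous_integrable_I continuous_intros continuous_U)
      show "norm (exp (\<i> * of_real (eigval j * s)) * q j s) \<le> 40 * K\<^sup>2 * norm (U s)" if "s \<in> {0..T}" for s
        unfolding norm_mult norm_exp_i_times using q_bound[OF that, of j] by simp
    qed
    also have "\<dots> = 40 * K\<^sup>2 * integral {0..T} (\<lambda>s. norm (U s))" by (rule integral_mult_right)
    also have "\<dots> \<le> 40 * K\<^sup>2 * (sqrt (T - 0) * L2_norm {0..T} U)"
      using T by (intro mult_left_mono L2_norm_integral_norm_bound U_L2) auto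
    also have "L2_norm {0..T} U = sqrt N2"
      using L2_norm_square_integral(2)[OF U_L2] by (simp add: N2_def real_sqrt_unique)
    finally show ?thesis by simp
  qed
  have i: "(\<lambda>x. gauge T x * (\<Psi> T x - 1)) absolutely_integrable_on {0..1}" "(\<lambda>x. gauge T x - 1) absolutely_integrable_on {0..1}"
    by (intro absolutely_integrable_continuous_real continuous_intros WT)+
  have cancel: "w = a + r - (a + (r - w))" for a r w :: complex by simp
  have G_eq: "(\<lambda>x. G T x - 1) = (\<lambda>x. gauge T x * (\<Psi> T x - 1) + (gauge T x - 1))"
    by (simp add: G_def algebra_simps)
  have z_eq: "z j T = coef (\<lambda>x. gauge T x * (\<Psi> T x - 1)) j + coef (\<lambda>x. gauge T x - 1) j"
    unfolding z_def G_eq by (rule coef_add[OF i])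
  have eq: "\<i> * of_real (U T) * coef M j = coef (\<lambda>x. gauge T x * (\<Psi> T x - 1)) j +
      coef (\<lambda>x. gauge T x - 1 + \<i> * of_real (U T) * M x) j - z j T"
    unfolding z_eq coef_gauge_expansion[of T j] by (rule cancel)
  have "norm (\<i> * of_real (U T) * coef M j) \<le> norm (coef (\<lambda>x. gauge T x * (\<Psi> T x - 1)) j) +
      norm (coef (\<lambda>x. gauge T x - 1 + \<i> * of_real (U T) * M x) j) + norm (z j T)"
    unfolding eq by (rule order_trans[OF norm_triangle_ineq4 add_right_mono[OF norm_triangle_ineq]])
  moreover have "norm (coef (\<lambda>x. gauge T x * (\<Psi> T x - 1)) j) \<le> 2 * E1"
  proof -
    have L: "(\<lambda>x. \<Psi> T x - 1) \<in> L2 {0..1}" by (intro continuous_imp_L2 continuous_intros WT)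
    have "L2_norm {0..1} (\<lambda>x. gauge T x * (\<Psi> T x - 1)) \<le> 1 * E1"
      unfolding E1_def
      by (rule L2_bounded_mult(2)[OF L continuous_imp_measurable_on_sets_lebesgue[OF continuous_gauge]]) (simp_all add: norm_gauge)
    moreover have "norm (coef (\<lambda>x. gauge T x * (\<Psi> T x - 1)) j) \<le> 2 * L2_norm {0..1} (\<lambda>x. gauge T x * (\<Psi> T x - 1))"
      by (rule norm_coef_le) (intro continuous_imp_L2 continuous_intros WT)
    ultimately show ?thesis by linarith
  qed
  \<comment> \<open>The remainder is quadratic in \<open>U(T)\<close>; trading one factor for
    \<open>sqrt T\<close> makes it at most half of the linear term, so it can be absorbed.\<close>
  moreover have "norm (coef (\<lambda>x. gauge T x - 1 + \<i> * of_real (U T) * M x) j) \<le> c / 2 * \<bar>U T\<bar>"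
  proof -
    have "norm (coef (\<lambda>x. gauge T x - 1 + \<i> * of_real (U T) * M x) j) \<le> 2 * (K\<^sup>2 * (U T)\<^sup>2)"
      by (rule coef_gauge_remainder)
    also have "(U T)\<^sup>2 = \<bar>U T\<bar> * \<bar>U T\<bar>" by (simp add: power2_eq_square)
    also have "2 * (K\<^sup>2 * (\<bar>U T\<bar> * \<bar>U T\<bar>)) \<le> 2 * (K\<^sup>2 * (sqrt T * \<bar>U T\<bar>))"
      using abs_U_le(1)[OF T_mem] by (intro mult_left_mono mult_right_mono) auto
    also have "\<dots> = 4 * K\<^sup>2 * sqrt T / 2 * \<bar>U T\<bar>" by simp
    also have "\<dots> \<le> c / 2 * \<bar>U T\<bar>" using T_small unfolding c_def by (intro mult_right_mono divide_right_mono) auto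
    finally show ?thesis .
  qed
  moreover have "norm (\<i> * of_real (U T) * coef M j) = c * \<bar>U T\<bar>" by (simp add: norm_mult c_def)
  ultimately have "c * \<bar>U T\<bar> / 2 \<le> 2 * E1 + 40 * K\<^sup>2 * (sqrt T * sqrt N2)" using z by simp
  then have "(c * \<bar>U T\<bar> / 2)\<^sup>2 \<le> (2 * E1 + 40 * K\<^sup>2 * (sqrt T * sqrt N2))\<^sup>2"
    by (intro power_mono) (simp_all add: c_def)
  also have "\<dots> \<le> 2 * ((2 * E1)\<^sup>2 + (40 * K\<^sup>2 * (sqrt T * sqrt N2))\<^sup>2)"
    by (rule sq)
  also have "\<dots> = 2 * (4 * E1\<^sup>2 + 1600 * K ^ 4 * (T * N2))"
    using T N2_nonneg by (simp add: power_mult_distrib)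
  finally have "c\<^sup>2 * (U T)\<^sup>2 / 4 \<le> 2 * (4 * E1\<^sup>2 + 1600 * K ^ 4 * (T * N2))"
    by (simp add: power_mult_distrib power_divide)
  then show ?thesis using assms(1) unfolding c_def[symmetric] by (simp add: field_simps)
qed

text \<open>\<open>G - 1\<close> splits into \<open>(gauge - 1) (\<Psi> - 1)\<close>,
  \<open>gauge - 1\<close> and \<open>\<Psi> - 1\<close>. In mode \<open>k\<close> the linear part
  of \<open>gauge - 1\<close> vanishes with \<open>coef M k\<close>, so that the cost is quadratic
  in \<open>U(T)\<close>; the product is split by \<open>2 a b \<le> a^2 + b^2\<close>.\<close>

lemma endpoint_difference:
  assumes k: "coef M k = 0"
  shows "norm (coef (\<lambda>x. \<Psi> T x - 1) k - z k T) \<le> 3 * K\<^sup>2 * (U T)\<^sup>2 + E1\<^sup>2"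
proof -
  note WT = W\<Psi>(4,5)[OF T_mem] WM(4) continuous_gauge WG(2)[OF T_mem]
  have i: "(\<lambda>x. (gauge T x - 1) * (\<Psi> T x - 1)) absolutely_integrable_on {0..1}" "(\<lambda>x. gauge T x - 1) absolutely_integrable_on {0..1}"
    "(\<lambda>x. \<Psi> T x - 1) absolutely_integrable_on {0..1}"
    by (intro absolutely_integrable_continuous_real continuous_intros WT)+
  have i2: "(\<lambda>x. (gauge T x - 1) * (\<Psi> T x - 1) + (gauge T x - 1)) absolutely_integrable_on {0..1}"
    by (intro absolutely_integrable_continuous_real continuous_intros WT)
  have cancel: "d - (a + r + d) = - a - r" for a r d :: complex by simp
  have G_eq: "(\<lambda>x. G T x - 1) = (\<lambda>x. ((gauge T x - 1) * (\<Psi> T x - 1) + (gauge T x - 1)) + (\<Psi> T x - 1))"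
    by (simp add: G_def algebra_simps)
  have z_eq: "z k T = coef (\<lambda>x. (gauge T x - 1) * (\<Psi> T x - 1)) k + coef (\<lambda>x. gauge T x - 1) k + coef (\<lambda>x. \<Psi> T x - 1) k"
    unfolding z_def G_eq coef_add[OF i2 i(3)] coef_add[OF i(1,2)] ..
  have "coef (\<lambda>x. gauge T x - 1) k = coef (\<lambda>x. gauge T x - 1 + \<i> * of_real (U T) * M x) k"
    unfolding coef_gauge_expansion[of T k] k by (simp only: mult_zero_right diff_zero)
  then have eq: "coef (\<lambda>x. \<Psi> T x - 1) k - z k T = - coef (\<lambda>x. (gauge T x - 1) * (\<Psi> T x - 1)) k
      - coef (\<lambda>x. gauge T x - 1 + \<i> * of_real (U T) * M x) k"
    unfolding z_eq by (simp only: cancel)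
  have "norm (coef (\<lambda>x. \<Psi> T x - 1) k - z k T) \<le> norm (coef (\<lambda>x. (gauge T x - 1) * (\<Psi> T x - 1)) k)
      + norm (coef (\<lambda>x. gauge T x - 1 + \<i> * of_real (U T) * M x) k)"
    unfolding eq using norm_triangle_ineq4[of "- coef (\<lambda>x. (gauge T x - 1) * (\<Psi> T x - 1)) k"] by simp
  also have "\<dots> \<le> 2 * (K * \<bar>U T\<bar> * E1) + 2 * (K\<^sup>2 * (U T)\<^sup>2)"
  proof (rule add_mono[OF _ coef_gauge_remainder])
    have L: "(\<lambda>x. \<Psi> T x - 1) \<in> L2 {0..1}" by (intro continuous_imp_L2 continuous_intros WT)
    have m: "(\<lambda>x. gauge T x - 1) \<in> borel_measurable (lebesgue_on {0..1})"
      by (intro continuous_imp_measurable_on_sets_lebesgue continuous_intros WT) simp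
    have "L2_norm {0..1} (\<lambda>x. (gauge T x - 1) * (\<Psi> T x - 1)) \<le> K * \<bar>U T\<bar> * E1"
      unfolding E1_def by (rule L2_bounded_mult(2)[OF L m gauge_near_1(1)]) (use K0 in simp_all)
    moreover have "norm (coef (\<lambda>x. (gauge T x - 1) * (\<Psi> T x - 1)) k) \<le> 2 * L2_norm {0..1} (\<lambda>x. (gauge T x - 1) * (\<Psi> T x - 1))"
      by (rule norm_coef_le) (intro continuous_imp_L2 continuous_intros WT)
    ultimately show "norm (coef (\<lambda>x. (gauge T x - 1) * (\<Psi> T x - 1)) k) \<le> 2 * (K * \<bar>U T\<bar> * E1)" by linarith
  qed
  also have "2 * (K * \<bar>U T\<bar> * E1) \<le> K\<^sup>2 * (U T)\<^sup>2 + E1\<^sup>2"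
    using sum_squares_bound[of "K * \<bar>U T\<bar>" E1] by (simp add: power_mult_distrib mult.assoc)
  finally show ?thesis by simp
qed

end

theorem theorem1p7:
  fixes k :: nat and \<mu> :: "real \<Rightarrow> real"
  assumes "\<mu> \<in> H2"
    and "ip (\<lambda>x. complex_of_real (\<mu> x)) (eigfun k) = 0"
    and "a_coeff \<mu> k \<noteq> 0"
  shows "summable (\<lambda>j. norm (a_term \<mu> k j)) \<and>
    (\<exists>Tstar>0. \<exists>C>0. \<exists>\<nu>>0. \<forall>T u \<psi>.
       0 < T \<longrightarrow> T < Tstar \<longrightarrow>
       u \<in> L2 {0<..<T} \<longrightarrow> L2_norm {0<..<T} u \<le> 1 \<longrightarrow>
       mild_solution T \<mu> u (eigfun 0) \<psi> \<longrightarrow>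
         norm (ip (\<lambda>x. \<psi> T x - eigfun 0 x) (eigfun k)
               + \<i> * a_coeff \<mu> k * complex_of_real ((L2_norm {0<..<T} (primitive u))\<^sup>2))
           \<le> C * T powr \<nu> * (L2_norm {0<..<T} (primitive u))\<^sup>2
             + C * (L2_norm I01 (\<lambda>x. \<psi> T x - eigfun 0 x))\<^sup>2)"
proof -
  have \<mu>H: "(\<lambda>x. complex_of_real (\<mu> x)) \<in> H2" by (rule H2_of_real[OF assms(1)])
  then have mL: "(\<lambda>x. complex_of_real (\<mu> x)) \<in> L2 I01" by (simp add: H2_def)
  obtain M M1 M2 where W: "W2 M M1 M2" and ae: "AE x in lebesgue_on {0..1}. complex_of_real (\<mu> x) = M x"
    using H2_W2[OF \<mu>H] .
  note WM = W2D[OF W]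
  have Mr: "cnj (M x) = M x" if "x \<in> {0..1}" for x
  proof (rule continuous_AE_eq[OF _ WM(4) _ that])
    show "continuous_on {0..1} (\<lambda>x. cnj (M x))" by (intro continuous_intros WM(4))
    show "AE x in lebesgue_on {0..1}. cnj (M x) = M x"
      using ae by eventually_elim (metis complex_cnj_complex_of_real)
  qed
  note aeq = a_coeff_eq[OF mL W ae, of k]
  have kM: "coef M k = 0" using assms(2) ip_eigfun[OF mL ae, of k] by simp
  have "\<exists>j. coef M j \<noteq> 0 \<and> j \<noteq> 0"
  proof (rule ccontr)
    assume "\<not> (\<exists>j. coef M j \<noteq> 0 \<and> j \<noteq> 0)"
    then have cM: "coef M j = 0" if "j \<noteq> 0" for j using that by blast
    have Mx: "M x = coef M 0" if x: "x \<in> {0..1}" for x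
    proof -
      have "(\<lambda>j. coef M j * eigfun j x) = (\<lambda>j. if j = 0 then coef M 0 * eigfun 0 x else 0)"
        using cM by auto
      then have "(\<lambda>j. if j = 0 then coef M 0 * eigfun 0 x else 0) sums M x"
        using W2_expansion[OF W x] by simp
      then have "M x = coef M 0 * eigfun 0 x"
        by (rule sums_unique2) (rule sums_single[of 0 "\<lambda>_. coef M 0 * eigfun 0 x"])
      then show ?thesis by (simp add: eigfun_def)
    qed
    have "AE x in lebesgue_on {0..1}. M1 x = 0"
    proof (rule AE_eq_0_of_integrals_eq_0[OF ac_absolutely_integrable[OF WM(1)]])
      fix t :: real assume t: "t \<in> {0..1}"
      show "integral {0..t} M1 = 0"
        using ac_diff_eq[OF WM(1), of 0 t] Mx[OF t] Mx[of 0] t by simp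
    qed
    then have "AE x in lebesgue_on {0..1}. M1 x * M1 x * eigfun k x = 0"
      by eventually_elim simp
    from integral_cong_AE_lebesgue(1)[OF this] have "a_coeff \<mu> k = 0"
      unfolding aeq(2) by simp
    then show False using assms(3) by simp
  qed
  then obtain j where j: "coef M j \<noteq> 0" "j \<noteq> 0" by blast
  define c where "c = norm (coef M j)"
  have c0: "0 < c" using j by (simp add: c_def)
  obtain K1 where K1: "\<forall>x\<in>{0..1}. norm (M x) \<le> K1" using continuous_bounded[OF WM(4)] by blast
  obtain K2 where K2: "\<forall>x\<in>{0..1}. norm (M1 x) \<le> K2" using continuous_bounded[OF WM(5)] by blast
  define K where "K = max (max 1 K1) (max K2 (L2_norm {0..1} M2))"
  have K: "1 \<le> K" "\<And>x. x \<in> {0..1} \<Longrightarrow> norm (M x) \<le> K" "\<And>x. x \<in> {0..1} \<Longrightarrow> norm (M1 x) \<le> K" "L2_norm {0..1} M2 \<le> K"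
    using K1 K2 by (auto simp: K_def le_max_iff_disj)
  \<comment> \<open>The two requirements on \<open>sqrt T\<close>: the first is \<open>small\<close>
    in \<open>bounded_flow\<close>, the second lets \<open>control_endpoint\<close> absorb its
    quadratic remainder. The 1 in \<open>Tstar\<close> ensures \<open>T \<le> 1\<close> for the
    large sieve.\<close>
  define s where "s = min (1 / (2 * K)) (c / (4 * K\<^sup>2))"
  have s0: "0 < s" using K(1) c0 by (simp add: s_def)
  define Tstar where "Tstar = min 1 (s\<^sup>2)"
  have Tstar: "0 < Tstar" using s0 by (simp add: Tstar_def)
  \<comment> \<open>Outside the locale \<open>CQ\<close> takes the arguments \<open>K\<close> and
    \<open>k\<close> alone, so this constant can be fixed before \<open>T\<close>, \<open>u\<close>
    and the solution.\<close>
  define C1 where "C1 = bounded_flow.CQ K k + 10 * K ^ 3 + 2 * K\<^sup>2 * eigval k"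
  \<comment> \<open>The cost of \<open>U(T)^2\<close> in \<open>endpoint_difference\<close> times
    the prefactor of \<open>control_endpoint\<close>.\<close>
  define C2 where "C2 = 3 * K\<^sup>2 * (8 / c\<^sup>2)"
  \<comment> \<open>One constant for both terms: \<open>C1 + 1600 C2 K^4\<close> collects what
    multiplies \<open>T^(1/4) N2\<close>, and \<open>4 C2 + 1\<close> what multiplies
    \<open>E1^2\<close>.\<close>
  define C where "C = \<bar>C1\<bar> + 1600 * C2 * K ^ 4 + 4 * C2 + 1"
  have C2: "0 \<le> C2" by (simp add: C2_def)
  have CK: "0 \<le> C2 * K ^ 4" using C2 by (intro mult_nonneg_nonneg) auto
  have C_eq: "C = \<bar>C1\<bar> + 1600 * (C2 * K ^ 4) + 4 * C2 + 1" by (simp add: C_def)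
  have CC: "C2 * (1600 * K ^ 4) = 1600 * (C2 * K ^ 4)" by simp
  have C: "0 < C" "C1 + C2 * (1600 * K ^ 4) \<le> C" "4 * C2 + 1 \<le> C"
    using C2 CK abs_ge_self[of C1] abs_ge_zero[of C1] unfolding C_eq CC by linarith+
  have main: "norm (ip (\<lambda>x. \<psi> T x - eigfun 0 x) (eigfun k)
               + \<i> * a_coeff \<mu> k * complex_of_real ((L2_norm {0<..<T} (primitive u))\<^sup>2))
           \<le> C * T powr (1/4) * (L2_norm {0<..<T} (primitive u))\<^sup>2
             + C * (L2_norm I01 (\<lambda>x. \<psi> T x - eigfun 0 x))\<^sup>2"
    if T: "0 < T" "T < Tstar" and u: "u \<in> L2 {0<..<T}" "L2_norm {0<..<T} u \<le> 1"
      and mild: "mild_solution T \<mu> u (eigfun 0) \<psi>" for T u \<psi>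
  proof -
    have T1: "T \<le> 1" using T by (simp add: Tstar_def)
    have "sqrt T \<le> s" using T s0 by (intro real_le_lsqrt) (auto simp: Tstar_def)
    then have sT: "sqrt T \<le> 1 / (2 * K)" "sqrt T \<le> c / (4 * K\<^sup>2)" by (auto simp: s_def)
    have T_small: "K * sqrt T \<le> 1 / 2" "4 * K\<^sup>2 * sqrt T \<le> c"
      using sT K(1) by (auto simp: field_simps)
    obtain \<Psi> \<Psi>1 \<Psi>2 where flow: "controlled_flow M M1 M2 T u \<Psi> \<Psi>1 \<Psi>2"
      and \<psi>\<Psi>: "\<And>t. t \<in> {0..T} \<Longrightarrow> AE x in lebesgue_on {0..1}. \<psi> t x = \<Psi> t x"
      and \<psi>L: "\<And>t. t \<in> {0..T} \<Longrightarrow> \<psi> t \<in> L2 {0..1}"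
      by (rule mild_solution_imp_controlled_flow[OF mL W ae Mr T(1) T1 u mild]) (assumption | rule that)+
    interpret controlled_flow M M1 M2 T u \<Psi> \<Psi>1 \<Psi>2 by (rule flow)
    interpret bounded_flow M M1 M2 T u \<Psi> \<Psi>1 \<Psi>2 K
      by unfold_locales (use K T_small in auto)
    have e1: "eigfun 0 x = 1" for x by (simp add: eigfun_def)
    have d: "AE x in lebesgue_on {0..1}. \<psi> T x - eigfun 0 x = \<Psi> T x - 1"
      using \<psi>\<Psi>[OF T_mem] by eventually_elim (simp add: e1)
    have dL: "(\<lambda>x. \<psi> T x - eigfun 0 x) \<in> L2 {0..1}"
      by (intro L2_diff(1) \<psi>L T_mem continuous_imp_L2 continuous_intros)
    have ip: "ip (\<lambda>x. \<psi> T x - eigfun 0 x) (eigfun k) = coef (\<lambda>x. \<Psi> T x - 1) k"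
      by (rule ip_eigfun[OF _ d]) (use dL in \<open>simp add: L2_Ioo_eq_Icc\<close>)
    have E: "L2_norm I01 (\<lambda>x. \<psi> T x - eigfun 0 x) = E1"
      unfolding L2_Ioo_eq_Icc E1_def
      by (rule L2_norm_cong_AE[OF d L2_measurable[OF dL] L2_measurable[OF continuous_imp_L2]])
        (intro continuous_intros W\<Psi>(4)[OF T_mem])
    have N: "(L2_norm {0<..<T} (primitive u))\<^sup>2 = N2"
    proof -
      have "primitive u t = U t" if "t \<in> {0..T}" for t
        unfolding primitive_def U_def
        by (rule LINT_Icc_eq_integral[OF abs_integrable_subinterval[OF u_integrable(1)]]) (use that in auto)
      then have "(LINT t|lebesgue_on {0..T}. (norm (primitive u t))\<^sup>2) = (LINT t|lebesgue_on {0..T}. (norm (U t))\<^sup>2)"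
        by (intro Bochner_Integration.integral_cong) simp_all
      then have "(L2_norm {0<..<T} (primitive u))\<^sup>2 = (L2_norm {0..T} U)\<^sup>2"
        by (simp add: L2_Ioo_eq_Icc L2_norm_square)
      then show ?thesis using L2_norm_square_integral(2)[OF U_L2] by (simp add: N2_def)
    qed
    have "coef (\<lambda>x. \<Psi> T x - 1) k + \<i> * a_coeff \<mu> k * of_real N2 =
        (z k T + \<i> * a_coeff \<mu> k * of_real N2) + (coef (\<lambda>x. \<Psi> T x - 1) k - z k T)" by simp
    then have "norm (coef (\<lambda>x. \<Psi> T x - 1) k + \<i> * a_coeff \<mu> k * of_real N2) \<le>
        norm (z k T + \<i> * a_coeff \<mu> k * of_real N2) + norm (coef (\<lambda>x. \<Psi> T x - 1) k - z k T)"
      using norm_triangle_ineq by (simp only:)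
    also have "\<dots> \<le> C1 * T powr (1/4) * N2 + (3 * K\<^sup>2 * (U T)\<^sup>2 + E1\<^sup>2)"
      unfolding aeq(2) C1_def by (intro add_mono quadratic_expansion endpoint_difference kM)
    also have "3 * K\<^sup>2 * (U T)\<^sup>2 \<le> 3 * K\<^sup>2 * (8 / c\<^sup>2 * (4 * E1\<^sup>2 + 1600 * K ^ 4 * (T * N2)))"
      unfolding c_def using c0 T_small(2) by (intro mult_left_mono control_endpoint) (auto simp: c_def)
    also have "\<dots> = C2 * (4 * E1\<^sup>2) + C2 * (1600 * K ^ 4) * (T * N2)"
      by (simp add: C2_def algebra_simps)
    also have "C2 * (1600 * K ^ 4) * (T * N2) \<le> C2 * (1600 * K ^ 4) * (T powr (1/4) * N2)"
      using C2 N2_nonneg T_powr(2) by (intro mult_left_mono mult_right_mono) auto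
    finally have "norm (coef (\<lambda>x. \<Psi> T x - 1) k + \<i> * a_coeff \<mu> k * of_real N2) \<le>
        (C1 + C2 * (1600 * K ^ 4)) * (T powr (1/4) * N2) + (4 * C2 + 1) * E1\<^sup>2"
      by (simp add: algebra_simps)
    also have "\<dots> \<le> C * (T powr (1/4) * N2) + C * E1\<^sup>2"
      using C N2_nonneg by (intro add_mono mult_right_mono) auto
    finally show ?thesis unfolding ip E N by (simp add: mult.assoc)
  qed
  from main have "\<forall>T u \<psi>. 0 < T \<and> T < Tstar \<and> u \<in> L2 {0<..<T} \<and> L2_norm {0<..<T} u \<le> 1 \<and>
      mild_solution T \<mu> u (eigfun 0) \<psi> \<longrightarrow>
      norm (ip (\<lambda>x. \<psi> T x - eigfun 0 x) (eigfun k)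
        + \<i> * a_coeff \<mu> k * complex_of_real ((L2_norm {0<..<T} (primitive u))\<^sup>2))
      \<le> C * T powr (1/4) * (L2_norm {0<..<T} (primitive u))\<^sup>2
        + C * (L2_norm I01 (\<lambda>x. \<psi> T x - eigfun 0 x))\<^sup>2"
    by blast
  moreover have "0 < (1/4 :: real)" by simp
  ultimately show ?thesis using aeq(1) Tstar C(1) by blast
qed

end
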